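(* Let $\theta \in (0,1)$, let $0 < \lambda \le \Lambda < \infty$ and let $Q_0\subset\mathbb{R}^n$ be a cube. Let $a$ be a $(\lambda,\Lambda)$-elliptic coefficient in $3Q_0$ and let $\Omega\subset Q_0$ be a domain. Let $q_l \in (1,2]$ be an admissible lower exponent for $a$ and let $q_h \in (2,\infty)$ be an admissible upper exponent for $a$ (both relative to $\Omega$), and assume $$N^{\Omega}_{h,bdr}(a,q_h) < \infty .$$ Let $p > q_l$ and assume that $F \in L^{p}(3Q_0;\mathbb{R}^n)$ and $f \in L^{p_*}(3Q_0)$. If $f$ is not identically zero, assume $q_{l*} > 1$. Let $u \in W^{1,2}_0(\Omega)$ be a solution to $$\operatorname{div} a(x,\nabla u(x)) = \operatorname{div} F(x) + f(x), \quad x \in \Omega.$$ Let $g \in L^{\infty}(3Q_0)$ be non-negative. Then there exists a $(1-\theta)$-sparse family $\mathcal{P}$ of cubes such that $3P \subset 3Q_0$ for all $P \in \mathcal{P}$ and $$\int_{\Omega} |\nabla u (x)|g(x) \, dx \le C \sum_{P \in \mathcal{P}} |P| \langle |F|\rangle_{3P,q_l}\langle g\rangle_{P,q_h'} + C \sum_{P \in \mathcal{P}} |P|\, 3\ell(P) \langle |f|\rangle_{3P,q_{l*}} \langle g\rangle_{P,q_h'},$$ where $$C = 9^{n/q_l} \left(N^{\Omega}_{l}(a,q_l)\Lambda+1\right) N^{\Omega}_{l}(a,q_l)\, N^{\Omega}_{h,bdr}(a,q_h) \left( \frac{\|M\|_{L^{1}(\mathbb{R}^n) \to L^{1,\infty}(\mathbb{R}^n)}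 }{\theta} \right)^{1/q_l}.$$
   Context: A cube is a cartesian product of $n$ equally long intervals in $\mathbb{R}^n$; $\ell(Q)=|Q|^{1/n}$; $cQ$ is the concentric cube of side length $c\,\ell(Q)$. For a measurable set $E$ of finite positive measure and $s\in(0,\infty)$, $\langle h\rangle_{E,s} := \left(\frac{1}{|E|}\int_E |h|^s\,dx\right)^{1/s}$. Exponents: $p_*=np/(n+p)$ (so $q_{l*}=nq_l/(n+q_l)$) and $p'=p/(p-1)$. Maximal function: $\mathcal{D}(Q_0)$ is the collection of dyadic subcubes of $Q_0$ (images, under the translation and scaling taking $[0,1)^n$ to $Q_0$, of the standard dyadic cubes $2^k([0,1)^n+j)$, $k\in\mathbb{Z}$, $j\in\mathbb{Z}^n$, contained in $[0,1)^n$), and $Mh(x)=\sup_{P\in\mathcal{D}(Q_0)}1_P(x)\langle h\rangle_{3P,1}$. Sparse family: for $\eta\in(0,1)$, a family $\mathcal{Q}$ of cubes is $\eta$-sparse if for each $Q\in\mathcal{Q}$ there is $E_Q\subset Q$ with $|E_Q|\ge \eta|Q|$ and $\sum_{Q\in\mathcal{Q}} 1_{E_Q}(x)\le 1$ for all $x\in\mathbb{R}^n$. Elliptic coefficient: $a:U\times\mathbb{R}^n\to\mathbb{R}^n$ is a $(\lambda,\Lambda)$-elliptic coefficient in $U$ if $x\mapsto a(x,\xi)$ is measurable for all $\xi$; $\xi\mapsto a(x,\xi)$ is continuously differentiable for all $x$; and for all $x\in U$, $\xi,\eta\in\mathbb{R}^n$: $a(x,0)=0$, $|a(x,\xi)-a(x,\eta)|\le\Lambda|\xi-\eta|$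 and $(a(x,\xi)-a(x,\eta))\cdot(\xi-\eta)\ge\lambda|\xi-\eta|^2$. Solution: for a domain $U$, $F\in L^1_{loc}(U;\mathbb{R}^n)$, $f\in L^1_{loc}(U)$, a function $u\in W^{1,2}(U)$ solves $\operatorname{div} a(x,\nabla u)=\operatorname{div}F+f$ in $U$ if $\int_U a(x,\nabla u)\cdot\nabla\varphi\,dx=\int_U F\cdot\nabla\varphi\,dx+\int_U f\varphi\,dx$ for all $\varphi\in C_c^\infty(U)$. Smoothened cubes: fix a smooth domain $O_0$ with $\frac{299}{100}[-1/2,1/2]^n\subset O_0\subset 3[-1/2,1/2]^n$. For a cube $Q$, $O_Q=A_Q^{-1}O_0$, where $A_Q$ is the scaling and translation with $A_QQ=[-1/2,1/2]^n$. Weak reverse Hölder inequality: for a domain $U$, $w\in L^1_{loc}(U)$ non-negative and $q>2$, $w$ satisfies a $q$-weak reverse Hölder inequality in $U$ if there is a constant $C_{w,q}$ such that $\left(\frac{1}{|P|}\int_P1_Uw^q\right)^{1/q}\le C_{w,q}\left(\frac{1}{|2P|}\int_{2P}1_Uw^{1/2}\right)^2$ for all cubes $P$; it is "local" if this holds only for $P$ with $2P\subset U$, and "boundary" if it holds only for $P$ with $P\cap U\ne\varnothing$. Admissible upper exponent (relative to a domain $\Omega$): for a cube $Q$ let $\mathcal{U}(Q)$ be the family of pairs $(u,v)$, $u,v\in W^{1,2}_0(\Omega)$ (extended by zero), such that $\operatorname{div}a(x,\nabla u)=\operatorname{div}a(x,\nabla v)$ weakly in $O_Q\cap\Omega$.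 A number $q>2$ is an admissible upper exponent for $a$ if for any cube $Q$ and any $(u,v)\in\mathcal{U}(Q)$ the function $1_{2Q}|\nabla u-\nabla v|$ satisfies a local or boundary $q$-weak reverse Hölder inequality in $\Omega\cap2Q$. One denotes $$N^{\Omega}_{h,bdr}(a,q)=\sup_Q\ \sup_{(u,v)\in\mathcal{U}(Q)}\ \sup_{P\subset2Q:\,P\cap\Omega\ne\varnothing}\frac{\langle|\nabla u-\nabla v|\rangle_{P,q}}{\langle|\nabla u-\nabla v|\rangle_{2P,1/2}},$$ where $Q$, $P$ range over cubes; this may be infinite a priori. Admissible lower exponent (relative to $\Omega$): $1<q\le2$ is an admissible lower exponent for $a$ if there is a finite number $N^{\Omega}_l(a,q)$ such that for all cubes $P$, all $F\in L^q_{loc}(\Omega;\mathbb{R}^n)$, $f\in L^{q_*}_{loc}(\Omega)$ (with $f\equiv0$ required if $q_*\le1$), and any solution $u\in W^{1,2}_0(O_P\cap\Omega)$ to $\operatorname{div}a(x,\nabla u)=\operatorname{div}F+f$ in $O_P\cap\Omega$, $$\|\nabla u\|_{L^q(O_P\cap\Omega)}\le N^{\Omega}_l(a,q)\left(\int_{O_P\cap\Omega}|F|^q\,dx+\left(\int_{O_P\cap\Omega}|f|^{q_*}\,dx\right)^{q/q_*}\right)^{1/q}.$$ *)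

theory Defs
  imports "HOL-Analysis.Analysis"
begin

text \<open>
  The ambient space is \<open>real ^ 'n\<close>, so \<open>n = CARD('n)\<close>. Functions that live on a subset of it are
  total functions whose values outside of the subset play no role. Averages, norms and operator
  norms take values in \<^typ>\<open>ennreal\<close>, where \<open>0 / 0 = 0\<close>.
\<close>

definition ennpowr :: "ennreal \<Rightarrow> real \<Rightarrow> ennreal"
  where "ennpowr x s = (if x = \<infinity> then \<infinity> else ennreal (enn2real x powr s))"
  \<comment> \<open>Only used with positive exponents.\<close>

definition is_domain :: "(real ^ 'n) set \<Rightarrow> bool"
  where "is_domain U \<longleftrightarrow> open U \<and> connected U \<and> U \<noteq> {}"

definition conj_exp :: "real \<Rightarrow> real"
  where "conj_exp p = p / (p - 1)"

definition star_exp :: "nat \<Rightarrow> real \<Rightarrow> real"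
  where "star_exp n p = real n * p / (real n + p)"


subsection \<open>Cubes\<close>

text \<open>
  The intervals may be open, closed or half-open; they are bounded and non-degenerate because
  their common length is finite and positive.
\<close>

definition is_cube :: "(real ^ 'n) set \<Rightarrow> bool"
  where "is_cube Q \<longleftrightarrow>
    (\<exists>I l. 0 < l \<and> (\<forall>i. is_interval (I i) \<and> emeasure lborel (I i) = ennreal l)
         \<and> Q = {x. \<forall>i. x $ i \<in> (I i :: real set)})"

definition side :: "(real ^ 'n) set \<Rightarrow> real"
  where "side Q = measure lebesgue Q powr (1 / real CARD('n))"

definition cube_center :: "(real ^ 'n) set \<Rightarrow> real ^ 'n"
  where "cube_center Q = (\<chi> i. ((INF x\<in>Q. x $ i) + (SUP x\<in>Q. x $ i)) / 2)"

definition dilate :: "real \<Rightarrow> (real ^ 'n) set \<Rightarrow> (real ^ 'n) set"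
  where "dilate c Q = (\<lambda>x. cube_center Q + c *\<^sub>R (x - cube_center Q)) ` Q"

definition average :: "(real ^ 'n) set \<Rightarrow> real \<Rightarrow> (real ^ 'n \<Rightarrow> real) \<Rightarrow> ennreal"
  where "average E s h =
    ennpowr ((\<integral>\<^sup>+x\<in>E. ennreal (\<bar>h x\<bar> powr s) \<partial>lebesgue) / emeasure lebesgue E) (1 / s)"


subsection \<open>Dyadic maximal function\<close>

definition std_dyadic_cube :: "int \<Rightarrow> (int ^ 'n) \<Rightarrow> (real ^ 'n) set"
  where "std_dyadic_cube k j =
    {x. \<forall>i. 2 powi k * real_of_int (j $ i) \<le> x $ i \<and> x $ i < 2 powi k * (real_of_int (j $ i) + 1)}"

text \<open>
  The affine map below sends \<open>[0,1)\<^sup>n\<close> to \<open>Q0\<close>, up to the faces when \<open>Q0\<close> is not half-open.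
\<close>

definition dyadic_subcubes :: "(real ^ 'n) set \<Rightarrow> (real ^ 'n) set set"
  where "dyadic_subcubes Q0 =
    {(\<lambda>y. cube_center Q0 + side Q0 *\<^sub>R (y - (\<chi> i. 1 / 2))) ` std_dyadic_cube k j | k j.
       std_dyadic_cube k j \<subseteq> {x. \<forall>i. 0 \<le> x $ i \<and> x $ i < 1}}"

definition maximal_fun :: "(real ^ 'n) set \<Rightarrow> (real ^ 'n \<Rightarrow> real) \<Rightarrow> real ^ 'n \<Rightarrow> ennreal"
  where "maximal_fun Q0 h x =
    (SUP P\<in>dyadic_subcubes Q0. indicator P x * average (dilate 3 P) 1 h)"


subsection \<open>Lebesgue spaces\<close>

definition Lp_on :: "real \<Rightarrow> (real ^ 'n) set \<Rightarrow> (real ^ 'n \<Rightarrow> 'b::euclidean_space) set"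
  where "Lp_on s U = {h \<in> borel_measurable (lebesgue_on U).
    (\<integral>\<^sup>+x\<in>U. ennreal (norm (h x) powr s) \<partial>lebesgue) < \<infinity>}"

definition Lp_loc_on :: "real \<Rightarrow> (real ^ 'n) set \<Rightarrow> (real ^ 'n \<Rightarrow> 'b::euclidean_space) set"
  where "Lp_loc_on s U = {h \<in> borel_measurable (lebesgue_on U).
    \<forall>K. compact K \<and> K \<subseteq> U \<longrightarrow> (\<integral>\<^sup>+x\<in>K. ennreal (norm (h x) powr s) \<partial>lebesgue) < \<infinity>}"

definition Linf_on :: "(real ^ 'n) set \<Rightarrow> (real ^ 'n \<Rightarrow> real) set"
  where "Linf_on U = {h \<in> borel_measurable (lebesgue_on U).
    \<exists>B. AE x in lebesgue_on U. \<bar>h x\<bar> \<le> B}"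

text \<open>Operator norm of the maximal function from \<open>L\<^sup>1\<close> to weak \<open>L\<^sup>1\<close> on the whole space.\<close>

definition maximal_norm :: "(real ^ 'n) set \<Rightarrow> ennreal"
  where "maximal_norm Q0 =
    (SUP h \<in> Lp_on 1 UNIV.
       (SUP t\<in>{0<..}. ennreal t * emeasure lebesgue {x. maximal_fun Q0 h x > ennreal t})
         / (\<integral>\<^sup>+x. ennreal \<bar>h x\<bar> \<partial>lebesgue))"


subsection \<open>Sparse families\<close>

definition sparse_family :: "real \<Rightarrow> (real ^ 'n) set set \<Rightarrow> bool"
  where "sparse_family \<eta> \<Q> \<longleftrightarrow>
    (\<forall>Q\<in>\<Q>. is_cube Q) \<and>
    (\<exists>E. (\<forall>Q\<in>\<Q>. E Q \<in> sets lebesgue \<and> E Q \<subseteq> Q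
                \<and> emeasure lebesgue (E Q) \<ge> ennreal \<eta> * emeasure lebesgue Q)
       \<and> (\<forall>x. (\<Sum>\<^sub>\<infinity>Q\<in>\<Q>. indicator (E Q) x) \<le> (1::ennreal)))"


subsection \<open>Smooth functions and smooth domains\<close>

definition gradient :: "(real ^ 'n \<Rightarrow> real) \<Rightarrow> real ^ 'n \<Rightarrow> real ^ 'n"
  where "gradient f x = (\<chi> i. frechet_derivative f (at x) (axis i 1))"

primrec C_k :: "nat \<Rightarrow> (real ^ 'n \<Rightarrow> real) \<Rightarrow> bool"
  where
    "C_k 0 f \<longleftrightarrow> continuous_on UNIV f"
  | "C_k (Suc k) f \<longleftrightarrow>
       (\<forall>x. f differentiable (at x)) \<and> (\<forall>i. C_k k (\<lambda>x. gradient f x $ i))"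

definition smooth :: "(real ^ 'n \<Rightarrow> real) \<Rightarrow> bool"
  where "smooth f \<longleftrightarrow> (\<forall>k. C_k k f)"

definition test_functions :: "(real ^ 'n) set \<Rightarrow> (real ^ 'n \<Rightarrow> real) set"
  where "test_functions U =
    {\<phi>. smooth \<phi> \<and> compact (closure {x. \<phi> x \<noteq> 0}) \<and> closure {x. \<phi> x \<noteq> 0} \<subseteq> U}"

text \<open>
  The boundary is locally the graph of a smooth function \<open>\<gamma>\<close> of the remaining \<open>n - 1\<close> coordinates
  (that is, \<open>\<gamma>\<close> does not depend on the \<open>i\<close>-th one), and the domain lies on one side of it; the
  sign \<open>\<sigma>\<close> accounts for the orientation of the \<open>i\<close>-th axis.
\<close>

definition smooth_domain :: "(real ^ 'n) set \<Rightarrow> bool"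
  where "smooth_domain U \<longleftrightarrow> is_domain U \<and>
    (\<forall>z\<in>frontier U. \<exists>r>0. \<exists>i. \<exists>\<sigma>\<in>{-1, 1}. \<exists>\<gamma>.
       smooth \<gamma> \<and> (\<forall>x t. \<gamma> (x + t *\<^sub>R axis i 1) = \<gamma> x) \<and>
       U \<inter> ball z r = {x \<in> ball z r. \<sigma> * (x $ i - \<gamma> x) > 0})"

definition reference_domain :: "(real ^ 'n) set \<Rightarrow> bool"
  where "reference_domain O0 \<longleftrightarrow> smooth_domain O0 \<and>
    dilate (299 / 100) (cbox (\<chi> i. - 1 / 2) (\<chi> i. 1 / 2)) \<subseteq> O0 \<and>
    O0 \<subseteq> dilate 3 (cbox (\<chi> i. - 1 / 2) (\<chi> i. 1 / 2))"

definition smoothened :: "(real ^ 'n) set \<Rightarrow> (real ^ 'n) set \<Rightarrow> (real ^ 'n) set"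
  where "smoothened O0 Q = (\<lambda>y. cube_center Q + side Q *\<^sub>R y) ` O0"


subsection \<open>Sobolev spaces\<close>

definition has_weak_gradient ::
    "(real ^ 'n) set \<Rightarrow> (real ^ 'n \<Rightarrow> real) \<Rightarrow> (real ^ 'n \<Rightarrow> real ^ 'n) \<Rightarrow> bool"
  where "has_weak_gradient U u G \<longleftrightarrow> u \<in> Lp_loc_on 1 U \<and> G \<in> Lp_loc_on 1 U \<and>
    (\<forall>\<phi>\<in>test_functions U. \<forall>i.
       (LINT x:U|lebesgue. u x * gradient \<phi> x $ i) = - (LINT x:U|lebesgue. G x $ i * \<phi> x))"

text \<open>The weak gradient is determined up to a null set; this is an arbitrary representative.\<close>

definition weak_gradient :: "(real ^ 'n) set \<Rightarrow> (real ^ 'n \<Rightarrow> real) \<Rightarrow> real ^ 'n \<Rightarrow> real ^ 'n"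
  where "weak_gradient U u = (SOME G. has_weak_gradient U u G)"

definition W12 :: "(real ^ 'n) set \<Rightarrow> (real ^ 'n \<Rightarrow> real) set"
  where "W12 U = {u \<in> Lp_on 2 U. \<exists>G \<in> Lp_on 2 U. has_weak_gradient U u G}"

text \<open>The closure of the test functions in \<open>W12 U\<close>.\<close>

definition W12_0 :: "(real ^ 'n) set \<Rightarrow> (real ^ 'n \<Rightarrow> real) set"
  where "W12_0 U = {u \<in> W12 U. \<exists>\<phi>. (\<forall>k. \<phi> k \<in> test_functions U) \<and>
    (\<lambda>k::nat. (\<integral>\<^sup>+x\<in>U. ennreal (\<bar>u x - \<phi> k x\<bar>\<^sup>2) \<partial>lebesgue)
            + (\<integral>\<^sup>+x\<in>U. ennreal ((norm (weak_gradient U u x - gradient (\<phi> k) x))\<^sup>2) \<partial>lebesgue))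
      \<longlonglongrightarrow> 0}"

definition W12_0_ext :: "(real ^ 'n) set \<Rightarrow> (real ^ 'n \<Rightarrow> real) set"
  where "W12_0_ext U = {u \<in> W12_0 U. \<forall>x. x \<notin> U \<longrightarrow> u x = 0}"


subsection \<open>Elliptic equations\<close>

definition elliptic_coefficient ::
    "real \<Rightarrow> real \<Rightarrow> (real ^ 'n) set \<Rightarrow> (real ^ 'n \<Rightarrow> real ^ 'n \<Rightarrow> real ^ 'n) \<Rightarrow> bool"
  where "elliptic_coefficient lam \<Lambda> U a \<longleftrightarrow>
    (\<forall>\<xi>. (\<lambda>x. a x \<xi>) \<in> borel_measurable (lebesgue_on U)) \<and>
    (\<forall>x\<in>U. \<exists>D. continuous_on UNIV D \<and>
             (\<forall>\<xi>. (a x has_derivative blinfun_apply (D \<xi>)) (at \<xi>))) \<and>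
    (\<forall>x\<in>U. \<forall>\<xi> \<eta>. a x 0 = 0 \<and>
             norm (a x \<xi> - a x \<eta>) \<le> \<Lambda> * norm (\<xi> - \<eta>) \<and>
             (a x \<xi> - a x \<eta>) \<bullet> (\<xi> - \<eta>) \<ge> lam * (norm (\<xi> - \<eta>))\<^sup>2)"

text \<open>\<open>U\<close> need not be connected: the definition is also used on \<open>smoothened O0 P \<inter> \<Omega>\<close>.\<close>

definition solves ::
    "(real ^ 'n) set \<Rightarrow> (real ^ 'n \<Rightarrow> real ^ 'n \<Rightarrow> real ^ 'n) \<Rightarrow>
     (real ^ 'n \<Rightarrow> real ^ 'n) \<Rightarrow> (real ^ 'n \<Rightarrow> real) \<Rightarrow> (real ^ 'n \<Rightarrow> real) \<Rightarrow> bool"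
  where "solves U a F f u \<longleftrightarrow>
    u \<in> W12 U \<and> F \<in> Lp_loc_on 1 U \<and> f \<in> Lp_loc_on 1 U \<and>
    (\<forall>\<phi>\<in>test_functions U.
       (LINT x:U|lebesgue. a x (weak_gradient U u x) \<bullet> gradient \<phi> x) =
       (LINT x:U|lebesgue. F x \<bullet> gradient \<phi> x) + (LINT x:U|lebesgue. f x * \<phi> x))"


subsection \<open>Weak reverse Hoelder inequalities and admissible exponents\<close>

text \<open>\<open>\<P>\<close> is the collection of cubes for which the inequality is required.\<close>

definition weak_rev_Hoelder ::
    "(real ^ 'n) set set \<Rightarrow> real \<Rightarrow> (real ^ 'n) set \<Rightarrow> (real ^ 'n \<Rightarrow> real) \<Rightarrow> bool"
  where "weak_rev_Hoelder \<P> q U w \<longleftrightarrow>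
    w \<in> Lp_loc_on 1 U \<and> (\<forall>x\<in>U. 0 \<le> w x) \<and>
    (\<exists>C::real. 0 \<le> C \<and> (\<forall>P\<in>\<P>. average P q (\<lambda>x. indicator U x * w x)
        \<le> ennreal C * average (dilate 2 P) (1 / 2) (\<lambda>x. indicator U x * w x)))"

definition local_weak_rev_Hoelder ::
    "real \<Rightarrow> (real ^ 'n) set \<Rightarrow> (real ^ 'n \<Rightarrow> real) \<Rightarrow> bool"
  where "local_weak_rev_Hoelder q U w \<longleftrightarrow> weak_rev_Hoelder {P. is_cube P \<and> dilate 2 P \<subseteq> U} q U w"

definition boundary_weak_rev_Hoelder ::
    "real \<Rightarrow> (real ^ 'n) set \<Rightarrow> (real ^ 'n \<Rightarrow> real) \<Rightarrow> bool"
  where "boundary_weak_rev_Hoelder q U w \<longleftrightarrow> weak_rev_Hoelder {P. is_cube P \<and> P \<inter> U \<noteq> {}} q U w"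

text \<open>
  Elements of \<open>W12_0_ext \<Omega>\<close> are weakly differentiable on the whole space, so their gradient is
  taken there.
\<close>

definition solution_pairs ::
    "(real ^ 'n) set \<Rightarrow> (real ^ 'n) set \<Rightarrow> (real ^ 'n \<Rightarrow> real ^ 'n \<Rightarrow> real ^ 'n) \<Rightarrow>
     (real ^ 'n) set \<Rightarrow> ((real ^ 'n \<Rightarrow> real) \<times> (real ^ 'n \<Rightarrow> real)) set"
  where "solution_pairs O0 \<Omega> a Q = {(u, v). u \<in> W12_0_ext \<Omega> \<and> v \<in> W12_0_ext \<Omega> \<and>
    (\<forall>\<phi>\<in>test_functions (smoothened O0 Q \<inter> \<Omega>).
       (LINT x:smoothened O0 Q \<inter> \<Omega>|lebesgue. a x (weak_gradient UNIV u x) \<bullet> gradient \<phi> x) =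
       (LINT x:smoothened O0 Q \<inter> \<Omega>|lebesgue. a x (weak_gradient UNIV v x) \<bullet> gradient \<phi> x))}"

definition grad_diff :: "(real ^ 'n \<Rightarrow> real) \<Rightarrow> (real ^ 'n \<Rightarrow> real) \<Rightarrow> real ^ 'n \<Rightarrow> real"
  where "grad_diff u v x = norm (weak_gradient UNIV u x - weak_gradient UNIV v x)"

definition admissible_upper_exponent ::
    "(real ^ 'n) set \<Rightarrow> (real ^ 'n) set \<Rightarrow> (real ^ 'n \<Rightarrow> real ^ 'n \<Rightarrow> real ^ 'n) \<Rightarrow> real \<Rightarrow> bool"
  where "admissible_upper_exponent O0 \<Omega> a q \<longleftrightarrow> 2 < q \<and>
    (\<forall>Q u v. is_cube Q \<and> (u, v) \<in> solution_pairs O0 \<Omega> a Q \<longrightarrow>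
       local_weak_rev_Hoelder q (\<Omega> \<inter> dilate 2 Q)
         (\<lambda>x. indicator (dilate 2 Q) x * grad_diff u v x) \<or>
       boundary_weak_rev_Hoelder q (\<Omega> \<inter> dilate 2 Q)
         (\<lambda>x. indicator (dilate 2 Q) x * grad_diff u v x))"

definition N_h_bdr ::
    "(real ^ 'n) set \<Rightarrow> (real ^ 'n) set \<Rightarrow> (real ^ 'n \<Rightarrow> real ^ 'n \<Rightarrow> real ^ 'n) \<Rightarrow> real \<Rightarrow> ennreal"
  where "N_h_bdr O0 \<Omega> a q =
    (SUP Q \<in> {Q. is_cube Q}. SUP (u, v) \<in> solution_pairs O0 \<Omega> a Q.
       SUP P \<in> {P. is_cube P \<and> P \<subseteq> dilate 2 Q \<and> P \<inter> \<Omega> \<noteq> {}}.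
         average P q (grad_diff u v) / average (dilate 2 P) (1 / 2) (grad_diff u v))"

text \<open>\<open>lower_constant O0 \<Omega> a q N\<close>: the number \<open>N\<close> can serve as the constant of the lower exponent \<open>q\<close>.\<close>

definition lower_constant ::
    "(real ^ 'n) set \<Rightarrow> (real ^ 'n) set \<Rightarrow> (real ^ 'n \<Rightarrow> real ^ 'n \<Rightarrow> real ^ 'n) \<Rightarrow> real \<Rightarrow> real \<Rightarrow> bool"
  where "lower_constant O0 \<Omega> a q N \<longleftrightarrow> 0 \<le> N \<and>
    (\<forall>P F f u. is_cube P \<longrightarrow>
       F \<in> Lp_loc_on q \<Omega> \<longrightarrow>
       f \<in> Lp_loc_on (star_exp CARD('n) q) \<Omega> \<longrightarrow>
       (star_exp CARD('n) q \<le> 1 \<longrightarrow> (AE x in lebesgue_on \<Omega>. f x = 0)) \<longrightarrow>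
       u \<in> W12_0 (smoothened O0 P \<inter> \<Omega>) \<longrightarrow>
       solves (smoothened O0 P \<inter> \<Omega>) a F f u \<longrightarrow>
       ennpowr (\<integral>\<^sup>+x\<in>smoothened O0 P \<inter> \<Omega>.
            ennreal (norm (weak_gradient (smoothened O0 P \<inter> \<Omega>) u x) powr q) \<partial>lebesgue) (1 / q)
       \<le> ennreal N * ennpowr
            ((\<integral>\<^sup>+x\<in>smoothened O0 P \<inter> \<Omega>. ennreal (norm (F x) powr q) \<partial>lebesgue)
             + ennpowr (\<integral>\<^sup>+x\<in>smoothened O0 P \<inter> \<Omega>.
                 ennreal (\<bar>f x\<bar> powr star_exp CARD('n) q) \<partial>lebesgue) (q / star_exp CARD('n) q))
            (1 / q))"

definition admissible_lower_exponent ::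
    "(real ^ 'n) set \<Rightarrow> (real ^ 'n) set \<Rightarrow> (real ^ 'n \<Rightarrow> real ^ 'n \<Rightarrow> real ^ 'n) \<Rightarrow> real \<Rightarrow> bool"
  where "admissible_lower_exponent O0 \<Omega> a q \<longleftrightarrow>
    1 < q \<and> q \<le> 2 \<and> (\<exists>N. lower_constant O0 \<Omega> a q N)"

end

theory Submission
  imports Defs
begin

text \<open>
  The sparse family comes from a stopping time on the dyadic subcubes of \<open>Q0\<close>. Each dyadic cube \<open>P\<close>
  carries a local solution: the element of \<open>W\<^sup>1\<^sup>2\<^sub>0\<close> of the smoothened cube intersected with \<open>\<Omega>\<close> that
  solves the equation there with the given right-hand side. For the largest cube this is \<open>u\<close> itself.
  Let \<open>G\<^sub>P\<close> be its gradient.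

  On a cube \<open>Q\<close> one stops at the maximal dyadic subcubes on whose triples the average of
  \<open>|G\<^sub>Q|\<close> to the power \<open>q\<^sub>l\<close> exceeds a threshold. The threshold is chosen such that, by the weak type
  inequality for the maximal function, the stopping cubes cover at most the fraction \<open>\<theta>\<close> of \<open>Q\<close>; this is
  what makes the family sparse. Off the stopping cubes this power of \<open>|G\<^sub>Q|\<close> is at most the threshold
  (\<open>dyadic_differentiation\<close>). On a stopping cube \<open>P\<close> the functions \<open>G\<^sub>Q\<close> and \<open>G\<^sub>P\<close> belong to
  solutions of the same equation near \<open>P\<close>. The upper exponent therefore turns an average of
  \<open>|G\<^sub>Q - G\<^sub>P|\<close> over \<open>2P\<close> into an average with exponent \<open>q\<^sub>h\<close> over \<open>P\<close>, and the lower exponent together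
  with the fact that the dyadic parent of \<open>P\<close> was not selected controls the former by the threshold
  (\<open>stopping_cube_comparison\<close>). Hoelder's inequality on \<open>Q\<close> gives
  \<open>\<integral>\<^sub>Q |G\<^sub>Q| g \<le> gap Q * |Q| * \<langle>g\<rangle> + \<Sum>\<^sub>P \<integral>\<^sub>P |G\<^sub>P| g\<close>, where the average of \<open>g\<close> over \<open>Q\<close> has the
  exponent conjugate to \<open>q\<^sub>h\<close>, the sum runs over the stopping cubes, and \<open>gap Q\<close> is a multiple of the
  threshold to the power \<open>1 / q\<^sub>l\<close> (\<open>mass_step\<close>). The lower exponent bounds \<open>gap Q\<close> by averages of the
  data over \<open>3Q\<close> (\<open>gap_le\<close>).

  This inequality is iterated (\<open>sparse_domination\<close>). The remainder after \<open>k\<close> generations tends to zero: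
  the union of the \<open>k\<close>-th generation has measure at most \<open>\<theta>\<^sup>k |Q0|\<close>, and every \<open>\<integral>\<^sub>P |G\<^sub>P| g\<close> is at most
  the integral over \<open>P\<close> of one fixed function, a maximal function raised to the power \<open>1 / q\<^sub>l < 1\<close>,
  which is integrable by Kolmogorov's inequality (\<open>mass_le_majorant\<close>, \<open>majorant_finite\<close>).

  Two points are less visible. Bounding the part off the stopping cubes by \<open>gap Q\<close> requires that
  the constant of the upper exponent is at least one. That is not a formality, since it needs a pair
  of solutions with different gradients that violates every smaller constant (\<open>N_h_bdr_ge_1\<close>). If the norm
  of the maximal function is infinite, the right-hand side is infinite unless the left-hand side is zero
  (\<open>mass_le_if_infinite_constant\<close>).

  The local solutions are found in the Hilbert space of pairs of a function and a gradient: \<open>W\<^sup>1\<^sup>2\<^sub>0\<close> is the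
  closure there of the test functions with their gradients, and the equation is a Lipschitz
  continuous and, by Poincare's inequality, strongly monotone operator equation on this subspace
  (\<open>strongly_monotone_equation_solvable\<close>).

  All cubes of the family are open; passing between a cube and its interior changes no integral.
\<close>

section \<open>Smooth functions with compact support\<close>

text \<open>
  Differentiating \<open>exp (- 1 / t)\<close> produces powers of \<open>1 / t\<close> as factors. With these factors included the
  family is closed under differentiation up to linear combinations.
\<close>

definition flat :: "nat \<Rightarrow> real \<Rightarrow> real"
  where "flat m t = (if 0 < t then (1 / t) ^ m * exp (- (1 / t)) else 0)"

lemma flat_tendsto_0: "((\<lambda>t. flat m t / t) \<longlongrightarrow> 0) (at 0)"
proof -
  have 1: "((\<lambda>s. s ^ Suc m / exp s) \<longlongrightarrow> (0::real)) at_top"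
    by (rule tendsto_power_div_exp_0)
  have 2: "((\<lambda>t. (inverse t) ^ Suc m / exp (inverse t)) \<longlongrightarrow> (0::real)) (at_right 0)"
    using filterlim_compose[OF 1 filterlim_inverse_at_top_right] .
  have "((\<lambda>t. flat m t / t) \<longlongrightarrow> 0) (at_right 0)"
    by (rule Lim_transform_eventually[OF 2])
      (auto simp: eventually_at_right_field flat_def field_simps exp_minus inverse_eq_divide intro!: exI[of _ 1])
  moreover have "((\<lambda>t. flat m t / t) \<longlongrightarrow> 0) (at_left 0)"
    by (rule Lim_transform_eventually[OF tendsto_const])
      (auto simp: eventually_at_left_field flat_def intro!: exI[of _ "-1"])
  ultimately show ?thesis
    by (simp add: filterlim_split_at)
qed

lemma has_derivative_flat:
  "((flat m) has_field_derivative (flat (m + 2) t - real m * flat (m + 1) t)) (at t)"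
proof -
  consider "0 < t" | "t < 0" | "t = 0" by linarith
  then show ?thesis
  proof cases
    case 1
    have "((\<lambda>t. (1 / t) ^ m * exp (- (1 / t))) has_field_derivative
        (flat (m + 2) t - real m * flat (m + 1) t)) (at t)"
    proof -
      define r where "r = 1 / t"
      have r: "((\<lambda>t. 1 / t) has_field_derivative - (r ^ 2)) (at t)"
        using 1 by (auto intro!: derivative_eq_intros simp: r_def field_simps power2_eq_square)
      have 2: "((\<lambda>t. (1 / t) ^ m) has_field_derivative - (real m * r ^ (m + 1))) (at t)"
        using DERIV_power[OF r, of m] by (cases m) (simp_all add: r_def[symmetric] power2_eq_square algebra_simps)
      have 3: "((\<lambda>t. exp (- (1 / t))) has_field_derivative exp (- r) * r ^ 2) (at t)"
        using DERIV_fun_exp[OF DERIV_minus[OF r]] by (simp add: r_def)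
      from DERIV_mult[OF 2 3] show ?thesis
        using 1 by (simp add: flat_def r_def[symmetric] power2_eq_square algebra_simps)
    qed
    then show ?thesis
      by (rule has_field_derivative_transform_within_open[of _ _ _ "{0<..}"])
        (use 1 in \<open>auto simp: flat_def\<close>)
  next
    case 2
    have "((\<lambda>t. 0) has_field_derivative (flat (m + 2) t - real m * flat (m + 1) t)) (at t)"
      using 2 by (auto simp: flat_def)
    then show ?thesis
      by (rule has_field_derivative_transform_within_open[of _ _ _ "{..<0}"])
        (use 2 in \<open>auto simp: flat_def\<close>)
  next
    case 3
    have "((\<lambda>h. (flat m (0 + h) - flat m 0) / h) \<longlongrightarrow> 0) (at 0)"
      using flat_tendsto_0[of m] by (simp add: flat_def)
    then show ?thesis
      using 3 by (simp add: DERIV_def flat_def)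
  qed
qed

text \<open>
  The partial derivatives of a function in this class belong to it again. Hence all its members are
  smooth, and this class contains the bump functions.
\<close>

inductive flat_product :: "(real ^ 'n \<Rightarrow> real) \<Rightarrow> bool"
  where
    coord: "flat_product (\<lambda>x. flat m (b * x $ i + c))"
  | const: "flat_product (\<lambda>x. c)"
  | add: "flat_product f \<Longrightarrow> flat_product g \<Longrightarrow> flat_product (\<lambda>x. f x + g x)"
  | mult: "flat_product f \<Longrightarrow> flat_product g \<Longrightarrow> flat_product (\<lambda>x. f x * g x)"

lemma gradient_nth:
  assumes "(f has_derivative D) (at x)"
  shows "gradient f x $ i = D (axis i 1)"
  using frechet_derivative_at[OF assms] by (simp add: gradient_def)

lemma frechet_derivative_gradient:
  fixes f :: "real ^ 'n \<Rightarrow> real"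
  assumes "f differentiable (at x)"
  shows "(f has_derivative (\<lambda>h. gradient f x \<bullet> h)) (at x)"
proof -
  let ?D = "frechet_derivative f (at x)"
  have D: "(f has_derivative ?D) (at x)"
    using assms frechet_derivative_works by blast
  then interpret linear ?D
    using has_derivative_linear by blast
  have "?D h = gradient f x \<bullet> h" for h
  proof -
    have "?D h = ?D (\<Sum>i\<in>UNIV. h $ i *\<^sub>R axis i 1)"
      by (simp add: scalar_mult_eq_scaleR[symmetric] basis_expansion)
    also have "\<dots> = gradient f x \<bullet> h"
      by (simp add: sum scale gradient_def inner_vec_def mult.commute)
    finally show ?thesis .
  qed
  then have "?D = (\<lambda>h. gradient f x \<bullet> h)" by auto
  with D show ?thesis by simp
qed

lemma gradient_add:
  assumes "f differentiable (at x)" "g differentiable (at x)"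
  shows "gradient (\<lambda>x. f x + g x) x = gradient f x + gradient g x"
  using gradient_nth[OF has_derivative_add[OF assms[THEN frechet_derivative_gradient]]]
  by (simp add: vec_eq_iff inner_add_left[symmetric] cart_eq_inner_axis)

lemma gradient_mult:
  assumes "f differentiable (at x)" "g differentiable (at x)"
  shows "gradient (\<lambda>x. f x * g x) x = f x *\<^sub>R gradient g x + g x *\<^sub>R gradient f x"
  using gradient_nth[OF has_derivative_mult[OF assms[THEN frechet_derivative_gradient]]]
  by (simp add: vec_eq_iff inner_add_left[symmetric] cart_eq_inner_axis algebra_simps)

lemma gradient_const: "gradient (\<lambda>x. c) x = 0"
  using gradient_nth[OF has_derivative_const, of c x] by (simp add: vec_eq_iff)

lemma flat_product_differentiable:
  "flat_product f \<Longrightarrow> f differentiable (at x) \<and> flat_product (\<lambda>x. gradient f x $ j)"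
proof (induction arbitrary: x j rule: flat_product.induct)
  case (coord m b i c)
  have D: "((\<lambda>x. flat m (b * x $ i + c)) has_derivative
      (\<lambda>h. (flat (m + 2) (b * x $ i + c) - real m * flat (m + 1) (b * x $ i + c)) * (b * h $ i))) (at x)" for x
  proof -
    have "((\<lambda>x. b * x $ i + c) has_derivative (\<lambda>h. b * h $ i)) (at x)"
      by (auto intro!: derivative_eq_intros bounded_linear_imp_has_derivative bounded_linear_vec_nth)
    from has_derivative_compose[OF this has_derivative_flat[unfolded has_field_derivative_def]]
    show ?thesis by (simp add: mult.commute)
  qed
  have "(\<lambda>x. gradient (\<lambda>x. flat m (b * x $ i + c)) x $ j) =
     (\<lambda>x. (flat (m + 2) (b * x $ i + c) + (- real m) * flat (m + 1) (b * x $ i + c)) * (if i = j then b else 0))"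
    by (auto simp: gradient_nth[OF D] axis_def fun_eq_iff)
  moreover have "flat_product \<dots>"
    by (intro flat_product.intros)
  ultimately show ?case
    using D by (auto simp: differentiable_def)
next
  case (const c)
  then show ?case by (auto simp: gradient_const intro: flat_product.intros)
next
  case (add f g)
  then have "(\<lambda>x. gradient (\<lambda>x. f x + g x) x $ j) = (\<lambda>x. gradient f x $ j + gradient g x $ j)"
    by (auto simp: fun_eq_iff gradient_add)
  with add show ?case by (auto intro: flat_product.intros)
next
  case (mult f g)
  then have "(\<lambda>x. gradient (\<lambda>x. f x * g x) x $ j) = (\<lambda>x. f x * gradient g x $ j + g x * gradient f x $ j)"
    by (auto simp: fun_eq_iff gradient_mult)
  with mult show ?case by (auto intro!: flat_product.intros)
qed

lemma smooth_flat_product: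
  assumes "flat_product f"
  shows "smooth f"
proof -
  have "C_k k f" for k
    using assms
  proof (induction k arbitrary: f)
    case 0
    then show ?case
      using flat_product_differentiable[OF 0]
      by (auto intro!: continuous_at_imp_continuous_on differentiable_imp_continuous_within)
  next
    case (Suc k)
    then show ?case
      using flat_product_differentiable[OF Suc.prems] by auto
  qed
  then show ?thesis by (simp add: smooth_def)
qed

lemma flat_product_prod:
  "finite I \<Longrightarrow> (\<And>i. i \<in> I \<Longrightarrow> flat_product (f i)) \<Longrightarrow> flat_product (\<lambda>x. \<Prod>i\<in>I. f i x)"
  by (induction I rule: finite_induct) (auto intro: flat_product.intros)

text \<open>
  Each factor is \<open>exp (- 1 / (s * (x\<^sub>i - a\<^sub>i)))\<close> or \<open>exp (- 1 / (s * (b\<^sub>i - x\<^sub>i)))\<close>, so that large \<open>s\<close> approximates the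
  indicator of the open box.
\<close>

definition bump :: "real \<Rightarrow> real ^ 'n \<Rightarrow> real ^ 'n \<Rightarrow> real ^ 'n \<Rightarrow> real"
  where "bump s a b x = (\<Prod>i\<in>UNIV. flat 0 (s * x $ i + - (s * a $ i)) * flat 0 ((-s) * x $ i + s * b $ i))"

lemma flat_0_bounds: "0 \<le> flat 0 t" "flat 0 t \<le> 1" "0 < flat 0 t \<longleftrightarrow> 0 < t" "flat 0 t = 0 \<longleftrightarrow> t \<le> 0"
  by (auto simp: flat_def)

lemma bump_bounds: "0 \<le> bump s a b x" "bump s a b x \<le> 1"
  unfolding bump_def
  by (auto intro!: prod_nonneg prod_le_1 mult_nonneg_nonneg mult_le_one flat_0_bounds)

lemma bump_eq_0_iff:
  assumes "0 < s"
  shows "bump s a b x = 0 \<longleftrightarrow> x \<notin> box a b"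
proof -
  have "s * x $ i + - (s * a $ i) \<le> 0 \<longleftrightarrow> x $ i \<le> a $ i"
    "(-s) * x $ i + s * b $ i \<le> 0 \<longleftrightarrow> b $ i \<le> x $ i" for i
    using assms by auto
  then show ?thesis
    unfolding bump_def by (auto simp: flat_0_bounds mem_box_cart not_less)
qed

lemma bump_tendsto_indicator:
  "(\<lambda>k. bump (real (Suc k)) a b x) \<longlonglongrightarrow> indicator (box a b) x"
proof (cases "x \<in> box a b")
  case False
  then have "bump (real (Suc k)) a b x = 0" for k
    by (subst bump_eq_0_iff) auto
  then show ?thesis using False by (simp del: of_nat_Suc)
next
  case True
  have *: "(\<lambda>k. flat 0 (real (Suc k) * t)) \<longlonglongrightarrow> 1" if "0 < t" for t :: real
  proof -
    have "(\<lambda>k. exp (- (1 / (real (Suc k) * t)))) \<longlonglongrightarrow> exp (- (0 * (1 / t)))"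
      using tendsto_mult_left_zero[OF LIMSEQ_inverse_real_of_nat, of "1 / t"]
      by (intro tendsto_intros) (simp add: inverse_eq_divide)
    moreover have "flat 0 (real (Suc k) * t) = exp (- (1 / (real (Suc k) * t)))" for k
      using that by (simp add: flat_def)
    ultimately show ?thesis by simp
  qed
  have "(\<lambda>k. bump (real (Suc k)) a b x) \<longlonglongrightarrow> (\<Prod>i\<in>(UNIV::'a set). 1 * 1)"
    unfolding bump_def
  proof (intro tendsto_intros)
    fix i
    have "real (Suc k) * x $ i + - (real (Suc k) * a $ i) = real (Suc k) * (x $ i - a $ i)" for k
      by (simp add: algebra_simps)
    then show "(\<lambda>k. flat 0 (real (Suc k) * x $ i + - (real (Suc k) * a $ i))) \<longlonglongrightarrow> 1"
      using True *[of "x $ i - a $ i"] by (simp add: mem_box_cart)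
    have "(- real (Suc k)) * x $ i + real (Suc k) * b $ i = real (Suc k) * (b $ i - x $ i)" for k
      by (simp add: algebra_simps)
    then show "(\<lambda>k. flat 0 ((- real (Suc k)) * x $ i + real (Suc k) * b $ i)) \<longlonglongrightarrow> 1"
      using True *[of "b $ i - x $ i"] by (simp add: mem_box_cart)
  qed
  then show ?thesis using True by simp
qed

lemma bump_test_function:
  assumes "0 < s" and "cbox a b \<subseteq> U"
  shows "bump s a b \<in> test_functions U"
proof -
  have "flat_product (bump s a b)"
    unfolding bump_def by (intro flat_product_prod flat_product.intros finite)
  then have "smooth (bump s a b)" by (rule smooth_flat_product)
  moreover have "{x. bump s a b x \<noteq> 0} = box a b"
    using assms(1) by (auto simp: bump_eq_0_iff)
  moreover have "closure (box a b) \<subseteq> cbox a b"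
    by (intro closure_minimal box_subset_cbox closed_cbox)
  ultimately show ?thesis
    using assms(2) by (auto simp: test_functions_def compact_closure intro: bounded_box)
qed

section \<open>Integration by parts\<close>

lemma integrable_compact_support:
  fixes \<phi> :: "'a::euclidean_space \<Rightarrow> real"
  assumes "continuous_on UNIV \<phi>" and "compact K" and "\<And>x. x \<notin> K \<Longrightarrow> \<phi> x = 0"
  shows "integrable lborel \<phi>"
proof -
  have "integrable lborel (\<lambda>x. indicator K x *\<^sub>R \<phi> x)"
    using assms by (intro borel_integrable_compact) (auto intro: continuous_on_subset)
  moreover have "(\<lambda>x. indicator K x *\<^sub>R \<phi> x) = \<phi>"
    using assms(3) by (auto simp: indicator_def fun_eq_iff)
  ultimately show ?thesis by simp
qed

lemma compact_support_bounded:
  fixes \<phi> :: "'a::euclidean_space \<Rightarrow> real"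
  assumes "continuous_on UNIV \<phi>" and "compact K" and "\<And>x. x \<notin> K \<Longrightarrow> \<phi> x = 0"
  obtains B where "0 \<le> B" "\<And>x. \<bar>\<phi> x\<bar> \<le> B"
proof -
  have "compact (\<phi> ` K)"
    using assms by (intro compact_continuous_image) (auto intro: continuous_on_subset)
  then obtain B where B: "\<And>y. y \<in> \<phi> ` K \<Longrightarrow> norm y \<le> B"
    using compact_imp_bounded bounded_iff by metis
  have "\<bar>\<phi> x\<bar> \<le> max B 0" for x
    using B[of "\<phi> x"] assms(3)[of x] by (cases "x \<in> K") auto
  then show ?thesis using that[of "max B 0"] by simp
qed

lemma gradient_eq_0_outside_support:
  assumes "x \<notin> closure {x. \<phi> x \<noteq> 0}"
  shows "gradient \<phi> x = 0"
proof -
  have "((\<lambda>x. 0) has_derivative (\<lambda>h. 0)) (at x)" by simp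
  then have "(\<phi> has_derivative (\<lambda>h. 0)) (at x)"
    by (rule has_derivative_transform_within_open[of _ _ _ _ "- closure {x. \<phi> x \<noteq> 0}"])
      (use assms closure_subset[of "{x. \<phi> x \<noteq> 0}"] in auto)
  from gradient_nth[OF this] show ?thesis by (simp add: vec_eq_iff)
qed

lemma integral_lborel_translate:
  fixes \<phi> :: "'a::euclidean_space \<Rightarrow> real"
  assumes "\<phi> \<in> borel_measurable borel"
  shows "(LINT x|lborel. \<phi> (x + c)) = (LINT x|lborel. \<phi> x)"
proof -
  have "(LINT x|lborel. \<phi> x) = integral\<^sup>L (distr lborel borel ((+) c)) \<phi>"
    by (simp add: lborel_distr_plus)
  also have "\<dots> = (LINT x|lborel. \<phi> (c + x))"
    using assms by (intro integral_distr) auto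
  finally show ?thesis by (simp add: add.commute)
qed

text \<open>
  The difference quotients in the \<open>i\<close>-th direction have integral zero because Lebesgue measure is invariant
  under translations, and they converge dominatedly to the partial derivative.
\<close>

lemma integral_gradient_eq_0:
  fixes \<phi> :: "real ^ 'n \<Rightarrow> real"
  assumes diff: "\<And>x. \<phi> differentiable (at x)"
    and cont: "continuous_on UNIV (\<lambda>x. gradient \<phi> x $ i)"
    and supp: "compact (closure {x. \<phi> x \<noteq> 0})"
  shows "(LINT x|lebesgue. gradient \<phi> x $ i) = 0"
proof -
  let ?e = "axis i (1::real)" and ?K = "closure {x. \<phi> x \<noteq> 0}"
  define h where "h = (\<lambda>m. inverse (real (Suc m)))"
  have h: "0 < h m" "h m \<le> 1" for m by (auto simp: h_def inverse_eq_divide)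
  have h0: "h \<longlonglongrightarrow> 0"
    using LIMSEQ_inverse_real_of_nat by (simp only: h_def)
  have contphi: "continuous_on UNIV \<phi>"
    using diff by (auto intro!: continuous_at_imp_continuous_on differentiable_imp_continuous_within)
  have out: "x \<notin> ?K \<Longrightarrow> \<phi> x = 0" for x
    using closure_subset[of "{x. \<phi> x \<noteq> 0}"] by blast
  obtain R where R: "?K \<subseteq> cball 0 R"
    using compact_imp_bounded[OF supp] unfolding bounded_iff by (auto simp: subset_iff)
  obtain B where B: "0 \<le> B" "\<And>x. \<bar>gradient \<phi> x $ i\<bar> \<le> B"
  proof (rule compact_support_bounded[OF cont supp])
    show "x \<notin> ?K \<Longrightarrow> gradient \<phi> x $ i = 0" for x
      using gradient_eq_0_outside_support[of x \<phi>] by simp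
  qed blast
  have line: "((\<lambda>t. \<phi> (x + t *\<^sub>R ?e)) has_real_derivative gradient \<phi> (x + t *\<^sub>R ?e) $ i) (at t)" for x t
  proof -
    have "((\<lambda>t. x + t *\<^sub>R ?e) has_derivative (\<lambda>s. s *\<^sub>R ?e)) (at t)"
      by (auto intro!: derivative_eq_intros)
    from has_derivative_compose[OF this frechet_derivative_gradient[OF diff]]
    show ?thesis
      by (simp add: has_field_derivative_def cart_eq_inner_axis mult_commute_abs)
  qed
  define s where "s m x = (\<phi> (x + h m *\<^sub>R ?e) - \<phi> x) / h m" for m x
  have lim: "(\<lambda>m. s m x) \<longlonglongrightarrow> gradient \<phi> x $ i" for x
  proof -
    have "((\<lambda>t. (\<phi> (x + (0 + t) *\<^sub>R ?e) - \<phi> (x + 0 *\<^sub>R ?e)) / t) \<longlongrightarrow> gradient \<phi> (x + 0 *\<^sub>R ?e) $ i) (at 0)"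
      using line[of x 0] unfolding DERIV_def .
    moreover have "filterlim h (at 0) sequentially"
      unfolding filterlim_at using h0 h(1) by (simp add: less_imp_neq[symmetric])
    ultimately show ?thesis
      using filterlim_compose[of "\<lambda>t. (\<phi> (x + (0 + t) *\<^sub>R ?e) - \<phi> (x + 0 *\<^sub>R ?e)) / t" _ _ h sequentially]
      by (simp add: s_def)
  qed
  have bound: "\<bar>s m x\<bar> \<le> B * indicator (cball 0 (R + 1)) x" for m x
  proof (cases "x \<in> cball 0 (R + 1)")
    case True
    obtain z where "\<phi> (x + h m *\<^sub>R ?e) - \<phi> (x + 0 *\<^sub>R ?e) = (h m - 0) * gradient \<phi> (x + z *\<^sub>R ?e) $ i"
      using MVT2[of 0 "h m" "\<lambda>t. \<phi> (x + t *\<^sub>R ?e)" "\<lambda>t. gradient \<phi> (x + t *\<^sub>R ?e) $ i"] h line by blast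
    then have "s m x = gradient \<phi> (x + z *\<^sub>R ?e) $ i"
      using h(1)[of m] by (simp add: s_def)
    then show ?thesis using B True by simp
  next
    case False
    then have "x \<notin> ?K" using R by auto
    moreover have "x + h m *\<^sub>R ?e \<notin> ?K"
    proof
      assume "x + h m *\<^sub>R ?e \<in> ?K"
      then have "norm (x + h m *\<^sub>R ?e) \<le> R" using R by auto
      moreover have "norm x \<le> norm (x + h m *\<^sub>R ?e) + norm (h m *\<^sub>R ?e)"
        by (metis add_diff_cancel_right' norm_triangle_ineq4)
      moreover have "norm (h m *\<^sub>R ?e) \<le> 1" using h[of m] by simp
      ultimately show False using False by simp
    qed
    ultimately have "\<phi> x = 0" "\<phi> (x + h m *\<^sub>R ?e) = 0" by (blast intro: out)+
    then have "s m x = 0" unfolding s_def by simp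
    then show ?thesis using False by simp
  qed
  have meas: "s m \<in> borel_measurable lborel" for m
  proof -
    have "continuous_on UNIV (\<lambda>x. \<phi> (x + h m *\<^sub>R ?e))"
      by (rule continuous_on_compose2[OF contphi, of UNIV "\<lambda>x. x + h m *\<^sub>R ?e"])
        (auto intro!: continuous_intros)
    then have "(\<lambda>x. \<phi> (x + h m *\<^sub>R ?e)) \<in> borel_measurable borel" "\<phi> \<in> borel_measurable borel"
      using contphi by (auto intro: borel_measurable_continuous_onI)
    then show ?thesis unfolding s_def by simp
  qed
  have "(\<lambda>m. LINT x|lborel. s m x) \<longlonglongrightarrow> (LINT x|lborel. gradient \<phi> x $ i)"
  proof (rule integral_dominated_convergence)
    show "integrable lborel (\<lambda>x. B * indicator (cball 0 (R + 1)) x)"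
      by (intro integrable_mult_right integrable_real_indicator emeasure_lborel_cball_finite) simp
    show "(\<lambda>x. gradient \<phi> x $ i) \<in> borel_measurable lborel"
      using cont by (simp add: borel_measurable_continuous_onI)
  qed (use meas lim bound in auto)
  moreover have "(LINT x|lborel. s m x) = 0" for m
  proof -
    have i1: "integrable lborel \<phi>"
      using integrable_compact_support[OF contphi supp out] by simp
    have i2: "integrable lborel (\<lambda>x. \<phi> (x + h m *\<^sub>R ?e))"
    proof (rule integrable_compact_support)
      show "continuous_on UNIV (\<lambda>x. \<phi> (x + h m *\<^sub>R ?e))"
        by (intro continuous_on_compose2[OF contphi] continuous_intros) auto
      show "compact ((\<lambda>x. - (h m *\<^sub>R ?e) + x) ` ?K)"
        by (intro compact_translation supp)
      fix x assume "x \<notin> (\<lambda>x. - (h m *\<^sub>R ?e) + x) ` ?K"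
      then have "x + h m *\<^sub>R ?e \<notin> ?K" by (force simp: image_iff)
      then show "\<phi> (x + h m *\<^sub>R ?e) = 0" by (rule out)
    qed
    have "(LINT x|lborel. s m x) = ((LINT x|lborel. \<phi> (x + h m *\<^sub>R ?e)) - (LINT x|lborel. \<phi> x)) / h m"
      unfolding s_def using i1 i2 by simp
    also have "\<dots> = 0"
      using contphi by (simp add: integral_lborel_translate borel_measurable_continuous_onI)
    finally show ?thesis .
  qed
  ultimately have "(LINT x|lborel. gradient \<phi> x $ i) = 0"
    by (simp add: LIMSEQ_const_iff)
  then show ?thesis
    using cont by (simp add: integral_completion borel_measurable_continuous_onI)
qed

lemma integration_by_parts:
  fixes \<phi> \<psi> :: "real ^ 'n \<Rightarrow> real"
  assumes d: "\<And>x. \<phi> differentiable (at x)" "\<And>x. \<psi> differentiable (at x)"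
    and c: "continuous_on UNIV (\<lambda>x. gradient \<phi> x $ i)" "continuous_on UNIV (\<lambda>x. gradient \<psi> x $ i)"
    and supp: "compact (closure {x. \<psi> x \<noteq> 0})"
  shows "(LINT x|lebesgue. \<phi> x * gradient \<psi> x $ i) = - (LINT x|lebesgue. gradient \<phi> x $ i * \<psi> x)"
proof -
  let ?K = "closure {x. \<psi> x \<noteq> 0}"
  have cont: "continuous_on UNIV \<phi>" "continuous_on UNIV \<psi>"
    using d by (auto intro!: continuous_at_imp_continuous_on differentiable_imp_continuous_within)
  have out: "x \<notin> ?K \<Longrightarrow> \<psi> x = 0" for x
    using closure_subset[of "{x. \<psi> x \<noteq> 0}"] by blast
  have g: "gradient (\<lambda>x. \<phi> x * \<psi> x) x $ i = \<phi> x * gradient \<psi> x $ i + gradient \<phi> x $ i * \<psi> x" for x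
    by (simp add: gradient_mult d)
  have sub: "closure {x. \<phi> x * \<psi> x \<noteq> 0} \<subseteq> ?K"
    by (intro closure_mono) auto
  have i1: "integrable lborel (\<lambda>x. \<phi> x * gradient \<psi> x $ i)"
    by (rule integrable_compact_support[OF continuous_on_mult[OF cont(1) c(2)] supp])
      (simp add: gradient_eq_0_outside_support)
  have i2: "integrable lborel (\<lambda>x. gradient \<phi> x $ i * \<psi> x)"
    by (rule integrable_compact_support[OF continuous_on_mult[OF c(1) cont(2)] supp])
      (blast intro: out mult_eq_0_iff[THEN iffD2])
  have "(LINT x|lebesgue. gradient (\<lambda>x. \<phi> x * \<psi> x) x $ i) = 0"
  proof (rule integral_gradient_eq_0)
    show "(\<lambda>x. \<phi> x * \<psi> x) differentiable (at x)" for x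
      using has_derivative_mult[OF d[THEN frechet_derivative_gradient]] unfolding differentiable_def by blast
    show "continuous_on UNIV (\<lambda>x. gradient (\<lambda>x. \<phi> x * \<psi> x) x $ i)"
      unfolding g by (intro continuous_on_add continuous_on_mult cont c)
    show "compact (closure {x. \<phi> x * \<psi> x \<noteq> 0})"
      using compact_Int_closed[OF supp closed_closure, of "{x. \<phi> x * \<psi> x \<noteq> 0}"] sub
      by (simp add: Int_absorb1)
  qed
  then show ?thesis
    unfolding g using i1 i2
    by (subst (asm) Bochner_Integration.integral_add) (auto simp: integrable_completion)
qed

lemma C_k_continuous: "C_k k f \<Longrightarrow> continuous_on UNIV f"
  by (cases k) (auto intro!: continuous_at_imp_continuous_on differentiable_imp_continuous_within)

lemma test_function_C1:
  assumes "\<phi> \<in> test_functions U"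
  shows "\<phi> differentiable (at x)" "continuous_on UNIV (\<lambda>x. gradient \<phi> x $ i)"
    "continuous_on UNIV \<phi>" "compact (closure {x. \<phi> x \<noteq> 0})" "closure {x. \<phi> x \<noteq> 0} \<subseteq> U"
    "continuous_on UNIV (gradient \<phi>)"
proof -
  have *: "C_k (Suc 0) \<phi>" using assms unfolding test_functions_def smooth_def by blast
  show "\<phi> differentiable (at x)" "continuous_on UNIV (\<lambda>x. gradient \<phi> x $ i)" "continuous_on UNIV \<phi>"
    using * C_k_continuous[OF *] by auto
  show "compact (closure {x. \<phi> x \<noteq> 0})" "closure {x. \<phi> x \<noteq> 0} \<subseteq> U"
    using assms by (auto simp: test_functions_def)
  show "continuous_on UNIV (gradient \<phi>)"
    using continuous_on_vec_lambda[of UNIV "\<lambda>i x. gradient \<phi> x $ i"] * by simp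
qed

lemma test_function_outside:
  assumes "\<phi> \<in> test_functions U" "x \<notin> U"
  shows "\<phi> x = 0" "gradient \<phi> x = 0"
  using test_function_C1(5)[OF assms(1)] closure_subset[of "{x. \<phi> x \<noteq> 0}"] assms(2)
    gradient_eq_0_outside_support[of x \<phi>] by blast+

lemma test_functions_mono: "U \<subseteq> V \<Longrightarrow> test_functions U \<subseteq> test_functions V"
  by (auto simp: test_functions_def)

lemma C_k_add_scale: "C_k k f \<Longrightarrow> C_k k g \<Longrightarrow> C_k k (\<lambda>x. f x + c * g x)"
proof (induction k arbitrary: f g)
  case 0
  then show ?case by (auto intro!: continuous_intros)
next
  case (Suc k)
  have "gradient (\<lambda>x. f x + c * g x) x $ i = gradient f x $ i + c * gradient g x $ i" for x i
    using Suc.prems by (simp add: gradient_add gradient_mult[where f="\<lambda>x. c"] gradient_const)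
  then show ?case using Suc by simp
qed

lemma test_functions_add_scale:
  assumes "\<phi> \<in> test_functions U" "\<psi> \<in> test_functions U"
  shows "(\<lambda>x. \<phi> x + c * \<psi> x) \<in> test_functions U"
    and "gradient (\<lambda>x. \<phi> x + c * \<psi> x) x = gradient \<phi> x + c *\<^sub>R gradient \<psi> x"
proof -
  have sup: "{x. \<phi> x + c * \<psi> x \<noteq> 0} \<subseteq> {x. \<phi> x \<noteq> 0} \<union> {x. \<psi> x \<noteq> 0}" by auto
  have sub: "closure {x. \<phi> x + c * \<psi> x \<noteq> 0} \<subseteq> closure {x. \<phi> x \<noteq> 0} \<union> closure {x. \<psi> x \<noteq> 0}"
    using closure_mono[OF sup] by (simp only: closure_Un)
  have "compact (closure {x. \<phi> x + c * \<psi> x \<noteq> 0})"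
    using bounded_subset[OF _ sup] assms[THEN test_function_C1(4)]
    unfolding compact_closure bounded_Un by iprover
  moreover have "smooth (\<lambda>x. \<phi> x + c * \<psi> x)"
    using assms unfolding test_functions_def smooth_def by (blast intro: C_k_add_scale)
  ultimately show "(\<lambda>x. \<phi> x + c * \<psi> x) \<in> test_functions U"
    using sub assms[THEN test_function_C1(5)] unfolding test_functions_def by blast
  show "gradient (\<lambda>x. \<phi> x + c * \<psi> x) x = gradient \<phi> x + c *\<^sub>R gradient \<psi> x"
    using assms[THEN test_function_C1(1)]
    by (simp add: gradient_add gradient_mult[where f="\<lambda>x. c"] gradient_const)
qed

lemma zero_test_function: "(\<lambda>x. 0) \<in> test_functions U"
  using smooth_flat_product[OF flat_product.const[of 0]] by (simp add: test_functions_def)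

section \<open>The fundamental lemma of the calculus of variations\<close>

text \<open>
  The positive and the negative part of \<open>g\<close> are densities of measures that agree on open boxes. These
  are stable under intersections and generate the Borel sets, so the measures coincide.
\<close>

lemma AE_eq_0_if_box_integrals_eq_0:
  fixes g :: "'a::euclidean_space \<Rightarrow> real"
  assumes int: "integrable lebesgue g"
    and zero: "\<And>a b. (LINT x:box a b|lebesgue. g x) = 0"
  shows "AE x in lebesgue. g x = 0"
proof -
  obtain h where h: "h \<in> borel_measurable lborel" "AE x in lborel. g x = h x"
    using completion_ex_borel_measurable_real[of g lborel] int by auto
  have [measurable]: "h \<in> borel_measurable borel" using h(1) by simp
  have gh: "AE x in lebesgue. g x = h x"
    using h(2) by (rule AE_completion)
  have inth: "integrable lborel h"
    using integrable_cong_AE[OF _ _ gh] int h(1) by (simp add: integrable_completion measurable_completion)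
  let ?M = "density lborel (\<lambda>x. ennreal (h x))" and ?N = "density lborel (\<lambda>x. ennreal (- h x))"
  let ?E = "range (\<lambda>(a, b). box a b::'a set)"
  have fin: "(\<integral>\<^sup>+x. ennreal (h x) \<partial>lborel) < \<infinity>" "(\<integral>\<^sup>+x. ennreal (- h x) \<partial>lborel) < \<infinity>"
    using inth unfolding real_integrable_def by (auto simp: top.not_eq_extremum)
  have *: "(\<integral>\<^sup>+x\<in>A. ennreal (h x) \<partial>lborel) < \<infinity>" "(\<integral>\<^sup>+x\<in>A. ennreal (- h x) \<partial>lborel) < \<infinity>" for A
    by (rule le_less_trans[OF _ fin(1)], rule nn_integral_mono, simp add: indicator_def)
      (rule le_less_trans[OF _ fin(2)], rule nn_integral_mono, simp add: indicator_def)
  have "?M = ?N"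
  proof (rule measure_eqI_generator_eq)
    show "Int_stable ?E"
      by (auto simp: Int_stable_def box_Int_box)
    show "?E \<subseteq> Pow UNIV" "sets ?M = sigma_sets UNIV ?E" "sets ?N = sigma_sets UNIV ?E"
      by (simp_all add: borel_eq_box)
    let ?A = "\<lambda>n::nat. box (- (real n *\<^sub>R One)) (real n *\<^sub>R One) :: 'a set"
    show "range ?A \<subseteq> ?E" "(\<Union>i. ?A i) = UNIV"
      unfolding UN_box_eq_UNIV by auto
    show "emeasure ?M (?A i) \<noteq> \<infinity>" for i
      using *(1)[of "?A i"] by (subst emeasure_density) auto
    fix X assume "X \<in> ?E"
    then obtain a b where X: "X = box a b" by auto
    have "(LINT x:X|lborel. h x) = (LINT x:X|lebesgue. h x)"
      unfolding set_lebesgue_integral_def X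
      by (intro integral_completion[symmetric]) simp
    also have "\<dots> = (LINT x:X|lebesgue. g x)"
      unfolding set_lebesgue_integral_def X
    proof (rule integral_cong_AE)
      have "g \<in> borel_measurable lebesgue" "h \<in> borel_measurable lebesgue"
        using int h(1) by (auto simp: measurable_completion)
      then show "(\<lambda>x. indicator (box a b) x *\<^sub>R h x) \<in> borel_measurable lebesgue"
        "(\<lambda>x. indicator (box a b) x *\<^sub>R g x) \<in> borel_measurable lebesgue"
        by (intro borel_measurable_scaleR borel_measurable_indicator; simp)+
      show "AE x in lebesgue. indicator (box a b) x *\<^sub>R h x = indicator (box a b) x *\<^sub>R g x"
        using gh by eventually_elim simp
    qed
    finally have "(LINT x|lborel. indicator X x * h x) = 0"
      using zero X by (simp add: set_lebesgue_integral_def)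
    moreover have "integrable lborel (\<lambda>x. indicator X x * h x)"
      using integrable_mult_indicator[OF _ inth, of X] X by simp
    ultimately have "enn2real (\<integral>\<^sup>+x. ennreal (indicator X x * h x) \<partial>lborel) =
        enn2real (\<integral>\<^sup>+x. ennreal (- (indicator X x * h x)) \<partial>lborel)"
      by (simp add: real_lebesgue_integral_def)
    moreover have "(\<integral>\<^sup>+x. ennreal (indicator X x * h x) \<partial>lborel) = (\<integral>\<^sup>+x\<in>X. ennreal (h x) \<partial>lborel)"
      "(\<integral>\<^sup>+x. ennreal (- (indicator X x * h x)) \<partial>lborel) = (\<integral>\<^sup>+x\<in>X. ennreal (- h x) \<partial>lborel)"
      by (auto intro!: nn_integral_cong simp: indicator_def)
    ultimately have "enn2real (\<integral>\<^sup>+x\<in>X. ennreal (h x) \<partial>lborel) = enn2real (\<integral>\<^sup>+x\<in>X. ennreal (- h x) \<partial>lborel)"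
      by simp
    then have "(\<integral>\<^sup>+x\<in>X. ennreal (h x) \<partial>lborel) = (\<integral>\<^sup>+x\<in>X. ennreal (- h x) \<partial>lborel)"
      using ennreal_enn2real[of "\<integral>\<^sup>+x\<in>X. ennreal (h x) \<partial>lborel"]
        ennreal_enn2real[of "\<integral>\<^sup>+x\<in>X. ennreal (- h x) \<partial>lborel"] *[of X] by simp
    then show "emeasure ?M X = emeasure ?N X"
      using X by (simp add: emeasure_density)
  qed
  then have "AE x in lborel. ennreal (h x) = ennreal (- h x)"
    using fin by (subst (asm) finite_density_unique) auto
  then have "AE x in lborel. h x = 0"
  proof eventually_elim
    case (elim x)
    then show ?case
      by (cases "0 \<le> h x") (auto simp: ennreal_neg ennreal_eq_0_iff dest!: sym[of 0])
  qed
  from AE_completion[OF this] gh show ?thesis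
    by eventually_elim simp
qed

lemma Lp_loc_on_1_integrable:
  fixes h :: "real ^ 'n \<Rightarrow> 'b::euclidean_space"
  assumes h: "h \<in> Lp_loc_on 1 U" and K: "compact K" "K \<subseteq> U" and U: "U \<in> sets lebesgue"
  shows "integrable lebesgue (\<lambda>x. indicator K x *\<^sub>R h x)"
proof (rule integrableI_bounded)
  have "h \<in> borel_measurable (lebesgue_on U)"
    using h by (simp add: Lp_loc_on_def)
  then have hU: "(\<lambda>x. if x \<in> U then h x else 0) \<in> borel_measurable lebesgue"
    using U by (simp add: borel_measurable_if)
  have "K \<in> sets lebesgue" using K(1) by (simp add: lmeasurable_compact fmeasurableD)
  then have "(\<lambda>x. indicator K x *\<^sub>R (if x \<in> U then h x else 0)) \<in> borel_measurable lebesgue"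
    using hU by (intro borel_measurable_scaleR) auto
  moreover have "(\<lambda>x. indicator K x *\<^sub>R (if x \<in> U then h x else 0)) = (\<lambda>x. indicator K x *\<^sub>R h x)"
    using K(2) by (auto simp: fun_eq_iff indicator_def)
  ultimately show "(\<lambda>x. indicator K x *\<^sub>R h x) \<in> borel_measurable lebesgue" by simp
  have "(\<integral>\<^sup>+x. ennreal (norm (indicator K x *\<^sub>R h x)) \<partial>lebesgue) =
      (\<integral>\<^sup>+x\<in>K. ennreal (norm (h x) powr 1) \<partial>lebesgue)"
    by (intro nn_integral_cong) (auto simp: indicator_def)
  also have "\<dots> < \<infinity>"
    using h K unfolding Lp_loc_on_def by blast
  finally show "(\<integral>\<^sup>+x. ennreal (norm (indicator K x *\<^sub>R h x)) \<partial>lebesgue) < \<infinity>" .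
qed

text \<open>
  Bump functions approximate the indicator of a box whose closure lies in \<open>U\<close>, so the integrals of \<open>g\<close> over all
  such boxes vanish. Countably many of these boxes cover \<open>U\<close>.
\<close>

lemma fundamental_lemma:
  fixes g :: "real ^ 'n \<Rightarrow> real"
  assumes U: "open U" and g: "g \<in> Lp_loc_on 1 U"
    and zero: "\<And>\<phi>. \<phi> \<in> test_functions U \<Longrightarrow> (LINT x:U|lebesgue. g x * \<phi> x) = 0"
  shows "AE x in lebesgue. x \<in> U \<longrightarrow> g x = 0"
proof -
  have Ul: "U \<in> sets lebesgue" using U by auto
  have box0: "(LINT x:box a b|lebesgue. g x) = 0" if ab: "cbox a b \<subseteq> U" for a b
  proof -
    let ?K = "cbox a b"
    have K: "integrable lebesgue (\<lambda>x. indicator ?K x * g x)"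
      using Lp_loc_on_1_integrable[OF g compact_cbox ab Ul] by simp
    have Km: "(\<lambda>x. indicator ?K x * g x) \<in> borel_measurable lebesgue"
      using K by (rule borel_measurable_integrable)
    have bump0: "bump (real (Suc k)) a b x = 0" if "x \<notin> box a b" for k x
      using that by (subst bump_eq_0_iff) auto
    have test: "bump (real (Suc k)) a b \<in> test_functions U" for k
      by (rule bump_test_function[OF _ ab]) simp
    have eq: "indicator U x *\<^sub>R (g x * bump (real (Suc k)) a b x) =
        indicator ?K x * g x * bump (real (Suc k)) a b x" for k x
      using ab box_subset_cbox[of a b] bump0[of x k] by (auto simp: indicator_def)
    have "(\<lambda>k. LINT x|lebesgue. indicator ?K x * g x * bump (real (Suc k)) a b x) \<longlonglongrightarrow>
        (LINT x|lebesgue. indicator ?K x * g x * indicator (box a b) x)"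
    proof (rule integral_dominated_convergence)
      show "integrable lebesgue (\<lambda>x. norm (indicator ?K x * g x))"
        using K by (rule integrable_norm)
      show "(\<lambda>x. indicator ?K x * g x * indicator (box a b) x) \<in> borel_measurable lebesgue"
        by (rule borel_measurable_times[OF Km]) (intro borel_measurable_indicator, simp)
      show "(\<lambda>x. indicator ?K x * g x * bump (real (Suc k)) a b x) \<in> borel_measurable lebesgue" for k
        using test_function_C1(3)[OF test]
        by (intro borel_measurable_times[OF Km]) (auto intro!: measurable_completion borel_measurable_continuous_onI)
      show "AE x in lebesgue. (\<lambda>k. indicator ?K x * g x * bump (real (Suc k)) a b x)
          \<longlonglongrightarrow> indicator ?K x * g x * indicator (box a b) x"
        using bump_tendsto_indicator by (intro AE_I2 tendsto_mult tendsto_const) auto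
      show "AE x in lebesgue. norm (indicator ?K x * g x * bump (real (Suc k)) a b x)
          \<le> norm (indicator ?K x * g x)" for k
      proof (rule AE_I2)
        fix x
        have "\<bar>indicator ?K x * g x\<bar> * bump (real (Suc k)) a b x \<le> \<bar>indicator ?K x * g x\<bar>"
          using bump_bounds[of "real (Suc k)" a b x] by (intro mult_right_le_one_le) auto
        then show "norm (indicator ?K x * g x * bump (real (Suc k)) a b x) \<le> norm (indicator ?K x * g x)"
          using bump_bounds(1)[of "real (Suc k)" a b x] by (simp add: abs_mult del: of_nat_Suc)
      qed
    qed
    moreover have "(LINT x|lebesgue. indicator ?K x * g x * bump (real (Suc k)) a b x) = 0" for k
      using zero[OF test] unfolding set_lebesgue_integral_def eq .
    ultimately have "(LINT x|lebesgue. indicator ?K x * g x * indicator (box a b) x) = 0"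
      by (simp add: LIMSEQ_const_iff)
    moreover have "indicator ?K x * g x * indicator (box a b) x = indicator (box a b) x *\<^sub>R g x" for x
      using box_subset_cbox[of a b] by (auto simp: indicator_def)
    ultimately show ?thesis by (simp add: set_lebesgue_integral_def)
  qed
  have on_box: "AE x in lebesgue. x \<in> box a b \<longrightarrow> g x = 0" if ab: "cbox a b \<subseteq> U" for a b
  proof -
    have K: "integrable lebesgue (\<lambda>x. indicator (cbox a b) x * g x)"
      using Lp_loc_on_1_integrable[OF g compact_cbox ab Ul] by simp
    have "(LINT x:box c d|lebesgue. indicator (cbox a b) x * g x * indicator (box a b) x) = 0" for c d
    proof -
      define p q where "p = (\<Sum>i\<in>Basis. max (a \<bullet> i) (c \<bullet> i) *\<^sub>R i)"
        and "q = (\<Sum>i\<in>Basis. min (b \<bullet> i) (d \<bullet> i) *\<^sub>R i)"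
      have pq: "box a b \<inter> box c d = box p q"
        by (simp add: box_Int_box p_def q_def)
      have "cbox p q \<subseteq> cbox a b"
        by (rule subset_box_imp) (auto simp: p_def q_def)
      with ab have "cbox p q \<subseteq> U" by blast
      from box0[OF this] have "(LINT x:box a b \<inter> box c d|lebesgue. g x) = 0" by (simp add: pq)
      moreover have "indicator (box a b \<inter> box c d) x *\<^sub>R g x =
          indicator (box c d) x *\<^sub>R (indicator (cbox a b) x * g x * indicator (box a b) x)" for x
        using box_subset_cbox[of a b] by (auto simp: indicator_def)
      ultimately show ?thesis by (simp only: set_lebesgue_integral_def)
    qed
    then have "AE x in lebesgue. indicator (cbox a b) x * g x * indicator (box a b) x = 0"
      using integrable_mult_indicator[OF _ K, of "box a b"]
      by (intro AE_eq_0_if_box_integrals_eq_0) (auto simp: mult.commute)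
    then show ?thesis
      by eventually_elim (use box_subset_cbox[of a b] in \<open>auto simp: indicator_def split: if_splits\<close>)
  qed
  let ?F = "{box a b | a b. cbox a b \<subseteq> U}"
  obtain F where F: "F \<subseteq> ?F" "countable F" "\<Union>F = \<Union>?F"
    using Lindelof[of ?F] by (auto simp: open_box)
  have cover: "U \<subseteq> \<Union>F"
  proof
    fix x assume "x \<in> U"
    then obtain e where e: "0 < e" "cball x e \<subseteq> U" using U open_contains_cball by blast
    obtain a b where ab: "x \<in> box a b" "box a b \<subseteq> ball x e"
      using rational_boxes[OF e(1), of x] by blast
    have "box a b \<noteq> {}" using ab(1) by auto
    then have "cbox a b \<subseteq> cball x e"
      using closure_mono[OF ab(2)] e(1) by (simp add: closure_box)
    with e(2) have "cbox a b \<subseteq> U" by (rule order_trans[rotated])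
    then have "box a b \<in> ?F" by (intro CollectI exI conjI) (rule refl)
    then have "x \<in> \<Union>?F" using ab(1) by (rule UnionI)
    then show "x \<in> \<Union>F" unfolding F(3) .
  qed
  have "AE x in lebesgue. \<forall>B\<in>F. x \<in> B \<longrightarrow> g x = 0"
    unfolding AE_ball_countable[OF F(2)]
  proof
    fix B assume "B \<in> F"
    with F(1) obtain a b where "B = box a b" "cbox a b \<subseteq> U" by auto
    then show "AE x in lebesgue. x \<in> B \<longrightarrow> g x = 0" by (simp add: on_box)
  qed
  then show ?thesis
    by eventually_elim (use cover in blast)
qed

section \<open>Strongly monotone equations in a Hilbert space\<close>

text \<open>
  A minimising sequence for the distance is a Cauchy sequence by the parallelogram law.
\<close>

lemma orthogonal_projection_exists:
  fixes V :: "'a::{real_inner,complete_space} set"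
  assumes V: "subspace V" "closed V"
  obtains p where "p \<in> V" "\<And>v. v \<in> V \<Longrightarrow> (x - p) \<bullet> v = 0"
proof -
  have V0: "V \<noteq> {}" using V(1) subspace_0 by blast
  define d where "d = infdist x V"
  have d: "0 \<le> d" "\<And>v. v \<in> V \<Longrightarrow> d \<le> norm (x - v)"
    by (auto simp: d_def infdist_nonneg dist_norm[symmetric] infdist_le)
  have "\<exists>v\<in>V. (norm (x - v))\<^sup>2 < d\<^sup>2 + 1 / real (Suc k)" for k
  proof -
    have "d < sqrt (d\<^sup>2 + 1 / real (Suc k))"
      using d(1) by (intro real_less_rsqrt) auto
    then obtain v where v: "v \<in> V" "dist x v < sqrt (d\<^sup>2 + 1 / real (Suc k))"
      unfolding d_def infdist_notempty[OF V0]
      using cInf_lessD[of "dist x ` V"] V0 by fastforce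
    then have "(dist x v)\<^sup>2 < (sqrt (d\<^sup>2 + 1 / real (Suc k)))\<^sup>2"
      by (intro power_strict_mono) auto
    then show ?thesis using v d(1) by (auto simp: dist_norm)
  qed
  then obtain w where w: "\<And>k. w k \<in> V" "\<And>k. (norm (x - w k))\<^sup>2 < d\<^sup>2 + 1 / real (Suc k)"
    by metis
  have par: "(norm (w m - w k))\<^sup>2 \<le> 2 / real (Suc m) + 2 / real (Suc k)" for m k
  proof -
    have "(1/2) *\<^sub>R (w m + w k) \<in> V" using V(1) w(1) by (intro subspace_scale subspace_add)
    then have "d\<^sup>2 \<le> (norm (x - (1/2) *\<^sub>R (w m + w k)))\<^sup>2"
      using d by (intro power_mono) auto
    moreover have "(norm (w m - w k))\<^sup>2 = 2 * (norm (x - w m))\<^sup>2 + 2 * (norm (x - w k))\<^sup>2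
        - 4 * (norm (x - (1/2) *\<^sub>R (w m + w k)))\<^sup>2"
      by (simp add: power2_norm_eq_inner inner_simps inner_commute field_simps)
    ultimately show ?thesis using w(2)[of m] w(2)[of k] by simp
  qed
  have "Cauchy w"
  proof (rule CauchyI)
    fix e :: real assume e: "0 < e"
    then obtain M where M: "4 / e\<^sup>2 < real M"
      using reals_Archimedean2 by blast
    have "norm (w m - w k) < e" if "M \<le> m" "M \<le> k" for m k
    proof -
      have M0: "0 < real M" by (rule le_less_trans[OF _ M]) simp
      have "2 / real (Suc m) + 2 / real (Suc k) \<le> 2 / real M + 2 / real M"
        using that M0 by (intro add_mono divide_left_mono) auto
      also have "\<dots> < e\<^sup>2" using M M0 e by (simp add: field_simps)
      finally have "(norm (w m - w k))\<^sup>2 < e\<^sup>2" using par[of m k] by linarith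
      then show ?thesis using e by (simp add: power_less_imp_less_base)
    qed
    then show "\<exists>M. \<forall>m\<ge>M. \<forall>n\<ge>M. norm (w m - w n) < e" by blast
  qed
  then obtain p where p: "w \<longlonglongrightarrow> p"
    using Cauchy_convergent convergent_def by blast
  have pV: "p \<in> V" using closed_sequentially[OF V(2) _ p] w(1) by blast
  have "(\<lambda>k. (norm (x - w k))\<^sup>2) \<longlonglongrightarrow> (norm (x - p))\<^sup>2"
    using p by (intro tendsto_intros)
  moreover have "(\<lambda>k. d\<^sup>2 + 1 / real (Suc k)) \<longlonglongrightarrow> d\<^sup>2 + 0"
    using LIMSEQ_inverse_real_of_nat by (intro tendsto_intros) (simp add: inverse_eq_divide)
  ultimately have "(norm (x - p))\<^sup>2 \<le> d\<^sup>2 + 0"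
    using w(2) by (intro LIMSEQ_le[of _ _ "\<lambda>k. d\<^sup>2 + 1 / real (Suc k)"]) (auto intro: less_imp_le)
  moreover have "d\<^sup>2 \<le> (norm (x - v))\<^sup>2" if "v \<in> V" for v
    using d that by (intro power_mono) auto
  ultimately have min: "(norm (x - p))\<^sup>2 \<le> (norm (x - v))\<^sup>2" if "v \<in> V" for v
    using that by (metis add.right_neutral order_trans)
  have "(x - p) \<bullet> v = 0" if v: "v \<in> V" for v
  proof (cases "v = 0")
    case False
    define c where "c = ((x - p) \<bullet> v) / (v \<bullet> v)"
    have "p + c *\<^sub>R v \<in> V" using V(1) pV v by (intro subspace_add subspace_scale)
    from min[OF this] have "0 \<le> - 2 * c * ((x - p) \<bullet> v) + c\<^sup>2 * (v \<bullet> v)"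
      unfolding power2_norm_eq_inner by (simp add: inner_simps inner_commute power2_eq_square algebra_simps)
    also have "\<dots> = - (((x - p) \<bullet> v)\<^sup>2 / (v \<bullet> v))"
      using False by (simp add: c_def power2_eq_square field_simps)
    finally have "((x - p) \<bullet> v)\<^sup>2 / (v \<bullet> v) \<le> 0" by simp
    moreover have "0 < v \<bullet> v" using False by simp
    ultimately have "((x - p) \<bullet> v)\<^sup>2 \<le> 0" by (simp only: divide_le_0_iff) auto
    then show ?thesis by simp
  qed simp
  with pV show thesis by (rule that)
qed

text \<open>
  Let \<open>P\<close> be the orthogonal projection onto \<open>V\<close>. The map \<open>x \<mapsto> P (x - \<rho> B x)\<close> changes squared distances in \<open>V\<close> at most
  by the factor \<open>1 - 2 \<rho> \<mu> + \<rho>\<^sup>2 L\<^sup>2\<close>, which is least, and less than one, for \<open>\<rho> = \<mu> / L\<^sup>2\<close>. The fixed point of this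
  contraction solves the equation.
\<close>

lemma strongly_monotone_equation_solvable:
  fixes B :: "'a::{real_inner,complete_space} \<Rightarrow> 'a"
  assumes V: "subspace V" "closed V"
    and lip: "\<And>x y. x \<in> V \<Longrightarrow> y \<in> V \<Longrightarrow> norm (B x - B y) \<le> L * norm (x - y)"
    and mono: "\<And>x y. x \<in> V \<Longrightarrow> y \<in> V \<Longrightarrow> (B x - B y) \<bullet> (x - y) \<ge> \<mu> * (norm (x - y))\<^sup>2"
    and pos: "0 < \<mu>" "\<mu> \<le> L"
  obtains x where "x \<in> V" "\<And>v. v \<in> V \<Longrightarrow> B x \<bullet> v = 0"
proof -
  define P where "P x = (SOME p. p \<in> V \<and> (\<forall>v\<in>V. (x - p) \<bullet> v = 0))" for x
  have P: "P x \<in> V" "v \<in> V \<Longrightarrow> (x - P x) \<bullet> v = 0" for x v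
  proof -
    have "\<exists>p. p \<in> V \<and> (\<forall>v\<in>V. (x - p) \<bullet> v = 0)"
      using orthogonal_projection_exists[OF V] by metis
    from someI_ex[OF this] show "P x \<in> V" "v \<in> V \<Longrightarrow> (x - P x) \<bullet> v = 0"
      unfolding P_def by blast+
  qed
  have nonexp: "norm (P x - P y) \<le> norm (x - y)" for x y
  proof -
    let ?w = "P x - P y"
    have wV: "?w \<in> V" using V(1) P(1) by (intro subspace_diff)
    have "(x - P x) \<bullet> ?w = 0" "(y - P y) \<bullet> ?w = 0" using P(2) wV by blast+
    then have "?w \<bullet> ?w = (x - y) \<bullet> ?w" by (simp add: inner_simps)
    also have "\<dots> \<le> norm (x - y) * norm ?w" by (rule norm_cauchy_schwarz)
    finally have "norm ?w * norm ?w \<le> norm (x - y) * norm ?w"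
      by (simp add: power2_norm_eq_inner[symmetric] power2_eq_square)
    then show ?thesis by (cases "norm ?w = 0") (auto simp: mult_le_cancel_right)
  qed
  define \<rho> where "\<rho> = \<mu> / L\<^sup>2"
  have L: "0 < L" using pos by linarith
  have \<rho>: "0 < \<rho>" using pos L by (simp add: \<rho>_def)
  define T where "T x = P (x - \<rho> *\<^sub>R B x)" for x
  define c where "c = sqrt (1 - (\<mu> / L)\<^sup>2)"
  have q: "0 \<le> 1 - (\<mu> / L)\<^sup>2" "1 - (\<mu> / L)\<^sup>2 < 1"
    using pos L by (auto simp: power_le_one_iff divide_le_eq_1)
  have c: "0 \<le> c" "c < 1" using q by (auto simp: c_def)
  have contr: "dist (T x) (T y) \<le> c * dist x y" if xy: "x \<in> V" "y \<in> V" for x y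
  proof -
    let ?d = "x - y" and ?b = "B x - B y"
    have "(norm ((x - \<rho> *\<^sub>R B x) - (y - \<rho> *\<^sub>R B y)))\<^sup>2 = (norm (?d - \<rho> *\<^sub>R ?b))\<^sup>2"
      by (simp add: algebra_simps)
    also have "\<dots> = (norm ?d)\<^sup>2 - 2 * \<rho> * (?b \<bullet> ?d) + \<rho>\<^sup>2 * (norm ?b)\<^sup>2"
    proof -
      have "(norm (d - \<rho> *\<^sub>R b))\<^sup>2 = (norm d)\<^sup>2 - 2 * \<rho> * (b \<bullet> d) + \<rho>\<^sup>2 * (norm b)\<^sup>2" for d b :: 'a
        unfolding power2_norm_eq_inner by (simp add: inner_simps inner_commute power2_eq_square)
      then show ?thesis .
    qed
    also have "\<dots> \<le> (norm ?d)\<^sup>2 - 2 * \<rho> * (\<mu> * (norm ?d)\<^sup>2) + \<rho>\<^sup>2 * (L * norm ?d)\<^sup>2"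
      using mono[OF xy] lip[OF xy] \<rho>
      by (intro add_mono diff_mono mult_left_mono power_mono) auto
    also have "\<dots> = (1 - (\<mu> / L)\<^sup>2) * (norm ?d)\<^sup>2"
      using L by (simp add: \<rho>_def power2_eq_square field_simps)
    also have "\<dots> = (c * norm ?d)\<^sup>2" using q by (simp add: c_def power_mult_distrib)
    finally have "norm ((x - \<rho> *\<^sub>R B x) - (y - \<rho> *\<^sub>R B y)) \<le> c * norm ?d"
      by (rule power2_le_imp_le) (simp add: c(1))
    then show ?thesis
      using nonexp[of "x - \<rho> *\<^sub>R B x" "y - \<rho> *\<^sub>R B y"] by (simp add: T_def dist_norm)
  qed
  have "\<exists>!x\<in>V. T x = x"
  proof (rule Banach_fix[OF _ _ c])
    show "complete V" using V(2) by (simp add: complete_eq_closed)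
    show "V \<noteq> {}" using V(1) subspace_0 by blast
    show "T ` V \<subseteq> V" by (auto simp: T_def P(1))
    show "dist (T x) (T y) \<le> c * dist x y" if "x \<in> V" "y \<in> V" for x y
      using that by (rule contr)
  qed
  then obtain x where x: "x \<in> V" "T x = x" by auto
  have "B x \<bullet> v = 0" if "v \<in> V" for v
  proof -
    have "(x - \<rho> *\<^sub>R B x - x) \<bullet> v = 0"
      using P(2)[OF that, of "x - \<rho> *\<^sub>R B x"] x(2) by (simp add: T_def)
    then show ?thesis using \<rho> by simp
  qed
  with x(1) show thesis by (rule that)
qed

section \<open>The Hilbert space of square integrable functions\<close>

definition square_integrable :: "('a::euclidean_space \<Rightarrow> 'b::euclidean_space) \<Rightarrow> bool"
  where "square_integrable f \<longleftrightarrow>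
    f \<in> borel_measurable lebesgue \<and> integrable lebesgue (\<lambda>x. (norm (f x))\<^sup>2)"

lemma square_integrable_iff_nn:
  "square_integrable f \<longleftrightarrow>
    f \<in> borel_measurable lebesgue \<and> (\<integral>\<^sup>+x. ennreal ((norm (f x))\<^sup>2) \<partial>lebesgue) < \<infinity>"
  by (auto simp: square_integrable_def integrable_iff_bounded)

lemma square_integrable_dominated:
  assumes "f \<in> borel_measurable lebesgue" "square_integrable g"
    and "\<And>x. (norm (f x))\<^sup>2 \<le> c * (norm (g x))\<^sup>2"
  shows "square_integrable f"
  unfolding square_integrable_def
proof (intro conjI assms(1))
  show "integrable lebesgue (\<lambda>x. (norm (f x))\<^sup>2)"
  proof (rule Bochner_Integration.integrable_bound)
    show "integrable lebesgue (\<lambda>x. c * (norm (g x))\<^sup>2)"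
      using assms(2) by (auto simp: square_integrable_def)
    show "(\<lambda>x. (norm (f x))\<^sup>2) \<in> borel_measurable lebesgue"
      using assms(1) by auto
    show "AE x in lebesgue. norm ((norm (f x))\<^sup>2) \<le> norm (c * (norm (g x))\<^sup>2)"
    proof (rule AE_I2)
      show "norm ((norm (f x))\<^sup>2) \<le> norm (c * (norm (g x))\<^sup>2)" for x
        using assms(3)[of x] abs_ge_self[of "c * (norm (g x))\<^sup>2"] by simp
    qed
  qed
qed

lemma norm_add_squared_le: "(norm (x + y))\<^sup>2 \<le> 2 * (norm x)\<^sup>2 + 2 * (norm (y::'a::real_inner))\<^sup>2"
proof -
  have "(norm (x + y))\<^sup>2 + (norm (x - y))\<^sup>2 = 2 * (norm x)\<^sup>2 + 2 * (norm y)\<^sup>2"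
    unfolding power2_norm_eq_inner by (simp add: inner_simps inner_commute)
  moreover have "0 \<le> (norm (x - y))\<^sup>2" by simp
  ultimately show ?thesis by linarith
qed

lemma square_integrable_add:
  assumes "square_integrable f" "square_integrable g"
  shows "square_integrable (\<lambda>x. f x + g x)"
  unfolding square_integrable_def
proof
  show m: "(\<lambda>x. f x + g x) \<in> borel_measurable lebesgue"
    using assms by (auto simp: square_integrable_def)
  show "integrable lebesgue (\<lambda>x. (norm (f x + g x))\<^sup>2)"
  proof (rule Bochner_Integration.integrable_bound)
    show "integrable lebesgue (\<lambda>x. 2 * (norm (f x))\<^sup>2 + 2 * (norm (g x))\<^sup>2)"
      using assms by (auto simp: square_integrable_def)
    show "(\<lambda>x. (norm (f x + g x))\<^sup>2) \<in> borel_measurable lebesgue"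
      using m by auto
    show "AE x in lebesgue. norm ((norm (f x + g x))\<^sup>2) \<le> norm (2 * (norm (f x))\<^sup>2 + 2 * (norm (g x))\<^sup>2)"
    proof (rule AE_I2)
      show "norm ((norm (f x + g x))\<^sup>2) \<le> norm (2 * (norm (f x))\<^sup>2 + 2 * (norm (g x))\<^sup>2)" for x
        using norm_add_squared_le[of "f x" "g x"] by simp
    qed
  qed
qed

lemma square_integrable_scaleR:
  "square_integrable f \<Longrightarrow> square_integrable (\<lambda>x. c *\<^sub>R f x)"
  by (auto simp: square_integrable_def power_mult_distrib intro!: borel_measurable_scaleR)

lemma square_integrable_inner:
  assumes "square_integrable f" "square_integrable g"
  shows "integrable lebesgue (\<lambda>x. f x \<bullet> g x)"
proof (rule Bochner_Integration.integrable_bound)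
  show "integrable lebesgue (\<lambda>x. (norm (f x))\<^sup>2 + (norm (g x))\<^sup>2)"
    using assms by (auto simp: square_integrable_def)
  show "(\<lambda>x. f x \<bullet> g x) \<in> borel_measurable lebesgue"
    using assms by (auto simp: square_integrable_def)
  have "\<bar>f x \<bullet> g x\<bar> \<le> (norm (f x))\<^sup>2 + (norm (g x))\<^sup>2" for x
  proof -
    have "2 * norm (f x) * norm (g x) \<le> (norm (f x))\<^sup>2 + (norm (g x))\<^sup>2"
      by (rule sum_squares_bound)
    moreover have "0 \<le> norm (f x) * norm (g x)" by simp
    ultimately show ?thesis using Cauchy_Schwarz_ineq2[of "f x" "g x"] by linarith
  qed
  then show "AE x in lebesgue. norm (f x \<bullet> g x) \<le> norm ((norm (f x))\<^sup>2 + (norm (g x))\<^sup>2)"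
    by (intro AE_I2) simp
qed

text \<open>
  Square integrable functions up to null sets form a type, so that the facts about the classes of
  inner product spaces and complete spaces apply to them. The relation is partial: functions that are not
  square integrable represent nothing.
\<close>

quotient_type (overloaded) ('a, 'b) lsq = "'a::euclidean_space \<Rightarrow> 'b::euclidean_space" / partial:
  "\<lambda>f g. square_integrable f \<and> square_integrable g \<and> (AE x in lebesgue. f x = g x)"
proof (rule part_equivpI)
  show "\<exists>f::'a \<Rightarrow> 'b. square_integrable f \<and> square_integrable f \<and> (AE x in lebesgue. f x = f x)"
    by (intro exI[of _ "\<lambda>x. 0"]) (simp add: square_integrable_def)
  show "symp (\<lambda>f g::'a \<Rightarrow> 'b. square_integrable f \<and> square_integrable g \<and> (AE x in lebesgue. f x = g x))"
    by (rule sympI) (auto elim: AE_mp)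
  show "transp (\<lambda>f g::'a \<Rightarrow> 'b. square_integrable f \<and> square_integrable g \<and> (AE x in lebesgue. f x = g x))"
  proof (rule transpI, elim conjE, intro conjI)
    fix f g h :: "'a \<Rightarrow> 'b"
    assume "AE x in lebesgue. f x = g x" "AE x in lebesgue. g x = h x"
    then show "AE x in lebesgue. f x = h x" by eventually_elim simp
  qed
qed

instantiation lsq :: (euclidean_space, euclidean_space) real_inner
begin

lift_definition zero_lsq :: "('a, 'b) lsq" is "\<lambda>x. 0"
  by (simp add: square_integrable_def)

lift_definition plus_lsq :: "('a, 'b) lsq \<Rightarrow> ('a, 'b) lsq \<Rightarrow> ('a, 'b) lsq" is "\<lambda>f g x. f x + g x"
  by (auto intro: square_integrable_add elim: AE_mp)

lift_definition scaleR_lsq :: "real \<Rightarrow> ('a, 'b) lsq \<Rightarrow> ('a, 'b) lsq" is "\<lambda>c f x. c *\<^sub>R f x"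
  by (auto intro: square_integrable_scaleR elim: AE_mp)

definition uminus_lsq :: "('a, 'b) lsq \<Rightarrow> ('a, 'b) lsq"
  where "uminus_lsq f = (-1) *\<^sub>R f"

definition minus_lsq :: "('a, 'b) lsq \<Rightarrow> ('a, 'b) lsq \<Rightarrow> ('a, 'b) lsq"
  where "minus_lsq f g = f + (- g)"

lift_definition inner_lsq :: "('a, 'b) lsq \<Rightarrow> ('a, 'b) lsq \<Rightarrow> real"
  is "\<lambda>f g. LINT x|lebesgue. f x \<bullet> g x"
proof (elim conjE)
  fix f f' g g' :: "'a \<Rightarrow> 'b"
  assume *: "AE x in lebesgue. f x = f' x" "AE x in lebesgue. g x = g' x"
    "square_integrable f" "square_integrable f'" "square_integrable g" "square_integrable g'"
  from *(1,2) have "AE x in lebesgue. f x \<bullet> g x = f' x \<bullet> g' x"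
    by eventually_elim simp
  then show "(LINT x|lebesgue. f x \<bullet> g x) = (LINT x|lebesgue. f' x \<bullet> g' x)"
    using *(3-) by (intro integral_cong_AE) (auto simp: square_integrable_def)
qed

definition norm_lsq :: "('a, 'b) lsq \<Rightarrow> real" where "norm_lsq f = sqrt (inner f f)"
definition sgn_lsq :: "('a, 'b) lsq \<Rightarrow> ('a, 'b) lsq" where "sgn_lsq f = inverse (norm f) *\<^sub>R f"
definition dist_lsq :: "('a, 'b) lsq \<Rightarrow> ('a, 'b) lsq \<Rightarrow> real" where "dist_lsq f g = norm (f - g)"
definition uniformity_lsq :: "(('a, 'b) lsq \<times> ('a, 'b) lsq) filter"
  where "uniformity_lsq = (INF e\<in>{0<..}. principal {(x, y). dist x y < e})"
definition open_lsq :: "('a, 'b) lsq set \<Rightarrow> bool"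
  where "open_lsq U = (\<forall>x\<in>U. \<forall>\<^sub>F (x', y) in uniformity. x' = x \<longrightarrow> y \<in> U)"

instance
proof
  fix f g h :: "('a, 'b) lsq" and a b :: real
  show "f + g + h = f + (g + h)"
    by transfer (auto simp: add.assoc square_integrable_add)
  show "f + g = g + f"
    by transfer (auto simp: add.commute square_integrable_add)
  show "0 + f = f"
    by transfer auto
  show "- f + f = 0"
    unfolding uminus_lsq_def
    by transfer (auto intro!: square_integrable_add square_integrable_scaleR[of _ "-1", simplified]
        simp: square_integrable_def)
  show "f - g = f + - g" by (simp add: minus_lsq_def)
  show "a *\<^sub>R (f + g) = a *\<^sub>R f + a *\<^sub>R g"
    by transfer (auto simp: scaleR_add_right intro: square_integrable_add square_integrable_scaleR)
  show "(a + b) *\<^sub>R f = a *\<^sub>R f + b *\<^sub>R f"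
    by transfer (auto simp: scaleR_add_left intro: square_integrable_add square_integrable_scaleR)
  show "a *\<^sub>R b *\<^sub>R f = (a * b) *\<^sub>R f"
    by transfer (auto intro: square_integrable_scaleR)
  show "1 *\<^sub>R f = f" by transfer auto
  show "dist f g = norm (f - g)" by (simp add: dist_lsq_def)
  show "sgn f = inverse (norm f) *\<^sub>R f" by (simp add: sgn_lsq_def)
  show "uniformity = (INF e\<in>{0<..}. principal {(x::('a, 'b) lsq, y). dist x y < e})"
    by (simp add: uniformity_lsq_def)
  show "open U = (\<forall>x\<in>U. \<forall>\<^sub>F (x', y) in uniformity. x' = x \<longrightarrow> y \<in> U)" for U :: "('a, 'b) lsq set"
    by (simp add: open_lsq_def)
  show "inner f g = inner g f"
    by transfer (simp add: inner_commute)
  show "inner (f + g) h = inner f h + inner g h"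
    by transfer (auto simp: inner_add_left square_integrable_inner)
  show "inner (a *\<^sub>R f) g = a * inner f g"
    by transfer simp
  show "0 \<le> inner f f"
    by transfer simp
  show "inner f f = 0 \<longleftrightarrow> f = 0"
  proof (transfer, elim conjE)
    fix f :: "'a \<Rightarrow> 'b" assume f: "square_integrable f"
    have "(LINT x|lebesgue. f x \<bullet> f x) = 0 \<longleftrightarrow> (AE x in lebesgue. f x \<bullet> f x = 0)"
      using square_integrable_inner[OF f f] by (intro integral_nonneg_eq_0_iff_AE) auto
    then show "((LINT x|lebesgue. f x \<bullet> f x) = 0) =
        (square_integrable f \<and> square_integrable (\<lambda>x. 0::'b) \<and> (AE x in lebesgue. f x = 0))"
      using f by (simp add: square_integrable_def)
  qed
  show "norm f = sqrt (inner f f)" by (simp add: norm_lsq_def)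
qed

end

text \<open>
  Functions that are not square integrable go to zero, which makes the map total.
\<close>

lift_definition lsq_of :: "('a::euclidean_space \<Rightarrow> 'b::euclidean_space) \<Rightarrow> ('a, 'b) lsq"
  is "\<lambda>f. if square_integrable f then f else (\<lambda>x. 0)"
  by (auto simp: square_integrable_def)

definition repr_lsq :: "('a::euclidean_space, 'b::euclidean_space) lsq \<Rightarrow> 'a \<Rightarrow> 'b"
  where "repr_lsq F = (SOME f. square_integrable f \<and> lsq_of f = F)"

lemma lsq_of_abs: "square_integrable f \<Longrightarrow> lsq_of f = abs_lsq f"
  by (simp add: lsq_of_def)

lemma lsq_of_eq_iff:
  assumes "square_integrable f" "square_integrable g"
  shows "lsq_of f = lsq_of g \<longleftrightarrow> (AE x in lebesgue. f x = g x)"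
  using Quotient3_rel[OF Quotient3_lsq, of f g] assms by (simp add: lsq_of_abs)

lemma repr_lsq: "square_integrable (repr_lsq F)" "lsq_of (repr_lsq F) = F"
proof -
  have "\<exists>f. square_integrable f \<and> lsq_of f = F"
  proof (induction F rule: lsq.abs_induct)
    case (1 f)
    then show ?case by (intro exI[of _ f] conjI lsq_of_abs) auto
  qed
  then have "square_integrable (repr_lsq F) \<and> lsq_of (repr_lsq F) = F"
    unfolding repr_lsq_def by (rule someI_ex)
  then show "square_integrable (repr_lsq F)" "lsq_of (repr_lsq F) = F"
    by simp_all
qed

lemma lsq_of_add_scaleR:
  assumes "square_integrable f" "square_integrable g"
  shows "lsq_of f + c *\<^sub>R lsq_of g = lsq_of (\<lambda>x. f x + c *\<^sub>R g x)"
  using assms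
  by (simp add: lsq_of_abs plus_lsq.abs_eq scaleR_lsq.abs_eq square_integrable_add square_integrable_scaleR)

lemma square_integrable_diff:
  assumes "square_integrable f" "square_integrable g"
  shows "square_integrable (\<lambda>x. f x - g x)"
  using square_integrable_add[OF assms(1) square_integrable_scaleR[OF assms(2), of "-1"]] by simp

lemma lsq_of_diff:
  assumes "square_integrable f" "square_integrable g"
  shows "lsq_of f - lsq_of g = lsq_of (\<lambda>x. f x - g x)"
  using lsq_of_add_scaleR[OF assms, of "-1"] by simp

lemma inner_lsq_of:
  assumes "square_integrable f" "square_integrable g"
  shows "lsq_of f \<bullet> lsq_of g = (LINT x|lebesgue. f x \<bullet> g x)"
  using assms by (simp add: lsq_of_abs inner_lsq.abs_eq)

lemma norm_lsq_of:
  assumes "square_integrable f"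
  shows "(norm (lsq_of f))\<^sup>2 = (LINT x|lebesgue. (norm (f x))\<^sup>2)"
  using inner_lsq_of[OF assms assms] by (simp add: power2_norm_eq_inner)

lemma nn_norm_lsq_of:
  assumes "square_integrable f"
  shows "ennreal ((norm (lsq_of f))\<^sup>2) = (\<integral>\<^sup>+x. ennreal ((norm (f x))\<^sup>2) \<partial>lebesgue)"
  using assms by (simp add: norm_lsq_of nn_integral_eq_integral square_integrable_def)

text \<open>
  The argument of Riesz and Fischer: a subsequence with geometrically decreasing distances converges
  almost everywhere, Fatou's lemma bounds its distance to the pointwise limit, and a Cauchy sequence
  with a convergent subsequence converges.
\<close>

instance lsq :: (euclidean_space, euclidean_space) complete_space
proof
  fix X :: "nat \<Rightarrow> ('a, 'b) lsq"
  assume X: "Cauchy X"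
  have "\<exists>N. \<forall>m\<ge>N. \<forall>n\<ge>N. norm (X m - X n) < (1 / 2) ^ k" for k :: nat
    using CauchyD[OF X, of "(1 / 2) ^ k"] by simp
  then obtain N where N: "\<And>k m n. N k \<le> m \<Longrightarrow> N k \<le> n \<Longrightarrow> norm (X m - X n) < (1 / 2) ^ k"
    by metis
  (* Strictly increasing, and at least N k for every k. *)
  define r where "r k = (\<Sum>i\<le>k. N i) + k" for k
  have rmono: "strict_mono r"
    by (rule strict_monoI_Suc) (simp add: r_def)
  have rN: "N k \<le> r k" for k
    using member_le_sum[of k "{..k}" N] by (simp add: r_def)
  have rdist: "norm (X (r m) - X (r k)) \<le> (1 / 2) ^ k" if "k \<le> m" for k m
  proof -
    have "r k \<le> r m" using that rmono by (simp add: strict_mono_less_eq)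
    then show ?thesis using N[of k "r m" "r k"] rN[of k] by simp
  qed
  define f where "f k = repr_lsq (X (r k))" for k
  have f: "square_integrable (f k)" "lsq_of (f k) = X (r k)" for k
    by (auto simp: f_def repr_lsq)
  have fm[measurable]: "f k \<in> borel_measurable lebesgue" for k
    using f(1) by (simp add: square_integrable_def)
  have fdist: "(\<integral>\<^sup>+x. ennreal ((norm (f m x - f k x))\<^sup>2) \<partial>lebesgue) \<le> ennreal ((1 / 4) ^ k)" if "k \<le> m" for k m
  proof -
    have "(\<integral>\<^sup>+x. ennreal ((norm (f m x - f k x))\<^sup>2) \<partial>lebesgue) = ennreal ((norm (X (r m) - X (r k)))\<^sup>2)"
      using nn_norm_lsq_of[OF square_integrable_diff[OF f(1) f(1)], of m k] lsq_of_diff[OF f(1) f(1), of m k]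
      by (simp add: f(2))
    also have "\<dots> \<le> ennreal (((1 / 2) ^ k)\<^sup>2)"
      using rdist[OF that] by (intro ennreal_leI power_mono) auto
    finally show ?thesis by (simp add: power2_eq_square power_mult_distrib[symmetric])
  qed
  define d where "d k x = f (Suc k) x - f k x" for k x
  have [measurable]: "d k \<in> borel_measurable lebesgue" for k unfolding d_def by measurable
  have "(\<integral>\<^sup>+x. (\<Sum>k. ennreal (2 ^ k * (norm (d k x))\<^sup>2)) \<partial>lebesgue) =
      (\<Sum>k. ennreal (2 ^ k) * (\<integral>\<^sup>+x. ennreal ((norm (d k x))\<^sup>2) \<partial>lebesgue))"
    by (subst nn_integral_suminf) (auto simp: ennreal_mult nn_integral_cmult)
  also have "\<dots> \<le> (\<Sum>k. ennreal (2 ^ k) * ennreal ((1 / 4) ^ k))"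
    using fdist[of _ "Suc _"] by (intro suminf_le mult_left_mono) (auto simp: d_def)
  also have "\<dots> = (\<Sum>k. ennreal ((1 / 2) ^ k))"
  proof (intro arg_cong[where f=suminf] ext)
    fix k :: nat
    have "(2::real) ^ k * (1 / 4) ^ k = (1 / 2) ^ k" by (simp flip: power_mult_distrib)
    then show "ennreal (2 ^ k) * ennreal ((1 / 4) ^ k) = ennreal ((1 / 2) ^ k)"
      by (subst ennreal_mult[symmetric]) auto
  qed
  also have "\<dots> < \<infinity>"
  proof -
    have "summable (\<lambda>k. (1 / 2 :: real) ^ k)" by (rule summable_geometric) simp
    then have "(\<Sum>k. ennreal ((1 / 2) ^ k)) = ennreal (\<Sum>k. (1 / 2) ^ k)"
      by (intro suminf_ennreal2) simp_all
    then show ?thesis by (simp only: ennreal_less_top infinity_ennreal_def)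
  qed
  finally have fin: "(\<integral>\<^sup>+x. (\<Sum>k. ennreal (2 ^ k * (norm (d k x))\<^sup>2)) \<partial>lebesgue) < \<infinity>" .
  have "AE x in lebesgue. (\<Sum>k. ennreal (2 ^ k * (norm (d k x))\<^sup>2)) \<noteq> \<infinity>"
    by (rule nn_integral_PInf_AE[OF _ less_imp_neq[OF fin]]) measurable
  then have conv: "AE x in lebesgue. convergent (\<lambda>k. f k x)"
  proof eventually_elim
    case (elim x)
    define s where "s = enn2real (\<Sum>k. ennreal (2 ^ k * (norm (d k x))\<^sup>2))"
    have s: "0 \<le> s" "(\<Sum>k. ennreal (2 ^ k * (norm (d k x))\<^sup>2)) = ennreal s"
      using elim by (simp_all add: s_def ennreal_enn2real_if)
    have "norm (d k x) \<le> sqrt s * (1 / sqrt 2) ^ k" for k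
    proof -
      have "ennreal (2 ^ k * (norm (d k x))\<^sup>2) \<le> ennreal s"
      proof -
        have "h k \<le> suminf h" for h :: "nat \<Rightarrow> ennreal"
          using sum_le_suminf[OF summableI, of "{k}" h] by simp
        then show ?thesis unfolding s(2)[symmetric] .
      qed
      then have "2 ^ k * (norm (d k x))\<^sup>2 \<le> s" using s(1) by (simp add: ennreal_le_iff)
      then have "(norm (d k x))\<^sup>2 \<le> s * (1 / 2) ^ k"
        by (simp add: power_one_over field_simps)
      also have "\<dots> = (sqrt s * (1 / sqrt 2) ^ k)\<^sup>2"
      proof -
        have "((1 / sqrt 2) ^ k)\<^sup>2 = ((1 / sqrt 2)\<^sup>2) ^ k"
          by (simp only: power_mult[symmetric] mult.commute)
        also have "(1 / sqrt 2)\<^sup>2 = 1 / 2" by (simp add: power_divide)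
        finally show ?thesis using s(1) by (simp add: power_mult_distrib)
      qed
      finally show ?thesis by (rule power2_le_imp_le) (use s(1) in simp)
    qed
    moreover have "summable (\<lambda>k. sqrt s * (1 / sqrt 2) ^ k)"
      by (intro summable_mult summable_geometric) simp
    ultimately have "summable (\<lambda>k. d k x)"
      using summable_comparison_test'[of "\<lambda>k. sqrt s * (1 / sqrt 2) ^ k" 0 "\<lambda>k. d k x"] by blast
    then have "(\<lambda>k. f 0 x + (\<Sum>i<k. d i x)) \<longlonglongrightarrow> f 0 x + suminf (\<lambda>k. d k x)"
      by (intro tendsto_add tendsto_const summable_LIMSEQ)
    moreover have "f 0 x + (\<Sum>i<k. d i x) = f k x" for k
      unfolding d_def using sum_lessThan_telescope[of "\<lambda>k. f k x" k] by simp
    ultimately show ?case by (auto simp: convergent_def)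
  qed
  define g where "g x = lim (\<lambda>k. f k x)" for x
  have [measurable]: "g \<in> borel_measurable lebesgue" unfolding g_def by measurable
  have gdist: "(\<integral>\<^sup>+x. ennreal ((norm (g x - f k x))\<^sup>2) \<partial>lebesgue) \<le> ennreal ((1 / 4) ^ k)" for k
  proof -
    have "AE x in lebesgue. ennreal ((norm (g x - f k x))\<^sup>2) = liminf (\<lambda>m. ennreal ((norm (f m x - f k x))\<^sup>2))"
      using conv
    proof eventually_elim
      case (elim x)
      then have "(\<lambda>m. f m x) \<longlonglongrightarrow> g x" by (simp add: g_def convergent_LIMSEQ_iff)
      then have "(\<lambda>m. ennreal ((norm (f m x - f k x))\<^sup>2)) \<longlonglongrightarrow> ennreal ((norm (g x - f k x))\<^sup>2)"
        by (intro tendsto_ennrealI tendsto_intros)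
      then show ?case by (intro lim_imp_Liminf[symmetric]) simp
    qed
    then have "(\<integral>\<^sup>+x. ennreal ((norm (g x - f k x))\<^sup>2) \<partial>lebesgue) =
        (\<integral>\<^sup>+x. liminf (\<lambda>m. ennreal ((norm (f m x - f k x))\<^sup>2)) \<partial>lebesgue)"
      by (rule nn_integral_cong_AE)
    also have "\<dots> \<le> liminf (\<lambda>m. \<integral>\<^sup>+x. ennreal ((norm (f m x - f k x))\<^sup>2) \<partial>lebesgue)"
      by (intro nn_integral_liminf) measurable
    also have "\<dots> \<le> liminf (\<lambda>m. ennreal ((1 / 4) ^ k))"
      using fdist by (intro Liminf_mono eventually_sequentiallyI[of k]) auto
    finally show ?thesis by (simp add: Liminf_const)
  qed
  have gf: "square_integrable (\<lambda>x. g x - f k x)" for k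
    unfolding square_integrable_iff_nn using gdist[of k] by (auto simp: le_less_trans)
  have g: "square_integrable g"
    using square_integrable_add[OF gf f(1), of 0 0] by simp
  have "norm (lsq_of g - X (r k)) \<le> (1 / 2) ^ k" for k
  proof -
    have "ennreal ((norm (lsq_of g - X (r k)))\<^sup>2) = (\<integral>\<^sup>+x. ennreal ((norm (g x - f k x))\<^sup>2) \<partial>lebesgue)"
      using nn_norm_lsq_of[OF gf] lsq_of_diff[OF g f(1)] f(2) by simp
    also have "\<dots> \<le> ennreal ((1 / 4) ^ k)" by (rule gdist)
    finally have "(norm (lsq_of g - X (r k)))\<^sup>2 \<le> (1 / 4) ^ k"
      by (subst (asm) ennreal_le_iff) auto
    also have "(1 / 4 :: real) ^ k = ((1 / 2) ^ k)\<^sup>2"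
      by (simp add: power2_eq_square power_mult_distrib[symmetric])
    finally show ?thesis by (rule power2_le_imp_le) simp
  qed
  moreover have "(\<lambda>k. (1 / 2 :: real) ^ k) \<longlonglongrightarrow> 0"
    by (rule LIMSEQ_power_zero) simp
  ultimately have "(\<lambda>k. X (r k) - lsq_of g) \<longlonglongrightarrow> 0"
    by (intro Lim_null_comparison[of "\<lambda>k. X (r k) - lsq_of g" "\<lambda>k. (1 / 2) ^ k"] always_eventually allI)
      (simp_all add: norm_minus_commute)
  then have "(X \<circ> r) \<longlonglongrightarrow> lsq_of g"
    by (simp add: LIM_zero_iff comp_def)
  then show "convergent X"
    using X rmono Cauchy_converges_subseq convergent_def by blast
qed

section \<open>The closure of the test functions\<close>

definition jet :: "(real ^ 'n \<Rightarrow> real) \<Rightarrow> real ^ 'n \<Rightarrow> real \<times> (real ^ 'n)"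
  where "jet \<phi> x = (\<phi> x, gradient \<phi> x)"

text \<open>
  Elements are pairs of a function and its weak gradient, so that the norm is the Sobolev norm and the
  closure is a closed subspace of a Hilbert space.
\<close>

definition sobolev0 :: "(real ^ 'n) set \<Rightarrow> (real ^ 'n, real \<times> (real ^ 'n)) lsq set"
  where "sobolev0 U = closure ((\<lambda>\<phi>. lsq_of (jet \<phi>)) ` test_functions U)"

lemma square_integrable_compact_support:
  fixes f :: "real ^ 'n \<Rightarrow> 'b::euclidean_space"
  assumes "continuous_on UNIV f" "compact K" "\<And>x. x \<notin> K \<Longrightarrow> f x = 0"
  shows "square_integrable f"
proof -
  have "integrable lborel (\<lambda>x. (norm (f x))\<^sup>2)"
    by (rule integrable_compact_support[OF _ assms(2)]) (auto intro!: continuous_intros assms(1) simp: assms(3))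
  moreover have "f \<in> borel_measurable borel" using assms(1) by (rule borel_measurable_continuous_onI)
  ultimately show ?thesis
    by (simp add: square_integrable_def measurable_completion integrable_completion)
qed

lemma square_integrable_jet:
  assumes "\<phi> \<in> test_functions U"
  shows "square_integrable (jet \<phi>)"
proof (rule square_integrable_compact_support)
  show "continuous_on UNIV (jet \<phi>)"
    unfolding jet_def using test_function_C1[OF assms] by (intro continuous_on_Pair) auto
  show "compact (closure {x. \<phi> x \<noteq> 0})" using test_function_C1[OF assms] by blast
  show "jet \<phi> x = 0" if "x \<notin> closure {x. \<phi> x \<noteq> 0}" for x
    using that gradient_eq_0_outside_support[OF that] closure_subset[of "{x. \<phi> x \<noteq> 0}"]
    unfolding jet_def by (auto simp: zero_prod_def)
qed

lemma borel_measurable_snd_comp: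
  fixes f :: "'a \<Rightarrow> 'b::euclidean_space \<times> 'c::euclidean_space"
  shows "f \<in> borel_measurable M \<Longrightarrow> (\<lambda>x. snd (f x)) \<in> borel_measurable M"
  by (rule measurable_compose[OF _ borel_measurable_continuous_onI[of snd]])
    (auto intro!: continuous_intros)

lemma subspace_sobolev0:
  fixes U :: "(real ^ 'n) set"
  shows "subspace (sobolev0 U)"
proof -
  have lin: "F + c *\<^sub>R G \<in> sobolev0 U" if FG: "F \<in> sobolev0 U" "G \<in> sobolev0 U" for F G c
  proof -
    let ?S = "(\<lambda>\<phi>. lsq_of (jet \<phi>)) ` test_functions U"
    obtain X Y where XY: "\<And>k. X k \<in> ?S" "X \<longlonglongrightarrow> F" "\<And>k. Y k \<in> ?S" "Y \<longlonglongrightarrow> G"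
      using FG unfolding sobolev0_def closure_sequential by blast
    have "X k + c *\<^sub>R Y k \<in> ?S" for k
    proof -
      obtain \<phi> \<psi> where *: "\<phi> \<in> test_functions U" "\<psi> \<in> test_functions U" "X k = lsq_of (jet \<phi>)" "Y k = lsq_of (jet \<psi>)"
        using XY(1)[of k] XY(3)[of k] by blast
      have "(\<lambda>x. jet \<phi> x + c *\<^sub>R jet \<psi> x) = jet (\<lambda>x. \<phi> x + c * \<psi> x)"
        using test_functions_add_scale(2)[OF *(1,2)] by (simp add: jet_def fun_eq_iff)
      then have "X k + c *\<^sub>R Y k = lsq_of (jet (\<lambda>x. \<phi> x + c * \<psi> x))"
        unfolding *(3,4) by (subst lsq_of_add_scaleR) (simp_all add: square_integrable_jet[OF *(1)] square_integrable_jet[OF *(2)])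
      then show ?thesis using test_functions_add_scale(1)[OF *(1,2)] by blast
    qed
    moreover have "(\<lambda>k. X k + c *\<^sub>R Y k) \<longlonglongrightarrow> F + c *\<^sub>R G"
      using XY by (intro tendsto_intros)
    ultimately show ?thesis unfolding sobolev0_def closure_sequential
      by (intro exI[of _ "\<lambda>k. X k + c *\<^sub>R Y k"] conjI allI)
  qed
  have "lsq_of (jet (\<lambda>x::real ^ 'n. 0)) = 0"
  proof -
    have "jet (\<lambda>x::real ^ 'n. 0) = (\<lambda>x. 0)" by (simp add: jet_def gradient_const zero_prod_def fun_eq_iff)
    moreover have "lsq_of (\<lambda>x::real ^ 'n. 0 :: real \<times> (real ^ 'n)) = 0" by (simp add: lsq_of_abs square_integrable_def zero_lsq_def)
    ultimately show ?thesis by simp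
  qed
  then have 0: "0 \<in> sobolev0 U"
    unfolding sobolev0_def using imageI[OF zero_test_function[of U], of "\<lambda>\<phi>. lsq_of (jet \<phi>)"]
    by (intro subsetD[OF closure_subset]) simp
  show ?thesis
    unfolding subspace_def using 0 lin[of _ _ 1] lin[OF 0] by auto
qed

lemma square_integrable_zero_snd:
  fixes f :: "real ^ 'n \<Rightarrow> real \<times> (real ^ 'n)"
  assumes "square_integrable f"
  shows "square_integrable (\<lambda>x. (0::real, snd (f x)))"
proof (rule square_integrable_dominated[OF _ assms, of _ 1])
  show "(\<lambda>x. (0::real, snd (f x))) \<in> borel_measurable lebesgue"
    using assms unfolding square_integrable_def
    by (intro borel_measurable_Pair) (auto intro: borel_measurable_snd_comp)
  show "(norm (0::real, snd (f x)))\<^sup>2 \<le> 1 * (norm (f x))\<^sup>2" for x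
    by (cases "f x") (simp add: norm_Pair)
qed

text \<open>
  The projection that keeps the gradient; the Dirichlet norm is the norm of this part.
\<close>

lift_definition gradient_part :: "(real ^ 'n, real \<times> (real ^ 'n)) lsq \<Rightarrow> (real ^ 'n, real \<times> (real ^ 'n)) lsq"
  is "\<lambda>f x. (0, snd (f x))"
proof (elim conjE, intro conjI square_integrable_zero_snd)
  fix f g :: "real ^ 'n \<Rightarrow> real \<times> (real ^ 'n)"
  assume "AE x in lebesgue. f x = g x"
  then show "AE x in lebesgue. (0::real, snd (f x)) = (0, snd (g x))"
    by eventually_elim simp
qed

lemma gradient_part_lsq_of:
  assumes "square_integrable f"
  shows "square_integrable (\<lambda>x. (0::real, snd (f x)))" "gradient_part (lsq_of f) = lsq_of (\<lambda>x. (0, snd (f x)))"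
proof -
  show *: "square_integrable (\<lambda>x. (0::real, snd (f x)))"
    using assms by (rule square_integrable_zero_snd)
  show "gradient_part (lsq_of f) = lsq_of (\<lambda>x. (0, snd (f x)))"
    using assms * by (simp add: lsq_of_abs gradient_part.abs_eq)
qed

lemma norm_gradient_part:
  assumes "square_integrable f"
  shows "(norm (gradient_part (lsq_of f)))\<^sup>2 = (LINT x|lebesgue. (norm (snd (f x)))\<^sup>2)"
  using assms by (simp add: gradient_part_lsq_of norm_lsq_of norm_Pair)

lemma bounded_linear_gradient_part: "bounded_linear gradient_part"
proof (rule bounded_linear_intro)
  fix F G :: "(real ^ 'n, real \<times> (real ^ 'n)) lsq" and r :: real
  obtain f g where fg: "square_integrable f" "F = lsq_of f" "square_integrable g" "G = lsq_of g"
    using repr_lsq by metis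
  show "gradient_part (F + G) = gradient_part F + gradient_part G"
    using lsq_of_add_scaleR[OF fg(1,3), of 1] lsq_of_add_scaleR[OF gradient_part_lsq_of(1)[OF fg(1)] gradient_part_lsq_of(1)[OF fg(3)], of 1]
    by (simp add: fg gradient_part_lsq_of square_integrable_add)
  have z: "square_integrable (\<lambda>x. 0 :: real \<times> (real ^ 'n))" "lsq_of (\<lambda>x. 0 :: real \<times> (real ^ 'n)) = 0"
    by (simp_all add: square_integrable_def lsq_of_abs zero_lsq_def)
  show "gradient_part (r *\<^sub>R F) = r *\<^sub>R gradient_part F"
    using lsq_of_add_scaleR[OF z(1) fg(1), of r] lsq_of_add_scaleR[OF z(1) gradient_part_lsq_of(1)[OF fg(1)], of r]
    by (simp add: fg z gradient_part_lsq_of square_integrable_scaleR)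
  have "(norm (gradient_part F))\<^sup>2 \<le> (norm F)\<^sup>2"
    unfolding fg norm_gradient_part[OF fg(1)] norm_lsq_of[OF fg(1)]
  proof (rule integral_mono)
    show "integrable lebesgue (\<lambda>x. (norm (snd (f x)))\<^sup>2)"
      using gradient_part_lsq_of(1)[OF fg(1)] by (simp add: square_integrable_def norm_Pair)
    show "integrable lebesgue (\<lambda>x. (norm (f x))\<^sup>2)" using fg(1) by (simp add: square_integrable_def)
    show "(norm (snd (f x)))\<^sup>2 \<le> (norm (f x))\<^sup>2" for x by (cases "f x") (simp add: norm_Pair)
  qed
  then show "norm (gradient_part F) \<le> norm F * 1"
    using power2_le_imp_le[OF _ norm_ge_zero] by simp
qed

text \<open>
  Integrate \<open>\<phi>\<^sup>2\<close> against the constant one, which is the \<open>i\<close>-th derivative of \<open>x\<^sub>i\<close>, by parts, and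
  absorb half of \<open>\<phi>\<^sup>2\<close> with \<open>2 a b \<le> a\<^sup>2 / 2 + 2 b\<^sup>2\<close>.
\<close>

lemma Poincare_test_function:
  fixes \<phi> :: "real ^ 'n \<Rightarrow> real"
  assumes \<phi>: "\<phi> \<in> test_functions U" and U: "\<And>x. x \<in> U \<Longrightarrow> norm x \<le> R" and R: "0 \<le> R"
  shows "(LINT x|lebesgue. (\<phi> x)\<^sup>2) \<le> 4 * R\<^sup>2 * (LINT x|lebesgue. (norm (gradient \<phi> x))\<^sup>2)"
proof -
  obtain i :: 'n where True by blast
  note C1 = test_function_C1[OF \<phi>] and out = test_function_outside[OF \<phi>]
  let ?K = "closure {x. \<phi> x \<noteq> 0}"
  have d2: "(\<lambda>x. \<phi> x * \<phi> x) differentiable (at x)"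
    "gradient (\<lambda>x. \<phi> x * \<phi> x) x $ i = 2 * \<phi> x * gradient \<phi> x $ i" for x
    using C1(1) by (auto simp: gradient_mult)
  have dx: "((\<lambda>x. x $ i) has_derivative (\<lambda>h. h $ i)) (at x)" for x :: "real ^ 'n"
    by (auto intro!: bounded_linear_imp_has_derivative bounded_linear_vec_nth)
  have gx: "gradient (\<lambda>x. x $ i) x $ i = 1" for x :: "real ^ 'n"
    by (simp add: gradient_nth[OF dx])
  have parts: "(LINT x|lebesgue. x $ i * gradient (\<lambda>x. \<phi> x * \<phi> x) x $ i) =
      - (LINT x|lebesgue. gradient (\<lambda>x. x $ i) x $ i * (\<phi> x * \<phi> x))"
  proof (rule integration_by_parts)
    show "(\<lambda>x::real ^ 'n. x $ i) differentiable (at x)" for x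
      using dx differentiable_def by blast
    show "continuous_on UNIV (\<lambda>x. gradient (\<lambda>x. x $ i) x $ i)" by (simp add: gx)
    show "continuous_on UNIV (\<lambda>x. gradient (\<lambda>x. \<phi> x * \<phi> x) x $ i)"
      unfolding d2 by (intro continuous_intros C1)
    show "compact (closure {x. \<phi> x * \<phi> x \<noteq> 0})" using C1(4) by simp
  qed (rule d2)
  have int: "integrable lebesgue f" if "continuous_on UNIV f" "\<And>x. \<phi> x = 0 \<Longrightarrow> gradient \<phi> x = 0 \<Longrightarrow> f x = 0"
    for f :: "real ^ 'n \<Rightarrow> real"
  proof -
    have "integrable lborel f"
    proof (rule integrable_compact_support[OF that(1) C1(4)])
      fix x assume x: "x \<notin> closure {x. \<phi> x \<noteq> 0}"
      have "\<phi> x = 0" using x closure_subset[of "{x. \<phi> x \<noteq> 0}"] by blast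
      then show "f x = 0" using gradient_eq_0_outside_support[OF x] by (rule that(2))
    qed
    then show ?thesis using that(1) by (simp add: integrable_completion borel_measurable_continuous_onI)
  qed
  have i1: "integrable lebesgue (\<lambda>x. (\<phi> x)\<^sup>2)"
    by (rule int) (auto intro!: continuous_intros C1)
  have i2: "integrable lebesgue (\<lambda>x. (norm (gradient \<phi> x))\<^sup>2)"
    by (rule int) (auto intro!: continuous_intros C1)
  have i3: "integrable lebesgue (\<lambda>x. - (x $ i * (2 * \<phi> x * gradient \<phi> x $ i)))"
    by (rule int) (auto intro!: continuous_intros C1)
  have "(LINT x|lebesgue. (\<phi> x)\<^sup>2) = - (LINT x|lebesgue. x $ i * (2 * \<phi> x * gradient \<phi> x $ i))"
    using parts unfolding d2 gx by (simp add: power2_eq_square)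
  also have "\<dots> = (LINT x|lebesgue. - (x $ i * (2 * \<phi> x * gradient \<phi> x $ i)))"
    by simp
  also have "\<dots> \<le> (LINT x|lebesgue. (1/2) * (\<phi> x)\<^sup>2 + 2 * R\<^sup>2 * (norm (gradient \<phi> x))\<^sup>2)"
  proof (rule integral_mono[OF i3])
    show "integrable lebesgue (\<lambda>x. (1/2) * (\<phi> x)\<^sup>2 + 2 * R\<^sup>2 * (norm (gradient \<phi> x))\<^sup>2)"
      using i1 i2 by auto
    fix x
    show "- (x $ i * (2 * \<phi> x * gradient \<phi> x $ i)) \<le> (1/2) * (\<phi> x)\<^sup>2 + 2 * R\<^sup>2 * (norm (gradient \<phi> x))\<^sup>2"
    proof (cases "x \<in> U")
      case True
      have "\<bar>x $ i * gradient \<phi> x $ i\<bar> \<le> R * norm (gradient \<phi> x)"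
        unfolding abs_mult using U[OF True] component_le_norm_cart[of x i] component_le_norm_cart[of "gradient \<phi> x" i]
        by (intro mult_mono) auto
      then have "(x $ i * gradient \<phi> x $ i)\<^sup>2 \<le> (R * norm (gradient \<phi> x))\<^sup>2"
        using R by (simp add: abs_le_square_iff[symmetric] abs_mult)
      moreover have "- (2 * a * b) \<le> (1/2) * a\<^sup>2 + 2 * b\<^sup>2" for a b :: real
        using zero_le_power2[of "a + 2 * b"] by (simp add: power2_eq_square algebra_simps)
      from this[of "\<phi> x" "x $ i * gradient \<phi> x $ i"]
      have "- (x $ i * (2 * \<phi> x * gradient \<phi> x $ i)) \<le> (1/2) * (\<phi> x)\<^sup>2 + 2 * (x $ i * gradient \<phi> x $ i)\<^sup>2"
        by (simp add: mult_ac)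
      ultimately show ?thesis by (simp add: power_mult_distrib)
    next
      case False
      then show ?thesis using out[OF False] by simp
    qed
  qed
  also have "\<dots> = (1/2) * (LINT x|lebesgue. (\<phi> x)\<^sup>2) + 2 * R\<^sup>2 * (LINT x|lebesgue. (norm (gradient \<phi> x))\<^sup>2)"
    using i1 i2 by simp
  finally show ?thesis by simp
qed

text \<open>
  The inequality holds for test functions, and both sides are continuous on the Hilbert space.
\<close>

lemma Poincare_sobolev0:
  fixes U :: "(real ^ 'n) set"
  assumes "F \<in> sobolev0 U" and U: "\<And>x. x \<in> U \<Longrightarrow> norm x \<le> R" and R: "0 \<le> R"
  shows "(norm F)\<^sup>2 \<le> (1 + 4 * R\<^sup>2) * (norm (gradient_part F))\<^sup>2"
proof -
  let ?S = "{F :: (real ^ 'n, real \<times> (real ^ 'n)) lsq. (norm F)\<^sup>2 \<le> (1 + 4 * R\<^sup>2) * (norm (gradient_part F))\<^sup>2}"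
  have "continuous_on UNIV (gradient_part :: _ \<Rightarrow> (real ^ 'n, real \<times> (real ^ 'n)) lsq)"
    by (rule linear_continuous_on[OF bounded_linear_gradient_part])
  then have "closed ?S"
    by (intro closed_Collect_le continuous_intros)
  moreover have "(\<lambda>\<phi>. lsq_of (jet \<phi>)) ` test_functions U \<subseteq> ?S"
  proof safe
    fix \<phi> :: "real ^ 'n \<Rightarrow> real" assume \<phi>: "\<phi> \<in> test_functions U"
    note sq = square_integrable_jet[OF \<phi>]
    have "integrable lebesgue (\<lambda>x. (norm (gradient \<phi> x))\<^sup>2)"
      using gradient_part_lsq_of(1)[OF sq] by (simp add: square_integrable_def jet_def norm_Pair)
    moreover have "integrable lebesgue (\<lambda>x. (norm (jet \<phi> x))\<^sup>2)"
      using sq by (simp add: square_integrable_def)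
    ultimately have "integrable lebesgue (\<lambda>x. (norm (jet \<phi> x))\<^sup>2 - (norm (gradient \<phi> x))\<^sup>2)" by simp
    then have i1: "integrable lebesgue (\<lambda>x. (\<phi> x)\<^sup>2)" by (simp add: jet_def norm_Pair)
    have "(norm (lsq_of (jet \<phi>)))\<^sup>2 = (LINT x|lebesgue. (\<phi> x)\<^sup>2 + (norm (gradient \<phi> x))\<^sup>2)"
      by (simp add: norm_lsq_of[OF sq] jet_def norm_Pair)
    also have "\<dots> = (LINT x|lebesgue. (\<phi> x)\<^sup>2) + (LINT x|lebesgue. (norm (gradient \<phi> x))\<^sup>2)"
      using i1 \<open>integrable lebesgue (\<lambda>x. (norm (gradient \<phi> x))\<^sup>2)\<close> by simp
    also have "\<dots> \<le> (1 + 4 * R\<^sup>2) * (LINT x|lebesgue. (norm (gradient \<phi> x))\<^sup>2)"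
      using Poincare_test_function[OF \<phi> U R] by (simp add: algebra_simps)
    finally show "(norm (lsq_of (jet \<phi>)))\<^sup>2 \<le> (1 + 4 * R\<^sup>2) * (norm (gradient_part (lsq_of (jet \<phi>))))\<^sup>2"
      by (simp add: norm_gradient_part[OF sq] jet_def)
  qed
  ultimately have "sobolev0 U \<subseteq> ?S" unfolding sobolev0_def by (rule closure_minimal[rotated])
  with assms(1) show ?thesis by blast
qed

section \<open>Functions vanishing on the boundary and their weak gradients\<close>

text \<open>
  \<open>u\<close> belongs to \<open>W\<^sup>1\<^sup>2\<^sub>0\<close> of \<open>U\<close> and has the weak gradient \<open>G\<close>. Both are functions on the whole space, and both vanish
  almost everywhere outside \<open>U\<close>. Naming the gradient avoids the arbitrary representative \<^const>\<open>weak_gradient\<close>.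
\<close>

definition W0 :: "(real ^ 'n) set \<Rightarrow> (real ^ 'n \<Rightarrow> real) \<Rightarrow> (real ^ 'n \<Rightarrow> real ^ 'n) \<Rightarrow> bool"
  where "W0 U u G \<longleftrightarrow> square_integrable (\<lambda>x. (u x, G x)) \<and> lsq_of (\<lambda>x. (u x, G x)) \<in> sobolev0 U"

lemma borel_measurable_fst_comp:
  fixes f :: "'a \<Rightarrow> 'b::euclidean_space \<times> 'c::euclidean_space"
  shows "f \<in> borel_measurable M \<Longrightarrow> (\<lambda>x. fst (f x)) \<in> borel_measurable M"
  by (rule measurable_compose[OF _ borel_measurable_continuous_onI[of fst]])
    (auto intro!: continuous_intros)

lemma square_integrable_Pair_iff:
  fixes u :: "real ^ 'n \<Rightarrow> real" and G :: "real ^ 'n \<Rightarrow> real ^ 'n"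
  shows "square_integrable (\<lambda>x. (u x, G x)) \<longleftrightarrow> square_integrable u \<and> square_integrable G"
proof
  assume *: "square_integrable (\<lambda>x. (u x, G x))"
  have m: "(\<lambda>x. (u x, G x)) \<in> borel_measurable lebesgue" using * by (simp add: square_integrable_def)
  show "square_integrable u \<and> square_integrable G"
    using borel_measurable_fst_comp[OF m] borel_measurable_snd_comp[OF m]
    by (intro conjI square_integrable_dominated[OF _ *, of _ 1]) (auto simp: norm_Pair)
next
  assume *: "square_integrable u \<and> square_integrable G"
  then have "(\<lambda>x. (u x, G x)) \<in> borel_measurable lebesgue"
    by (intro borel_measurable_Pair) (auto simp: square_integrable_def)
  then show "square_integrable (\<lambda>x. (u x, G x))"
    using * by (simp add: square_integrable_def norm_Pair)
qed

lemma W0_square_integrable: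
  assumes "W0 U u G"
  shows "square_integrable u" "square_integrable G" "square_integrable (\<lambda>x. (u x, G x))"
    "u \<in> borel_measurable lebesgue" "G \<in> borel_measurable lebesgue"
  using assms by (auto simp: W0_def square_integrable_Pair_iff square_integrable_def[of u] square_integrable_def[of G])

lemma norm_lsq_of_diff_jet:
  assumes "square_integrable (\<lambda>x. (u x, G x))" "\<phi> \<in> test_functions V"
  shows "ennreal ((norm (lsq_of (jet \<phi>) - lsq_of (\<lambda>x. (u x, G x))))\<^sup>2) =
    (\<integral>\<^sup>+x. ennreal (\<bar>u x - \<phi> x\<bar>\<^sup>2) \<partial>lebesgue) + (\<integral>\<^sup>+x. ennreal ((norm (G x - gradient \<phi> x))\<^sup>2) \<partial>lebesgue)"
proof -
  note j = square_integrable_jet[OF assms(2)]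
  have [measurable]: "u \<in> borel_measurable lebesgue" "G \<in> borel_measurable lebesgue"
    using assms(1) by (simp_all add: square_integrable_Pair_iff square_integrable_def)
  have [measurable]: "\<phi> \<in> borel_measurable lebesgue" "gradient \<phi> \<in> borel_measurable lebesgue"
    using test_function_C1[OF assms(2)]
    by (auto intro!: measurable_completion borel_measurable_continuous_onI)
  have "ennreal ((norm (lsq_of (jet \<phi>) - lsq_of (\<lambda>x. (u x, G x))))\<^sup>2) =
      (\<integral>\<^sup>+x. ennreal ((norm (jet \<phi> x - (u x, G x)))\<^sup>2) \<partial>lebesgue)"
    using nn_norm_lsq_of[OF square_integrable_diff[OF j assms(1)]] lsq_of_diff[OF j assms(1)] by simp
  also have "\<dots> = (\<integral>\<^sup>+x. (ennreal (\<bar>u x - \<phi> x\<bar>\<^sup>2) + ennreal ((norm (G x - gradient \<phi> x))\<^sup>2)) \<partial>lebesgue)"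
    by (intro nn_integral_cong)
      (simp add: jet_def norm_Pair norm_minus_commute power2_commute flip: ennreal_plus)
  also have "\<dots> = (\<integral>\<^sup>+x. ennreal (\<bar>u x - \<phi> x\<bar>\<^sup>2) \<partial>lebesgue) + (\<integral>\<^sup>+x. ennreal ((norm (G x - gradient \<phi> x))\<^sup>2) \<partial>lebesgue)"
    by (intro nn_integral_add) measurable
  finally show ?thesis .
qed

lemma W0_sequence:
  assumes "W0 U u G"
  shows "\<exists>\<phi>. (\<forall>k::nat. \<phi> k \<in> test_functions U) \<and> (\<lambda>k. lsq_of (jet (\<phi> k))) \<longlonglongrightarrow> lsq_of (\<lambda>x. (u x, G x)) \<and>
    (\<lambda>k. (\<integral>\<^sup>+x. ennreal (\<bar>u x - \<phi> k x\<bar>\<^sup>2) \<partial>lebesgue) + (\<integral>\<^sup>+x. ennreal ((norm (G x - gradient (\<phi> k) x))\<^sup>2) \<partial>lebesgue)) \<longlonglongrightarrow> 0"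
proof -
  let ?F = "lsq_of (\<lambda>x. (u x, G x))"
  obtain X where X: "\<And>k. X k \<in> (\<lambda>\<phi>. lsq_of (jet \<phi>)) ` test_functions U" "X \<longlonglongrightarrow> ?F"
    using assms unfolding W0_def sobolev0_def closure_sequential by blast
  have "\<forall>k. \<exists>\<phi>. \<phi> \<in> test_functions U \<and> X k = lsq_of (jet \<phi>)" using X(1) by blast
  then obtain \<phi> where \<phi>: "\<And>k. \<phi> k \<in> test_functions U" "\<And>k. X k = lsq_of (jet (\<phi> k))"
    by metis
  have lim: "(\<lambda>k. lsq_of (jet (\<phi> k))) \<longlonglongrightarrow> ?F"
  proof -
    have "(\<lambda>k. lsq_of (jet (\<phi> k))) = X" by (rule ext) (simp add: \<phi>(2))
    with X(2) show ?thesis by (simp only:)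
  qed
  then have "(\<lambda>k. ennreal ((norm (lsq_of (jet (\<phi> k)) - ?F))\<^sup>2)) \<longlonglongrightarrow> ennreal 0"
    using tendsto_power[OF tendsto_norm[OF LIM_zero[OF lim]], of 2] by (intro tendsto_ennrealI) simp
  then have "(\<lambda>k. (\<integral>\<^sup>+x. ennreal (\<bar>u x - \<phi> k x\<bar>\<^sup>2) \<partial>lebesgue) + (\<integral>\<^sup>+x. ennreal ((norm (G x - gradient (\<phi> k) x))\<^sup>2) \<partial>lebesgue)) \<longlonglongrightarrow> 0"
    using norm_lsq_of_diff_jet[OF W0_square_integrable(3)[OF assms] \<phi>(1)] by simp
  with \<phi>(1) lim show ?thesis by blast
qed

lemma W0_I:
  assumes sq: "square_integrable (\<lambda>x. (u x, G x))" and \<phi>: "\<And>k::nat. \<phi> k \<in> test_functions U"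
    and lim: "(\<lambda>k. (\<integral>\<^sup>+x. ennreal (\<bar>u x - \<phi> k x\<bar>\<^sup>2) \<partial>lebesgue) + (\<integral>\<^sup>+x. ennreal ((norm (G x - gradient (\<phi> k) x))\<^sup>2) \<partial>lebesgue)) \<longlonglongrightarrow> 0"
  shows "W0 U u G"
proof -
  let ?F = "lsq_of (\<lambda>x. (u x, G x))"
  have "(\<lambda>k. ennreal ((norm (lsq_of (jet (\<phi> k)) - ?F))\<^sup>2)) \<longlonglongrightarrow> ennreal 0"
    using lim norm_lsq_of_diff_jet[OF sq \<phi>] by simp
  then have "(\<lambda>k. (norm (lsq_of (jet (\<phi> k)) - ?F))\<^sup>2) \<longlonglongrightarrow> 0"
    by (subst (asm) tendsto_ennreal_iff) auto
  then have "(\<lambda>k. sqrt ((norm (lsq_of (jet (\<phi> k)) - ?F))\<^sup>2)) \<longlonglongrightarrow> sqrt 0"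
    by (rule tendsto_real_sqrt)
  then have "(\<lambda>k. lsq_of (jet (\<phi> k))) \<longlonglongrightarrow> ?F"
    by (simp add: LIM_zero_iff tendsto_norm_zero_iff)
  then show ?thesis
    unfolding W0_def sobolev0_def closure_sequential using sq \<phi> 
    by (intro conjI exI[of _ "\<lambda>k. lsq_of (jet (\<phi> k))"]) auto
qed

lemma W0_mono:
  assumes "U \<subseteq> V" "W0 U u G"
  shows "W0 V u G"
  using closure_mono[OF image_mono[OF test_functions_mono[OF assms(1)]], of "\<lambda>\<phi>. lsq_of (jet \<phi>)"] assms(2)
  unfolding W0_def sobolev0_def by blast

lemma W0_cong_AE:
  assumes "W0 U u G" "AE x in lebesgue. u x = u' x" "AE x in lebesgue. G x = G' x"
    and "u' \<in> borel_measurable lebesgue" "G' \<in> borel_measurable lebesgue"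
  shows "W0 U u' G'"
proof -
  have ae: "AE x in lebesgue. (u x, G x) = (u' x, G' x)"
    using assms(2,3) by eventually_elim simp
  then have "AE x in lebesgue. (norm (u x, G x))\<^sup>2 = (norm (u' x, G' x))\<^sup>2"
    by eventually_elim simp
  moreover have m: "(\<lambda>x. (u' x, G' x)) \<in> borel_measurable lebesgue"
    using assms(4,5) by (rule borel_measurable_Pair)
  moreover have sq: "square_integrable (\<lambda>x. (u x, G x))" using assms(1) by (rule W0_square_integrable)
  ultimately have "integrable lebesgue (\<lambda>x. (norm (u' x, G' x))\<^sup>2)"
    using integrable_cong_AE[of "\<lambda>x. (norm (u x, G x))\<^sup>2" lebesgue "\<lambda>x. (norm (u' x, G' x))\<^sup>2"]
    by (auto simp: square_integrable_def)
  then have sq': "square_integrable (\<lambda>x. (u' x, G' x))" using m by (simp add: square_integrable_def)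
  have "lsq_of (\<lambda>x. (u x, G x)) = lsq_of (\<lambda>x. (u' x, G' x))"
    using ae by (simp add: lsq_of_eq_iff[OF sq sq'])
  then show ?thesis using assms(1) sq' by (simp add: W0_def)
qed

lemma W0_vanishes_outside:
  assumes "W0 U u G" "U \<in> sets lebesgue"
  shows "AE x in lebesgue. x \<notin> U \<longrightarrow> u x = 0 \<and> G x = 0"
proof -
  obtain \<phi> where \<phi>: "\<And>k::nat. \<phi> k \<in> test_functions U" and "(\<lambda>k. lsq_of (jet (\<phi> k))) \<longlonglongrightarrow> lsq_of (\<lambda>x. (u x, G x))"
    and lim: "(\<lambda>k. (\<integral>\<^sup>+x. ennreal (\<bar>u x - \<phi> k x\<bar>\<^sup>2) \<partial>lebesgue) + (\<integral>\<^sup>+x. ennreal ((norm (G x - gradient (\<phi> k) x))\<^sup>2) \<partial>lebesgue)) \<longlonglongrightarrow> 0"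
    using W0_sequence[OF assms(1)] by blast
  have [measurable]: "u \<in> borel_measurable lebesgue" "G \<in> borel_measurable lebesgue" "U \<in> sets lebesgue"
    using W0_square_integrable[OF assms(1)] assms(2) by auto
  let ?w = "\<lambda>x. indicator (- U) x * (ennreal (\<bar>u x\<bar>\<^sup>2) + ennreal ((norm (G x))\<^sup>2))"
  have "(\<integral>\<^sup>+x. ?w x \<partial>lebesgue) \<le> (\<integral>\<^sup>+x. ennreal (\<bar>u x - \<phi> k x\<bar>\<^sup>2) \<partial>lebesgue) + (\<integral>\<^sup>+x. ennreal ((norm (G x - gradient (\<phi> k) x))\<^sup>2) \<partial>lebesgue)" for k
  proof -
    have [measurable]: "\<phi> k \<in> borel_measurable lebesgue" "gradient (\<phi> k) \<in> borel_measurable lebesgue"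
      using test_function_C1[OF \<phi>]
      by (auto intro!: measurable_completion borel_measurable_continuous_onI)
    have "(\<integral>\<^sup>+x. ?w x \<partial>lebesgue) \<le> (\<integral>\<^sup>+x. ennreal (\<bar>u x - \<phi> k x\<bar>\<^sup>2) + ennreal ((norm (G x - gradient (\<phi> k) x))\<^sup>2) \<partial>lebesgue)"
    proof (rule nn_integral_mono)
      show "?w x \<le> ennreal (\<bar>u x - \<phi> k x\<bar>\<^sup>2) + ennreal ((norm (G x - gradient (\<phi> k) x))\<^sup>2)" for x
        using test_function_outside[OF \<phi>, of x k] by (cases "x \<in> U") auto
    qed
    also have "\<dots> = (\<integral>\<^sup>+x. ennreal (\<bar>u x - \<phi> k x\<bar>\<^sup>2) \<partial>lebesgue) + (\<integral>\<^sup>+x. ennreal ((norm (G x - gradient (\<phi> k) x))\<^sup>2) \<partial>lebesgue)"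
      by (intro nn_integral_add) measurable
    finally show ?thesis .
  qed
  then have "(\<integral>\<^sup>+x. ?w x \<partial>lebesgue) \<le> 0"
    using lim by (intro LIMSEQ_le_const[OF lim]) blast
  then have "AE x in lebesgue. ?w x = 0"
    by (subst nn_integral_0_iff_AE[symmetric]) (auto intro!: borel_measurable_times_ennreal)
  then show ?thesis
    by eventually_elim (auto simp: indicator_def)
qed

lemma W0_restrict:
  assumes "W0 U u G" "U \<in> sets lebesgue"
  shows "W0 U (\<lambda>x. if x \<in> U then u x else 0) (\<lambda>x. if x \<in> U then G x else 0)"
proof (rule W0_cong_AE[OF assms(1)])
  have m: "u \<in> borel_measurable lebesgue" "G \<in> borel_measurable lebesgue"
    using W0_square_integrable[OF assms(1)] by auto
  show "(\<lambda>x. if x \<in> U then u x else 0) \<in> borel_measurable lebesgue"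
    "(\<lambda>x. if x \<in> U then G x else 0) \<in> borel_measurable lebesgue"
    using m assms(2) by (auto intro!: measurable_If)
  show "AE x in lebesgue. u x = (if x \<in> U then u x else 0)"
    "AE x in lebesgue. G x = (if x \<in> U then G x else 0)"
    using W0_vanishes_outside[OF assms] by (eventually_elim; simp)+
qed

lemma square_integrable_Lp_loc_on:
  fixes f :: "real ^ 'n \<Rightarrow> 'b::euclidean_space"
  assumes f: "square_integrable f" and U: "U \<in> sets lebesgue" and s: "0 < s" "s \<le> 2"
  shows "f \<in> Lp_loc_on s U"
  unfolding Lp_loc_on_def
proof (intro CollectI conjI allI impI)
  have m[measurable]: "f \<in> borel_measurable lebesgue" using f by (simp add: square_integrable_def)
  then show "f \<in> borel_measurable (lebesgue_on U)" by (rule measurable_restrict_space1)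
  fix K assume K: "compact K \<and> K \<subseteq> U"
  have [measurable]: "K \<in> sets lebesgue" using K by (simp add: lmeasurable_compact fmeasurableD)
  have "(\<integral>\<^sup>+x\<in>K. ennreal (norm (f x) powr s) \<partial>lebesgue) \<le>
      (\<integral>\<^sup>+x. indicator K x + ennreal ((norm (f x))\<^sup>2) \<partial>lebesgue)"
  proof (rule nn_integral_mono)
    fix x
    have "norm (f x) powr s \<le> 1 + (norm (f x))\<^sup>2"
    proof (cases "norm (f x) \<le> 1")
      case True
      then have "norm (f x) powr s \<le> 1" using s by (intro powr_le1) auto
      then show ?thesis by (meson add_increasing2 zero_le_power2)
    next
      case False
      then have "norm (f x) powr s \<le> norm (f x) powr 2" using s by (intro powr_mono) auto
      then show ?thesis using False by (simp add: powr_numeral)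
    qed
    then have "ennreal (norm (f x) powr s) \<le> ennreal 1 + ennreal ((norm (f x))\<^sup>2)"
      by (subst ennreal_plus[symmetric]) (simp_all del: ennreal_1 ennreal_plus add: ennreal_leI)
    then show "ennreal (norm (f x) powr s) * indicator K x \<le> indicator K x + ennreal ((norm (f x))\<^sup>2)"
      by (auto simp: indicator_def)
  qed
  also have "\<dots> = emeasure lebesgue K + (\<integral>\<^sup>+x. ennreal ((norm (f x))\<^sup>2) \<partial>lebesgue)"
    by (subst nn_integral_add) auto
  also have "\<dots> < \<infinity>"
    using f K lmeasurable_compact[of K] by (auto simp: square_integrable_iff_nn fmeasurable_def)
  finally show "(\<integral>\<^sup>+x\<in>K. ennreal (norm (f x) powr s) \<partial>lebesgue) < \<infinity>" .
qed

text \<open>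
  For a fixed test function both sides of the integration by parts formula are inner products in the
  Hilbert space, hence they are preserved in the limit. As \<open>V\<close> may be larger than \<open>U\<close>, extension by
  zero preserves weak differentiability.
\<close>

lemma W0_has_weak_gradient:
  assumes W: "W0 U u G" and V: "V \<in> sets lebesgue"
  shows "has_weak_gradient V u G"
  unfolding has_weak_gradient_def
proof (intro conjI ballI allI)
  note sq = W0_square_integrable[OF W]
  show "u \<in> Lp_loc_on 1 V" "G \<in> Lp_loc_on 1 V"
    using sq V by (auto intro: square_integrable_Lp_loc_on)
  fix \<psi> i assume \<psi>: "\<psi> \<in> test_functions V"
  let ?h1 = "\<lambda>x. (gradient \<psi> x $ i, 0 :: real ^ 'n)" and ?h2 = "\<lambda>x. (0 :: real, \<psi> x *\<^sub>R axis i (1::real))"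
  note C1 = test_function_C1[OF \<psi>]
  have out: "\<psi> x = 0" if "x \<notin> closure {x. \<psi> x \<noteq> 0}" for x
    using that closure_subset[of "{x. \<psi> x \<noteq> 0}"] by blast
  have h: "square_integrable ?h1" "square_integrable ?h2"
  proof -
    show "square_integrable ?h1"
    proof (rule square_integrable_compact_support[OF _ C1(4)])
      show "continuous_on UNIV ?h1" by (intro continuous_intros C1)
      show "?h1 x = 0" if "x \<notin> closure {x. \<psi> x \<noteq> 0}" for x
        using gradient_eq_0_outside_support[OF that] by (simp add: zero_prod_def)
    qed
    show "square_integrable ?h2"
    proof (rule square_integrable_compact_support[OF _ C1(4)])
      show "continuous_on UNIV ?h2" by (intro continuous_intros C1)
      show "?h2 x = 0" if "x \<notin> closure {x. \<psi> x \<noteq> 0}" for x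
        using out[OF that] by (simp add: zero_prod_def)
    qed
  qed
  obtain \<phi> where \<phi>: "\<And>k::nat. \<phi> k \<in> test_functions U"
    and lim: "(\<lambda>k. lsq_of (jet (\<phi> k))) \<longlonglongrightarrow> lsq_of (\<lambda>x. (u x, G x))"
    using W0_sequence[OF W] by blast
  have ip: "lsq_of f \<bullet> lsq_of ?h1 = (LINT x|lebesgue. fst (f x) * gradient \<psi> x $ i)"
    "lsq_of f \<bullet> lsq_of ?h2 = (LINT x|lebesgue. snd (f x) $ i * \<psi> x)" if "square_integrable f" for f
    using inner_lsq_of[OF that h(1)] inner_lsq_of[OF that h(2)]
    by (simp_all add: inner_prod_def cart_eq_inner_axis mult.commute)
  have "lsq_of (jet (\<phi> k)) \<bullet> lsq_of ?h1 = - (lsq_of (jet (\<phi> k)) \<bullet> lsq_of ?h2)" for k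
    using integration_by_parts[of "\<phi> k" \<psi> i] test_function_C1[OF \<phi>[of k]] C1
    by (simp add: ip[OF square_integrable_jet[OF \<phi>]] jet_def)
  moreover have "(\<lambda>k. lsq_of (jet (\<phi> k)) \<bullet> lsq_of ?h1) \<longlonglongrightarrow> lsq_of (\<lambda>x. (u x, G x)) \<bullet> lsq_of ?h1"
    "(\<lambda>k. - (lsq_of (jet (\<phi> k)) \<bullet> lsq_of ?h2)) \<longlonglongrightarrow> - (lsq_of (\<lambda>x. (u x, G x)) \<bullet> lsq_of ?h2)"
    by (intro tendsto_minus tendsto_inner tendsto_const lim)+
  ultimately have "lsq_of (\<lambda>x. (u x, G x)) \<bullet> lsq_of ?h1 = - (lsq_of (\<lambda>x. (u x, G x)) \<bullet> lsq_of ?h2)"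
    using LIMSEQ_unique by simp
  then have "(LINT x|lebesgue. u x * gradient \<psi> x $ i) = - (LINT x|lebesgue. G x $ i * \<psi> x)"
    by (simp add: ip[OF sq(3)])
  moreover have "indicator V x *\<^sub>R (u x * gradient \<psi> x $ i) = u x * gradient \<psi> x $ i"
    "indicator V x *\<^sub>R (G x $ i * \<psi> x) = G x $ i * \<psi> x" for x
    using test_function_outside[OF \<psi>, of x] by (auto simp: indicator_def)
  ultimately show "(LINT x:V|lebesgue. u x * gradient \<psi> x $ i) = - (LINT x:V|lebesgue. G x $ i * \<psi> x)"
    by (simp only: set_lebesgue_integral_def)
qed

lemma weak_gradient_unique:
  assumes U: "open U" and GH: "has_weak_gradient U u G" "has_weak_gradient U u H"
  shows "AE x in lebesgue. x \<in> U \<longrightarrow> G x = H x"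
proof -
  have Ul: "U \<in> sets lebesgue" using U by auto
  have loc: "G \<in> Lp_loc_on 1 U" "H \<in> Lp_loc_on 1 U" using GH by (auto simp: has_weak_gradient_def)
  have comp: "AE x in lebesgue. x \<in> U \<longrightarrow> G x $ i - H x $ i = 0" for i
  proof (rule fundamental_lemma[OF U])
    have m: "G \<in> borel_measurable (lebesgue_on U)" "H \<in> borel_measurable (lebesgue_on U)"
      using loc by (auto simp: Lp_loc_on_def)
    have K: "integrable lebesgue (\<lambda>x. indicator K x *\<^sub>R (G x - H x))" if "compact K" "K \<subseteq> U" for K
      using Bochner_Integration.integrable_diff[OF Lp_loc_on_1_integrable[OF loc(1) that Ul] Lp_loc_on_1_integrable[OF loc(2) that Ul]]
      by (simp add: scaleR_diff_right)
    show "(\<lambda>x. G x $ i - H x $ i) \<in> Lp_loc_on 1 U"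
      unfolding Lp_loc_on_def
    proof (intro CollectI conjI allI impI)
      show "(\<lambda>x. G x $ i - H x $ i) \<in> borel_measurable (lebesgue_on U)"
        using m by (intro borel_measurable_diff) (auto simp: cart_eq_inner_axis)
      fix C assume C: "compact C \<and> C \<subseteq> U"
      have "(\<integral>\<^sup>+x\<in>C. ennreal (norm (G x $ i - H x $ i) powr 1) \<partial>lebesgue) \<le>
          (\<integral>\<^sup>+x. ennreal (norm (indicator C x *\<^sub>R (G x - H x))) \<partial>lebesgue)"
        using component_le_norm_cart[of "G x - H x" i for x]
        by (intro nn_integral_mono) (auto simp: indicator_def ennreal_leI)
      also have "\<dots> < \<infinity>" using K C by (auto simp: integrable_iff_bounded)
      finally show "(\<integral>\<^sup>+x\<in>C. ennreal (norm (G x $ i - H x $ i) powr 1) \<partial>lebesgue) < \<infinity>" .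
    qed
    fix \<phi> assume \<phi>: "\<phi> \<in> test_functions U"
    let ?K = "closure {x. \<phi> x \<noteq> 0}"
    note C1 = test_function_C1[OF \<phi>]
    obtain B where B: "0 \<le> B" "\<And>x. \<bar>\<phi> x\<bar> \<le> B"
    proof (rule compact_support_bounded[OF C1(3,4)])
      show "\<phi> x = 0" if "x \<notin> ?K" for x
        using that closure_subset[of "{x. \<phi> x \<noteq> 0}"] by blast
    qed blast
    have int: "integrable lebesgue (\<lambda>x. indicator U x *\<^sub>R (g x $ i * \<phi> x))" if "g \<in> Lp_loc_on 1 U" for g :: "real ^ 'a \<Rightarrow> real ^ 'a"
    proof (rule Bochner_Integration.integrable_bound)
      note gK = Lp_loc_on_1_integrable[OF that C1(4,5) Ul]
      show "integrable lebesgue (\<lambda>x. B * norm (indicator ?K x *\<^sub>R g x))"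
        using gK by (intro integrable_mult_right integrable_norm)
      have eq: "indicator U x *\<^sub>R (g x $ i * \<phi> x) = (indicator ?K x *\<^sub>R g x) $ i * \<phi> x" for x
        using C1(5) closure_subset[of "{x. \<phi> x \<noteq> 0}"] by (cases "\<phi> x = 0") (auto simp: indicator_def)
      show "(\<lambda>x. indicator U x *\<^sub>R (g x $ i * \<phi> x)) \<in> borel_measurable lebesgue"
        unfolding eq
      proof (rule borel_measurable_times)
        show "(\<lambda>x. (indicator ?K x *\<^sub>R g x) $ i) \<in> borel_measurable lebesgue"
          unfolding cart_eq_inner_axis[of _ i]
          by (rule borel_measurable_inner[OF borel_measurable_integrable[OF gK] borel_measurable_const])
        show "\<phi> \<in> borel_measurable lebesgue"
          using C1(3) by (auto intro!: measurable_completion borel_measurable_continuous_onI)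
      qed
      show "AE x in lebesgue. norm (indicator U x *\<^sub>R (g x $ i * \<phi> x)) \<le> norm (B * norm (indicator ?K x *\<^sub>R g x))"
        unfolding eq
      proof (rule AE_I2)
        fix x
        have "\<bar>(indicator ?K x *\<^sub>R g x) $ i\<bar> * \<bar>\<phi> x\<bar> \<le> norm (indicator ?K x *\<^sub>R g x) * B"
          by (intro mult_mono component_le_norm_cart B abs_ge_zero norm_ge_zero)
        then show "norm ((indicator ?K x *\<^sub>R g x) $ i * \<phi> x) \<le> norm (B * norm (indicator ?K x *\<^sub>R g x))"
          by (simp only: real_norm_def abs_mult abs_norm_cancel abs_of_nonneg[OF B(1)] mult.commute[of B])
      qed
    qed
    have "(LINT x:U|lebesgue. G x $ i * \<phi> x) = (LINT x:U|lebesgue. H x $ i * \<phi> x)"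
    proof -
      have "(LINT x:U|lebesgue. u x * gradient \<phi> x $ i) = - (LINT x:U|lebesgue. G x $ i * \<phi> x)"
        "(LINT x:U|lebesgue. u x * gradient \<phi> x $ i) = - (LINT x:U|lebesgue. H x $ i * \<phi> x)"
        using GH \<phi> unfolding has_weak_gradient_def by blast+
      then show ?thesis by linarith
    qed
    then show "(LINT x:U|lebesgue. (G x $ i - H x $ i) * \<phi> x) = 0"
      using int[OF loc(1)] int[OF loc(2)]
      by (simp add: set_lebesgue_integral_def left_diff_distrib right_diff_distrib)
  qed
  then have "AE x in lebesgue. \<forall>i. x \<in> U \<longrightarrow> G x $ i - H x $ i = 0"
    by (subst AE_all_countable) auto
  then show ?thesis by eventually_elim (simp add: vec_eq_iff)
qed

lemma has_weak_gradient_weak_gradient: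
  "has_weak_gradient U u G \<Longrightarrow> has_weak_gradient U u (weak_gradient U u)"
  unfolding weak_gradient_def by (rule someI[of "has_weak_gradient U u"])

lemma W0_imp_W12_0:
  assumes W: "W0 U u G" and U: "open U"
  shows "u \<in> W12_0 U" "AE x in lebesgue. x \<in> U \<longrightarrow> weak_gradient U u x = G x"
proof -
  have Ul[measurable]: "U \<in> sets lebesgue" using U by auto
  note sq = W0_square_integrable[OF W]
  have wg: "has_weak_gradient U u G" using W Ul by (rule W0_has_weak_gradient)
  then have wg': "has_weak_gradient U u (weak_gradient U u)"
    by (rule has_weak_gradient_weak_gradient)
  from weak_gradient_unique[OF U wg' wg]
  show ae: "AE x in lebesgue. x \<in> U \<longrightarrow> weak_gradient U u x = G x" .
  have L2: "h \<in> Lp_on 2 U" if "square_integrable h" for h :: "real ^ 'a \<Rightarrow> 'b::euclidean_space"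
  proof -
    have "(\<integral>\<^sup>+x\<in>U. ennreal (norm (h x) powr 2) \<partial>lebesgue) \<le> (\<integral>\<^sup>+x. ennreal ((norm (h x))\<^sup>2) \<partial>lebesgue)"
      by (intro nn_integral_mono) (auto simp: indicator_def powr_numeral)
    then show ?thesis
      using that by (auto simp: Lp_on_def square_integrable_iff_nn measurable_restrict_space1 intro: le_less_trans)
  qed
  obtain \<phi> where \<phi>: "\<And>k::nat. \<phi> k \<in> test_functions U" and "(\<lambda>k. lsq_of (jet (\<phi> k))) \<longlonglongrightarrow> lsq_of (\<lambda>x. (u x, G x))"
    and lim: "(\<lambda>k. (\<integral>\<^sup>+x. ennreal (\<bar>u x - \<phi> k x\<bar>\<^sup>2) \<partial>lebesgue) + (\<integral>\<^sup>+x. ennreal ((norm (G x - gradient (\<phi> k) x))\<^sup>2) \<partial>lebesgue)) \<longlonglongrightarrow> 0"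
    using W0_sequence[OF W] by blast
  have le: "(\<integral>\<^sup>+x\<in>U. ennreal (\<bar>u x - \<phi> k x\<bar>\<^sup>2) \<partial>lebesgue) + (\<integral>\<^sup>+x\<in>U. ennreal ((norm (weak_gradient U u x - gradient (\<phi> k) x))\<^sup>2) \<partial>lebesgue)
      \<le> (\<integral>\<^sup>+x. ennreal (\<bar>u x - \<phi> k x\<bar>\<^sup>2) \<partial>lebesgue) + (\<integral>\<^sup>+x. ennreal ((norm (G x - gradient (\<phi> k) x))\<^sup>2) \<partial>lebesgue)" for k
  proof (rule add_mono)
    show "(\<integral>\<^sup>+x\<in>U. ennreal (\<bar>u x - \<phi> k x\<bar>\<^sup>2) \<partial>lebesgue) \<le> (\<integral>\<^sup>+x. ennreal (\<bar>u x - \<phi> k x\<bar>\<^sup>2) \<partial>lebesgue)"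
      by (intro nn_integral_mono) (auto simp: indicator_def)
    show "(\<integral>\<^sup>+x\<in>U. ennreal ((norm (weak_gradient U u x - gradient (\<phi> k) x))\<^sup>2) \<partial>lebesgue)
        \<le> (\<integral>\<^sup>+x. ennreal ((norm (G x - gradient (\<phi> k) x))\<^sup>2) \<partial>lebesgue)"
    proof (rule nn_integral_mono_AE)
      show "AE x in lebesgue. ennreal ((norm (weak_gradient U u x - gradient (\<phi> k) x))\<^sup>2) * indicator U x
          \<le> ennreal ((norm (G x - gradient (\<phi> k) x))\<^sup>2)"
        using ae by eventually_elim (auto simp: indicator_def)
    qed
  qed
  have "(\<lambda>k. (\<integral>\<^sup>+x\<in>U. ennreal (\<bar>u x - \<phi> k x\<bar>\<^sup>2) \<partial>lebesgue) + (\<integral>\<^sup>+x\<in>U. ennreal ((norm (weak_gradient U u x - gradient (\<phi> k) x))\<^sup>2) \<partial>lebesgue)) \<longlonglongrightarrow> 0"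
    by (rule tendsto_sandwich[OF always_eventually always_eventually tendsto_const lim]; rule allI)
      (simp, rule le)
  moreover have "u \<in> W12 U" unfolding W12_def using L2[OF sq(1)] L2[OF sq(2)] wg by blast
  ultimately show "u \<in> W12_0 U" using \<phi> unfolding W12_0_def by blast
qed

lemma W0_imp_W12_0_ext:
  assumes W: "W0 U u G" and U: "open U" and 0: "\<And>x. x \<notin> U \<Longrightarrow> u x = 0"
  shows "u \<in> W12_0_ext U" "AE x in lebesgue. weak_gradient UNIV u x = G x"
proof -
  show "u \<in> W12_0_ext U" using W0_imp_W12_0(1)[OF W U] 0 by (simp add: W12_0_ext_def)
  have wg: "has_weak_gradient UNIV u G" using W by (rule W0_has_weak_gradient) simp
  then have wg': "has_weak_gradient UNIV u (weak_gradient UNIV u)"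
    by (rule has_weak_gradient_weak_gradient)
  from weak_gradient_unique[OF open_UNIV wg' wg]
  show "AE x in lebesgue. weak_gradient UNIV u x = G x" by simp
qed

text \<open>
  The converse of \<open>W0_imp_W12_0\<close>: after extension by zero, convergence in the norms on \<open>U\<close> is
  convergence in the Hilbert space on the whole space.
\<close>

lemma W12_0_imp_W0:
  fixes u :: "real ^ 'n \<Rightarrow> real"
  assumes u: "u \<in> W12_0 U" and U: "open U"
  shows "W0 U (\<lambda>x. if x \<in> U then u x else 0) (\<lambda>x. if x \<in> U then weak_gradient U u x else 0)"
proof -
  have Ul[measurable]: "U \<in> sets lebesgue" using U by auto
  have uW: "u \<in> W12 U" using u by (simp add: W12_0_def)
  then obtain G where G: "G \<in> Lp_on 2 U" "has_weak_gradient U u G" by (auto simp: W12_def)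
  then have wg': "has_weak_gradient U u (weak_gradient U u)"
    by (intro has_weak_gradient_weak_gradient)
  have ae: "AE x in lebesgue. x \<in> U \<longrightarrow> weak_gradient U u x = G x"
    by (rule weak_gradient_unique[OF U wg' G(2)])
  have L2: "square_integrable (\<lambda>x. if x \<in> U then h x else 0)" if "h \<in> Lp_on 2 U" for h :: "real ^ 'n \<Rightarrow> 'b::euclidean_space"
  proof -
    have "(\<integral>\<^sup>+x. ennreal ((norm (if x \<in> U then h x else 0))\<^sup>2) \<partial>lebesgue) = (\<integral>\<^sup>+x\<in>U. ennreal (norm (h x) powr 2) \<partial>lebesgue)"
      by (intro nn_integral_cong) (auto simp: indicator_def powr_numeral)
    then show ?thesis
      using that by (auto simp: Lp_on_def square_integrable_iff_nn borel_measurable_if)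
  qed
  have wm: "weak_gradient U u \<in> borel_measurable (lebesgue_on U)"
    using wg' by (simp add: has_weak_gradient_def Lp_loc_on_def)
  have "weak_gradient U u \<in> Lp_on 2 U"
  proof -
    have "(\<integral>\<^sup>+x\<in>U. ennreal (norm (weak_gradient U u x) powr 2) \<partial>lebesgue) = (\<integral>\<^sup>+x\<in>U. ennreal (norm (G x) powr 2) \<partial>lebesgue)"
    proof (rule nn_integral_cong_AE)
      show "AE x in lebesgue. ennreal (norm (weak_gradient U u x) powr 2) * indicator U x
          = ennreal (norm (G x) powr 2) * indicator U x"
        using ae by eventually_elim (auto simp: indicator_def)
    qed
    then show ?thesis using G(1) wm by (simp add: Lp_on_def)
  qed
  then have sq: "square_integrable (\<lambda>x. (if x \<in> U then u x else 0, if x \<in> U then weak_gradient U u x else 0))"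
    using uW by (auto simp: square_integrable_Pair_iff W12_def intro!: L2)
  obtain \<phi> where \<phi>: "\<And>k::nat. \<phi> k \<in> test_functions U"
    and lim: "(\<lambda>k. (\<integral>\<^sup>+x\<in>U. ennreal (\<bar>u x - \<phi> k x\<bar>\<^sup>2) \<partial>lebesgue)
            + (\<integral>\<^sup>+x\<in>U. ennreal ((norm (weak_gradient U u x - gradient (\<phi> k) x))\<^sup>2) \<partial>lebesgue)) \<longlonglongrightarrow> 0"
    using u unfolding W12_0_def by blast
  have eq: "(\<integral>\<^sup>+x. ennreal (\<bar>(if x \<in> U then u x else 0) - \<phi> k x\<bar>\<^sup>2) \<partial>lebesgue) = (\<integral>\<^sup>+x\<in>U. ennreal (\<bar>u x - \<phi> k x\<bar>\<^sup>2) \<partial>lebesgue)"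
    "(\<integral>\<^sup>+x. ennreal ((norm ((if x \<in> U then weak_gradient U u x else 0) - gradient (\<phi> k) x))\<^sup>2) \<partial>lebesgue) =
     (\<integral>\<^sup>+x\<in>U. ennreal ((norm (weak_gradient U u x - gradient (\<phi> k) x))\<^sup>2) \<partial>lebesgue)" for k
    using test_function_outside[OF \<phi>, of _ k] by (auto intro!: nn_integral_cong simp: indicator_def)
  show ?thesis
    by (rule W0_I[OF sq, of \<phi>], rule \<phi>) (simp only: eq lim)
qed

section \<open>Existence of weak solutions\<close>

text \<open>
  Composition with a simple function is a finite sum of measurable pieces; a general \<open>h\<close> is a pointwise limit of
  simple functions, and continuity of \<open>a x\<close> carries the limit over.
\<close>

lemma Caratheodory_measurable:
  fixes a :: "'a \<Rightarrow> 'b::euclidean_space \<Rightarrow> 'c::euclidean_space"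
  assumes U[measurable]: "U \<in> sets M"
    and a: "\<And>\<xi>. (\<lambda>x. if x \<in> U then a x \<xi> else 0) \<in> borel_measurable M"
    and cont: "\<And>x. x \<in> U \<Longrightarrow> continuous_on UNIV (a x)"
    and h: "h \<in> borel_measurable M"
  shows "(\<lambda>x. if x \<in> U then a x (h x) else 0) \<in> borel_measurable M"
proof -
  obtain s where s: "\<And>i. simple_function M (s i)" "\<And>x. x \<in> space M \<Longrightarrow> (\<lambda>i. s i x) \<longlonglongrightarrow> h x"
    using borel_measurable_implies_sequence_metric[OF h, of 0] by blast
  show ?thesis
  proof (rule borel_measurable_LIMSEQ_metric)
    fix i
    have fin: "finite (s i ` space M)" using s(1) by (rule simple_functionD)
    have "(\<lambda>x. \<Sum>y\<in>s i ` space M. indicator (s i -` {y} \<inter> space M) x *\<^sub>R (if x \<in> U then a x y else 0)) \<in> borel_measurable M"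
      using simple_functionD(2)[OF s(1)]
      by (intro borel_measurable_sum borel_measurable_scaleR borel_measurable_indicator a)
    moreover have "(\<Sum>y\<in>s i ` space M. indicator (s i -` {y} \<inter> space M) x *\<^sub>R (if x \<in> U then a x y else 0)) =
        (if x \<in> U then a x (s i x) else 0)" if x: "x \<in> space M" for x
    proof -
      have "(\<Sum>y\<in>s i ` space M. indicator (s i -` {y} \<inter> space M) x *\<^sub>R (if x \<in> U then a x y else 0)) =
          (\<Sum>y\<in>{s i x}. indicator (s i -` {y} \<inter> space M) x *\<^sub>R (if x \<in> U then a x y else 0))"
        by (rule sum.mono_neutral_right[OF fin]) (use x in auto)
      also have "\<dots> = indicator (s i -` {s i x} \<inter> space M) x *\<^sub>R (if x \<in> U then a x (s i x) else 0)"
      proof -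
        have "sum h {y} = h y" for h :: "'b \<Rightarrow> 'c" and y by simp
        then show ?thesis .
      qed
      also have "indicator (s i -` {s i x} \<inter> space M) x = (1::real)" using x by simp
      finally show ?thesis by (simp only: scaleR_one)
    qed
    ultimately show "(\<lambda>x. if x \<in> U then a x (s i x) else 0) \<in> borel_measurable M"
      using measurable_cong[of M "\<lambda>x. \<Sum>y\<in>s i ` space M. indicator (s i -` {y} \<inter> space M) x *\<^sub>R (if x \<in> U then a x y else 0)"
          "\<lambda>x. if x \<in> U then a x (s i x) else 0" borel] by blast
  next
    fix x assume x: "x \<in> space M"
    show "(\<lambda>i. if x \<in> U then a x (s i x) else 0) \<longlonglongrightarrow> (if x \<in> U then a x (h x) else 0)"
    proof (cases "x \<in> U")
      case True
      then have "isCont (a x) (h x)" using cont continuous_on_eq_continuous_at open_UNIV by blast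
      then show ?thesis using True isCont_tendsto_compose[OF _ s(2)[OF x]] by simp
    qed simp
  qed
qed

text \<open>
  The flux defines a Lipschitz operator on the Hilbert space that depends on the gradient part only. It is
  strongly monotone with respect to the gradient part, and by Poincare's inequality with respect to
  the full norm on the closure of the test functions.
\<close>

lemma weak_solution_exists:
  fixes a :: "real ^ 'n \<Rightarrow> real ^ 'n \<Rightarrow> real ^ 'n" and T :: "real ^ 'n \<Rightarrow> real ^ 'n"
  assumes U: "open U" "\<And>x. x \<in> U \<Longrightarrow> norm x \<le> R" and R: "0 \<le> R" and lam: "0 < lam" "lam \<le> \<Lambda>"
    and ell: "elliptic_coefficient lam \<Lambda> D a" and UD: "U \<subseteq> D" and T: "square_integrable T"
  obtains u G where "W0 U u G"
    "\<And>\<phi>. \<phi> \<in> test_functions U \<Longrightarrow>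
      (LINT x:U|lebesgue. a x (G x) \<bullet> gradient \<phi> x) = (LINT x:U|lebesgue. T x \<bullet> gradient \<phi> x)"
proof -
  have Ul[measurable]: "U \<in> sets lebesgue" using U(1) by auto
  have aU: "a x 0 = 0" "norm (a x \<xi> - a x \<eta>) \<le> \<Lambda> * norm (\<xi> - \<eta>)"
    "(a x \<xi> - a x \<eta>) \<bullet> (\<xi> - \<eta>) \<ge> lam * (norm (\<xi> - \<eta>))\<^sup>2" "continuous_on UNIV (a x)" if "x \<in> U" for x \<xi> \<eta>
  proof -
    have xD: "x \<in> D" using that UD by blast
    then show "a x 0 = 0" "norm (a x \<xi> - a x \<eta>) \<le> \<Lambda> * norm (\<xi> - \<eta>)"
      "(a x \<xi> - a x \<eta>) \<bullet> (\<xi> - \<eta>) \<ge> lam * (norm (\<xi> - \<eta>))\<^sup>2"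
      using ell unfolding elliptic_coefficient_def by blast+
    obtain D' where "\<And>\<xi>. (a x has_derivative blinfun_apply (D' \<xi>)) (at \<xi>)"
      using ell xD unfolding elliptic_coefficient_def by blast
    then show "continuous_on UNIV (a x)"
      by (intro continuous_at_imp_continuous_on ballI) (blast intro: has_derivative_continuous)
  qed
  have am: "(\<lambda>x. if x \<in> U then a x \<xi> else 0) \<in> borel_measurable lebesgue" for \<xi>
    using ell UD unfolding elliptic_coefficient_def borel_measurable_if[OF Ul]
    by (blast intro: measurable_restrict_mono)
  (* Off U the operator is continued by a multiple of the identity, which keeps it Lipschitz and
     monotone without reference to the support of the arguments. *)
  define b where "b x \<xi> = (if x \<in> U then a x \<xi> - T x else \<Lambda> *\<^sub>R \<xi>)" for x \<xi>
  have b: "norm (b x \<xi> - b x \<eta>) \<le> \<Lambda> * norm (\<xi> - \<eta>)"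
    "(b x \<xi> - b x \<eta>) \<bullet> (\<xi> - \<eta>) \<ge> lam * (norm (\<xi> - \<eta>))\<^sup>2" for x \<xi> \<eta>
  proof -
    show "norm (b x \<xi> - b x \<eta>) \<le> \<Lambda> * norm (\<xi> - \<eta>)"
      using aU(2)[of x \<xi> \<eta>] lam by (simp add: b_def scaleR_diff_right[symmetric])
    have "lam * (norm (\<xi> - \<eta>))\<^sup>2 \<le> \<Lambda> * (norm (\<xi> - \<eta>))\<^sup>2"
      using lam by (intro mult_right_mono) auto
    then show "(b x \<xi> - b x \<eta>) \<bullet> (\<xi> - \<eta>) \<ge> lam * (norm (\<xi> - \<eta>))\<^sup>2"
      using aU(3)[of x \<xi> \<eta>] by (simp add: b_def scaleR_diff_right[symmetric] power2_norm_eq_inner)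
  qed
  have sqa: "square_integrable (\<lambda>x. if x \<in> U then a x (g x) else 0)" if g: "square_integrable g" for g
  proof (rule square_integrable_dominated[OF _ g, of _ "\<Lambda>\<^sup>2"])
    have gm: "g \<in> borel_measurable lebesgue" using g by (simp add: square_integrable_def)
    show "(\<lambda>x. if x \<in> U then a x (g x) else 0) \<in> borel_measurable lebesgue"
      by (rule Caratheodory_measurable[OF Ul am aU(4) gm])
    have "norm (a x (g x)) \<le> \<Lambda> * norm (g x)" if "x \<in> U" for x
      using aU(2)[OF that, of "g x" 0] aU(1)[OF that] by simp
    then have "norm (if x \<in> U then a x (g x) else 0) \<le> \<Lambda> * norm (g x)" for x
      using lam by auto
    then show "(norm (if x \<in> U then a x (g x) else 0))\<^sup>2 \<le> \<Lambda>\<^sup>2 * (norm (g x))\<^sup>2" for x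
      unfolding power_mult_distrib[symmetric] by (intro power_mono) auto
  qed
  have sqU: "square_integrable (\<lambda>x. if P x then g x else 0)" if g: "square_integrable g" and P: "Measurable.pred lebesgue P"
    for g :: "real ^ 'n \<Rightarrow> real ^ 'n" and P
    using g P by (intro square_integrable_dominated[OF _ g, of _ 1]) (auto simp: square_integrable_def)
  have sqb: "square_integrable (\<lambda>x. b x (g x))" if g: "square_integrable g" for g
  proof -
    have "square_integrable (\<lambda>x. ((if x \<in> U then a x (g x) else 0) - (if x \<in> U then T x else 0)) + (if x \<notin> U then \<Lambda> *\<^sub>R g x else 0))"
      by (intro square_integrable_add square_integrable_diff sqa g sqU T square_integrable_scaleR) measurable
    moreover have "((if x \<in> U then a x (g x) else 0) - (if x \<in> U then T x else 0)) + (if x \<notin> U then \<Lambda> *\<^sub>R g x else 0) = b x (g x)" for x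
      by (simp add: b_def)
    ultimately show ?thesis by simp
  qed
  define \<xi> where "\<xi> F x = snd (repr_lsq F x)" for F :: "(real ^ 'n, real \<times> (real ^ 'n)) lsq" and x
  have sqxi: "square_integrable (\<xi> F)" for F
    unfolding \<xi>_def using repr_lsq(1)[of F] square_integrable_Pair_iff[of "\<lambda>x. fst (repr_lsq F x)" "\<lambda>x. snd (repr_lsq F x)"] by simp
  define B where "B F = lsq_of (\<lambda>x. (0::real, b x (\<xi> F x)))" for F
  have sqz: "square_integrable (\<lambda>x. (0::real, g x))" if "square_integrable g" for g :: "real ^ 'n \<Rightarrow> real ^ 'n"
    using that by (simp add: square_integrable_def norm_Pair borel_measurable_Pair)
  have diffB: "B F - B F' = lsq_of (\<lambda>x. (0, b x (\<xi> F x) - b x (\<xi> F' x)))" for F F'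
    unfolding B_def by (simp add: lsq_of_diff sqz sqb sqxi)
  have diffF: "F - F' = lsq_of (\<lambda>x. repr_lsq F x - repr_lsq F' x)" for F F'
    using lsq_of_diff[OF repr_lsq(1) repr_lsq(1), of F F'] by (simp add: repr_lsq(2))
  have sqd: "square_integrable (\<lambda>x. repr_lsq F x - repr_lsq F' x)" for F F' :: "(real ^ 'n, real \<times> (real ^ 'n)) lsq"
    by (intro square_integrable_diff repr_lsq)
  have grad_le: "(LINT x|lebesgue. (norm (\<xi> F x - \<xi> F' x))\<^sup>2) = (norm (gradient_part (F - F')))\<^sup>2" for F F'
    unfolding diffF norm_gradient_part[OF sqd] by (simp add: \<xi>_def)
  have int: "integrable lebesgue (\<lambda>x. (norm (\<xi> F x - \<xi> F' x))\<^sup>2)" for F F'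
    using square_integrable_diff[OF sqxi sqxi] by (simp add: square_integrable_def)
  have lip: "norm (B F - B F') \<le> \<Lambda> * norm (F - F')" for F F'
  proof (rule power2_le_imp_le)
    have "(norm (B F - B F'))\<^sup>2 = (LINT x|lebesgue. (norm (b x (\<xi> F x) - b x (\<xi> F' x)))\<^sup>2)"
      unfolding diffB by (subst norm_lsq_of) (simp_all add: sqz square_integrable_diff sqb sqxi norm_Pair)
    also have "\<dots> \<le> (LINT x|lebesgue. \<Lambda>\<^sup>2 * (norm (\<xi> F x - \<xi> F' x))\<^sup>2)"
    proof (rule integral_mono)
      show "integrable lebesgue (\<lambda>x. (norm (b x (\<xi> F x) - b x (\<xi> F' x)))\<^sup>2)"
        using square_integrable_diff[OF sqb[OF sqxi] sqb[OF sqxi]] by (simp add: square_integrable_def)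
      show "integrable lebesgue (\<lambda>x. \<Lambda>\<^sup>2 * (norm (\<xi> F x - \<xi> F' x))\<^sup>2)"
        by (intro integrable_mult_right int)
      show "(norm (b x (\<xi> F x) - b x (\<xi> F' x)))\<^sup>2 \<le> \<Lambda>\<^sup>2 * (norm (\<xi> F x - \<xi> F' x))\<^sup>2" for x
        unfolding power_mult_distrib[symmetric] by (intro power_mono b) auto
    qed
    also have "\<dots> = \<Lambda>\<^sup>2 * (norm (gradient_part (F - F')))\<^sup>2" by (simp add: grad_le)
    also have "\<dots> \<le> \<Lambda>\<^sup>2 * (norm (F - F'))\<^sup>2"
    proof (intro mult_left_mono power_mono)
      show "norm (gradient_part (F - F')) \<le> norm (F - F')"
      proof (rule power2_le_imp_le)
        show "(norm (gradient_part (F - F')))\<^sup>2 \<le> (norm (F - F'))\<^sup>2"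
          unfolding diffF norm_gradient_part[OF sqd] norm_lsq_of[OF sqd]
        proof (rule integral_mono)
          show "integrable lebesgue (\<lambda>x. (norm (snd (repr_lsq F x - repr_lsq F' x)))\<^sup>2)"
            using int[of F F'] by (simp add: \<xi>_def)
          show "integrable lebesgue (\<lambda>x. (norm (repr_lsq F x - repr_lsq F' x))\<^sup>2)"
            using sqd by (simp add: square_integrable_def)
          show "(norm (snd (repr_lsq F x - repr_lsq F' x)))\<^sup>2 \<le> (norm (repr_lsq F x - repr_lsq F' x))\<^sup>2" for x
            using norm_snd_le[of "snd (repr_lsq F x - repr_lsq F' x)" "fst (repr_lsq F x - repr_lsq F' x)"]
            by (intro power_mono) (simp_all only: prod.collapse norm_ge_zero)
        qed
      qed simp
    qed auto
    finally show "(norm (B F - B F'))\<^sup>2 \<le> (\<Lambda> * norm (F - F'))\<^sup>2" by (simp add: power_mult_distrib)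
    show "0 \<le> \<Lambda> * norm (F - F')" using lam by simp
  qed
  define \<mu> where "\<mu> = lam / (1 + 4 * R\<^sup>2)"
  have R1: "1 \<le> 1 + 4 * R\<^sup>2" by simp
  have R0: "0 < 1 + 4 * R\<^sup>2" using R1 by linarith
  have \<mu>: "0 < \<mu>" "\<mu> \<le> \<Lambda>"
  proof -
    show "0 < \<mu>" unfolding \<mu>_def by (rule divide_pos_pos[OF lam(1) R0])
    have "lam / (1 + 4 * R\<^sup>2) \<le> lam / 1" using lam R1 R0 by (intro divide_left_mono mult_pos_pos) linarith+
    then show "\<mu> \<le> \<Lambda>" using lam by (simp add: \<mu>_def)
  qed
  have mono: "(B F - B F') \<bullet> (F - F') \<ge> \<mu> * (norm (F - F'))\<^sup>2" if F: "F \<in> sobolev0 U" "F' \<in> sobolev0 U" for F F'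
  proof -
    have "F - F' \<in> sobolev0 U" using subspace_diff[OF subspace_sobolev0 F] .
    from Poincare_sobolev0[OF this U(2) R]
    have "\<mu> * (norm (F - F'))\<^sup>2 \<le> \<mu> * ((1 + 4 * R\<^sup>2) * (norm (gradient_part (F - F')))\<^sup>2)"
      using \<mu> by (intro mult_left_mono) auto
    also have "\<dots> = lam * (norm (gradient_part (F - F')))\<^sup>2"
    proof -
      have "\<mu> * (1 + 4 * R\<^sup>2) = lam" unfolding \<mu>_def using R0 by (metis less_irrefl nonzero_eq_divide_eq)
      then show ?thesis by (metis mult.assoc)
    qed
    also have "\<dots> = (LINT x|lebesgue. lam * (norm (\<xi> F x - \<xi> F' x))\<^sup>2)" by (simp add: grad_le)
    also have "\<dots> \<le> (LINT x|lebesgue. (b x (\<xi> F x) - b x (\<xi> F' x)) \<bullet> (\<xi> F x - \<xi> F' x))"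
      by (intro integral_mono integrable_mult_right int b square_integrable_inner square_integrable_diff sqb sqxi)
    also have "\<dots> = (B F - B F') \<bullet> (F - F')"
      unfolding diffB unfolding diffF
      by (subst inner_lsq_of[OF sqz[OF square_integrable_diff[OF sqb[OF sqxi] sqb[OF sqxi]]] sqd])
        (simp add: inner_prod_def \<xi>_def)
    finally show ?thesis .
  qed
  obtain F where F: "F \<in> sobolev0 U" "\<And>v. v \<in> sobolev0 U \<Longrightarrow> B F \<bullet> v = 0"
    by (rule strongly_monotone_equation_solvable[OF subspace_sobolev0 _ lip mono \<mu>]) (auto simp: sobolev0_def)
  have W: "W0 U (\<lambda>x. fst (repr_lsq F x)) (\<xi> F)"
    unfolding W0_def \<xi>_def using F(1) repr_lsq[of F] by simp
  show thesis
  proof (rule that[OF W])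
    fix \<phi> assume \<phi>: "\<phi> \<in> test_functions U"
    have sqg: "square_integrable (gradient \<phi>)"
      using square_integrable_jet[OF \<phi>] unfolding jet_def by (simp add: square_integrable_Pair_iff)
    have "lsq_of (jet \<phi>) \<in> sobolev0 U"
      unfolding sobolev0_def using \<phi> by (intro subsetD[OF closure_subset] imageI)
    from F(2)[OF this] have "(LINT x|lebesgue. b x (\<xi> F x) \<bullet> gradient \<phi> x) = 0"
      unfolding B_def inner_lsq_of[OF sqz[OF sqb[OF sqxi]] square_integrable_jet[OF \<phi>]]
      by (simp add: jet_def inner_prod_def)
    moreover have "b x (\<xi> F x) \<bullet> gradient \<phi> x =
        (if x \<in> U then a x (\<xi> F x) else 0) \<bullet> gradient \<phi> x - (if x \<in> U then T x else 0) \<bullet> gradient \<phi> x" for x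
      using test_function_outside(2)[OF \<phi>, of x] by (simp add: b_def inner_diff_left)
    ultimately have "(LINT x|lebesgue. (if x \<in> U then a x (\<xi> F x) else 0) \<bullet> gradient \<phi> x) =
        (LINT x|lebesgue. (if x \<in> U then T x else 0) \<bullet> gradient \<phi> x)"
      using square_integrable_inner[OF sqa[OF sqxi] sqg] square_integrable_inner[OF sqU[OF T] sqg, of "\<lambda>x. x \<in> U"] by simp
    moreover have "(LINT x:U|lebesgue. h x \<bullet> gradient \<phi> x) = (LINT x|lebesgue. (if x \<in> U then h x else 0) \<bullet> gradient \<phi> x)" for h
      unfolding set_lebesgue_integral_def by (intro Bochner_Integration.integral_cong) (auto simp: indicator_def)
    ultimately show "(LINT x:U|lebesgue. a x (\<xi> F x) \<bullet> gradient \<phi> x) = (LINT x:U|lebesgue. T x \<bullet> gradient \<phi> x)"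
      by simp
  qed
qed

section \<open>Powers and integral inequalities\<close>

lemma ennpowr_ennreal: "0 \<le> x \<Longrightarrow> ennpowr (ennreal x) s = ennreal (x powr s)"
  by (simp add: ennpowr_def)

lemma ennpowr_top [simp]: "ennpowr top s = top"
  by (simp add: ennpowr_def)

lemma ennpowr_0 [simp]: "ennpowr 0 s = 0"
  by (simp add: ennpowr_def)

lemma ennpowr_mono:
  assumes "x \<le> y" "0 \<le> s"
  shows "ennpowr x s \<le> ennpowr y s"
proof (cases y)
  case (real b)
  with assms(1) obtain a where "x = ennreal a" "0 \<le> a" "a \<le> b"
    by (cases x) (auto simp: top_unique)
  then show ?thesis using real assms(2) by (simp add: ennpowr_ennreal ennreal_leI powr_mono2)
qed simp

lemma ennpowr_mult:
  assumes "0 < s"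
  shows "ennpowr (x * y) s = ennpowr x s * ennpowr y s"
proof -
  have top: "ennpowr (top * y) s = ennpowr top s * ennpowr y s" for y
  proof (cases "y = 0")
    case False
    then have "ennpowr y s \<noteq> 0" by (cases y) (auto simp: ennpowr_ennreal ennreal_eq_0_iff powr_eq_0_iff)
    with False show ?thesis by (simp add: ennreal_top_mult)
  qed simp
  show ?thesis
  proof (cases x)
    case (real a)
    show ?thesis
    proof (cases y)
      case (real b)
      then show ?thesis using \<open>x = ennreal a\<close> \<open>0 \<le> a\<close>
        by (simp add: ennpowr_ennreal ennreal_mult[symmetric] powr_mult)
    qed (use top[of x] in \<open>simp add: mult.commute\<close>)
  qed (use top[of y] in simp)
qed

lemma ennpowr_ennpowr: "ennpowr (ennpowr x s) t = ennpowr x (s * t)"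
  by (cases x) (simp_all add: ennpowr_ennreal powr_powr)

lemma ennpowr_1 [simp]: "ennpowr x 1 = x"
  by (cases x) (simp_all add: ennpowr_ennreal)

lemma ennpowr_eq_0_iff: "ennpowr x s = 0 \<longleftrightarrow> x = 0"
  by (cases x) (auto simp: ennpowr_ennreal ennreal_eq_0_iff powr_eq_0_iff)

lemma ennpowr_less_top: "x < top \<Longrightarrow> ennpowr x s < top"
  by (cases x) (auto simp: ennpowr_ennreal)

lemma ennpowr_divide:
  assumes "0 < s" "0 < c"
  shows "ennpowr (x / ennreal c) s = ennpowr x s / ennreal (c powr s)"
proof -
  have "x / ennreal c = x * ennreal (1 / c)" "ennpowr x s / ennreal (c powr s) = ennpowr x s * ennreal (1 / c powr s)"
    using assms by (simp_all add: divide_ennreal_def inverse_ennreal inverse_eq_divide)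
  then show ?thesis
    using assms by (simp add: ennpowr_mult ennpowr_ennreal powr_divide)
qed

lemma powr_subadditive:
  fixes a b s :: real
  assumes "0 \<le> a" "0 \<le> b" "0 < s" "s \<le> 1"
  shows "(a + b) powr s \<le> a powr s + b powr s"
proof (cases "a + b = 0")
  case False
  then have pos: "0 < a + b" using assms by linarith
  have *: "x \<le> x powr s" if "0 \<le> x" "x \<le> 1" for x :: real
    using powr_mono'[of s 1 x] that assms by simp
  have "1 = a / (a + b) + b / (a + b)" using pos by (simp add: add_divide_distrib[symmetric])
  also have "\<dots> \<le> (a / (a + b)) powr s + (b / (a + b)) powr s"
    using pos assms by (intro add_mono *) (auto simp: divide_le_eq)
  also have "\<dots> = (a powr s + b powr s) / (a + b) powr s"
    using assms pos by (simp add: powr_divide add_divide_distrib)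
  finally show ?thesis using pos by (simp add: le_divide_eq)
qed (use assms in \<open>simp add: add_nonneg_eq_0_iff\<close>)

lemma ennpowr_subadditive:
  assumes "0 < s" "s \<le> 1"
  shows "ennpowr (x + y) s \<le> ennpowr x s + ennpowr y s"
proof (cases x)
  case (real a)
  show ?thesis
  proof (cases y)
    case (real b)
    then show ?thesis using \<open>x = ennreal a\<close> \<open>0 \<le> a\<close> assms powr_subadditive[of a b s]
      by (simp add: ennpowr_ennreal ennreal_plus[symmetric] ennreal_leI del: ennreal_plus)
  qed simp
qed simp

lemma Hoelder_inequality:
  fixes f g :: "'a \<Rightarrow> real"
  assumes pq: "1 < p" "1 < q" "1 / p + 1 / q = 1"
    and [measurable]: "f \<in> borel_measurable M" "g \<in> borel_measurable M"
  shows "(\<integral>\<^sup>+x. ennreal (\<bar>f x\<bar> * \<bar>g x\<bar>) \<partial>M) \<le>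
    ennpowr (\<integral>\<^sup>+x. ennreal (\<bar>f x\<bar> powr p) \<partial>M) (1 / p) * ennpowr (\<integral>\<^sup>+x. ennreal (\<bar>g x\<bar> powr q) \<partial>M) (1 / q)"
    (is "?I \<le> ennpowr ?A _ * ennpowr ?B _")
proof -
  have zero: "?I = 0" if "?A = 0 \<or> ?B = 0"
  proof -
    have "AE x in M. \<bar>f x\<bar> * \<bar>g x\<bar> = 0"
      using that
    proof
      assume "?A = 0"
      then have "AE x in M. ennreal (\<bar>f x\<bar> powr p) = 0" by (subst (asm) nn_integral_0_iff_AE) auto
      then show ?thesis by eventually_elim (simp add: ennreal_eq_0_iff powr_eq_0_iff)
    next
      assume "?B = 0"
      then have "AE x in M. ennreal (\<bar>g x\<bar> powr q) = 0" by (subst (asm) nn_integral_0_iff_AE) auto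
      then show ?thesis by eventually_elim (simp add: ennreal_eq_0_iff powr_eq_0_iff)
    qed
    then have "AE x in M. ennreal (\<bar>f x\<bar> * \<bar>g x\<bar>) = 0" by eventually_elim simp
    then have "?I = (\<integral>\<^sup>+x. 0 \<partial>M)" by (rule nn_integral_cong_AE)
    then show ?thesis by simp
  qed
  consider "?A = 0 \<or> ?B = 0" | "?A \<noteq> 0" "?B \<noteq> 0" "?A = top \<or> ?B = top"
    | "?A \<noteq> 0" "?B \<noteq> 0" "?A \<noteq> top" "?B \<noteq> top" by blast
  then show ?thesis
  proof cases
    case 1
    then show ?thesis using zero by simp
  next
    case 2
    then have "ennpowr ?A (1 / p) * ennpowr ?B (1 / q) = top"
      using ennpowr_eq_0_iff[of ?A "1 / p"] ennpowr_eq_0_iff[of ?B "1 / q"]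
      by (elim disjE) (simp_all only: ennpowr_top ennreal_top_mult ennreal_mult_top if_False)
    then show ?thesis by simp
  next
    case 3
    define A B where "A = enn2real ?A" and "B = enn2real ?B"
    have AB: "?A = ennreal A" "0 < A" "?B = ennreal B" "0 < B"
      using 3 by (simp_all add: A_def B_def ennreal_enn2real_if enn2real_positive_iff less_top zero_less_iff_neq_zero)
    define a b where "a = A powr (1 / p)" and "b = B powr (1 / q)"
    have ab: "0 < a" "0 < b" "a powr p = A" "b powr q = B"
      using AB pq by (auto simp: a_def b_def powr_powr)
    have young: "\<bar>f x\<bar> * \<bar>g x\<bar> \<le> (a * b / (p * A)) * \<bar>f x\<bar> powr p + (a * b / (q * B)) * \<bar>g x\<bar> powr q" for x
    proof -
      have "(\<bar>f x\<bar> / a) * (\<bar>g x\<bar> / b) \<le> (\<bar>f x\<bar> / a) powr p / p + (\<bar>g x\<bar> / b) powr q / q"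
        using Youngs_inequality[of p q "\<bar>f x\<bar> / a" "\<bar>g x\<bar> / b"] pq ab by simp
      also have "\<dots> = \<bar>f x\<bar> powr p / (p * A) + \<bar>g x\<bar> powr q / (q * B)"
        using ab by (simp add: powr_divide mult.commute)
      finally have "a * b * ((\<bar>f x\<bar> / a) * (\<bar>g x\<bar> / b)) \<le> a * b * (\<bar>f x\<bar> powr p / (p * A) + \<bar>g x\<bar> powr q / (q * B))"
        using ab by (intro mult_left_mono) auto
      then show ?thesis using ab by (simp add: distrib_left)
    qed
    define c d where "c = a * b / (p * A)" and "d = a * b / (q * B)"
    have c: "0 \<le> c" "0 \<le> d" using ab AB pq by (auto simp: c_def d_def)
    have "?I \<le> (\<integral>\<^sup>+x. ennreal c * ennreal (\<bar>f x\<bar> powr p) + ennreal d * ennreal (\<bar>g x\<bar> powr q) \<partial>M)"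
    proof (rule nn_integral_mono)
      show "ennreal (\<bar>f x\<bar> * \<bar>g x\<bar>) \<le> ennreal c * ennreal (\<bar>f x\<bar> powr p) + ennreal d * ennreal (\<bar>g x\<bar> powr q)" for x
        using young[of x, folded c_def d_def, THEN ennreal_leI] c by (simp add: ennreal_mult)
    qed
    also have "\<dots> = ennreal c * ?A + ennreal d * ?B"
      by (subst nn_integral_add) (auto simp: nn_integral_cmult)
    also have "\<dots> = ennreal (c * A + d * B)"
      using c AB by (simp add: ennreal_mult)
    also have "c * A + d * B = a * b / (p * A) * A + a * b / (q * B) * B" by (simp add: c_def d_def)
    also have "a * b / (p * A) * A + a * b / (q * B) * B = a * b * (1 / p + 1 / q)"
      using AB pq by (simp add: field_simps)
    also have "ennreal (a * b * (1 / p + 1 / q)) = ennpowr ?A (1 / p) * ennpowr ?B (1 / q)"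
      unfolding pq(3) AB(1,3) using AB ab by (simp add: ennpowr_ennreal a_def[symmetric] b_def[symmetric] ennreal_mult)
    finally show ?thesis .
  qed
qed

lemma powr_convex_combination:
  fixes x y s t q :: real
  assumes q: "1 \<le> q" and st: "0 \<le> s" "0 \<le> t" "s + t = 1" and xy: "0 \<le> x" "0 \<le> y"
  shows "(s * x + t * y) powr q \<le> s * x powr q + t * y powr q"
proof -
  have le: "r powr q \<le> r" if "0 \<le> r" "r \<le> 1" for r :: real
    using powr_mono'[of 1 q r] that q by simp
  consider "x = 0" | "y = 0" | "0 < x" "0 < y" using xy by linarith
  then show ?thesis
  proof cases
    case 1
    then show ?thesis using st xy q by (simp add: powr_mult mult_right_mono le)
  next
    case 2
    then show ?thesis using st xy q by (simp add: powr_mult mult_right_mono le)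
  next
    case 3
    have s: "s = 1 - t" using st by simp
    show ?thesis
      using convex_onD[OF powr_convex[OF q], of t x y] st 3 unfolding s by simp
  qed
qed

text \<open>
  Convexity of \<open>t\<^sup>q\<close> for the values \<open>f / \<alpha>\<close> and \<open>g / \<beta>\<close> with the weights \<open>\<alpha> / (\<alpha> + \<beta>)\<close> and \<open>\<beta> / (\<alpha> + \<beta>)\<close>.
\<close>

lemma Minkowski_inequality:
  fixes f g :: "'a \<Rightarrow> real"
  assumes q: "1 \<le> q" and [measurable]: "f \<in> borel_measurable M" "g \<in> borel_measurable M"
    and nn: "\<And>x. 0 \<le> f x" "\<And>x. 0 \<le> g x"
    and f: "(\<integral>\<^sup>+x. ennreal (f x powr q) \<partial>M) \<le> ennreal (\<alpha> powr q)" and g: "(\<integral>\<^sup>+x. ennreal (g x powr q) \<partial>M) \<le> ennreal (\<beta> powr q)"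
    and pos: "0 < \<alpha>" "0 < \<beta>"
  shows "(\<integral>\<^sup>+x. ennreal ((f x + g x) powr q) \<partial>M) \<le> ennreal ((\<alpha> + \<beta>) powr q)"
proof -
  define c where "c = \<alpha> + \<beta>"
  have c: "0 < c" using pos by (simp add: c_def)
  have le: "(f x + g x) powr q \<le> c powr q * (\<alpha> / c / \<alpha> powr q) * f x powr q + c powr q * (\<beta> / c / \<beta> powr q) * g x powr q" for x
  proof -
    have "((\<alpha> / c) *\<^sub>R (f x / \<alpha>) + (\<beta> / c) *\<^sub>R (g x / \<beta>)) powr q \<le> (\<alpha> / c) * (f x / \<alpha>) powr q + (\<beta> / c) * (g x / \<beta>) powr q"
      unfolding real_scaleR_def
      using pos nn c by (intro powr_convex_combination q) (auto simp: c_def add_divide_distrib[symmetric])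
    moreover have "(\<alpha> / c) *\<^sub>R (f x / \<alpha>) + (\<beta> / c) *\<^sub>R (g x / \<beta>) = (f x + g x) / c"
      using pos c by (simp add: add_divide_distrib)
    ultimately have "c powr q * ((f x + g x) / c) powr q \<le> c powr q * ((\<alpha> / c) * (f x / \<alpha>) powr q + (\<beta> / c) * (g x / \<beta>) powr q)"
      by (intro mult_left_mono) auto
    then show ?thesis
      using pos c nn by (simp add: powr_divide distrib_left mult.assoc)
  qed
  define d e where "d = c powr q * (\<alpha> / c / \<alpha> powr q)" and "e = c powr q * (\<beta> / c / \<beta> powr q)"
  have n: "0 \<le> d" "0 \<le> e" using pos c by (auto simp: d_def e_def)
  have "(\<integral>\<^sup>+x. ennreal ((f x + g x) powr q) \<partial>M) \<le>
      (\<integral>\<^sup>+x. ennreal d * ennreal (f x powr q) + ennreal e * ennreal (g x powr q) \<partial>M)"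
  proof (rule nn_integral_mono)
    show "ennreal ((f x + g x) powr q) \<le> ennreal d * ennreal (f x powr q) + ennreal e * ennreal (g x powr q)" for x
      using le[of x, folded d_def e_def, THEN ennreal_leI] n by (simp add: ennreal_mult)
  qed
  also have "\<dots> = ennreal d * (\<integral>\<^sup>+x. ennreal (f x powr q) \<partial>M) + ennreal e * (\<integral>\<^sup>+x. ennreal (g x powr q) \<partial>M)"
    by (subst nn_integral_add) (auto simp: nn_integral_cmult)
  also have "\<dots> \<le> ennreal d * ennreal (\<alpha> powr q) + ennreal e * ennreal (\<beta> powr q)"
    by (intro add_mono mult_left_mono f g) auto
  also have "\<dots> = ennreal (d * \<alpha> powr q + e * \<beta> powr q)"
    using n by (simp add: ennreal_mult)
  also have "d * \<alpha> powr q + e * \<beta> powr q = c powr q * (\<alpha> / c / \<alpha> powr q) * \<alpha> powr q + c powr q * (\<beta> / c / \<beta> powr q) * \<beta> powr q"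
    by (simp add: d_def e_def)
  also have "c powr q * (\<alpha> / c / \<alpha> powr q) * \<alpha> powr q + c powr q * (\<beta> / c / \<beta> powr q) * \<beta> powr q = c powr q * ((\<alpha> + \<beta>) / c)"
    using pos by (simp add: add_divide_distrib distrib_left)
  also have "\<dots> = (\<alpha> + \<beta>) powr q" using c by (simp add: c_def)
  finally show ?thesis .
qed

lemma average_mono_exponent:
  assumes s: "0 < s" "s < q" and E[measurable]: "E \<in> sets lebesgue" and V: "emeasure lebesgue E = ennreal V" "0 < V"
    and [measurable]: "h \<in> borel_measurable lebesgue"
  shows "average E s h \<le> average E q h"
proof -
  define p where "p = q / s"
  have p: "1 < p" using s by (simp add: p_def)
  define p' where "p' = p / (p - 1)"
  have p': "1 < p'" "1 / p + 1 / p' = 1" using p by (simp_all add: p'_def field_simps)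
  have "(\<integral>\<^sup>+x\<in>E. ennreal (\<bar>h x\<bar> powr s) \<partial>lebesgue) = (\<integral>\<^sup>+x. ennreal (\<bar>indicator E x * \<bar>h x\<bar> powr s\<bar> * \<bar>indicator E x\<bar>) \<partial>lebesgue)"
    by (intro nn_integral_cong) (simp add: indicator_def)
  also have "\<dots> \<le> ennpowr (\<integral>\<^sup>+x. ennreal (\<bar>indicator E x * \<bar>h x\<bar> powr s\<bar> powr p) \<partial>lebesgue) (1 / p)
      * ennpowr (\<integral>\<^sup>+x. ennreal (\<bar>indicator E x :: real\<bar> powr p') \<partial>lebesgue) (1 / p')"
    by (rule Hoelder_inequality[OF p p']) measurable
  also have "(\<integral>\<^sup>+x. ennreal (\<bar>indicator E x * \<bar>h x\<bar> powr s\<bar> powr p) \<partial>lebesgue) = (\<integral>\<^sup>+x\<in>E. ennreal (\<bar>h x\<bar> powr q) \<partial>lebesgue)"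
    using s by (intro nn_integral_cong) (simp add: indicator_def p_def powr_powr)
  also have "(\<integral>\<^sup>+x. ennreal (\<bar>indicator E x :: real\<bar> powr p') \<partial>lebesgue) = (\<integral>\<^sup>+x. indicator E x \<partial>lebesgue)"
    by (intro nn_integral_cong) (simp add: indicator_def)
  also have "\<dots> = ennreal V" by (simp add: V)
  finally have main: "(\<integral>\<^sup>+x\<in>E. ennreal (\<bar>h x\<bar> powr s) \<partial>lebesgue) \<le>
      ennpowr (\<integral>\<^sup>+x\<in>E. ennreal (\<bar>h x\<bar> powr q) \<partial>lebesgue) (1 / p) * ennreal (V powr (1 / p'))"
    using V(2) by (simp add: ennpowr_ennreal)
  have "average E s h = ennpowr ((\<integral>\<^sup>+x\<in>E. ennreal (\<bar>h x\<bar> powr s) \<partial>lebesgue) / ennreal V) (1 / s)"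
    by (simp add: average_def V)
  also have "\<dots> \<le> ennpowr ((ennpowr (\<integral>\<^sup>+x\<in>E. ennreal (\<bar>h x\<bar> powr q) \<partial>lebesgue) (1 / p) * ennreal (V powr (1 / p'))) / ennreal V) (1 / s)"
    using s by (intro ennpowr_mono divide_right_mono_ennreal main) auto
  also have "(ennpowr (\<integral>\<^sup>+x\<in>E. ennreal (\<bar>h x\<bar> powr q) \<partial>lebesgue) (1 / p) * ennreal (V powr (1 / p'))) / ennreal V =
      ennpowr ((\<integral>\<^sup>+x\<in>E. ennreal (\<bar>h x\<bar> powr q) \<partial>lebesgue) / ennreal V) (1 / p)"
  proof -
    have "V powr (1 / p') / V = 1 / V powr (1 / p)"
    proof -
      have "V powr (1 / p) * V powr (1 / p') = V" using V(2) p'(2) by (simp add: powr_add[symmetric])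
      then show ?thesis using V(2) by (simp add: field_simps)
    qed
    then have "x * ennreal (V powr (1 / p')) / ennreal V = x / ennreal (V powr (1 / p))" for x
      using V(2) by (simp add: ennreal_times_divide[symmetric] divide_ennreal divide_ennreal_def inverse_ennreal inverse_eq_divide)
        (simp add: mult.assoc ennreal_mult[symmetric])
    then show ?thesis using p V(2) by (simp add: ennpowr_divide)
  qed
  also have "ennpowr (ennpowr ((\<integral>\<^sup>+x\<in>E. ennreal (\<bar>h x\<bar> powr q) \<partial>lebesgue) / ennreal V) (1 / p)) (1 / s) = average E q h"
    using s by (simp add: ennpowr_ennpowr average_def V p_def)
  finally show ?thesis .
qed

section \<open>Cubes\<close>

definition ocube :: "real ^ 'n \<Rightarrow> real \<Rightarrow> (real ^ 'n) set"
  where "ocube x r = {y. \<forall>i. \<bar>y $ i - x $ i\<bar> < r}"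

definition ccube :: "real ^ 'n \<Rightarrow> real \<Rightarrow> (real ^ 'n) set"
  where "ccube x r = {y. \<forall>i. \<bar>y $ i - x $ i\<bar> \<le> r}"

text \<open>
  A cube, whatever faces it contains, lies between the open and the closed cube with its center and side length \<open>2 r\<close>.
  These differ by a null set, so measures, averages, side lengths and dilations can be computed
  for open cubes.
\<close>

definition cube_like :: "(real ^ 'n) set \<Rightarrow> real ^ 'n \<Rightarrow> real \<Rightarrow> bool"
  where "cube_like Q x r \<longleftrightarrow> 0 < r \<and> ocube x r \<subseteq> Q \<and> Q \<subseteq> ccube x r"

lemma ocube_box: "ocube x r = box (x - (\<chi> i. r)) (x + (\<chi> i. r))"
  by (auto simp: ocube_def mem_box_cart abs_less_iff algebra_simps; smt (verit))

lemma ccube_cbox: "ccube x r = cbox (x - (\<chi> i. r)) (x + (\<chi> i. r))"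
  by (auto simp: ccube_def mem_box_cart abs_le_iff algebra_simps; smt (verit))

lemma open_ocube: "open (ocube x r)"
  by (simp add: ocube_box open_box)

lemma ocube_subset_ccube: "ocube x r \<subseteq> ccube x r"
  by (auto simp: ocube_def ccube_def less_imp_le)

lemma ocube_mono: "r \<le> s \<Longrightarrow> ocube x r \<subseteq> ocube x s"
  by (auto simp: ocube_def intro: less_le_trans)

lemma ccube_subset_ocube: "r < s \<Longrightarrow> ccube x r \<subseteq> ocube x s"
  by (auto simp: ocube_def ccube_def intro: le_less_trans)

lemma center_in_ocube: "0 < r \<Longrightarrow> x \<in> ocube x r"
  by (simp add: ocube_def)

lemma sets_ocube [measurable, simp]: "ocube x r \<in> sets lebesgue" "ocube x r \<in> sets borel"
  using open_ocube[of x r] by auto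

lemma sets_ccube [measurable, simp]: "ccube x r \<in> sets lebesgue" "ccube x r \<in> sets borel"
  by (simp_all add: ccube_cbox)

lemma emeasure_ocube:
  fixes x :: "real ^ 'n"
  assumes "0 \<le> r"
  shows "emeasure lebesgue (ocube x r) = ennreal ((2 * r) ^ CARD('n))"
    "emeasure lebesgue (ccube x r) = ennreal ((2 * r) ^ CARD('n))"
    "emeasure lborel (ocube x r) = ennreal ((2 * r) ^ CARD('n))"
    "emeasure lborel (ccube x r) = ennreal ((2 * r) ^ CARD('n))"
proof -
  let ?l = "x - (\<chi> i. r)" and ?u = "x + (\<chi> i. r)"
  have *: "(?u - ?l) \<bullet> b = 2 * r" if "b \<in> Basis" for b
    using that by (auto simp: Basis_vec_def inner_axis)
  have le: "?l \<bullet> b \<le> ?u \<bullet> b" if "b \<in> Basis" for b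
    using *[OF that] assms unfolding inner_diff_left by linarith
  have "(\<Prod>b\<in>Basis. (?u - ?l) \<bullet> b) = (2 * r) ^ CARD('n)"
    using * by (simp add: prod.cong[OF refl *])
  then show "emeasure lebesgue (ocube x r) = ennreal ((2 * r) ^ CARD('n))"
    "emeasure lebesgue (ccube x r) = ennreal ((2 * r) ^ CARD('n))"
    "emeasure lborel (ocube x r) = ennreal ((2 * r) ^ CARD('n))"
    "emeasure lborel (ccube x r) = ennreal ((2 * r) ^ CARD('n))"
    using emeasure_lborel_box[OF le] emeasure_lborel_cbox[OF le]
    by (simp_all add: ocube_box ccube_cbox)
qed

lemma negligible_cube_frontier:
  fixes x :: "real ^ 'n"
  assumes "0 \<le> r"
  shows "negligible (ccube x r - ocube x r)"
proof -
  have "emeasure lebesgue (ccube x r - ocube x r) = emeasure lebesgue (ccube x r) - emeasure lebesgue (ocube x r)"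
    by (rule emeasure_Diff) (simp_all add: emeasure_ocube assms ocube_subset_ccube)
  also have "\<dots> = 0" by (simp add: emeasure_ocube assms)
  finally show ?thesis by (simp add: negligible_iff_null_sets null_sets_def ccube_cbox)
qed

lemma cube_like_AE:
  assumes "cube_like Q x r"
  shows "AE y in lebesgue. y \<in> Q \<longleftrightarrow> y \<in> ocube x r"
proof -
  have "ccube x r - ocube x r \<in> null_sets lebesgue"
    using negligible_cube_frontier[of r x] assms by (simp add: cube_like_def negligible_iff_null_sets)
  then have "AE y in lebesgue. y \<notin> ccube x r - ocube x r"
    by (rule AE_not_in)
  then show ?thesis
    by eventually_elim (use assms in \<open>auto simp: cube_like_def\<close>)
qed

lemma cube_like_sets: "cube_like Q x r \<Longrightarrow> Q \<in> sets lebesgue"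
proof -
  assume Q: "cube_like Q x r"
  then have "0 \<le> r" "Q - ocube x r \<subseteq> ccube x r - ocube x r" by (auto simp: cube_like_def)
  then have "negligible (Q - ocube x r)"
    using negligible_subset[OF negligible_cube_frontier] by blast
  then have "Q - ocube x r \<in> sets lebesgue" by (rule negligible_imp_sets)
  then have "ocube x r \<union> (Q - ocube x r) \<in> sets lebesgue" by (rule sets.Un[OF sets_ocube(1)])
  moreover have "ocube x r \<union> (Q - ocube x r) = Q" using Q by (auto simp: cube_like_def)
  ultimately show ?thesis by simp
qed

lemma cube_like_emeasure:
  fixes x :: "real ^ 'n"
  assumes "cube_like Q x r"
  shows "emeasure lebesgue Q = ennreal ((2 * r) ^ CARD('n))"
proof -
  have "emeasure lebesgue Q = emeasure lebesgue (ocube x r)"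
    by (rule emeasure_eq_AE[OF cube_like_AE[OF assms] cube_like_sets[OF assms]]) simp
  then show ?thesis using assms by (simp add: emeasure_ocube cube_like_def)
qed

lemma cube_like_side:
  fixes x :: "real ^ 'n"
  assumes "cube_like Q x r"
  shows "side Q = 2 * r"
proof -
  have r: "0 < r" using assms by (simp add: cube_like_def)
  have "measure lebesgue Q = (2 * r) ^ CARD('n)"
    using r by (simp add: measure_def cube_like_emeasure[OF assms])
  also have "\<dots> = (2 * r) powr real CARD('n)" using r by (intro powr_realpow[symmetric]) simp
  finally have "side Q = (2 * r) powr (real CARD('n) * (1 / real CARD('n)))"
    by (simp only: side_def powr_powr)
  then show ?thesis using r by simp
qed

lemma cube_like_center:
  fixes x :: "real ^ 'n"
  assumes "cube_like Q x r"
  shows "cube_center Q = x"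
proof -
  have r: "0 < r" and sub: "ocube x r \<subseteq> Q" "Q \<subseteq> ccube x r" using assms by (auto simp: cube_like_def)
  have "(INF y\<in>Q. y $ i) = x $ i - r \<and> (SUP y\<in>Q. y $ i) = x $ i + r" for i
  proof -
    let ?S = "(\<lambda>y. y $ i) ` Q"
    have lower: "{x $ i - r<..<x $ i + r} \<subseteq> ?S"
    proof
      fix t assume t: "t \<in> {x $ i - r<..<x $ i + r}"
      have "x + (t - x $ i) *\<^sub>R axis i 1 \<in> ocube x r"
        using t r by (auto simp: ocube_def axis_def)
      then have "(x + (t - x $ i) *\<^sub>R axis i 1) $ i \<in> ?S" using sub by blast
      then show "t \<in> ?S" by (simp add: axis_def)
    qed
    have upper: "?S \<subseteq> {x $ i - r..x $ i + r}"
    proof (rule image_subsetI)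
      fix y assume "y \<in> Q"
      then have "\<bar>y $ i - x $ i\<bar> \<le> r" using sub(2) by (auto simp: ccube_def)
      then show "y $ i \<in> {x $ i - r..x $ i + r}" unfolding atLeastAtMost_iff by linarith
    qed
    have ne: "?S \<noteq> {}" using sub(1) center_in_ocube[OF r, of x] by blast
    have "Inf ?S \<le> Inf {x $ i - r<..<x $ i + r}"
      by (rule cInf_superset_mono[OF _ _ lower]) (use r upper in \<open>auto intro!: bdd_belowI[of _ "x $ i - r"]\<close>)
    moreover have "x $ i - r \<le> Inf ?S"
      using ne upper by (intro cInf_greatest) auto
    moreover have "Sup {x $ i - r<..<x $ i + r} \<le> Sup ?S"
      by (rule cSup_subset_mono[OF _ _ lower]) (use r upper in \<open>auto intro!: bdd_aboveI[of _ "x $ i + r"]\<close>)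
    moreover have "Sup ?S \<le> x $ i + r"
      using ne upper by (intro cSup_least) auto
    ultimately show ?thesis using r by simp
  qed
  then show ?thesis by (simp add: cube_center_def vec_eq_iff)
qed

lemma cube_like_dilate:
  fixes x :: "real ^ 'n"
  assumes Q: "cube_like Q x r" and c: "0 < c"
  shows "cube_like (dilate c Q) x (c * r)"
proof -
  have r: "0 < r" and sub: "ocube x r \<subseteq> Q" "Q \<subseteq> ccube x r" using Q by (auto simp: cube_like_def)
  have d: "dilate c Q = (\<lambda>y. x + c *\<^sub>R (y - x)) ` Q"
    by (simp add: dilate_def cube_like_center[OF Q])
  have "ocube x (c * r) \<subseteq> dilate c Q"
  proof
    fix y assume y: "y \<in> ocube x (c * r)"
    have "\<bar>(x + (1 / c) *\<^sub>R (y - x)) $ i - x $ i\<bar> < r" for i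
    proof -
      have "\<bar>y $ i - x $ i\<bar> < c * r" using y by (simp add: ocube_def)
      then show ?thesis using c by (simp add: abs_mult abs_divide divide_less_eq mult.commute)
    qed
    then have "x + (1 / c) *\<^sub>R (y - x) \<in> Q" using sub by (auto simp: ocube_def)
    moreover have "y = x + c *\<^sub>R ((x + (1 / c) *\<^sub>R (y - x)) - x)" using c by simp
    ultimately show "y \<in> dilate c Q" unfolding d by blast
  qed
  moreover have "dilate c Q \<subseteq> ccube x (c * r)"
  proof
    fix y assume "y \<in> dilate c Q"
    then obtain z where z: "z \<in> Q" "y = x + c *\<^sub>R (z - x)" unfolding d by blast
    then have "\<bar>z $ i - x $ i\<bar> \<le> r" for i using sub by (auto simp: ccube_def)
    then show "y \<in> ccube x (c * r)" using c by (auto simp: ccube_def z(2) abs_mult)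
  qed
  ultimately show ?thesis using c r by (simp add: cube_like_def)
qed

lemma cube_like_average:
  assumes "cube_like Q x r"
  shows "average Q s h = average (ocube x r) s h"
proof -
  have "(\<integral>\<^sup>+y\<in>Q. ennreal (\<bar>h y\<bar> powr s) \<partial>lebesgue) = (\<integral>\<^sup>+y\<in>ocube x r. ennreal (\<bar>h y\<bar> powr s) \<partial>lebesgue)"
  proof (rule nn_integral_cong_AE)
    show "AE y in lebesgue. ennreal (\<bar>h y\<bar> powr s) * indicator Q y = ennreal (\<bar>h y\<bar> powr s) * indicator (ocube x r) y"
      using cube_like_AE[OF assms] by eventually_elim (simp add: indicator_def)
  qed
  then show ?thesis
    using assms by (simp add: average_def cube_like_emeasure[OF assms] emeasure_ocube cube_like_def)
qed

lemma cube_like_ocube: "0 < r \<Longrightarrow> cube_like (ocube x r) x r"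
  by (simp add: cube_like_def ocube_subset_ccube)

lemma dilate_ocube:
  fixes x :: "real ^ 'n"
  assumes "0 < r" "0 < c"
  shows "dilate c (ocube x r) = ocube x (c * r)"
proof
  note cl = cube_like_dilate[OF cube_like_ocube[OF assms(1)] assms(2), of x]
  show "ocube x (c * r) \<subseteq> dilate c (ocube x r)" using cl by (simp add: cube_like_def)
  show "dilate c (ocube x r) \<subseteq> ocube x (c * r)"
  proof
    fix y assume "y \<in> dilate c (ocube x r)"
    then obtain z where z: "z \<in> ocube x r" "y = x + c *\<^sub>R (z - x)"
      unfolding dilate_def cube_like_center[OF cube_like_ocube[OF assms(1)]] by blast
    then have "\<bar>z $ i - x $ i\<bar> < r" for i by (simp add: ocube_def)
    then show "y \<in> ocube x (c * r)" using assms(2) by (simp add: ocube_def z(2) abs_mult)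
  qed
qed

lemma is_cube_ocube:
  fixes x :: "real ^ 'n"
  assumes "0 < r"
  shows "is_cube (ocube x r)"
  unfolding is_cube_def
proof (intro exI conjI allI)
  show "0 < 2 * r" using assms by simp
  show "is_interval {x $ i - r<..<x $ i + r}" for i by (rule is_interval_oo)
  show "emeasure lborel {x $ i - r<..<x $ i + r} = ennreal (2 * r)" for i using assms by simp
  show "ocube x r = {y. \<forall>i. y $ i \<in> {x $ i - r<..<x $ i + r}}"
    by (auto simp: ocube_def abs_less_iff) (metis add.commute diff_less_eq less_diff_eq minus_diff_eq, smt (verit))+
qed

lemma interval_between:
  fixes I :: "real set"
  assumes I: "is_interval I" and l: "emeasure lborel I = ennreal l" "0 < l"
  obtains c where "{c - l / 2<..<c + l / 2} \<subseteq> I" "I \<subseteq> {c - l / 2..c + l / 2}"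
proof -
  have Im: "I \<in> sets borel" using I by (simp add: real_interval_borel_measurable)
  have ne: "I \<noteq> {}" using l by auto
  have seg: "b - a \<le> l" if "a \<in> I" "b \<in> I" "a \<le> b" for a b
  proof -
    have "{a..b} \<subseteq> I" by (intro subsetI mem_is_interval_1_I[OF I that(1,2)]) auto
    then have "emeasure lborel {a..b} \<le> emeasure lborel I" using Im by (intro emeasure_mono) auto
    then show ?thesis using that l by (simp add: ennreal_le_iff2)
  qed
  obtain z where z: "z \<in> I" using ne by blast
  have bd: "bdd_below I" "bdd_above I"
  proof -
    show "bdd_below I"
    proof (rule bdd_belowI)
      show "z - l \<le> x" if "x \<in> I" for x using seg[OF that z] l by (cases "x \<le> z") auto
    qed
    show "bdd_above I"
    proof (rule bdd_aboveI)
      show "x \<le> z + l" if "x \<in> I" for x using seg[OF z that] l by (cases "z \<le> x") auto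
    qed
  qed
  define a b where "a = Inf I" and "b = Sup I"
  have up: "I \<subseteq> {a..b}" using bd by (auto simp: a_def b_def intro: cInf_lower cSup_upper)
  have lo: "{a<..<b} \<subseteq> I"
  proof
    fix t assume t: "t \<in> {a<..<b}"
    obtain p where p: "p \<in> I" "p < t" using t cInf_lessD[OF ne] by (auto simp: a_def)
    obtain q where q: "q \<in> I" "t < q" using t less_cSupD[OF ne] by (auto simp: b_def)
    show "t \<in> I"
      by (rule mem_is_interval_1_I[OF I p(1) q(1) less_imp_le[OF p(2)] less_imp_le[OF q(2)]])
  qed
  have ab: "a \<le> b" using up z by auto
  have "emeasure lborel {a<..<b} \<le> emeasure lborel I" using lo Im by (intro emeasure_mono) auto
  moreover have "emeasure lborel I \<le> emeasure lborel {a..b}" using up by (intro emeasure_mono) auto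
  ultimately have "b - a = l" using ab l by (simp add: ennreal_le_iff2 antisym)
  then have "(a + b) / 2 - l / 2 = a" "(a + b) / 2 + l / 2 = b" by (auto simp: field_simps)
  then show thesis using that[of "(a + b) / 2"] up lo by simp
qed

lemma is_cube_imp_cube_like:
  fixes Q :: "(real ^ 'n) set"
  assumes "is_cube Q"
  obtains x r where "cube_like Q x r"
proof -
  from assms obtain I l where "0 < l \<and> (\<forall>i. is_interval (I i) \<and> emeasure lborel (I i) = ennreal l) \<and>
    Q = {x. \<forall>i. x $ i \<in> (I i :: real set)}"
    unfolding is_cube_def by (elim exE) (rule that)
  then have I: "0 < l" "\<And>i. is_interval (I i)" "\<And>i. emeasure lborel (I i) = ennreal l"
    "Q = {x. \<forall>i. x $ i \<in> (I i :: real set)}" by blast+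
  have "\<exists>c. {c - l / 2<..<c + l / 2} \<subseteq> I i \<and> I i \<subseteq> {c - l / 2..c + l / 2}" for i
    using interval_between[OF I(2,3,1)] by metis
  then obtain c where c: "\<And>i. {c i - l / 2<..<c i + l / 2} \<subseteq> I i" "\<And>i. I i \<subseteq> {c i - l / 2..c i + l / 2}"
    by metis
  have "cube_like Q (\<chi> i. c i) (l / 2)"
    unfolding cube_like_def
  proof (intro conjI subsetI)
    show "0 < l / 2" using I(1) by simp
    fix y
    show "y \<in> Q" if y: "y \<in> ocube (\<chi> i. c i) (l / 2)"
    proof -
      have "y $ i \<in> {c i - l / 2<..<c i + l / 2}" for i
      proof -
        have "\<bar>y $ i - c i\<bar> < l / 2" using y by (simp add: ocube_def)
        then show ?thesis unfolding greaterThanLessThan_iff by linarith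
      qed
      then show ?thesis unfolding I(4) using c(1) by blast
    qed
    show "y \<in> ccube (\<chi> i. c i) (l / 2)" if y: "y \<in> Q"
    proof -
      have "y $ i \<in> {c i - l / 2..c i + l / 2}" for i using y c(2) unfolding I(4) by blast
      then have "c i - l / 2 \<le> y $ i" "y $ i \<le> c i + l / 2" for i unfolding atLeastAtMost_iff by blast+
      then have "\<bar>y $ i - c i\<bar> \<le> l / 2" for i by (metis (no_types) abs_diff_le_iff)
      then show ?thesis by (simp add: ccube_def)
    qed
  qed
  then show thesis by (rule that)
qed

lemma ocube_subset_imp:
  fixes x y :: "real ^ 'n"
  assumes sub: "ocube x r \<subseteq> ocube y s" and r: "0 < r"
  shows "\<bar>x $ i - y $ i\<bar> \<le> s - r"
proof (rule field_le_epsilon)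
  fix e :: real assume e: "0 < e"
  define d where "d = max 0 (r - e)"
  have d: "0 \<le> d" "d < r" "r - e \<le> d" using r e by (auto simp: d_def)
  have "x + (\<sigma> * d) *\<^sub>R axis i 1 \<in> ocube y s" if "\<bar>\<sigma>\<bar> = 1" for \<sigma> :: real
    using d r that by (intro subsetD[OF sub]) (auto simp: ocube_def axis_def abs_mult)
  from this[of 1] this[of "-1"] have "\<bar>x $ i + d - y $ i\<bar> < s" "\<bar>x $ i - d - y $ i\<bar> < s"
    by (auto simp: ocube_def axis_def dest!: spec[of _ i])
  then show "\<bar>x $ i - y $ i\<bar> \<le> s - r + e" using d by linarith
qed

text \<open>
  The inclusion in the open triple cube holds because the reference domain is open and lies in a closed cube.
\<close>

lemma smoothened_ocube:
  fixes x :: "real ^ 'n"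
  assumes O0: "reference_domain O0" and r: "0 < r"
  shows "open (smoothened O0 (ocube x r))" "ccube x (2 * r) \<subseteq> smoothened O0 (ocube x r)"
    "smoothened O0 (ocube x r) \<subseteq> ocube x (3 * r)"
proof -
  have op: "open O0" using O0 by (simp add: reference_domain_def smooth_domain_def is_domain_def)
  have cc: "cbox (\<chi> i. - 1 / 2) (\<chi> i. 1 / 2) = ccube (0 :: real ^ 'n) (1 / 2)"
  proof -
    have "(\<chi> i. - 1 / 2) = (0 :: real ^ 'n) - (\<chi> i. 1 / 2)" by (simp add: vec_eq_iff)
    then show ?thesis by (simp only: ccube_cbox add_0_left)
  qed
  have cl: "cube_like (ccube (0 :: real ^ 'n) (1 / 2)) 0 (1 / 2)"
    by (simp add: cube_like_def ocube_subset_ccube)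
  have 1: "ocube 0 (299 / 200) \<subseteq> O0"
  proof -
    have "dilate (299 / 100) (ccube 0 (1 / 2)) \<subseteq> O0" using O0 unfolding reference_domain_def cc by blast
    then show ?thesis using cube_like_dilate[OF cl, of "299 / 100"] by (simp add: cube_like_def) blast
  qed
  have "O0 \<subseteq> ccube 0 (3 / 2)"
  proof -
    have "O0 \<subseteq> dilate 3 (ccube 0 (1 / 2))" using O0 unfolding reference_domain_def cc by blast
    then show ?thesis using cube_like_dilate[OF cl, of 3] by (simp add: cube_like_def) blast
  qed
  then have "O0 \<subseteq> interior (ccube 0 (3 / 2))" using op by (rule interior_maximal)
  then have 2: "O0 \<subseteq> ocube 0 (3 / 2)" unfolding ccube_cbox ocube_box interior_cbox .
  have sm: "smoothened O0 (ocube x r) = (\<lambda>y. x + (2 * r) *\<^sub>R y) ` O0"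
    by (simp add: smoothened_def cube_like_center[OF cube_like_ocube[OF r]] cube_like_side[OF cube_like_ocube[OF r]])
  show "open (smoothened O0 (ocube x r))"
    unfolding sm using open_affinity[OF op, of "2 * r" x] r by simp
  show "smoothened O0 (ocube x r) \<subseteq> ocube x (3 * r)"
    unfolding sm
  proof (rule image_subsetI)
    fix y assume "y \<in> O0"
    then have "\<bar>y $ i\<bar> < 3 / 2" for i using 2 by (auto simp: ocube_def)
    then have "2 * r * \<bar>y $ i\<bar> < 2 * r * (3 / 2)" for i using r by (intro mult_strict_left_mono) auto
    then show "x + (2 * r) *\<^sub>R y \<in> ocube x (3 * r)" using r by (simp add: ocube_def abs_mult)
  qed
  show "ccube x (2 * r) \<subseteq> smoothened O0 (ocube x r)"
  proof
    fix y assume y: "y \<in> ccube x (2 * r)"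
    have "\<bar>((1 / (2 * r)) *\<^sub>R (y - x)) $ i\<bar> < 299 / 200" for i
    proof -
      have "\<bar>y $ i - x $ i\<bar> \<le> 2 * r" using y by (simp add: ccube_def)
      then have "\<bar>y $ i - x $ i\<bar> / (2 * r) \<le> 1" using r by (simp add: divide_le_eq)
      moreover have "\<bar>((1 / (2 * r)) *\<^sub>R (y - x)) $ i\<bar> = \<bar>y $ i - x $ i\<bar> / (2 * r)"
        using r by (simp add: abs_divide abs_mult)
      ultimately show ?thesis by linarith
    qed
    then have "(1 / (2 * r)) *\<^sub>R (y - x) \<in> O0" using 1 by (auto simp: ocube_def)
    moreover have "y = x + (2 * r) *\<^sub>R ((1 / (2 * r)) *\<^sub>R (y - x))" using r by simp
    ultimately show "y \<in> smoothened O0 (ocube x r)" unfolding sm by blast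
  qed
qed

section \<open>Dyadic cubes\<close>

definition dcenter :: "real ^ 'n \<Rightarrow> real \<Rightarrow> nat \<Rightarrow> int ^ 'n \<Rightarrow> real ^ 'n"
  where "dcenter c R m j = c + (\<chi> i. R * ((2 * real_of_int (j $ i) + 1) / 2 ^ m - 1))"

text \<open>
  The open dyadic cubes of level \<open>m\<close> in the cube with center \<open>c\<close> and side length \<open>2 R\<close>.
\<close>

definition dcube :: "real ^ 'n \<Rightarrow> real \<Rightarrow> nat \<Rightarrow> int ^ 'n \<Rightarrow> (real ^ 'n) set"
  where "dcube c R m j = ocube (dcenter c R m j) (R / 2 ^ m)"

definition dindex :: "nat \<Rightarrow> (int ^ 'n) set"
  where "dindex m = {j. \<forall>i. 0 \<le> j $ i \<and> j $ i < 2 ^ m}"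

definition dyadic :: "real ^ 'n \<Rightarrow> real \<Rightarrow> (real ^ 'n) set set"
  where "dyadic c R = {dcube c R m j | m j. j \<in> dindex m}"

lemma countable_dyadic: "countable (dyadic c R)"
proof -
  have "dyadic c R \<subseteq> (\<lambda>(m, j). dcube c R m j) ` UNIV" by (auto simp: dyadic_def)
  then show ?thesis by (rule countable_subset) simp
qed

lemma mem_dcube:
  assumes R: "0 < R"
  shows "y \<in> dcube c R m j \<longleftrightarrow> (\<forall>i. real_of_int (j $ i) < 2 ^ m * ((y $ i - c $ i) / R + 1) / 2 \<and>
     2 ^ m * ((y $ i - c $ i) / R + 1) / 2 < real_of_int (j $ i) + 1)"
proof -
  have "\<bar>y $ i - dcenter c R m j $ i\<bar> < R / 2 ^ m \<longleftrightarrow>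
      real_of_int (j $ i) < 2 ^ m * ((y $ i - c $ i) / R + 1) / 2 \<and>
      2 ^ m * ((y $ i - c $ i) / R + 1) / 2 < real_of_int (j $ i) + 1" for i
  proof -
    define t where "t = (y $ i - c $ i) / R + 1"
    have y: "y $ i = c $ i + R * (t - 1)" using R by (simp add: t_def)
    have "y $ i - dcenter c R m j $ i = R * (t - (2 * real_of_int (j $ i) + 1) / 2 ^ m)"
      unfolding y by (simp add: dcenter_def right_diff_distrib)
    also have "\<dots> = (R / 2 ^ m) * (2 ^ m * t - (2 * real_of_int (j $ i) + 1))"
      by (simp add: right_diff_distrib)
    finally have "\<bar>y $ i - dcenter c R m j $ i\<bar> = (R / 2 ^ m) * \<bar>2 ^ m * t - (2 * real_of_int (j $ i) + 1)\<bar>"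
      using R by (simp add: abs_mult)
    then have "\<bar>y $ i - dcenter c R m j $ i\<bar> < R / 2 ^ m \<longleftrightarrow> \<bar>2 ^ m * t - (2 * real_of_int (j $ i) + 1)\<bar> < 1"
    proof -
      have p: "0 < R / 2 ^ m" using R by simp
      assume "\<bar>y $ i - dcenter c R m j $ i\<bar> = (R / 2 ^ m) * \<bar>2 ^ m * t - (2 * real_of_int (j $ i) + 1)\<bar>"
      then show ?thesis using mult_less_cancel_left_pos[OF p, of _ 1] by simp
    qed
    also have "\<dots> \<longleftrightarrow> real_of_int (j $ i) < 2 ^ m * t / 2 \<and> 2 ^ m * t / 2 < real_of_int (j $ i) + 1"
      by (simp add: abs_less_iff) linarith
    finally show ?thesis by (simp add: t_def)
  qed
  then show ?thesis by (simp add: dcube_def ocube_def)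
qed

lemma dcube_floor:
  assumes "0 < R" "y \<in> dcube c R m j"
  shows "j $ i = \<lfloor>2 ^ m * ((y $ i - c $ i) / R + 1) / 2\<rfloor>"
  using assms(2) unfolding mem_dcube[OF assms(1)] by (intro floor_unique[symmetric]) (auto intro: less_imp_le)

lemma dcube_eq_if_meet:
  assumes "0 < R" "y \<in> dcube c R m j" "y \<in> dcube c R m j'"
  shows "j = j'"
  using dcube_floor[OF assms(1,2)] dcube_floor[OF assms(1,3)] by (simp add: vec_eq_iff)

lemma dcube_ancestor:
  assumes R: "0 < R" and m: "m \<le> m'"
  shows "dcube c R m' j \<subseteq> dcube c R m (\<chi> i. j $ i div 2 ^ (m' - m))"
    and "j \<in> dindex m' \<Longrightarrow> (\<chi> i. j $ i div 2 ^ (m' - m)) \<in> dindex m"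
proof -
  define k where "k = m' - m"
  have k: "m' = m + k" using m by (simp add: k_def)
  show "dcube c R m' j \<subseteq> dcube c R m (\<chi> i. j $ i div 2 ^ (m' - m))"
  proof
    fix y assume y: "y \<in> dcube c R m' j"
    have "real_of_int (j $ i div 2 ^ k) < 2 ^ m * ((y $ i - c $ i) / R + 1) / 2 \<and>
        2 ^ m * ((y $ i - c $ i) / R + 1) / 2 < real_of_int (j $ i div 2 ^ k) + 1" for i
    proof -
      define q s where "q = j $ i div 2 ^ k" and "s = 2 ^ m * ((y $ i - c $ i) / R + 1) / 2"
      have s: "2 ^ m' * ((y $ i - c $ i) / R + 1) / 2 = 2 ^ k * s" by (simp add: s_def k power_add)
      have "real_of_int (j $ i) < 2 ^ m' * ((y $ i - c $ i) / R + 1) / 2"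
        "2 ^ m' * ((y $ i - c $ i) / R + 1) / 2 < real_of_int (j $ i) + 1"
        using y unfolding mem_dcube[OF R] by blast+
      then have js: "real_of_int (j $ i) < 2 ^ k * s" "2 ^ k * s < real_of_int (j $ i) + 1"
        unfolding s .
      have "q * 2 ^ k + j $ i mod 2 ^ k = j $ i" unfolding q_def by (rule div_mult_mod_eq)
      moreover have "0 \<le> j $ i mod 2 ^ k" "j $ i mod 2 ^ k < 2 ^ k" by simp_all
      ultimately have "q * 2 ^ k \<le> j $ i" "j $ i + 1 \<le> q * 2 ^ k + 2 ^ k" by linarith+
      then have "real_of_int (q * 2 ^ k) \<le> real_of_int (j $ i)" "real_of_int (j $ i + 1) \<le> real_of_int (q * 2 ^ k + 2 ^ k)"
        by (simp_all only: of_int_le_iff)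
      then have "real_of_int q * 2 ^ k \<le> real_of_int (j $ i)" "real_of_int (j $ i) + 1 \<le> real_of_int q * 2 ^ k + 2 ^ k"
        by simp_all
      with js have "real_of_int q * 2 ^ k < s * 2 ^ k" "s * 2 ^ k < (real_of_int q + 1) * 2 ^ k"
        unfolding distrib_right mult.commute[of s] mult_1 by linarith+
      then have "real_of_int q < s" "s < real_of_int q + 1"
        by (simp_all only: mult_less_cancel_right_pos zero_less_power zero_less_numeral)
      then show ?thesis unfolding q_def[symmetric] s_def[symmetric] by simp
    qed
    then show "y \<in> dcube c R m (\<chi> i. j $ i div 2 ^ (m' - m))"
      unfolding mem_dcube[OF R] k_def[symmetric] by simp
  qed
  show "(\<chi> i. j $ i div 2 ^ (m' - m)) \<in> dindex m" if j: "j \<in> dindex m'"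
  proof -
    have "0 \<le> j $ i div 2 ^ k \<and> j $ i div 2 ^ k < 2 ^ m" for i
    proof -
      have "0 \<le> j $ i" "j $ i < 2 ^ m * 2 ^ k" using j by (simp_all add: dindex_def k power_add)
      moreover have "(j $ i div 2 ^ k) * 2 ^ k \<le> j $ i"
      proof -
        have "(j $ i div 2 ^ k) * 2 ^ k + j $ i mod 2 ^ k = j $ i" by (rule div_mult_mod_eq)
        moreover have "0 \<le> j $ i mod 2 ^ k" by simp
        ultimately show ?thesis by linarith
      qed
      ultimately have "(j $ i div 2 ^ k) * 2 ^ k < 2 ^ m * 2 ^ k" by linarith
      then have "j $ i div 2 ^ k < 2 ^ m" by simp
      then show ?thesis using \<open>0 \<le> j $ i\<close> by (simp add: pos_imp_zdiv_nonneg_iff)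
    qed
    then show ?thesis by (simp add: dindex_def k_def[symmetric])
  qed
qed

lemma dcube_nested:
  assumes R: "0 < R" and m: "m \<le> m'" and meet: "dcube c R m j \<inter> dcube c R m' j' \<noteq> {}"
  shows "dcube c R m' j' \<subseteq> dcube c R m j"
proof -
  obtain y where y: "y \<in> dcube c R m j" "y \<in> dcube c R m' j'" using meet by blast
  then have "y \<in> dcube c R m (\<chi> i. j' $ i div 2 ^ (m' - m))"
    using dcube_ancestor(1)[OF R m] by blast
  with y(1) have "j = (\<chi> i. j' $ i div 2 ^ (m' - m))" by (rule dcube_eq_if_meet[OF R])
  then show ?thesis using dcube_ancestor(1)[OF R m, where c = c and j = j'] by simp
qed

lemma dyadic_ocube:
  assumes "0 < R" "P \<in> dyadic c R"
  obtains z r where "P = ocube z r" "0 < r" "r \<le> R"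
proof -
  obtain m j where "P = dcube c R m j" using assms by (auto simp: dyadic_def)
  moreover have "R / 2 ^ m \<le> R / 1" using assms(1) by (intro divide_left_mono) auto
  ultimately show thesis using that[of "dcenter c R m j" "R / 2 ^ m"] assms(1) by (simp add: dcube_def)
qed

lemma dcube_0: "dcube c R 0 0 = ocube c R"
proof -
  have "dcenter c R 0 0 = c" by (simp add: dcenter_def vec_eq_iff)
  then show ?thesis by (simp add: dcube_def)
qed

lemma zero_in_dindex: "0 \<in> dindex m"
  by (simp add: dindex_def)

lemma top_in_dyadic: "ocube c R \<in> dyadic c R"
  unfolding dyadic_def using dcube_0[symmetric] zero_in_dindex by blast

lemma dyadic_subset_top:
  assumes R: "0 < R" and "P \<in> dyadic c R"
  shows "P \<subseteq> ocube c R"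
proof -
  obtain m j where P: "P = dcube c R m j" "j \<in> dindex m" using assms by (auto simp: dyadic_def)
  have "(\<chi> i. j $ i div 2 ^ (m - 0)) = 0"
    using P(2) by (simp add: dindex_def vec_eq_iff)
  moreover have "dcube c R m j \<subseteq> dcube c R 0 (\<chi> i. j $ i div 2 ^ (m - 0))"
    by (rule dcube_ancestor(1)[OF R le0])
  ultimately show ?thesis unfolding P dcube_0[symmetric, where c = c and R = R] by (simp only:)
qed

lemma AE_in_dcubes:
  fixes c :: "real ^ 'n"
  assumes R: "0 < R"
  shows "AE y in lebesgue. y \<in> ocube c R \<longrightarrow> (\<forall>m. \<exists>j\<in>dindex m. y \<in> dcube c R m j)"
proof -
  have "AE y in lebesgue. 2 ^ m * ((y $ i - c $ i) / R + 1) / 2 \<noteq> real_of_int k" for m :: nat and i :: 'n and k :: int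
  proof -
    define a where "a = R * (2 * real_of_int k / 2 ^ m - 1) + c $ i"
    have "negligible {y :: real ^ 'n. y $ i = a}"
      by (simp add: cart_eq_inner_axis negligible_standard_hyperplane)
    then have "AE y in lebesgue. y \<notin> {y :: real ^ 'n. y $ i = a}"
      by (intro AE_not_in) (simp add: negligible_iff_null_sets)
    then show ?thesis
      by eventually_elim (use R in \<open>auto simp: a_def field_simps\<close>)
  qed
  then have "AE y in lebesgue. \<forall>m::nat. \<forall>i::'n. \<forall>k::int. 2 ^ m * ((y $ i - c $ i) / R + 1) / 2 \<noteq> real_of_int k"
    by (simp add: AE_all_countable)
  then show ?thesis
  proof eventually_elim
    case (elim y)
    show ?case
    proof (intro impI allI)
      fix m assume y: "y \<in> ocube c R"
      define j where "j = (\<chi> i. \<lfloor>2 ^ m * ((y $ i - c $ i) / R + 1) / 2\<rfloor>)"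
      have "real_of_int (j $ i) < 2 ^ m * ((y $ i - c $ i) / R + 1) / 2 \<and>
          2 ^ m * ((y $ i - c $ i) / R + 1) / 2 < real_of_int (j $ i) + 1" for i
      proof -
        have "real_of_int (j $ i) \<le> 2 ^ m * ((y $ i - c $ i) / R + 1) / 2"
          "2 ^ m * ((y $ i - c $ i) / R + 1) / 2 < real_of_int (j $ i) + 1"
          by (simp_all only: j_def vec_lambda_beta of_int_floor_le real_of_int_floor_add_one_gt)
        moreover have "2 ^ m * ((y $ i - c $ i) / R + 1) / 2 \<noteq> real_of_int (j $ i)" using elim by blast
        ultimately show ?thesis by linarith
      qed
      then have yj: "y \<in> dcube c R m j" unfolding mem_dcube[OF R] by blast
      have "0 \<le> j $ i \<and> j $ i < 2 ^ m" for i
      proof -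
        have "\<bar>y $ i - c $ i\<bar> < R" using y by (simp add: ocube_def)
        then have "- 1 < (y $ i - c $ i) / R" "(y $ i - c $ i) / R < 1"
          using R by (simp_all add: abs_less_iff less_divide_eq divide_less_eq)
        then have "0 < 2 ^ m * ((y $ i - c $ i) / R + 1) / 2" "2 ^ m * ((y $ i - c $ i) / R + 1) / 2 < 2 ^ m"
          by simp_all
        then show ?thesis by (simp add: j_def floor_less_iff le_floor_iff)
      qed
      then have "j \<in> dindex m" by (simp add: dindex_def)
      with yj show "\<exists>j\<in>dindex m. y \<in> dcube c R m j" by blast
    qed
  qed
qed

section \<open>The dyadic maximal function\<close>

lemma cube_like_std_dyadic:
  fixes c :: "real ^ 'n"
  assumes R: "0 < R"
  shows "cube_like ((\<lambda>y. c + (2 * R) *\<^sub>R (y - (\<chi> i. 1 / 2))) ` std_dyadic_cube k j)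
     (c + (\<chi> i. R * ((2 powi k) * (2 * real_of_int (j $ i) + 1) - 1))) (R * 2 powi k)"
proof -
  let ?T = "\<lambda>y. c + (2 * R) *\<^sub>R (y - (\<chi> i. 1 / 2))" and ?z = "c + (\<chi> i. R * ((2 powi k) * (2 * real_of_int (j $ i) + 1) - 1))"
  let ?K = "2 powi k :: real"
  have K: "0 < ?K" by simp
  have inv: "?T (\<chi> i. ((w $ i - c $ i) / R + 1) / 2) = w" for w
    using R by (simp add: vec_eq_iff field_simps)
  have z: "w $ i - ?z $ i = 2 * R * (((w $ i - c $ i) / R + 1) / 2 - ?K * (real_of_int (j $ i) + 1 / 2))" for w i
    using R by (simp add: field_simps)
  have sc: "\<bar>2 * R * d\<bar> < R * ?K \<longleftrightarrow> \<bar>d\<bar> < ?K / 2" "\<bar>2 * R * d\<bar> \<le> R * ?K \<longleftrightarrow> \<bar>d\<bar> \<le> ?K / 2" for d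
    using R by (simp_all add: abs_mult field_simps)
  show ?thesis
    unfolding cube_like_def
  proof (intro conjI subsetI)
    show "0 < R * ?K" using R K by simp
    fix w
    show "w \<in> ?T ` std_dyadic_cube k j" if w: "w \<in> ocube ?z (R * ?K)"
    proof -
      have *: "\<bar>((w $ i - c $ i) / R + 1) / 2 - ?K * (real_of_int (j $ i) + 1 / 2)\<bar> < ?K / 2" for i
        using w unfolding ocube_def z sc by blast
      have "?K * real_of_int (j $ i) \<le> ((w $ i - c $ i) / R + 1) / 2 \<and>
          ((w $ i - c $ i) / R + 1) / 2 < ?K * (real_of_int (j $ i) + 1)" for i
        proof -
        have e: "?K * (real_of_int (j $ i) + 1 / 2) = ?K * real_of_int (j $ i) + ?K / 2"
          "?K * (real_of_int (j $ i) + 1) = ?K * real_of_int (j $ i) + ?K"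
          by (simp_all add: distrib_left)
        have "x \<le> s \<and> s < x + q" if "\<bar>s - (x + q / 2)\<bar> < q / 2" for s x q :: real
          using that by (simp add: abs_less_iff field_simps)
        from this[OF *[of i, unfolded e(1)]] show ?thesis unfolding e(2) .
      qed
      then have "(\<chi> i. ((w $ i - c $ i) / R + 1) / 2) \<in> std_dyadic_cube k j"
        by (simp only: std_dyadic_cube_def mem_Collect_eq vec_lambda_beta) simp
      then show ?thesis by (intro image_eqI[where x = "\<chi> i. ((w $ i - c $ i) / R + 1) / 2"] inv[symmetric])
    qed
    show "w \<in> ccube ?z (R * ?K)" if w: "w \<in> ?T ` std_dyadic_cube k j"
    proof -
      obtain y where y: "y \<in> std_dyadic_cube k j" "w = ?T y" using w by blast
      have "((w $ i - c $ i) / R + 1) / 2 = y $ i" for i using R by (simp add: y(2) field_simps)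
      moreover have "\<bar>y $ i - ?K * (real_of_int (j $ i) + 1 / 2)\<bar> \<le> ?K / 2" for i
      proof -
        have "?K * real_of_int (j $ i) \<le> y $ i" "y $ i < ?K * real_of_int (j $ i) + ?K"
          using y(1) by (simp_all add: std_dyadic_cube_def distrib_left)
        then show ?thesis unfolding distrib_left by linarith
      qed
      ultimately show ?thesis unfolding ccube_def z by (simp only: sc mem_Collect_eq) simp
    qed
  qed
qed

lemma dyadic_subcube_exists:
  fixes c :: "real ^ 'n"
  assumes Q0: "cube_like Q0 c R" and P: "P \<in> dyadic c R"
  obtains P' z r where "P' \<in> dyadic_subcubes Q0" "cube_like P' z r" "P = ocube z r"
proof -
  have R: "0 < R" using Q0 by (simp add: cube_like_def)
  obtain m j where mj: "P = dcube c R m j" "j \<in> dindex m" using P by (auto simp: dyadic_def)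
  let ?P = "(\<lambda>y. c + (2 * R) *\<^sub>R (y - (\<chi> i. 1 / 2))) ` std_dyadic_cube (- int m) j"
  have pw: "2 powi (- int m) = 1 / (2::real) ^ m" by (simp add: power_int_minus inverse_eq_divide)
  have "std_dyadic_cube (- int m) j \<subseteq> {x. \<forall>i. 0 \<le> x $ i \<and> x $ i < 1}"
  proof
    fix x assume x: "x \<in> std_dyadic_cube (- int m) j"
    have "0 \<le> x $ i \<and> x $ i < 1" for i
    proof -
      have j: "0 \<le> real_of_int (j $ i)" "real_of_int (j $ i) + 1 \<le> 2 ^ m"
      proof -
        show "0 \<le> real_of_int (j $ i)" using mj(2) by (simp add: dindex_def)
        have "j $ i + 1 \<le> 2 ^ m" using mj(2) by (simp add: dindex_def add1_zle_eq)
        then have "real_of_int (j $ i + 1) \<le> real_of_int (2 ^ m)" by (simp only: of_int_le_iff)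
        then show "real_of_int (j $ i) + 1 \<le> 2 ^ m" by simp
      qed
      have "1 / 2 ^ m * real_of_int (j $ i) \<le> x $ i" "x $ i < 1 / 2 ^ m * (real_of_int (j $ i) + 1)"
        using x by (simp_all only: std_dyadic_cube_def pw mem_Collect_eq)
      moreover have "0 \<le> 1 / 2 ^ m * real_of_int (j $ i)" using j by simp
      moreover have "1 / 2 ^ m * (real_of_int (j $ i) + 1) \<le> 1" using j by (simp add: divide_le_eq)
      ultimately show ?thesis by linarith
    qed
    then show "x \<in> {x. \<forall>i. 0 \<le> x $ i \<and> x $ i < 1}" by simp
  qed
  then have "?P \<in> dyadic_subcubes Q0"
    unfolding dyadic_subcubes_def cube_like_center[OF Q0] cube_like_side[OF Q0] by blast
  moreover have "cube_like ?P (dcenter c R m j) (R / 2 ^ m)"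
    using cube_like_std_dyadic[OF R, of c "- int m" j] unfolding pw dcenter_def by simp
  ultimately show thesis using mj(1) by (intro that) (auto simp: dcube_def)
qed

definition tripled_average :: "(real ^ 'n) set \<Rightarrow> (real ^ 'n \<Rightarrow> real) \<Rightarrow> ennreal"
  where "tripled_average P h = average (dilate 3 P) 1 h"

text \<open>
  The operator norm refers to dyadic cubes that contain some of their faces; each open dyadic cube is the
  interior of one of those and has the same average over its triple.
\<close>

lemma weak_type:
  fixes c :: "real ^ 'n"
  assumes Q0: "cube_like Q0 c R" and fin: "maximal_norm Q0 < top" and h: "h \<in> Lp_on 1 UNIV" and t: "0 < t"
  shows "ennreal t * emeasure lebesgue (\<Union>{P \<in> dyadic c R. ennreal t < tripled_average P h})
    \<le> maximal_norm Q0 * (\<integral>\<^sup>+x. ennreal \<bar>h x\<bar> \<partial>lebesgue)"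
proof -
  have R: "0 < R" using Q0 by (simp add: cube_like_def)
  let ?I = "\<integral>\<^sup>+x. ennreal \<bar>h x\<bar> \<partial>lebesgue" and ?E = "{x. maximal_fun Q0 h x > ennreal t}"
  let ?B = "{P \<in> dyadic_subcubes Q0. ennreal t < average (dilate 3 P) 1 h}"
  have E: "?E = \<Union>?B"
    by (auto simp: maximal_fun_def less_SUP_iff indicator_def split: if_splits)
  have "countable (dyadic_subcubes Q0)"
  proof -
    have "dyadic_subcubes Q0 \<subseteq> (\<lambda>(k, j). (\<lambda>y. cube_center Q0 + side Q0 *\<^sub>R (y - (\<chi> i. 1 / 2))) ` std_dyadic_cube k j) ` UNIV"
      unfolding dyadic_subcubes_def by auto
    then show ?thesis by (rule countable_subset) simp
  qed
  then have "countable ?B" by (rule countable_subset[rotated]) blast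
  moreover have "P \<in> sets lebesgue" if "P \<in> ?B" for P
    using that cube_like_sets[OF cube_like_std_dyadic[OF R]]
    unfolding dyadic_subcubes_def cube_like_center[OF Q0] cube_like_side[OF Q0] by blast
  ultimately have Em: "?E \<in> sets lebesgue" unfolding E by (intro sets.countable_Union) auto
  have sub: "AE x in lebesgue. x \<in> \<Union>{P \<in> dyadic c R. ennreal t < tripled_average P h} \<longrightarrow> x \<in> ?E"
  proof (intro AE_I2 impI)
    fix x assume "x \<in> \<Union>{P \<in> dyadic c R. ennreal t < tripled_average P h}"
    then obtain P where P: "P \<in> dyadic c R" "ennreal t < tripled_average P h" "x \<in> P" by blast
    obtain P' z r where P': "P' \<in> dyadic_subcubes Q0" "cube_like P' z r" "P = ocube z r"
      using dyadic_subcube_exists[OF Q0 P(1)] by blast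
    have r: "0 < r" using P'(2) by (simp add: cube_like_def)
    have "average (dilate 3 P') 1 h = tripled_average P h"
      unfolding tripled_average_def P'(3) dilate_ocube[OF r zero_less_numeral]
      by (rule cube_like_average[OF cube_like_dilate[OF P'(2)]]) simp
    moreover have "x \<in> P'" using P(3) P'(2,3) by (auto simp: cube_like_def)
    ultimately show "x \<in> ?E" unfolding E using P(2) P'(1) by auto
  qed
  have "emeasure lebesgue (\<Union>{P \<in> dyadic c R. ennreal t < tripled_average P h}) \<le> emeasure lebesgue ?E"
    using sub Em by (rule emeasure_mono_AE)
  then have "ennreal t * emeasure lebesgue (\<Union>{P \<in> dyadic c R. ennreal t < tripled_average P h}) \<le> ennreal t * emeasure lebesgue ?E"
    by (intro mult_left_mono) auto
  also have "\<dots> \<le> (SUP t\<in>{0<..}. ennreal t * emeasure lebesgue {x. maximal_fun Q0 h x > ennreal t})"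
    using t by (intro SUP_upper) auto
  also have "\<dots> \<le> maximal_norm Q0 * ?I"
  proof -
    let ?S = "SUP t\<in>{0<..}. ennreal t * emeasure lebesgue {x. maximal_fun Q0 h x > ennreal t}"
    have q: "?S / ?I \<le> maximal_norm Q0"
      unfolding maximal_norm_def using h by (intro SUP_upper2[of h]) auto
    have I: "?I < top" using h by (simp add: Lp_on_def)
    show ?thesis
    proof (cases "?I = 0")
      case True
      have "?S = 0"
      proof (rule ccontr)
        assume "?S \<noteq> 0"
        then have "?S / ?I = top" using True by (simp add: ennreal_divide_zero)
        then show False using q fin by (simp add: top_unique)
      qed
      then show ?thesis by simp
    next
      case False
      have "?S = ?S / ?I * ?I"
        using False I by (simp add: ennreal_divide_times ennreal_times_divide[symmetric] ennreal_mult_divide_eq less_top)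
      also have "\<dots> \<le> maximal_norm Q0 * ?I" using q by (intro mult_right_mono) auto
      finally show ?thesis .
    qed
  qed
  finally show ?thesis .
qed

lemma Union_dyadic_sets: "A \<subseteq> dyadic c R \<Longrightarrow> \<Union>A \<in> sets lebesgue"
proof -
  assume A: "A \<subseteq> dyadic c R"
  have "open P" if "P \<in> A" for P using A that by (auto simp: dyadic_def dcube_def open_ocube)
  then have "open (\<Union>A)" by blast
  then show ?thesis by auto
qed

text \<open>
  For \<open>t > 0\<close> this is the weak type inequality divided by \<open>t\<close>. For \<open>t = 0\<close> the integral times the norm vanishes, so
  the superlevel sets for the thresholds \<open>1 / (k + 1)\<close> are null sets that exhaust the one for zero.
\<close>

lemma superlevel_measure:
  fixes c :: "real ^ 'n"
  assumes Q0: "cube_like Q0 c R" and fin: "maximal_norm Q0 < top" and h: "h \<in> Lp_on 1 UNIV" and V: "0 < V"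
    and t: "ennreal t = maximal_norm Q0 * (\<integral>\<^sup>+x. ennreal \<bar>h x\<bar> \<partial>lebesgue) / ennreal V" "0 \<le> t"
  shows "emeasure lebesgue (\<Union>{P \<in> dyadic c R. ennreal t < tripled_average P h}) \<le> ennreal V"
proof -
  let ?I = "\<integral>\<^sup>+x. ennreal \<bar>h x\<bar> \<partial>lebesgue" and ?U = "\<lambda>t. \<Union>{P \<in> dyadic c R. ennreal t < tripled_average P h}"
  have NI: "maximal_norm Q0 * ?I = ennreal (t * V)"
  proof -
    have "maximal_norm Q0 * ?I < top" using fin h by (simp add: Lp_on_def ennreal_mult_less_top)
    then obtain r where r: "maximal_norm Q0 * ?I = ennreal r" "0 \<le> r" by (cases "maximal_norm Q0 * ?I") auto
    then have "ennreal t = ennreal (r / V)" using t(1) V by (simp add: divide_ennreal)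
    then have "t = r / V" using t(2) r(2) V by (subst (asm) ennreal_inj) auto
    then show ?thesis using r V by simp
  qed
  show ?thesis
  proof (cases "t = 0")
    case False
    then have t0: "0 < t" using t(2) by simp
    have "ennreal t * emeasure lebesgue (?U t) \<le> ennreal t * ennreal V"
      using weak_type[OF Q0 fin h t0] NI t0 V by (simp add: ennreal_mult)
    then show ?thesis using t0 by (simp add: ennreal_mult_le_mult_iff)
  next
    case True
    have "emeasure lebesgue (?U (1 / real (Suc k))) = 0" for k
    proof -
      have "ennreal (1 / real (Suc k)) * emeasure lebesgue (?U (1 / real (Suc k))) \<le> 0"
        using weak_type[OF Q0 fin h, of "1 / real (Suc k)"] NI True by simp
      then show ?thesis by (auto simp: ennreal_eq_0_iff)
    qed
    then have null: "(\<Union>k. ?U (1 / real (Suc k))) \<in> null_sets lebesgue"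
      by (intro null_sets_UN) (auto simp: null_sets_def intro!: Union_dyadic_sets)
    have sub: "?U t \<subseteq> (\<Union>k. ?U (1 / real (Suc k)))"
    proof
      fix x assume "x \<in> ?U t"
      then obtain P where P: "P \<in> dyadic c R" "0 < tripled_average P h" "x \<in> P" using True by auto
      have "\<exists>k. ennreal (1 / real (Suc k)) < tripled_average P h"
      proof (cases "tripled_average P h")
        case (real r)
        then obtain k where "inverse (real (Suc k)) < r" using P(2) reals_Archimedean[of r] by auto
        then show ?thesis using real by (intro exI[of _ k]) (simp add: inverse_eq_divide ennreal_less_iff)
      qed simp
      then show "x \<in> (\<Union>k. ?U (1 / real (Suc k)))" using P by blast
    qed
    have "?U t \<in> sets lebesgue" by (intro Union_dyadic_sets) auto
    from null_sets_subset[OF null this sub]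
    show ?thesis by (simp add: null_sets_def)
  qed
qed

lemma ocube_in_open:
  fixes x :: "real ^ 'n"
  assumes "open U" "x \<in> U"
  obtains e where "0 < e" "ocube x e \<subseteq> U"
proof -
  obtain d where d: "0 < d" "ball x d \<subseteq> U" using assms open_contains_ball by blast
  define e where "e = d / real (CARD('n) + 1)"
  have e: "0 < e" using d by (simp add: e_def)
  have "ocube x e \<subseteq> ball x d"
  proof
    fix y assume y: "y \<in> ocube x e"
    have "norm (y - x) \<le> (\<Sum>i\<in>UNIV. \<bar>(y - x) $ i\<bar>)" by (rule norm_le_l1_cart)
    also have "\<dots> \<le> (\<Sum>i\<in>(UNIV::'n set). e)" using y by (intro sum_mono) (simp add: ocube_def less_imp_le)
    also have "\<dots> = real CARD('n) * e" by simp
    also have "\<dots> < real (CARD('n) + 1) * e" using e by (intro mult_strict_right_mono) auto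
    also have "\<dots> = d" by (simp add: e_def)
    finally show "y \<in> ball x d" by (simp add: dist_norm norm_minus_commute)
  qed
  with d e show thesis by (intro that[of e]) auto
qed

lemma nn_integral_average_1:
  fixes z :: "real ^ 'n"
  assumes "0 < r"
  shows "average (ocube z r) 1 h = (\<integral>\<^sup>+x\<in>ocube z r. ennreal \<bar>h x\<bar> \<partial>lebesgue) / ennreal ((2 * r) ^ CARD('n))"
  using assms by (simp add: average_def emeasure_ocube powr_one_gt_zero_iff) 

text \<open>
  A substitute for Lebesgue's differentiation theorem that needs only the weak type inequality.
  Suppose that the set \<open>S\<close> of points where \<open>h > s > t\<close> although all small cubes have averages at most \<open>t\<close> had positive
  measure. Choose an open \<open>G \<supseteq> S\<close> with \<open>G - S\<close> small. The weak type inequality for the indicator of \<open>G - S\<close>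
  yields a point of \<open>S\<close> such that \<open>G - S\<close> occupies at most the fraction \<open>\<delta>\<close> of the triples of all dyadic cubes around it.
  For a small cube this triple lies in \<open>G\<close>, and the average of \<open>h\<close> over it is at least \<open>s (1 - \<delta>) > t\<close>.
\<close>

lemma dyadic_differentiation:
  fixes c :: "real ^ 'n"
  assumes Q0: "cube_like Q0 c R" and fin: "maximal_norm Q0 < top" and h: "h \<in> Lp_on 1 UNIV"
    and t: "0 \<le> t"
  shows "AE y in lebesgue. y \<in> ocube c R \<longrightarrow>
    (\<forall>m\<ge>m0. \<forall>j\<in>dindex m. y \<in> dcube c R m j \<longrightarrow> tripled_average (dcube c R m j) h \<le> ennreal t) \<longrightarrow> h y \<le> t"
proof -
  have R: "0 < R" using Q0 by (simp add: cube_like_def)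
  have hm[measurable]: "h \<in> borel_measurable lebesgue" using h by (simp add: Lp_on_def lebesgue_on_UNIV_eq)
  define B where "B = \<Union>{dcube c R m j | m j. m0 \<le> m \<and> j \<in> dindex m \<and> ennreal t < tripled_average (dcube c R m j) h}"
  have "open B" unfolding B_def by (intro open_Union ballI) (auto simp: dcube_def open_ocube)
  then have Bm[measurable]: "B \<in> sets lebesgue" by auto
  have small: "AE y in lebesgue. \<not> (y \<in> ocube c R \<and> y \<notin> B \<and> s < h y)" if s: "t < s" for s
  proof -
    define S where "S = {y. s < h y} \<inter> ocube c R - B"
    have "{y. s < h y} = h -` {s<..} \<inter> space lebesgue" by auto
    then have "{y. s < h y} \<in> sets lebesgue" using hm by (simp only: measurable_sets greaterThan_borel)
    then have Sm: "S \<in> sets lebesgue" unfolding S_def by (intro sets.Diff sets.Int Bm sets_ocube)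
    have "emeasure lebesgue S = 0"
    proof (rule ccontr)
      assume ne: "emeasure lebesgue S \<noteq> 0"
      have "emeasure lebesgue S \<le> emeasure lebesgue (ocube c R)"
        by (rule emeasure_mono) (auto simp: S_def)
      also have "\<dots> < top" using R by (simp add: emeasure_ocube)
      finally obtain \<mu> where \<mu>: "emeasure lebesgue S = ennreal \<mu>" "0 < \<mu>"
        using ne by (cases "emeasure lebesgue S") (auto simp: less_le)
      have s0: "0 < s" using t s by linarith
      (* Any value between zero and one with t < s * (1 - \<delta>) works. *)
      define \<delta> where "\<delta> = (s - t) / (2 * s)"
      have \<delta>: "0 < \<delta>" "\<delta> < 1" "t < s * (1 - \<delta>)"
        using s s0 t by (auto simp: \<delta>_def field_simps)
      obtain N where N: "maximal_norm Q0 = ennreal N" "0 \<le> N" using fin by (cases "maximal_norm Q0") auto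
      (* By the weak type inequality the exceptional set then has measure at most
         N * \<epsilon> / \<delta> < \<mu>, so it cannot contain all of S. *)
      define \<epsilon> where "\<epsilon> = \<mu> * \<delta> / (2 * (N + 1))"
      have \<epsilon>: "0 < \<epsilon>" using \<mu> \<delta> N by (simp add: \<epsilon>_def)
      obtain G where G: "open G" "S \<subseteq> G" "G - S \<in> lmeasurable" "emeasure lebesgue (G - S) < ennreal \<epsilon>"
        using sets_lebesgue_outer_open[OF Sm \<epsilon>] by blast
      define b where "b = (indicator (G - S) :: real ^ 'n \<Rightarrow> real)"
      have GSm[measurable]: "G - S \<in> sets lebesgue" using G(3) by (simp add: fmeasurableD)
      have Ib: "(\<integral>\<^sup>+x. ennreal \<bar>b x\<bar> \<partial>lebesgue) = emeasure lebesgue (G - S)"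
      proof -
        have "(\<integral>\<^sup>+x. ennreal \<bar>b x\<bar> \<partial>lebesgue) = (\<integral>\<^sup>+x. indicator (G - S) x \<partial>lebesgue)"
          unfolding b_def by (intro nn_integral_cong) (auto simp: indicator_def)
        then show ?thesis by simp
      qed
      have bL: "b \<in> Lp_on 1 UNIV"
      proof -
        have "(\<integral>\<^sup>+x\<in>UNIV. ennreal (norm (b x) powr 1) \<partial>lebesgue) = (\<integral>\<^sup>+x. ennreal \<bar>b x\<bar> \<partial>lebesgue)"
          by (intro nn_integral_cong) simp
        also have "\<dots> < \<infinity>" unfolding Ib using G(4) by (auto intro: less_trans)
        finally show ?thesis unfolding Lp_on_def b_def by simp
      qed
      let ?U = "\<Union>{P \<in> dyadic c R. ennreal \<delta> < tripled_average P b}"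
      have Um: "?U \<in> sets lebesgue" by (intro Union_dyadic_sets) auto
      have "emeasure lebesgue ?U < ennreal \<mu>"
      proof -
        have "ennreal \<delta> * emeasure lebesgue ?U \<le> ennreal N * ennreal \<epsilon>"
          using weak_type[OF Q0 fin bL \<delta>(1)] G(4) unfolding N(1) Ib
          by (meson less_imp_le mult_left_mono order_trans zero_le)
        also have "\<dots> = ennreal (N * \<epsilon>)" using N(2) \<epsilon> by (simp add: ennreal_mult)
        also have "\<dots> < ennreal (\<delta> * \<mu>)"
        proof (rule ennreal_lessI)
          show "0 < \<delta> * \<mu>" using \<delta> \<mu> by simp
          have "N * \<epsilon> = \<delta> * \<mu> * (N / (2 * (N + 1)))" by (simp add: \<epsilon>_def)
          also have "\<dots> < \<delta> * \<mu> * 1"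
            using N(2) \<delta> \<mu> by (intro mult_strict_left_mono) (auto simp: divide_less_eq)
          finally show "N * \<epsilon> < \<delta> * \<mu>" by simp
        qed
        finally have "ennreal \<delta> * emeasure lebesgue ?U < ennreal \<delta> * ennreal \<mu>" using \<delta>(1) \<mu>(2) by (simp add: ennreal_mult)
        then show ?thesis by (meson mult_left_mono not_le zero_le)
      qed
      have "\<not> (AE y in lebesgue. y \<notin> S - ?U)"
      proof
        assume "AE y in lebesgue. y \<notin> S - ?U"
        then have "AE y in lebesgue. y \<in> S \<longrightarrow> y \<in> ?U" by eventually_elim blast
        then have "emeasure lebesgue S \<le> emeasure lebesgue ?U" using Um by (rule emeasure_mono_AE)
        then show False using \<open>emeasure lebesgue ?U < ennreal \<mu>\<close> \<mu>(1) by simp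
      qed
      then obtain y where y: "y \<in> S" "y \<notin> ?U" and dy: "\<And>m. \<exists>j\<in>dindex m. y \<in> dcube c R m j"
      proof -
        have "\<exists>y. y \<in> S - ?U \<and> (y \<in> ocube c R \<longrightarrow> (\<forall>m. \<exists>j\<in>dindex m. y \<in> dcube c R m j))"
        proof (rule ccontr)
          assume no: "\<not> ?thesis"
          have "AE y in lebesgue. y \<notin> S - ?U"
            using AE_in_dcubes[OF R, of c] by eventually_elim (use no in blast)
          then show False using \<open>\<not> (AE y in lebesgue. y \<notin> S - ?U)\<close> by blast
        qed
        then show thesis using that unfolding S_def by blast
      qed
      obtain e where e: "0 < e" "ocube y e \<subseteq> G" using ocube_in_open[OF G(1)] y(1) G(2) by blast
      obtain k :: nat where k: "4 * R / e < 2 ^ k" using real_arch_pow[of 2 "4 * R / e"] by auto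
      define m where "m = max m0 k"
      have m: "m0 \<le> m" "4 * R / 2 ^ m < e"
      proof -
        show "m0 \<le> m" by (simp add: m_def)
        have "4 * R < e * 2 ^ k" using k e by (simp add: divide_less_eq mult.commute)
        also have "\<dots> \<le> e * 2 ^ m" using e by (intro mult_left_mono power_increasing) (auto simp: m_def)
        finally show "4 * R / 2 ^ m < e" by (simp add: divide_less_eq)
      qed
      obtain j where j: "j \<in> dindex m" "y \<in> dcube c R m j" using dy by blast
      define z r where "z = dcenter c R m j" and "r = R / 2 ^ m"
      have r: "0 < r" using R by (simp add: r_def)
      have P: "dcube c R m j = ocube z r" by (simp add: dcube_def z_def r_def)
      have P3: "tripled_average (dcube c R m j) g = average (ocube z (3 * r)) 1 g" for g
        unfolding tripled_average_def P dilate_ocube[OF r zero_less_numeral] ..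
      let ?T = "ocube z (3 * r)"
      have TG: "?T \<subseteq> G"
      proof
        fix w assume w: "w \<in> ?T"
        have "\<bar>w $ i - y $ i\<bar> < e" for i
        proof -
          have "\<bar>w $ i - z $ i\<bar> < 3 * r" "\<bar>y $ i - z $ i\<bar> < r" using w j(2) unfolding P by (simp_all add: ocube_def)
          then show ?thesis using m(2) by (simp add: r_def)
        qed
        then show "w \<in> G" using e(2) by (auto simp: ocube_def)
      qed
      define v where "v = (2 * (3 * r)) ^ CARD('n)"
      have v: "0 < v" "emeasure lebesgue ?T = ennreal v" using r by (auto simp: v_def emeasure_ocube)
      have avg: "(\<integral>\<^sup>+x\<in>?T. ennreal \<bar>g x\<bar> \<partial>lebesgue) \<le> ennreal (a * v)" if "tripled_average (dcube c R m j) g \<le> ennreal a" "0 \<le> a" for g a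
      proof -
        let ?J = "\<integral>\<^sup>+x\<in>?T. ennreal \<bar>g x\<bar> \<partial>lebesgue"
        have "?J / ennreal v \<le> ennreal a"
          using that r unfolding P3 v_def by (subst (asm) nn_integral_average_1) auto
        then have "?J / ennreal v * ennreal v \<le> ennreal a * ennreal v" by (intro mult_right_mono) auto
        then show ?thesis using v(1) that(2)
          by (simp add: ennreal_divide_times ennreal_mult_divide_eq ennreal_times_divide[symmetric] ennreal_mult)
      qed
      have b_le: "emeasure lebesgue (?T - S) \<le> ennreal (\<delta> * v)"
      proof -
        have "dcube c R m j \<in> dyadic c R" using j(1) by (auto simp: dyadic_def)
        then have "tripled_average (dcube c R m j) b \<le> ennreal \<delta>" using y(2) j(2) by (auto simp: not_less[symmetric])
        from avg[OF this] \<delta>(1) have "(\<integral>\<^sup>+x\<in>?T. ennreal \<bar>b x\<bar> \<partial>lebesgue) \<le> ennreal (\<delta> * v)" by simp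
        moreover have "(\<integral>\<^sup>+x\<in>?T. ennreal \<bar>b x\<bar> \<partial>lebesgue) = (\<integral>\<^sup>+x. indicator (?T - S) x \<partial>lebesgue)"
          using TG unfolding b_def by (intro nn_integral_cong) (auto simp: indicator_def)
        moreover have "?T - S \<in> sets lebesgue" using Sm by (intro sets.Diff sets_ocube)
        ultimately show ?thesis by simp
      qed
      have "y \<notin> B" using y(1) by (simp add: S_def)
      then have "\<not> ennreal t < tripled_average (dcube c R m j) h"
        unfolding B_def using j m(1) by blast
      then have h_le: "(\<integral>\<^sup>+x\<in>?T. ennreal \<bar>h x\<bar> \<partial>lebesgue) \<le> ennreal (t * v)"
        using avg t by (simp add: not_less)
      have "ennreal v \<le> emeasure lebesgue (?T \<inter> S) + emeasure lebesgue (?T - S)"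
        unfolding v(2)[symmetric] using Sm by (subst plus_emeasure) (auto simp: Int_Diff_Un)
      also have "\<dots> \<le> emeasure lebesgue (?T \<inter> S) + ennreal (\<delta> * v)" using b_le by (intro add_left_mono)
      finally have "ennreal s * ennreal v \<le> ennreal s * emeasure lebesgue (?T \<inter> S) + ennreal s * ennreal (\<delta> * v)"
        unfolding distrib_left[symmetric] by (intro mult_left_mono) auto
      also have "ennreal s * emeasure lebesgue (?T \<inter> S) = (\<integral>\<^sup>+x\<in>?T \<inter> S. ennreal s \<partial>lebesgue)"
        using Sm by (simp add: nn_integral_cmult_indicator)
      also have "\<dots> \<le> (\<integral>\<^sup>+x\<in>?T. ennreal \<bar>h x\<bar> \<partial>lebesgue)"
        by (intro nn_integral_mono) (auto simp: indicator_def S_def intro!: ennreal_leI)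
      also note h_le
      finally have "ennreal (s * v) \<le> ennreal (t * v + s * (\<delta> * v))"
        using s0 v(1) \<delta> t by (simp add: ennreal_mult)
      then have "s * v \<le> t * v + s * (\<delta> * v)" using s0 v(1) \<delta> t by (subst (asm) ennreal_le_iff) auto
      then have "(s * (1 - \<delta>)) * v \<le> t * v" by (simp add: algebra_simps)
      then show False using v(1) \<delta>(3) by (simp add: mult_le_cancel_right)
    qed
    then have "S \<in> null_sets lebesgue" using Sm by (simp add: null_sets_def)
    then have "AE y in lebesgue. y \<notin> S" by (rule AE_not_in)
    then show ?thesis by eventually_elim (auto simp: S_def)
  qed
  have "AE y in lebesgue. \<forall>k::nat. \<not> (y \<in> ocube c R \<and> y \<notin> B \<and> t + 1 / real (Suc k) < h y)"
    by (subst AE_all_countable) (intro allI small, simp)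
  then show ?thesis
  proof eventually_elim
    case (elim y)
    show ?case
    proof (intro impI)
      assume y: "y \<in> ocube c R"
        "\<forall>m\<ge>m0. \<forall>j\<in>dindex m. y \<in> dcube c R m j \<longrightarrow> tripled_average (dcube c R m j) h \<le> ennreal t"
      have "y \<notin> B" unfolding B_def using y(2) by (force simp: not_less[symmetric])
      then have le: "h y \<le> t + 1 / real (Suc k)" for k using elim y(1) by (simp add: not_less)
      show "h y \<le> t"
      proof (rule field_le_epsilon)
        fix e :: real assume "0 < e"
        then obtain k where "inverse (real (Suc k)) < e" using reals_Archimedean by blast
        then show "h y \<le> t + e" using le[of k] by (simp add: inverse_eq_divide)
      qed
    qed
  qed
qed

definition dyadic_maximal :: "real ^ 'n \<Rightarrow> real \<Rightarrow> (real ^ 'n \<Rightarrow> real) \<Rightarrow> real ^ 'n \<Rightarrow> ennreal"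
  where "dyadic_maximal c R h y = (SUP P\<in>dyadic c R. indicator P y * tripled_average P h)"

text \<open>
  The superlevel set for \<open>2\<^sup>k\<close> has measure \<open>O(2\<^sup>-\<^sup>k)\<close>, and \<open>\<Sum> 2\<^sup>k\<^sup>d 2\<^sup>-\<^sup>k\<close> converges for \<open>d < 1\<close>.
\<close>

lemma Kolmogorov:
  fixes c :: "real ^ 'n"
  assumes Q0: "cube_like Q0 c R" and fin: "maximal_norm Q0 < top" and h: "h \<in> Lp_on 1 UNIV"
    and d: "0 < d" "d < 1"
  shows "(\<integral>\<^sup>+y\<in>ocube c R. ennpowr (dyadic_maximal c R h y) d \<partial>lebesgue) < top"
proof -
  have R: "0 < R" using Q0 by (simp add: cube_like_def)
  let ?U = "\<lambda>k::nat. \<Union>{P \<in> dyadic c R. ennreal (2 ^ k) < tripled_average P h}"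
  define a where "a k = (2 ^ Suc k) powr d" for k :: nat
  have a: "0 \<le> a k" for k by (simp add: a_def)
  have Um[measurable]: "?U k \<in> sets lebesgue" for k by (intro Union_dyadic_sets) auto
  have U: "y \<in> ?U k \<longleftrightarrow> ennreal (2 ^ k) < dyadic_maximal c R h y" for y k
    by (auto simp: dyadic_maximal_def less_SUP_iff indicator_def split: if_splits)
  have le: "ennpowr (dyadic_maximal c R h y) d \<le> 1 + (\<Sum>k. ennreal (a k) * indicator (?U k) y)" for y
  proof -
    have sum_ge: "ennreal (a k) \<le> (\<Sum>k. ennreal (a k) * indicator (?U k) y)" if "y \<in> ?U k" for k
    proof -
      have "f k \<le> suminf f" for f :: "nat \<Rightarrow> ennreal"
        using sum_le_suminf[OF summableI, of "{k}" f] by simp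
      from this[of "\<lambda>k. ennreal (a k) * indicator (?U k) y"] show ?thesis using that by simp
    qed
    consider "dyadic_maximal c R h y \<le> 1" | "dyadic_maximal c R h y = top"
      | r where "dyadic_maximal c R h y = ennreal r" "1 < r"
      by (cases "dyadic_maximal c R h y") (force simp: ennreal_le_1)+
    then show ?thesis
    proof cases
      case 1
      then have "ennpowr (dyadic_maximal c R h y) d \<le> ennpowr 1 d" using d by (intro ennpowr_mono) auto
      also have "ennpowr 1 d = 1" using ennpowr_ennreal[of 1 d] by simp
      finally show ?thesis by (simp add: add_increasing2)
    next
      case 2
      have ge: "ennreal (a k) \<le> (\<Sum>k. ennreal (a k) * indicator (?U k) y)" for k
      proof (rule sum_ge)
        show "y \<in> ?U k" unfolding U using 2 by simp
      qed
      have unb: "\<exists>k. x < a k" for x :: real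
      proof -
        obtain k where k: "x < (2 powr d) ^ k"
          using real_arch_pow[of "2 powr d" x] d by auto
        also have "(2 powr d) ^ k = (2 ^ k) powr d"
          by (simp add: powr_realpow[symmetric] powr_powr mult.commute)
        also have "\<dots> \<le> a k" unfolding a_def using d by (intro powr_mono2) auto
        finally show ?thesis by blast
      qed
      have "(\<Sum>k. ennreal (a k) * indicator (?U k) y) = top"
      proof (cases "\<Sum>k. ennreal (a k) * indicator (?U k) y")
        case (real x)
        obtain k where k: "x < a k" using unb by blast
        have "ennreal (a k) \<le> ennreal x" using ge[of k] by (simp only: real(2))
        then show ?thesis using real(1) k by (simp add: ennreal_le_iff)
      qed
      then show ?thesis by simp
    next
      case 3
      then obtain k where k: "2 ^ k < r" "r \<le> 2 ^ Suc k"
      proof -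
        define k where "k = (LEAST k. r \<le> 2 ^ Suc k)"
        have ex: "\<exists>k. r \<le> 2 ^ Suc k"
          using real_arch_pow[of 2 r] by (metis less_imp_le one_less_numeral_iff order_less_trans power_strict_increasing lessI semiring_norm(76))
        then have 1: "r \<le> 2 ^ Suc k" unfolding k_def by (rule LeastI_ex)
        have "2 ^ k < r"
        proof (cases k)
          case 0
          then show ?thesis using 3 by simp
        next
          case (Suc l)
          then have "\<not> r \<le> 2 ^ Suc l" using not_less_Least[of l "\<lambda>k. r \<le> 2 ^ Suc k"] by (simp add: k_def)
          then show ?thesis using Suc by simp
        qed
        with 1 show thesis by (rule that[rotated])
      qed
      have "ennpowr (dyadic_maximal c R h y) d = ennreal (r powr d)" using 3 by (simp add: ennpowr_ennreal)
      also have "\<dots> \<le> ennreal (a k)" unfolding a_def using 3 k d by (intro ennreal_leI powr_mono2) auto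
      also have "\<dots> \<le> (\<Sum>k. ennreal (a k) * indicator (?U k) y)"
      proof (rule sum_ge)
        show "y \<in> ?U k" unfolding U using 3 k by (simp add: ennreal_less_iff)
      qed
      finally show ?thesis by (simp add: add_increasing)
    qed
  qed
  obtain C where C: "maximal_norm Q0 * (\<integral>\<^sup>+x. ennreal \<bar>h x\<bar> \<partial>lebesgue) = ennreal C" "0 \<le> C"
  proof -
    have "maximal_norm Q0 * (\<integral>\<^sup>+x. ennreal \<bar>h x\<bar> \<partial>lebesgue) < top"
      using fin h by (simp add: Lp_on_def ennreal_mult_less_top)
    then show thesis using that by (cases "maximal_norm Q0 * (\<integral>\<^sup>+x. ennreal \<bar>h x\<bar> \<partial>lebesgue)") auto
  qed
  have Uk: "emeasure lebesgue (?U k) \<le> ennreal (C / 2 ^ k)" for k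
  proof -
    have "ennreal (2 ^ k) * emeasure lebesgue (?U k) \<le> ennreal (2 ^ k) * ennreal (C / 2 ^ k)"
      using weak_type[OF Q0 fin h, of "2 ^ k"] C by (simp add: ennreal_mult[symmetric])
    then show ?thesis by (subst (asm) ennreal_mult_le_mult_iff) auto
  qed
  have "(\<integral>\<^sup>+y\<in>ocube c R. ennpowr (dyadic_maximal c R h y) d \<partial>lebesgue)
      \<le> (\<integral>\<^sup>+y. indicator (ocube c R) y + (\<Sum>k. ennreal (a k) * indicator (?U k) y) \<partial>lebesgue)"
    using le by (intro nn_integral_mono) (auto simp: indicator_def add_increasing)
  also have "\<dots> = emeasure lebesgue (ocube c R) + (\<Sum>k. ennreal (a k) * emeasure lebesgue (?U k))"
    by (simp add: nn_integral_add nn_integral_suminf nn_integral_cmult_indicator)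
  also have "\<dots> \<le> emeasure lebesgue (ocube c R) + (\<Sum>k. ennreal (2 powr d * C * (2 powr (d - 1)) ^ k))"
  proof (intro add_left_mono suminf_le summableI)
    fix k
    have "ennreal (a k) * emeasure lebesgue (?U k) \<le> ennreal (a k) * ennreal (C / 2 ^ k)"
      using Uk by (intro mult_left_mono) auto
    also have "\<dots> = ennreal (a k * (C / 2 ^ k))"
      by (rule ennreal_mult[symmetric]) (use a C in auto)
    also have "a k * (C / 2 ^ k) = 2 powr d * C * (2 powr (d - 1)) ^ k"
    proof -
      have "a k = 2 powr d * (2 powr d) ^ k"
        by (simp add: a_def powr_mult powr_realpow[symmetric] powr_powr mult.commute)
      moreover have "(2 powr (d - 1)) ^ k = (2 powr d) ^ k / 2 ^ k"
        by (simp add: powr_diff power_divide)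
      ultimately show ?thesis by simp
    qed
    finally show "ennreal (a k) * emeasure lebesgue (?U k) \<le> ennreal (2 powr d * C * (2 powr (d - 1)) ^ k)" .
  qed
  also have "\<dots> < top"
  proof -
    have "2 powr (d - 1) < 2 powr 0" using d by (intro powr_less_mono) auto
    then have "summable (\<lambda>k. 2 powr d * C * (2 powr (d - 1)) ^ k)"
      by (intro summable_mult summable_geometric) simp
    then have "(\<Sum>k. ennreal (2 powr d * C * (2 powr (d - 1)) ^ k)) = ennreal (\<Sum>k. 2 powr d * C * (2 powr (d - 1)) ^ k)"
      using C by (intro suminf_ennreal2) auto
    then show ?thesis using R by (simp add: emeasure_ocube)
  qed
  finally show ?thesis .
qed

section \<open>Comparison of solutions\<close>

lemma square_integrable_local:
  fixes h :: "real ^ 'n \<Rightarrow> 'b::euclidean_space"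
  assumes "square_integrable h" "0 < s" "s \<le> 2"
  shows "(\<integral>\<^sup>+x\<in>ocube z r. ennreal (norm (h x) powr s) \<partial>lebesgue) < top"
proof -
  have "(\<integral>\<^sup>+x\<in>ocube z r. ennreal (norm (h x) powr s) \<partial>lebesgue) \<le> (\<integral>\<^sup>+x\<in>ccube z r. ennreal (norm (h x) powr s) \<partial>lebesgue)"
    using ocube_subset_ccube[of z r] by (intro nn_integral_mono) (auto simp: indicator_def)
  also have "\<dots> < top"
    using square_integrable_Lp_loc_on[OF assms(1), of UNIV s] assms(2,3) compact_cbox
    by (simp add: Lp_loc_on_def ccube_cbox)
  finally show ?thesis .
qed

lemma ennreal_divide_less_top: "x < top \<Longrightarrow> 0 < v \<Longrightarrow> x / ennreal v < top"
  by (cases x) (auto simp: divide_ennreal)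

lemma ennreal_square_le: "x\<^sup>2 \<le> y\<^sup>2 \<Longrightarrow> x \<le> (y :: ennreal)"
proof (cases y)
  case (real b)
  assume le: "x\<^sup>2 \<le> y\<^sup>2"
  show ?thesis
  proof (cases x)
    case (real a)
    then have "a\<^sup>2 \<le> b\<^sup>2" using le \<open>y = ennreal b\<close> \<open>0 \<le> b\<close> by (simp add: ennreal_power)
    then have "a \<le> b" using \<open>0 \<le> b\<close> by (rule power2_le_imp_le)
    then show ?thesis using real \<open>y = ennreal b\<close> by (simp add: ennreal_leI)
  next
    case top
    then show ?thesis using le real by (simp add: top_unique power2_eq_square ennreal_mult[symmetric])
  qed
qed simp

lemma W0_zero: "W0 U (\<lambda>x. 0) (\<lambda>x. 0)"
  by (rule W0_I[of _ _ "\<lambda>k x. 0"]) (simp_all add: square_integrable_def zero_test_function gradient_const)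

locale elliptic_setting =
  fixes lam \<Lambda> :: real and Q0 O0 \<Omega> :: "(real ^ 'n) set" and c :: "real ^ 'n" and R :: real
    and a :: "real ^ 'n \<Rightarrow> real ^ 'n \<Rightarrow> real ^ 'n"
  assumes lam: "0 < lam" "lam \<le> \<Lambda>"
    and O0: "reference_domain O0" and Q0: "cube_like Q0 c R"
    and ell: "elliptic_coefficient lam \<Lambda> (dilate 3 Q0) a"
    and dom: "is_domain \<Omega>" and \<Omega>Q0: "\<Omega> \<subseteq> Q0"
begin

lemma R: "0 < R" using Q0 by (simp add: cube_like_def)

lemma open_\<Omega>: "open \<Omega>" using dom by (simp add: is_domain_def)

lemma \<Omega>_sets [measurable, simp]: "\<Omega> \<in> sets lebesgue" using open_\<Omega> by auto

lemma \<Omega>_top: "\<Omega> \<subseteq> ocube c R"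
proof -
  have "\<Omega> \<subseteq> ccube c R" using Q0 \<Omega>Q0 by (auto simp: cube_like_def)
  then have "\<Omega> \<subseteq> interior (ccube c R)" using open_\<Omega> by (rule interior_maximal)
  then show ?thesis unfolding ccube_cbox ocube_box interior_cbox .
qed

lemma \<Omega>_dilate: "\<Omega> \<subseteq> dilate 3 Q0"
proof -
  have "ocube c R \<subseteq> ocube c (3 * R)" using R by (intro ocube_mono) simp
  then show ?thesis using \<Omega>_top cube_like_dilate[OF Q0, of 3] by (auto simp: cube_like_def)
qed

lemma \<Omega>_bounded:
  obtains B where "0 \<le> B" "\<And>x. x \<in> \<Omega> \<Longrightarrow> norm x \<le> B"
proof -
  have "bounded \<Omega>" using bounded_subset[OF bounded_box] \<Omega>_top unfolding ocube_box by blast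
  then obtain B where "\<And>x. x \<in> \<Omega> \<Longrightarrow> norm x \<le> B" unfolding bounded_iff by blast
  then show thesis using that[of "max B 0"] by (meson max.coboundedI1 max.cobounded2)
qed

lemma a_props:
  assumes "x \<in> \<Omega>"
  shows "a x 0 = 0" "norm (a x \<xi>) \<le> \<Lambda> * norm \<xi>" "continuous_on UNIV (a x)"
proof -
  have xD: "x \<in> dilate 3 Q0" using assms \<Omega>_dilate by blast
  then have "a x 0 = 0" "norm (a x \<xi> - a x 0) \<le> \<Lambda> * norm (\<xi> - 0)"
    using ell unfolding elliptic_coefficient_def by blast+
  then show "a x 0 = 0" "norm (a x \<xi>) \<le> \<Lambda> * norm \<xi>" by simp_all
  obtain D' where "\<And>\<xi>. (a x has_derivative blinfun_apply (D' \<xi>)) (at \<xi>)"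
    using ell xD unfolding elliptic_coefficient_def by blast
  then show "continuous_on UNIV (a x)"
    by (intro continuous_at_imp_continuous_on ballI) (blast intro: has_derivative_continuous)
qed

lemma a_measurable:
  assumes "U \<in> sets lebesgue" "U \<subseteq> \<Omega>" "g \<in> borel_measurable lebesgue"
  shows "(\<lambda>x. if x \<in> U then a x (g x) else 0) \<in> borel_measurable lebesgue"
proof (rule Caratheodory_measurable[OF assms(1) _ _ assms(3)])
  show "(\<lambda>x. if x \<in> U then a x \<xi> else 0) \<in> borel_measurable lebesgue" for \<xi>
  proof -
    have "(\<lambda>x. a x \<xi>) \<in> borel_measurable (lebesgue_on (dilate 3 Q0))"
      using ell by (simp add: elliptic_coefficient_def)
    then have "(\<lambda>x. a x \<xi>) \<in> borel_measurable (lebesgue_on U)"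
      using assms(2) \<Omega>_dilate by (rule measurable_restrict_mono[OF _ order_trans])
    then show ?thesis by (simp add: borel_measurable_if[OF assms(1)])
  qed
  show "x \<in> U \<Longrightarrow> continuous_on UNIV (a x)" for x using a_props(3) assms(2) by blast
qed

lemma a_integral_cong:
  assumes U: "U \<in> sets lebesgue" "U \<subseteq> \<Omega>" and g: "g \<in> borel_measurable lebesgue" "g' \<in> borel_measurable lebesgue"
    and ae: "AE x in lebesgue. x \<in> U \<longrightarrow> g x = g' x" and \<phi>: "\<phi> \<in> test_functions V"
  shows "(LINT x:U|lebesgue. a x (g x) \<bullet> gradient \<phi> x) = (LINT x:U|lebesgue. a x (g' x) \<bullet> gradient \<phi> x)"
proof -
  have gm: "gradient \<phi> \<in> borel_measurable lebesgue"
    using test_function_C1(6)[OF \<phi>] by (auto intro!: measurable_completion borel_measurable_continuous_onI)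
  have eq: "indicator U x *\<^sub>R (a x (k x) \<bullet> gradient \<phi> x) = (if x \<in> U then a x (k x) else 0) \<bullet> gradient \<phi> x" for k x
    by (simp add: indicator_def)
  show ?thesis
    unfolding set_lebesgue_integral_def eq
  proof (rule integral_cong_AE)
    show "AE x in lebesgue. (if x \<in> U then a x (g x) else 0) \<bullet> gradient \<phi> x = (if x \<in> U then a x (g' x) else 0) \<bullet> gradient \<phi> x"
      using ae by eventually_elim simp
  qed (intro borel_measurable_inner a_measurable U g gm)+
qed

text \<open>
  The pairs in \<^const>\<open>solution_pairs\<close> vanish at every point outside \<open>\<Omega>\<close>, not only at almost every one.
\<close>

definition ext :: "(real ^ 'n \<Rightarrow> real) \<Rightarrow> real ^ 'n \<Rightarrow> real"
  where "ext u x = (if x \<in> \<Omega> then u x else 0)"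

lemma W0_ext:
  assumes "W0 \<Omega> u G"
  shows "ext u \<in> W12_0_ext \<Omega>" "AE x in lebesgue. weak_gradient UNIV (ext u) x = G x"
    "weak_gradient UNIV (ext u) \<in> borel_measurable lebesgue"
proof -
  have W: "W0 \<Omega> (ext u) (\<lambda>x. if x \<in> \<Omega> then G x else 0)"
    using W0_restrict[OF assms \<Omega>_sets] unfolding ext_def .
  show "ext u \<in> W12_0_ext \<Omega>"
    by (rule W0_imp_W12_0_ext(1)[OF W open_\<Omega>]) (simp add: ext_def)
  have "AE x in lebesgue. weak_gradient UNIV (ext u) x = (if x \<in> \<Omega> then G x else 0)"
    by (rule W0_imp_W12_0_ext(2)[OF W open_\<Omega>]) (simp add: ext_def)
  then show "AE x in lebesgue. weak_gradient UNIV (ext u) x = G x"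
    using W0_vanishes_outside[OF assms \<Omega>_sets] by eventually_elim (auto split: if_splits)
  have "has_weak_gradient UNIV (ext u) (weak_gradient UNIV (ext u))"
    by (rule has_weak_gradient_weak_gradient[OF W0_has_weak_gradient[OF W]]) simp
  then show "weak_gradient UNIV (ext u) \<in> borel_measurable lebesgue"
    by (simp add: has_weak_gradient_def Lp_loc_on_def lebesgue_on_UNIV_eq)
qed

text \<open>
  The pair \<open>(u, v)\<close> is one of those over which the supremum defining the constant is taken. Finiteness of the
  constant excludes the case that only the denominator of the quotient vanishes.
\<close>

lemma comparison:
  assumes W: "W0 \<Omega> u G" "W0 \<Omega> v H" and r: "0 < r" and s: "0 < s"
    and eq: "\<And>\<phi>. \<phi> \<in> test_functions (smoothened O0 (ocube z r) \<inter> \<Omega>) \<Longrightarrow>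
      (LINT x:smoothened O0 (ocube z r) \<inter> \<Omega>|lebesgue. a x (G x) \<bullet> gradient \<phi> x) =
      (LINT x:smoothened O0 (ocube z r) \<inter> \<Omega>|lebesgue. a x (H x) \<bullet> gradient \<phi> x)"
    and sub: "ocube y s \<subseteq> ocube z (2 * r)" and meet: "ocube y s \<inter> \<Omega> \<noteq> {}" and fin: "N_h_bdr O0 \<Omega> a q < top"
  shows "average (ocube y s) q (\<lambda>x. norm (G x - H x)) \<le> N_h_bdr O0 \<Omega> a q * average (ocube y (2 * s)) (1 / 2) (\<lambda>x. norm (G x - H x))"
proof -
  let ?U = "smoothened O0 (ocube z r) \<inter> \<Omega>" and ?w = "grad_diff (ext u) (ext v)"
  have U: "?U \<in> sets lebesgue" "?U \<subseteq> \<Omega>"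
    using smoothened_ocube(1)[OF O0 r, of z] open_\<Omega> by auto
  have pair: "(ext u, ext v) \<in> solution_pairs O0 \<Omega> a (ocube z r)"
    unfolding solution_pairs_def
  proof (intro CollectI case_prodI conjI ballI W0_ext(1)[OF W(1)] W0_ext(1)[OF W(2)])
    fix \<phi> assume \<phi>: "\<phi> \<in> test_functions ?U"
    have "(LINT x:?U|lebesgue. a x (weak_gradient UNIV (ext u) x) \<bullet> gradient \<phi> x) = (LINT x:?U|lebesgue. a x (G x) \<bullet> gradient \<phi> x)"
      by (rule a_integral_cong[OF U W0_ext(3)[OF W(1)] W0_square_integrable(5)[OF W(1)] _ \<phi>])
        (use W0_ext(2)[OF W(1)] in eventually_elim, simp)
    also note eq[OF \<phi>]
    also have "(LINT x:?U|lebesgue. a x (H x) \<bullet> gradient \<phi> x) = (LINT x:?U|lebesgue. a x (weak_gradient UNIV (ext v) x) \<bullet> gradient \<phi> x)"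
      by (rule a_integral_cong[OF U W0_square_integrable(5)[OF W(2)] W0_ext(3)[OF W(2)] _ \<phi>])
        (use W0_ext(2)[OF W(2)] in eventually_elim, simp)
    finally show "(LINT x:?U|lebesgue. a x (weak_gradient UNIV (ext u) x) \<bullet> gradient \<phi> x) =
        (LINT x:?U|lebesgue. a x (weak_gradient UNIV (ext v) x) \<bullet> gradient \<phi> x)" .
  qed
  have ae: "AE x in lebesgue. ?w x = norm (G x - H x)"
    using W0_ext(2)[OF W(1)] W0_ext(2)[OF W(2)] by eventually_elim (simp add: grad_diff_def)
  have avg: "average E t ?w = average E t (\<lambda>x. norm (G x - H x))" for E t
  proof -
    have "(\<integral>\<^sup>+x\<in>E. ennreal (\<bar>?w x\<bar> powr t) \<partial>lebesgue) = (\<integral>\<^sup>+x\<in>E. ennreal (\<bar>norm (G x - H x)\<bar> powr t) \<partial>lebesgue)"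
    proof (rule nn_integral_cong_AE)
      show "AE x in lebesgue. ennreal (\<bar>?w x\<bar> powr t) * indicator E x = ennreal (\<bar>norm (G x - H x)\<bar> powr t) * indicator E x"
        using ae by eventually_elim simp
    qed
    then show ?thesis by (simp add: average_def)
  qed
  have avg_fin: "average (ocube y (2 * s)) (1 / 2) (\<lambda>x. norm (G x - H x)) < top"
  proof -
    have "(\<integral>\<^sup>+x\<in>ocube y (2 * s). ennreal (norm (G x - H x) powr (1 / 2)) \<partial>lebesgue) < top"
      using square_integrable_diff[OF W0_square_integrable(2)[OF W(1)] W0_square_integrable(2)[OF W(2)]]
      by (rule square_integrable_local) auto
    then show ?thesis using s
      by (auto simp: average_def emeasure_ocube simp del: power_mult_distrib intro!: ennpowr_less_top ennreal_divide_less_top)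
  qed
  have "average (ocube y s) q ?w / average (dilate 2 (ocube y s)) (1 / 2) ?w \<le> N_h_bdr O0 \<Omega> a q"
    unfolding N_h_bdr_def
  proof (rule SUP_upper2[of "ocube z r"])
    show "ocube z r \<in> {Q. is_cube Q}" using r by (simp add: is_cube_ocube)
    show "average (ocube y s) q ?w / average (dilate 2 (ocube y s)) (1 / 2) ?w \<le>
        (SUP (u, v) \<in> solution_pairs O0 \<Omega> a (ocube z r).
         SUP P \<in> {P. is_cube P \<and> P \<subseteq> dilate 2 (ocube z r) \<and> P \<inter> \<Omega> \<noteq> {}}.
         average P q (grad_diff u v) / average (dilate 2 P) (1 / 2) (grad_diff u v))"
    proof (rule SUP_upper2[OF pair], simp only: case_prod_conv, rule SUP_upper)
      show "ocube y s \<in> {P. is_cube P \<and> P \<subseteq> dilate 2 (ocube z r) \<and> P \<inter> \<Omega> \<noteq> {}}"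
        using s r sub meet by (simp add: is_cube_ocube dilate_ocube)
    qed
  qed
  then have le: "average (ocube y s) q (\<lambda>x. norm (G x - H x)) / average (ocube y (2 * s)) (1 / 2) (\<lambda>x. norm (G x - H x))
      \<le> N_h_bdr O0 \<Omega> a q"
    using s by (simp add: avg dilate_ocube)
  let ?x = "average (ocube y s) q (\<lambda>x. norm (G x - H x))" and ?y = "average (ocube y (2 * s)) (1 / 2) (\<lambda>x. norm (G x - H x))"
  show ?thesis
  proof (cases "?y = 0")
    case True
    have "?x = 0"
    proof (rule ccontr)
      assume "?x \<noteq> 0"
      then have "?x / ?y = top" using True by (simp add: ennreal_divide_zero)
      then show False using le fin by (simp add: top_unique)
    qed
    then show ?thesis by simp
  next
    case False
    have "?x = ?x / ?y * ?y"
      using False avg_fin by (simp add: ennreal_divide_times ennreal_times_divide[symmetric] ennreal_mult_divide_eq less_top)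
    also have "\<dots> \<le> N_h_bdr O0 \<Omega> a q * ?y" using le by (intro mult_right_mono) auto
    finally show ?thesis .
  qed
qed

text \<open>
  A function with this decay vanishes. On a dyadic cube of generation \<open>m\<close>, doubling the radius \<open>m\<close> times stays within the
  large cube and gains the factor \<open>\<kappa>\<^sup>m\<close> with \<open>\<kappa> = sqrt \<epsilon>\<close> in the mean of \<open>sqrt w\<close>. The sum over all
  cubes of the generation bounds the integral of \<open>sqrt w\<close> by a constant times \<open>\<kappa>\<^sup>m\<close>.
\<close>

lemma decay_imp_zero:
  fixes w :: "real ^ 'n \<Rightarrow> real"
  assumes w: "square_integrable w" "\<And>x. 0 \<le> w x" and \<epsilon>: "0 \<le> \<epsilon>" "\<epsilon> < 1" and \<rho>: "0 < \<rho>"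
    and decay: "\<And>z r. 0 < r \<Longrightarrow> ocube z r \<subseteq> ocube y (2 * \<rho>) \<Longrightarrow>
      average (ocube z r) (1 / 2) w \<le> ennreal \<epsilon> * average (ocube z (2 * r)) (1 / 2) w"
  shows "AE x in lebesgue. x \<in> ocube y \<rho> \<longrightarrow> w x = 0"
proof -
  have wm[measurable]: "w \<in> borel_measurable lebesgue" using w(1) by (simp add: square_integrable_def)
  define h where "h x = ennreal (w x powr (1 / 2))" for x
  have hm[measurable]: "h \<in> borel_measurable lebesgue" unfolding h_def by measurable
  define I where "I z r = (\<integral>\<^sup>+x\<in>ocube z r. h x \<partial>lebesgue)" for z r
  define n where "n = CARD('n)"
  have avg: "average (ocube z r) (1 / 2) w = (I z r / ennreal ((2 * r) ^ n))\<^sup>2" if "0 < r" for z r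
  proof -
    have "(\<integral>\<^sup>+x\<in>ocube z r. ennreal (\<bar>w x\<bar> powr (1 / 2)) \<partial>lebesgue) = I z r"
      unfolding I_def h_def using w(2) by simp
    moreover have "ennpowr x 2 = x\<^sup>2" for x
      by (cases x) (simp_all add: ennpowr_ennreal powr_numeral ennreal_power)
    ultimately show ?thesis using that by (simp add: average_def emeasure_ocube n_def)
  qed
  define \<kappa> where "\<kappa> = sqrt \<epsilon>"
  have \<kappa>: "0 \<le> \<kappa>" "\<kappa> < 1" "\<kappa>\<^sup>2 = \<epsilon>" using \<epsilon> by (simp_all add: \<kappa>_def)
  have one: "I z r \<le> ennreal (\<kappa> / 2 ^ n) * I z (2 * r)" if r: "0 < r" and sub: "ocube z r \<subseteq> ocube y (2 * \<rho>)" for z r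
  proof -
    have "(I z r / ennreal ((2 * r) ^ n))\<^sup>2 \<le> (ennreal \<kappa> * (I z (2 * r) / ennreal ((2 * (2 * r)) ^ n)))\<^sup>2"
      using decay[OF r sub] r \<kappa> unfolding avg[OF r] by (subst (asm) avg) (auto simp: power_mult_distrib ennreal_power)
    then have le: "I z r / ennreal ((2 * r) ^ n) \<le> ennreal \<kappa> * (I z (2 * r) / ennreal ((2 * (2 * r)) ^ n))" by (rule ennreal_square_le)
    define v where "v = (2 * r) ^ n"
    have v: "0 < v" "(2 * (2 * r)) ^ n = 2 ^ n * v"
      using r power_mult_distrib[of 2 "2 * r" n] by (simp_all only: v_def) simp
    have "I z r = I z r / ennreal v * ennreal v"
      using v(1) by (simp add: ennreal_divide_times ennreal_times_divide[symmetric] ennreal_mult_divide_eq)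
    also have "\<dots> \<le> ennreal \<kappa> * (I z (2 * r) / ennreal (2 ^ n * v)) * ennreal v"
      using le unfolding v_def[symmetric] v(2) by (intro mult_right_mono) auto
    also have "\<dots> = ennreal (\<kappa> / 2 ^ n) * I z (2 * r)"
    proof -
      have "ennreal \<kappa> * (x / ennreal (2 ^ n * v)) * ennreal v = ennreal \<kappa> * ennreal (1 / (2 ^ n * v)) * ennreal v * x" for x
        using v(1) by (simp add: divide_ennreal_def inverse_ennreal inverse_eq_divide mult_ac)
      moreover have "ennreal \<kappa> * ennreal (1 / (2 ^ n * v)) * ennreal v = ennreal (\<kappa> / 2 ^ n)"
        using v(1) \<kappa> by (simp add: ennreal_mult[symmetric])
      ultimately show ?thesis by simp
    qed
    finally show ?thesis .
  qed
  have Hfin: "I y (2 * \<rho>) < top"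
    using square_integrable_local[OF w(1), of "1 / 2" y "2 * \<rho>"] w(2) by (simp add: I_def h_def)
  obtain H where H: "I y (2 * \<rho>) = ennreal H" "0 \<le> H" using Hfin by (cases "I y (2 * \<rho>)") auto
  have iter: "I (dcenter y \<rho> m j) (\<rho> / 2 ^ m) \<le> ennreal ((\<kappa> / 2 ^ n) ^ k) * I (dcenter y \<rho> m j) (\<rho> / 2 ^ m * 2 ^ k)"
    if j: "j \<in> dindex m" and k: "k \<le> m" for j m k
    using k
  proof (induction k)
    case 0
    then show ?case by simp
  next
    case (Suc k)
    let ?z = "dcenter y \<rho> m j"
    have sub: "ocube ?z (\<rho> / 2 ^ m * 2 ^ k) \<subseteq> ocube y (2 * \<rho>)"
    proof
      fix x assume x: "x \<in> ocube ?z (\<rho> / 2 ^ m * 2 ^ k)"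
      have "dcube y \<rho> m j \<in> dyadic y \<rho>" using j by (auto simp: dyadic_def)
      then have "ocube ?z (\<rho> / 2 ^ m) \<subseteq> ocube y \<rho>" using dyadic_subset_top[OF \<rho>] by (simp add: dcube_def)
      then have c: "\<bar>?z $ i - y $ i\<bar> \<le> \<rho> - \<rho> / 2 ^ m" for i by (rule ocube_subset_imp) (use \<rho> in simp)
      have "(2::real) ^ k \<le> 2 ^ m" using Suc by (intro power_increasing) auto
      then have "\<rho> / 2 ^ m * 2 ^ k \<le> \<rho>" using \<rho> by (simp add: divide_le_eq)
      moreover have "0 < \<rho> / 2 ^ m" using \<rho> by simp
      moreover have "\<bar>x $ i - ?z $ i\<bar> < \<rho> / 2 ^ m * 2 ^ k" for i using x by (simp add: ocube_def)
      ultimately have "\<bar>x $ i - y $ i\<bar> < 2 * \<rho>" for i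
        using c[of i] by (smt (verit))
      then show "x \<in> ocube y (2 * \<rho>)" by (simp add: ocube_def)
    qed
    have "I ?z (\<rho> / 2 ^ m) \<le> ennreal ((\<kappa> / 2 ^ n) ^ k) * I ?z (\<rho> / 2 ^ m * 2 ^ k)" using Suc by simp
    also have "\<dots> \<le> ennreal ((\<kappa> / 2 ^ n) ^ k) * (ennreal (\<kappa> / 2 ^ n) * I ?z (2 * (\<rho> / 2 ^ m * 2 ^ k)))"
      using \<rho> by (intro mult_left_mono one sub) auto
    also have "\<dots> = ennreal ((\<kappa> / 2 ^ n) ^ Suc k) * I ?z (\<rho> / 2 ^ m * 2 ^ Suc k)"
    proof -
      have "ennreal (q ^ Suc k) = ennreal (q ^ k) * ennreal q" if "0 \<le> q" for q
        using that by (simp add: ennreal_mult[symmetric] mult.commute)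
      moreover have "0 \<le> \<kappa> / 2 ^ n" using \<kappa> by simp
      moreover have "2 * (\<rho> / 2 ^ m * 2 ^ k) = \<rho> / 2 ^ m * 2 ^ Suc k" by simp
      ultimately show ?thesis by (simp only: mult.assoc)
    qed
    finally show ?case .
  qed
  define \<nu> where "\<nu> = density lebesgue h"
  have nu: "emeasure \<nu> (ocube z r) = I z r" for z r
    unfolding \<nu>_def I_def by (subst emeasure_density) (auto simp: mult.commute)
  define v where "v = (2 * \<rho>) ^ n"
  have v: "0 < v" using \<rho> by (simp add: v_def)
  have small: "I y \<rho> \<le> ennreal (\<kappa> ^ m * H)" for m
  proof -
    let ?D = "\<Union>(dcube y \<rho> m ` dindex m)"
    have Dm: "?D \<in> sets lebesgue" by (intro Union_dyadic_sets[of _ y \<rho>]) (auto simp: dyadic_def)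
    have disj: "disjoint_family_on (dcube y \<rho> m) (dindex m)"
      unfolding disjoint_family_on_def using dcube_eq_if_meet[OF \<rho>] by blast
    have each: "emeasure \<nu> (dcube y \<rho> m j) \<le> ennreal (\<kappa> ^ m * H / v) * emeasure lebesgue (dcube y \<rho> m j)"
      if j: "j \<in> dindex m" for j
    proof -
      have "emeasure \<nu> (dcube y \<rho> m j) \<le> ennreal ((\<kappa> / 2 ^ n) ^ m) * I (dcenter y \<rho> m j) (\<rho> / 2 ^ m * 2 ^ m)"
        using iter[OF j order_refl] by (simp add: dcube_def nu)
      also have "I (dcenter y \<rho> m j) (\<rho> / 2 ^ m * 2 ^ m) \<le> I y (2 * \<rho>)"
      proof -
        have "ocube (dcenter y \<rho> m j) \<rho> \<subseteq> ocube y (2 * \<rho>)"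
        proof
          fix x assume x: "x \<in> ocube (dcenter y \<rho> m j) \<rho>"
          have "dcube y \<rho> m j \<in> dyadic y \<rho>" using j by (auto simp: dyadic_def)
          then have "ocube (dcenter y \<rho> m j) (\<rho> / 2 ^ m) \<subseteq> ocube y \<rho>" using dyadic_subset_top[OF \<rho>] by (simp add: dcube_def)
          then have c: "\<bar>dcenter y \<rho> m j $ i - y $ i\<bar> \<le> \<rho> - \<rho> / 2 ^ m" for i by (rule ocube_subset_imp) (use \<rho> in simp)
          have p: "0 < \<rho> / 2 ^ m" using \<rho> by simp
          have "\<bar>x $ i - y $ i\<bar> < 2 * \<rho>" for i
          proof -
            have "\<bar>x $ i - dcenter y \<rho> m j $ i\<bar> < \<rho>" using x by (simp add: ocube_def)
            then show ?thesis using c[of i] p by linarith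
          qed
          then show "x \<in> ocube y (2 * \<rho>)" by (simp add: ocube_def)
        qed
        then show ?thesis unfolding I_def by (intro nn_integral_mono) (auto simp: indicator_def)
      qed
      also have "ennreal ((\<kappa> / 2 ^ n) ^ m) * I y (2 * \<rho>) = ennreal (\<kappa> ^ m * H / v) * emeasure lebesgue (dcube y \<rho> m j)"
      proof -
        have "(\<kappa> / 2 ^ n) ^ m * H = (\<kappa> ^ m * H / v) * (2 * (\<rho> / 2 ^ m)) ^ n"
        proof -
          have "(2 * (\<rho> / 2 ^ m)) ^ n = v / (2 ^ n) ^ m"
            by (simp add: v_def power_divide power_mult_distrib power_mult[symmetric] mult.commute)
          then show ?thesis using v by (simp add: power_divide)
        qed
        then show ?thesis using \<rho> \<kappa> H v
          by (simp add: dcube_def emeasure_ocube n_def[symmetric] ennreal_mult[symmetric])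
      qed
      finally show ?thesis by (simp add: mult_left_mono)
    qed
    have "I y \<rho> = (\<integral>\<^sup>+x\<in>?D. h x \<partial>lebesgue)"
      unfolding I_def
    proof (rule nn_integral_cong_AE)
      have sub: "dcube y \<rho> m j \<subseteq> ocube y \<rho>" if "j \<in> dindex m" for j
        using that by (intro dyadic_subset_top[OF \<rho>]) (auto simp: dyadic_def)
      show "AE x in lebesgue. h x * indicator (ocube y \<rho>) x = h x * indicator ?D x"
        using AE_in_dcubes[OF \<rho>, of y]
      proof eventually_elim
        case (elim x)
        then have "x \<in> ocube y \<rho> \<longleftrightarrow> x \<in> ?D" using sub by blast
        then show ?case by (simp add: indicator_def)
      qed
    qed
    also have "\<dots> = emeasure \<nu> ?D" unfolding \<nu>_def using Dm by (subst emeasure_density) (auto simp: mult.commute)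
    also have "\<dots> = (\<integral>\<^sup>+j. emeasure \<nu> (dcube y \<rho> m j) \<partial>count_space (dindex m))"
      by (rule emeasure_UN_countable[OF _ _ disj]) (auto simp: \<nu>_def dcube_def)
    also have "\<dots> \<le> (\<integral>\<^sup>+j. ennreal (\<kappa> ^ m * H / v) * emeasure lebesgue (dcube y \<rho> m j) \<partial>count_space (dindex m))"
      using each by (intro nn_integral_mono) simp
    also have "\<dots> = ennreal (\<kappa> ^ m * H / v) * (\<integral>\<^sup>+j. emeasure lebesgue (dcube y \<rho> m j) \<partial>count_space (dindex m))"
      by (rule nn_integral_cmult) simp
    also have "(\<integral>\<^sup>+j. emeasure lebesgue (dcube y \<rho> m j) \<partial>count_space (dindex m)) = emeasure lebesgue ?D"
      by (rule emeasure_UN_countable[OF _ _ disj, symmetric]) (auto simp: dcube_def)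
    also have "emeasure lebesgue ?D \<le> emeasure lebesgue (ocube y \<rho>)"
    proof (rule emeasure_mono)
      show "?D \<subseteq> ocube y \<rho>" by (intro UN_least dyadic_subset_top[OF \<rho>]) (auto simp: dyadic_def)
    qed simp
    also have "ennreal (\<kappa> ^ m * H / v) * emeasure lebesgue (ocube y \<rho>) = ennreal (\<kappa> ^ m * H)"
    proof -
      have "emeasure lebesgue (ocube y \<rho>) = ennreal v"
        using emeasure_ocube(1)[of \<rho> y] \<rho> by (simp only: v_def n_def less_imp_le)
      then show ?thesis using \<kappa> H v by (simp only: ennreal_mult[symmetric] mult_nonneg_nonneg zero_le_power divide_nonneg_pos less_imp_le) simp
    qed
    finally show ?thesis by (simp add: mult_left_mono)
  qed
  have "(\<lambda>m. ennreal (\<kappa> ^ m * H)) \<longlonglongrightarrow> ennreal (0 * H)"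
    using \<kappa> by (intro tendsto_ennrealI tendsto_mult LIMSEQ_power_zero tendsto_const) auto
  then have "I y \<rho> \<le> ennreal (0 * H)" by (rule LIMSEQ_le_const) (use small in blast)
  then have "I y \<rho> = 0" by simp
  then have "AE x in lebesgue. h x * indicator (ocube y \<rho>) x = 0"
    unfolding I_def by (subst (asm) nn_integral_0_iff_AE) auto
  then show ?thesis
    by eventually_elim (auto simp: h_def indicator_def ennreal_eq_0_iff powr_eq_0_iff split: if_splits)
qed

end

text \<open>
  In the half of the box near the face \<open>x\<^sub>i = a\<^sub>i\<close> the logarithmic derivative of the increasing factor dominates that of the decreasing one.
\<close>

lemma gradient_bump_pos:
  fixes a b :: "real ^ 'n"
  assumes x: "x \<in> box a b" and left: "x $ i - a $ i < b $ i - x $ i"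
  shows "0 < gradient (bump 1 a b) x $ i"
proof -
  let ?e = "axis i (1::real)" and ?\<phi> = "bump 1 a b"
  have test: "?\<phi> \<in> test_functions UNIV" by (rule bump_test_function) simp_all
  have pos: "0 < x $ k - a $ k" "0 < b $ k - x $ k" for k using x by (simp_all add: mem_box_cart)
  define C where "C = (\<Prod>k\<in>UNIV - {i}. flat 0 (x $ k - a $ k) * flat 0 (b $ k - x $ k))"
  have C: "0 < C" unfolding C_def using pos by (intro prod_pos mult_pos_pos) (simp_all add: flat_0_bounds)
  have phi: "?\<phi> (x + t *\<^sub>R ?e) = C * (flat 0 (x $ i + t - a $ i) * flat 0 (b $ i - (x $ i + t)))" for t
  proof -
    have "?\<phi> (x + t *\<^sub>R ?e) = (\<Prod>k\<in>UNIV. flat 0 ((x + t *\<^sub>R ?e) $ k - a $ k) * flat 0 (b $ k - (x + t *\<^sub>R ?e) $ k))"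
      by (simp add: bump_def algebra_simps)
    also have "\<dots> = flat 0 ((x + t *\<^sub>R ?e) $ i - a $ i) * flat 0 (b $ i - (x + t *\<^sub>R ?e) $ i) *
        (\<Prod>k\<in>UNIV - {i}. flat 0 ((x + t *\<^sub>R ?e) $ k - a $ k) * flat 0 (b $ k - (x + t *\<^sub>R ?e) $ k))"
      by (rule prod.remove) simp_all
    also have "(\<Prod>k\<in>UNIV - {i}. flat 0 ((x + t *\<^sub>R ?e) $ k - a $ k) * flat 0 (b $ k - (x + t *\<^sub>R ?e) $ k)) = C"
      unfolding C_def by (rule prod.cong) (simp_all add: axis_def)
    finally show ?thesis by (simp add: axis_def mult.commute)
  qed
  have d1: "((\<lambda>t. ?\<phi> (x + t *\<^sub>R ?e)) has_real_derivative gradient ?\<phi> x $ i) (at 0)"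
  proof -
    have "((\<lambda>t. x + t *\<^sub>R ?e) has_derivative (\<lambda>s. s *\<^sub>R ?e)) (at 0)"
      by (auto intro!: derivative_eq_intros)
    from has_derivative_compose[OF this, of ?\<phi> "\<lambda>h. gradient ?\<phi> x \<bullet> h"] frechet_derivative_gradient[OF test_function_C1(1)[OF test], of x]
    show ?thesis
      by (simp add: has_field_derivative_def cart_eq_inner_axis mult_commute_abs)
  qed
  define s r where "s = x $ i - a $ i" and "r = b $ i - x $ i"
  have sr: "0 < s" "s < r" using pos left by (simp_all add: s_def r_def)
  have f1: "((\<lambda>t. flat 0 (x $ i + t - a $ i)) has_real_derivative flat 2 s) (at 0)"
  proof -
    have "((\<lambda>t. x $ i + t - a $ i) has_real_derivative 1) (at 0)" by (auto intro!: derivative_eq_intros)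
    from DERIV_chain2[OF has_derivative_flat[of 0 "x $ i + 0 - a $ i"] this]
    show ?thesis by (simp add: s_def numeral_2_eq_2)
  qed
  have f2: "((\<lambda>t. flat 0 (b $ i - (x $ i + t))) has_real_derivative - flat 2 r) (at 0)"
  proof -
    have "((\<lambda>t. b $ i - (x $ i + t)) has_real_derivative - 1) (at 0)" by (auto intro!: derivative_eq_intros)
    from DERIV_chain2[OF has_derivative_flat[of 0 "b $ i - (x $ i + 0)"] this]
    show ?thesis by (simp add: r_def numeral_2_eq_2)
  qed
  have d2: "((\<lambda>t. ?\<phi> (x + t *\<^sub>R ?e)) has_real_derivative C * (flat 2 s * flat 0 r + (- flat 2 r) * flat 0 s)) (at 0)"
    unfolding phi using DERIV_cmult[OF DERIV_mult[OF f1 f2], of C] by (simp add: s_def r_def)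
  have "gradient ?\<phi> x $ i = C * (flat 2 s * flat 0 r + (- flat 2 r) * flat 0 s)"
    by (rule DERIV_unique[OF d1 d2])
  also have "\<dots> = C * (exp (- (1 / s)) * exp (- (1 / r)) * ((1 / s)\<^sup>2 - (1 / r)\<^sup>2))"
    using sr by (simp add: flat_def algebra_simps)
  also have "\<dots> > 0"
  proof -
    have "1 / r < 1 / s" using sr by (intro divide_strict_left_mono) auto
    then have "(1 / r)\<^sup>2 < (1 / s)\<^sup>2" using sr by (intro power_strict_mono) auto
    then show ?thesis using C by simp
  qed
  finally show ?thesis .
qed

context elliptic_setting
begin

text \<open>
  Consider the solution for the divergence of the vector field that is a coordinate vector on a
  box \<open>K\<close> and zero elsewhere. Near a point off the boundary of \<open>K\<close> this right-hand side is not seen, so the solution can be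
  compared with zero there. A constant below one makes the averages of the gradient decay under
  every halving of the cube, hence the gradient vanishes off the boundary of \<open>K\<close> and thus almost everywhere.
  That contradicts the equation tested with a bump function whose \<open>i\<close>-th derivative is positive on \<open>K\<close>.
\<close>

lemma N_h_bdr_ge_1:
  assumes q: "1 / 2 < q"
  shows "1 \<le> N_h_bdr O0 \<Omega> a q"
proof (rule ccontr)
  assume "\<not> 1 \<le> N_h_bdr O0 \<Omega> a q"
  then have N1: "N_h_bdr O0 \<Omega> a q < 1" by simp
  then have fin: "N_h_bdr O0 \<Omega> a q < top" by (meson ennreal_one_less_top less_trans)
  then obtain \<epsilon> where \<epsilon>: "N_h_bdr O0 \<Omega> a q = ennreal \<epsilon>" "0 \<le> \<epsilon>" by (cases "N_h_bdr O0 \<Omega> a q") auto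
  have \<epsilon>1: "\<epsilon> < 1" using N1 \<epsilon> by simp
  obtain x0 where x0: "x0 \<in> \<Omega>" using dom by (auto simp: is_domain_def)
  obtain e where e: "0 < e" "ocube x0 e \<subseteq> \<Omega>" using ocube_in_open[OF open_\<Omega> x0] by blast
  obtain i :: 'n where True by blast
  define a0 b0 b1 where "a0 = x0 - (\<chi> i. e / 2)" and "b0 = x0 + (\<chi> i. e / 2)"
    and "b1 = (\<chi> k. if k = i then x0 $ k else b0 $ k)"
  define K where "K = box a0 b1"
  define \<phi> where "\<phi> = bump 1 a0 b0"
  have cb: "cbox a0 b0 \<subseteq> \<Omega>"
  proof -
    have "cbox a0 b0 = ccube x0 (e / 2)" by (simp add: ccube_cbox a0_def b0_def)
    then show ?thesis using ccube_subset_ocube[of "e / 2" e x0] e by auto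
  qed
  have \<phi>: "\<phi> \<in> test_functions \<Omega>" unfolding \<phi>_def by (rule bump_test_function[OF _ cb]) simp
  have K0: "K \<subseteq> box a0 b0"
  proof
    fix x assume "x \<in> K"
    moreover have "b1 $ k \<le> b0 $ k" for k using e by (simp add: b1_def b0_def)
    ultimately show "x \<in> box a0 b0" unfolding K_def mem_box_cart by (meson less_le_trans)
  qed
  have KO: "K \<subseteq> \<Omega>" using K0 cb box_subset_cbox by blast
  have gpos: "0 < gradient \<phi> x $ i" if "x \<in> K" for x
    unfolding \<phi>_def
  proof (rule gradient_bump_pos)
    show "x \<in> box a0 b0" using that K0 by blast
    have "x $ i < b1 $ i" using that by (auto simp: K_def mem_box_cart)
    then show "x $ i - a0 $ i < b0 $ i - x $ i" by (simp add: b1_def a0_def b0_def)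
  qed
  have Km[measurable]: "K \<in> sets lebesgue" by (simp add: K_def)
  have Kpos: "emeasure lebesgue K \<noteq> 0"
  proof -
    have "(\<chi> k. x0 $ k - e / 4) \<in> K" using e by (auto simp: K_def mem_box_cart a0_def b1_def b0_def)
    then have "\<not> negligible K" using open_not_negligible[of K] by (auto simp: K_def open_box)
    then show ?thesis by (auto simp: negligible_iff_null_sets null_sets_def)
  qed
  define T where "T x = indicator K x *\<^sub>R axis i (1::real)" for x :: "real ^ 'n"
  have T: "square_integrable T"
  proof -
    have "emeasure lebesgue K \<le> emeasure lebesgue (cbox a0 b0)"
      using K0 box_subset_cbox by (intro emeasure_mono) auto
    then have "emeasure lebesgue K < top" using emeasure_lborel_cbox_finite[of a0 b0] by (simp add: le_less_trans)
    moreover have "(norm (T x))\<^sup>2 = indicator K x" for x by (simp add: T_def indicator_def)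
    ultimately show ?thesis unfolding square_integrable_def T_def
      by (auto intro!: borel_measurable_scaleR)
  qed
  obtain B where B: "0 \<le> B" "\<And>x. x \<in> \<Omega> \<Longrightarrow> norm x \<le> B" using \<Omega>_bounded by blast
  obtain u G where W: "W0 \<Omega> u G" and sol: "\<And>\<psi>. \<psi> \<in> test_functions \<Omega> \<Longrightarrow>
      (LINT x:\<Omega>|lebesgue. a x (G x) \<bullet> gradient \<psi> x) = (LINT x:\<Omega>|lebesgue. T x \<bullet> gradient \<psi> x)"
  proof (rule weak_solution_exists[OF open_\<Omega> _ B(1) lam ell \<Omega>_dilate T])
    show "norm x \<le> B" if "x \<in> \<Omega>" for x using that by (rule B(2))
  qed blast
  (* The smoothened cube of radius d / 3 lies in the cube of radius d, on which T is constant. *)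
  have local: "AE x in lebesgue. x \<in> ocube y (d / 3) \<longrightarrow> G x = 0"
    if d: "0 < d" and sub: "ocube y d \<subseteq> \<Omega>" and side: "ocube y d \<subseteq> K \<or> ocube y d \<inter> K = {}" for y d
  proof -
    let ?\<rho> = "d / 3" and ?U = "smoothened O0 (ocube y (d / 3)) \<inter> \<Omega>"
    have \<rho>: "0 < ?\<rho>" using d by simp
    have Ud: "?U \<subseteq> ocube y d" using smoothened_ocube(3)[OF O0 \<rho>, of y] by auto
    have sq: "square_integrable (\<lambda>x. norm (G x - 0))"
      using W0_square_integrable(2)[OF W] by (auto simp: square_integrable_def intro: borel_measurable_norm)
    have eq: "(LINT x:?U|lebesgue. a x (G x) \<bullet> gradient \<psi> x) = (LINT x:?U|lebesgue. a x 0 \<bullet> gradient \<psi> x)"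
      if \<psi>: "\<psi> \<in> test_functions ?U" for \<psi>
    proof -
      have out: "gradient \<psi> x = 0" if "x \<notin> ?U" for x using test_function_outside(2)[OF \<psi> that] .
      have \<psi>': "\<psi> \<in> test_functions \<Omega>" using \<psi> test_functions_mono[of ?U \<Omega>] by blast
      have "(LINT x:?U|lebesgue. a x (G x) \<bullet> gradient \<psi> x) = (LINT x:\<Omega>|lebesgue. a x (G x) \<bullet> gradient \<psi> x)"
        unfolding set_lebesgue_integral_def
        by (intro Bochner_Integration.integral_cong refl) (use out in \<open>auto simp: indicator_def\<close>)
      also have "\<dots> = (LINT x:\<Omega>|lebesgue. T x \<bullet> gradient \<psi> x)" by (rule sol[OF \<psi>'])
      also have "\<dots> = 0"
        using side
      proof
        assume "ocube y d \<subseteq> K"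
        then have "(LINT x:\<Omega>|lebesgue. T x \<bullet> gradient \<psi> x) = (LINT x|lebesgue. gradient \<psi> x $ i)"
          unfolding set_lebesgue_integral_def
        proof (intro Bochner_Integration.integral_cong refl)
          fix x assume K: "ocube y d \<subseteq> K"
          show "indicator \<Omega> x *\<^sub>R (T x \<bullet> gradient \<psi> x) = gradient \<psi> x $ i"
          proof (cases "x \<in> ?U")
            case True
            then have "x \<in> K" using K Ud by blast
            then show ?thesis using True by (simp add: T_def inner_axis' )
          next
            case False
            then show ?thesis using out[OF False] by simp
          qed
        qed
        also have "\<dots> = 0" using test_function_C1[OF \<psi>] by (intro integral_gradient_eq_0)
        finally show ?thesis .
      next
        assume K: "ocube y d \<inter> K = {}"
        have "indicator \<Omega> x *\<^sub>R (T x \<bullet> gradient \<psi> x) = 0" for x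
        proof (cases "x \<in> ?U")
          case True
          then have "x \<notin> K" using K Ud by blast
          then show ?thesis by (simp add: T_def)
        next
          case False
          then show ?thesis using out[OF False] by simp
        qed
        then show ?thesis unfolding set_lebesgue_integral_def by (simp only: integral_zero)
      qed
      also have "0 = (LINT x:?U|lebesgue. a x 0 \<bullet> gradient \<psi> x)"
      proof -
        have "indicator ?U x *\<^sub>R (a x 0 \<bullet> gradient \<psi> x) = 0" for x using a_props(1)[of x] by (auto simp: indicator_def)
        then show ?thesis unfolding set_lebesgue_integral_def by (simp only: integral_zero)
      qed
      finally show ?thesis .
    qed
    have "AE x in lebesgue. x \<in> ocube y ?\<rho> \<longrightarrow> norm (G x - 0) = 0"
    proof (rule decay_imp_zero[OF sq norm_ge_zero \<epsilon>(2) \<epsilon>1 \<rho>])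
      fix z r assume r: "0 < r" and zr: "ocube z r \<subseteq> ocube y (2 * ?\<rho>)"
      have "ocube y (2 * ?\<rho>) \<subseteq> \<Omega>" using ocube_mono[of "2 * ?\<rho>" d y] d sub by auto
      then have meet: "ocube z r \<inter> \<Omega> \<noteq> {}" using zr center_in_ocube[OF r, of z] by blast
      have wm: "(\<lambda>x. norm (G x - 0)) \<in> borel_measurable lebesgue" using sq by (simp add: square_integrable_def)
      have "average (ocube z r) (1 / 2) (\<lambda>x. norm (G x - 0)) \<le> average (ocube z r) q (\<lambda>x. norm (G x - 0))"
        using q r by (intro average_mono_exponent[OF _ _ sets_ocube(1) emeasure_ocube(1) _ wm]) auto
      also have "\<dots> \<le> N_h_bdr O0 \<Omega> a q * average (ocube z (2 * r)) (1 / 2) (\<lambda>x. norm (G x - 0))"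
        by (rule comparison[OF W W0_zero \<rho> r _ zr meet fin]) (rule eq)
      finally show "average (ocube z r) (1 / 2) (\<lambda>x. norm (G x - 0)) \<le> ennreal \<epsilon> * average (ocube z (2 * r)) (1 / 2) (\<lambda>x. norm (G x - 0))"
        unfolding \<epsilon>(1) .
    qed
    then show ?thesis by simp
  qed
  define V where "V = \<Omega> \<inter> (K \<union> - cbox a0 b1)"
  have V: "open V" unfolding V_def K_def by (intro open_Int open_Un open_\<Omega> open_box) auto
  have "AE x in lebesgue. x \<in> V \<longrightarrow> G x = 0"
  proof -
    let ?F = "{ocube y (d / 3) | y d. 0 < d \<and> ocube y d \<subseteq> \<Omega> \<and> (ocube y d \<subseteq> K \<or> ocube y d \<inter> K = {})}"
    have op: "open S" if "S \<in> ?F" for S using that open_ocube by auto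
    obtain F where F: "F \<subseteq> ?F" "countable F" "\<Union>F = \<Union>?F" by (rule Lindelof[of ?F, OF op])
    have "V \<subseteq> \<Union>?F"
    proof
      fix y assume y: "y \<in> V"
      obtain V' where V': "open V'" "y \<in> V'" "V' \<subseteq> \<Omega>" "V' \<subseteq> K \<or> V' \<inter> K = {}"
      proof (cases "y \<in> K")
        case True
        then show thesis using that[of K] KO by (simp add: K_def open_box)
      next
        case False
        then have "y \<in> \<Omega> \<inter> - cbox a0 b1" using y by (auto simp: V_def)
        moreover have "open (\<Omega> \<inter> - cbox a0 b1)" by (intro open_Int open_\<Omega>) auto
        moreover have "\<Omega> \<inter> - cbox a0 b1 \<inter> K = {}" using box_subset_cbox[of a0 b1] by (auto simp: K_def)
        ultimately show thesis using that[of "\<Omega> \<inter> - cbox a0 b1"] by blast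
      qed
      obtain d where d: "0 < d" "ocube y d \<subseteq> V'" using ocube_in_open[OF V'(1,2)] by blast
      then have "ocube y (d / 3) \<in> ?F" using V'(3,4) by blast
      then show "y \<in> \<Union>?F" using center_in_ocube[of "d / 3" y] d(1) by (intro UnionI) auto
    qed
    then have VF: "V \<subseteq> \<Union>F" unfolding F(3) .
    have "AE x in lebesgue. \<forall>S\<in>F. x \<in> S \<longrightarrow> G x = 0"
      unfolding AE_ball_countable[OF F(2)]
    proof
      fix S assume "S \<in> F"
      with F(1) obtain y d where "S = ocube y (d / 3)" "0 < d" "ocube y d \<subseteq> \<Omega>" "ocube y d \<subseteq> K \<or> ocube y d \<inter> K = {}" by blast
      then show "AE x in lebesgue. x \<in> S \<longrightarrow> G x = 0" using local by blast
    qed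
    then show ?thesis by eventually_elim (use VF in blast)
  qed
  moreover have "AE x in lebesgue. x \<notin> cbox a0 b1 - box a0 b1"
  proof (rule AE_not_in)
    have "cbox a0 b1 - box a0 b1 = frontier (cbox a0 b1)" by (simp add: frontier_cbox)
    then show "cbox a0 b1 - box a0 b1 \<in> null_sets lebesgue"
      using negligible_frontier_interval[of a0 b1] by (simp add: negligible_iff_null_sets)
  qed
  ultimately have G0: "AE x in lebesgue. x \<in> \<Omega> \<longrightarrow> G x = 0"
    by eventually_elim (auto simp: V_def K_def)
  have "(LINT x:\<Omega>|lebesgue. a x (G x) \<bullet> gradient \<phi> x) = (LINT x:\<Omega>|lebesgue. a x 0 \<bullet> gradient \<phi> x)"
    by (rule a_integral_cong[OF \<Omega>_sets order_refl W0_square_integrable(5)[OF W] _ G0 \<phi>]) simp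
  also have "\<dots> = 0"
  proof -
    have "indicator \<Omega> x *\<^sub>R (a x 0 \<bullet> gradient \<phi> x) = 0" for x using a_props(1)[of x] by (auto simp: indicator_def)
    then show ?thesis unfolding set_lebesgue_integral_def by (simp only: integral_zero)
  qed
  finally have "(LINT x:\<Omega>|lebesgue. T x \<bullet> gradient \<phi> x) = 0" using sol[OF \<phi>] by simp
  moreover have eqT: "indicator \<Omega> x *\<^sub>R (T x \<bullet> gradient \<phi> x) = indicator K x * gradient \<phi> x $ i" for x
    using KO by (auto simp: T_def indicator_def inner_axis')
  ultimately have "(LINT x|lebesgue. indicator K x * gradient \<phi> x $ i) = 0"
    by (simp only: set_lebesgue_integral_def)
  moreover have "integrable lebesgue (\<lambda>x. indicator K x * gradient \<phi> x $ i)"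
  proof -
    have "integrable lebesgue (\<lambda>x. T x \<bullet> gradient \<phi> x)"
      using square_integrable_jet[OF \<phi>] unfolding jet_def square_integrable_Pair_iff
      by (intro square_integrable_inner T) blast
    moreover have "T x \<bullet> gradient \<phi> x = indicator K x * gradient \<phi> x $ i" for x by (simp add: T_def inner_axis')
    ultimately show ?thesis by simp
  qed
  ultimately have "AE x in lebesgue. indicator K x * gradient \<phi> x $ i = 0"
    using gpos by (subst integral_nonneg_eq_0_iff_AE[symmetric]) (auto intro!: AE_I2 simp: indicator_def less_imp_le)
  then have "AE x in lebesgue. x \<notin> K"
    by eventually_elim (use gpos in \<open>force simp: indicator_def split: if_splits\<close>)
  then have "K \<in> null_sets lebesgue" using AE_iff_null_sets[OF Km] by simp
  then show False using Kpos by (simp add: null_sets_def)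
qed

end

section \<open>Local solutions on the dyadic cubes\<close>

context elliptic_setting
begin

text \<open>
  The domain of the local solution on \<open>P\<close>. It lies between \<open>2P \<inter> \<Omega>\<close> and \<open>3P \<inter> \<Omega>\<close>.
\<close>

definition piece :: "(real ^ 'n) set \<Rightarrow> (real ^ 'n) set"
  where "piece P = smoothened O0 P \<inter> \<Omega>"

lemma piece_props:
  assumes "0 < r"
  shows "open (piece (ocube z r))" "piece (ocube z r) \<subseteq> \<Omega>" "piece (ocube z r) \<subseteq> ocube z (3 * r)"
    "ocube z (2 * r) \<inter> \<Omega> \<subseteq> piece (ocube z r)" "piece (ocube z r) \<in> sets lebesgue"
  using smoothened_ocube[OF O0 assms, of z] open_\<Omega> ocube_subset_ccube[of z "2 * r"] by (auto simp: piece_def)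

lemma test_integral_restrict:
  assumes "V \<subseteq> U" "\<phi> \<in> test_functions V"
  shows "(LINT x:U|lebesgue. k x \<bullet> gradient \<phi> x) = (LINT x:V|lebesgue. k x \<bullet> gradient \<phi> x)"
    "(LINT x:U|lebesgue. f x * \<phi> x) = (LINT x:V|lebesgue. f x * \<phi> x)"
proof -
  note out = test_function_outside[OF assms(2)]
  show "(LINT x:U|lebesgue. k x \<bullet> gradient \<phi> x) = (LINT x:V|lebesgue. k x \<bullet> gradient \<phi> x)"
    unfolding set_lebesgue_integral_def
    by (intro Bochner_Integration.integral_cong refl) (use assms(1) out in \<open>auto simp: indicator_def\<close>)
  show "(LINT x:U|lebesgue. f x * \<phi> x) = (LINT x:V|lebesgue. f x * \<phi> x)"
    unfolding set_lebesgue_integral_def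
    by (intro Bochner_Integration.integral_cong refl) (use assms(1) out in \<open>auto simp: indicator_def\<close>)
qed

lemma square_integrable_flux:
  assumes "square_integrable G"
  shows "square_integrable (\<lambda>x. if x \<in> \<Omega> then a x (G x) else 0)"
proof (rule square_integrable_dominated[OF _ assms, of _ "\<Lambda>\<^sup>2"])
  show "(\<lambda>x. if x \<in> \<Omega> then a x (G x) else 0) \<in> borel_measurable lebesgue"
    using assms by (intro a_measurable) (auto simp: square_integrable_def)
  have "norm (if x \<in> \<Omega> then a x (G x) else 0) \<le> \<Lambda> * norm (G x)" for x
    using a_props(2)[of x "G x"] lam by auto
  then show "(norm (if x \<in> \<Omega> then a x (G x) else 0))\<^sup>2 \<le> \<Lambda>\<^sup>2 * (norm (G x))\<^sup>2" for x
    unfolding power_mult_distrib[symmetric] by (intro power_mono) auto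
qed

lemma lower_estimate:
  assumes low: "lower_constant O0 \<Omega> a q N" and r: "0 < r"
    and W: "W0 (piece (ocube z r)) v G"
    and eq: "\<And>\<phi>. \<phi> \<in> test_functions (piece (ocube z r)) \<Longrightarrow>
      (LINT x:piece (ocube z r)|lebesgue. a x (G x) \<bullet> gradient \<phi> x) =
      (LINT x:piece (ocube z r)|lebesgue. F x \<bullet> gradient \<phi> x) + (LINT x:piece (ocube z r)|lebesgue. f x * \<phi> x)"
    and F: "F \<in> Lp_loc_on q \<Omega>" "F \<in> Lp_loc_on 1 (piece (ocube z r))"
    and f: "f \<in> Lp_loc_on (star_exp CARD('n) q) \<Omega>" "f \<in> Lp_loc_on 1 (piece (ocube z r))"
      "star_exp CARD('n) q \<le> 1 \<longrightarrow> (AE x in lebesgue_on \<Omega>. f x = 0)"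
  shows "ennpowr (\<integral>\<^sup>+x. ennreal (norm (G x) powr q) \<partial>lebesgue) (1 / q) \<le> ennreal N * ennpowr
     ((\<integral>\<^sup>+x\<in>piece (ocube z r). ennreal (norm (F x) powr q) \<partial>lebesgue)
      + ennpowr (\<integral>\<^sup>+x\<in>piece (ocube z r). ennreal (\<bar>f x\<bar> powr star_exp CARD('n) q) \<partial>lebesgue) (q / star_exp CARD('n) q)) (1 / q)"
proof -
  let ?U = "piece (ocube z r)"
  note U = piece_props[OF r, of z]
  have v: "v \<in> W12_0 ?U" and ae: "AE x in lebesgue. x \<in> ?U \<longrightarrow> weak_gradient ?U v x = G x"
    using W0_imp_W12_0[OF W U(1)] by blast+
  have wm: "(\<lambda>x. if x \<in> ?U then weak_gradient ?U v x else 0) \<in> borel_measurable lebesgue"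
    using W0_square_integrable(5)[OF W12_0_imp_W0[OF v U(1)]] .
  have "solves ?U a F f v"
    unfolding solves_def
  proof (intro conjI ballI F f)
    show "v \<in> W12 ?U" using v by (simp add: W12_0_def)
    fix \<phi> assume \<phi>: "\<phi> \<in> test_functions ?U"
    have "(LINT x:?U|lebesgue. a x (weak_gradient ?U v x) \<bullet> gradient \<phi> x) =
        (LINT x:?U|lebesgue. a x (if x \<in> ?U then weak_gradient ?U v x else 0) \<bullet> gradient \<phi> x)"
      unfolding set_lebesgue_integral_def by (intro Bochner_Integration.integral_cong refl) (simp add: indicator_def)
    also have "\<dots> = (LINT x:?U|lebesgue. a x (G x) \<bullet> gradient \<phi> x)"
      by (rule a_integral_cong[OF U(5,2) wm W0_square_integrable(5)[OF W] _ \<phi>])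
        (use ae in eventually_elim, simp)
    finally show "(LINT x:?U|lebesgue. a x (weak_gradient ?U v x) \<bullet> gradient \<phi> x) =
        (LINT x:?U|lebesgue. F x \<bullet> gradient \<phi> x) + (LINT x:?U|lebesgue. f x * \<phi> x)"
      using eq[OF \<phi>] by simp
  qed
  then have "ennpowr (\<integral>\<^sup>+x\<in>?U. ennreal (norm (weak_gradient ?U v x) powr q) \<partial>lebesgue) (1 / q) \<le> ennreal N * ennpowr
     ((\<integral>\<^sup>+x\<in>?U. ennreal (norm (F x) powr q) \<partial>lebesgue)
      + ennpowr (\<integral>\<^sup>+x\<in>?U. ennreal (\<bar>f x\<bar> powr star_exp CARD('n) q) \<partial>lebesgue) (q / star_exp CARD('n) q)) (1 / q)"
    using low is_cube_ocube[OF r, of z] F f v unfolding lower_constant_def piece_def by blast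
  moreover have "(\<integral>\<^sup>+x\<in>?U. ennreal (norm (weak_gradient ?U v x) powr q) \<partial>lebesgue) = (\<integral>\<^sup>+x. ennreal (norm (G x) powr q) \<partial>lebesgue)"
  proof (rule nn_integral_cong_AE)
    show "AE x in lebesgue. ennreal (norm (weak_gradient ?U v x) powr q) * indicator ?U x = ennreal (norm (G x) powr q)"
      using ae W0_vanishes_outside[OF W U(5)] by eventually_elim (auto simp: indicator_def)
  qed
  ultimately show ?thesis by simp
qed

text \<open>
  The equation has the right-hand side \<open>div F\<close> with the flux \<open>F = a x (H x)\<close>, which is at most \<open>\<Lambda> |H|\<close>.
\<close>

lemma lower_estimate_homogeneous:
  assumes low: "lower_constant O0 \<Omega> a q N" and q: "1 < q" "q \<le> 2" and r: "0 < r"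
    and W: "W0 (piece (ocube z r)) v G" and H: "square_integrable H"
    and eq: "\<And>\<phi>. \<phi> \<in> test_functions (piece (ocube z r)) \<Longrightarrow>
      (LINT x:piece (ocube z r)|lebesgue. a x (G x) \<bullet> gradient \<phi> x) =
      (LINT x:piece (ocube z r)|lebesgue. a x (H x) \<bullet> gradient \<phi> x)"
  shows "(\<integral>\<^sup>+x. ennreal (norm (G x) powr q) \<partial>lebesgue) \<le>
    ennreal ((N * \<Lambda>) powr q) * (\<integral>\<^sup>+x\<in>ocube z (3 * r). ennreal (norm (H x) powr q) \<partial>lebesgue)"
proof -
  let ?U = "piece (ocube z r)" and ?F = "\<lambda>x. if x \<in> \<Omega> then a x (H x) else 0" and ?s = "star_exp CARD('n) q"
  note U = piece_props[OF r, of z]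
  have N: "0 \<le> N" using low by (simp add: lower_constant_def)
  have sF: "square_integrable ?F" by (rule square_integrable_flux[OF H])
  have z: "square_integrable (\<lambda>x::real ^ 'n. 0::real)" by (simp add: square_integrable_def)
  have zero: "(\<lambda>x::real ^ 'n. 0::real) \<in> Lp_loc_on s V" for s V
    by (simp add: Lp_loc_on_def)
  have "ennpowr (\<integral>\<^sup>+x. ennreal (norm (G x) powr q) \<partial>lebesgue) (1 / q) \<le> ennreal N * ennpowr
     ((\<integral>\<^sup>+x\<in>?U. ennreal (norm (?F x) powr q) \<partial>lebesgue)
      + ennpowr (\<integral>\<^sup>+x\<in>?U. ennreal (\<bar>0\<bar> powr ?s) \<partial>lebesgue) (q / ?s)) (1 / q)"
  proof (rule lower_estimate[OF low r W, where F = ?F and f = "\<lambda>x. 0"])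
    fix \<phi> assume \<phi>: "\<phi> \<in> test_functions ?U"
    have "(LINT x:?U|lebesgue. a x (H x) \<bullet> gradient \<phi> x) = (LINT x:?U|lebesgue. ?F x \<bullet> gradient \<phi> x)"
      unfolding set_lebesgue_integral_def
      by (intro Bochner_Integration.integral_cong refl) (use U(2) in \<open>auto simp: indicator_def\<close>)
    then show "(LINT x:?U|lebesgue. a x (G x) \<bullet> gradient \<phi> x) =
        (LINT x:?U|lebesgue. ?F x \<bullet> gradient \<phi> x) + (LINT x:?U|lebesgue. 0 * \<phi> x)"
      using eq[OF \<phi>] by (simp add: set_lebesgue_integral_def)
  next
    show "?F \<in> Lp_loc_on q \<Omega>" "?F \<in> Lp_loc_on 1 ?U"
      using sF U(5) q by (auto intro!: square_integrable_Lp_loc_on)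
  qed (use zero in auto)
  also have "\<dots> \<le> ennreal N * ennpowr (ennreal (\<Lambda> powr q) * (\<integral>\<^sup>+x\<in>ocube z (3 * r). ennreal (norm (H x) powr q) \<partial>lebesgue)) (1 / q)"
  proof (intro mult_left_mono ennpowr_mono)
    have "(\<integral>\<^sup>+x\<in>?U. ennreal (norm (?F x) powr q) \<partial>lebesgue) \<le> (\<integral>\<^sup>+x. ennreal (\<Lambda> powr q) * (ennreal (norm (H x) powr q) * indicator (ocube z (3 * r)) x) \<partial>lebesgue)"
    proof (rule nn_integral_mono)
      fix x
      show "ennreal (norm (?F x) powr q) * indicator ?U x \<le> ennreal (\<Lambda> powr q) * (ennreal (norm (H x) powr q) * indicator (ocube z (3 * r)) x)"
      proof (cases "x \<in> ?U")
        case True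
        then have "norm (?F x) powr q \<le> (\<Lambda> * norm (H x)) powr q"
          using a_props(2)[of x "H x"] U(2) q by (intro powr_mono2) auto
        also have "\<dots> = \<Lambda> powr q * norm (H x) powr q" using lam by (simp add: powr_mult)
        finally have "ennreal (norm (?F x) powr q) \<le> ennreal (\<Lambda> powr q) * ennreal (norm (H x) powr q)"
          by (simp add: ennreal_mult[symmetric] ennreal_leI)
        moreover have "x \<in> ocube z (3 * r)" using True U(3) by blast
        ultimately show ?thesis using True by simp
      qed simp
    qed
    also have "\<dots> = ennreal (\<Lambda> powr q) * (\<integral>\<^sup>+x\<in>ocube z (3 * r). ennreal (norm (H x) powr q) \<partial>lebesgue)"
      using H by (intro nn_integral_cmult) (auto simp: square_integrable_def intro!: borel_measurable_times_ennreal)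
    finally show "(\<integral>\<^sup>+x\<in>?U. ennreal (norm (?F x) powr q) \<partial>lebesgue)
        + ennpowr (\<integral>\<^sup>+x\<in>?U. ennreal (\<bar>0\<bar> powr ?s) \<partial>lebesgue) (q / ?s)
        \<le> ennreal (\<Lambda> powr q) * (\<integral>\<^sup>+x\<in>ocube z (3 * r). ennreal (norm (H x) powr q) \<partial>lebesgue)"
      by simp
  qed (use q in auto)
  finally have *: "ennpowr (\<integral>\<^sup>+x. ennreal (norm (G x) powr q) \<partial>lebesgue) (1 / q) \<le>
    ennreal N * ennpowr (ennreal (\<Lambda> powr q) * (\<integral>\<^sup>+x\<in>ocube z (3 * r). ennreal (norm (H x) powr q) \<partial>lebesgue)) (1 / q)" .
  have inv: "ennpowr (ennpowr x (1 / q)) q = x" for x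
    using q by (simp add: ennpowr_ennpowr)
  have "ennpowr (ennpowr (\<integral>\<^sup>+x. ennreal (norm (G x) powr q) \<partial>lebesgue) (1 / q)) q \<le>
    ennpowr (ennreal N * ennpowr (ennreal (\<Lambda> powr q) * (\<integral>\<^sup>+x\<in>ocube z (3 * r). ennreal (norm (H x) powr q) \<partial>lebesgue)) (1 / q)) q"
    using * q by (intro ennpowr_mono) auto
  also have "\<dots> = ennreal (N powr q) * (ennreal (\<Lambda> powr q) * (\<integral>\<^sup>+x\<in>ocube z (3 * r). ennreal (norm (H x) powr q) \<partial>lebesgue))"
    using q N by (subst ennpowr_mult) (simp_all add: inv ennpowr_ennreal)
  also have "\<dots> = ennreal ((N * \<Lambda>) powr q) * (\<integral>\<^sup>+x\<in>ocube z (3 * r). ennreal (norm (H x) powr q) \<partial>lebesgue)"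
    using N lam by (simp add: powr_mult ennreal_mult mult.assoc)
  finally show ?thesis unfolding inv .
qed

end

locale localized_equation = elliptic_setting lam \<Lambda> Q0 O0 \<Omega> c R a
  for lam \<Lambda> :: real and Q0 O0 \<Omega> :: "(real ^ 'n) set" and c :: "real ^ 'n" and R :: real
    and a :: "real ^ 'n \<Rightarrow> real ^ 'n \<Rightarrow> real ^ 'n" +
  fixes ql qh Nl :: real and F :: "real ^ 'n \<Rightarrow> real ^ 'n" and f g :: "real ^ 'n \<Rightarrow> real" and Bg :: real
    and u0 :: "real ^ 'n \<Rightarrow> real" and G0 :: "real ^ 'n \<Rightarrow> real ^ 'n"
  assumes ql: "1 < ql" "ql \<le> 2" and qh: "2 < qh"
    and low: "lower_constant O0 \<Omega> a ql Nl" and Nhfin: "N_h_bdr O0 \<Omega> a qh < top"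
    and F: "F \<in> Lp_loc_on ql \<Omega>" "F \<in> Lp_loc_on 1 \<Omega>"
    and f: "f \<in> Lp_loc_on (star_exp CARD('n) ql) \<Omega>" "f \<in> Lp_loc_on 1 \<Omega>"
      "star_exp CARD('n) ql \<le> 1 \<longrightarrow> (AE x in lebesgue_on \<Omega>. f x = 0)"
    and W00: "W0 \<Omega> u0 G0"
    and sol0: "\<And>\<phi>. \<phi> \<in> test_functions \<Omega> \<Longrightarrow>
      (LINT x:\<Omega>|lebesgue. a x (G0 x) \<bullet> gradient \<phi> x) =
      (LINT x:\<Omega>|lebesgue. F x \<bullet> gradient \<phi> x) + (LINT x:\<Omega>|lebesgue. f x * \<phi> x)"
    and g: "g \<in> borel_measurable lebesgue" "\<And>x. 0 \<le> g x" "\<And>x. g x \<le> Bg"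
begin

definition local_solution :: "(real ^ 'n) set \<Rightarrow> (real ^ 'n \<Rightarrow> real ^ 'n) \<Rightarrow> bool"
  where "local_solution P G \<longleftrightarrow> (\<exists>v. W0 (piece P) v G) \<and> (\<forall>\<phi>\<in>test_functions (piece P).
      (LINT x:piece P|lebesgue. a x (G x) \<bullet> gradient \<phi> x) =
      (LINT x:piece P|lebesgue. F x \<bullet> gradient \<phi> x) + (LINT x:piece P|lebesgue. f x * \<phi> x))"

lemma Nl: "0 \<le> Nl" using low by (simp add: lower_constant_def)

lemma Bg: "0 \<le> Bg" using g(2,3) by (meson order_trans)

lemma local_solution_exists:
  assumes r: "0 < r"
  shows "\<exists>G. local_solution (ocube z r) G"
proof -
  let ?U = "piece (ocube z r)" and ?T = "\<lambda>x. if x \<in> \<Omega> then a x (G0 x) else 0"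
  note U = piece_props[OF r, of z]
  obtain B where B: "0 \<le> B" "\<And>x. x \<in> \<Omega> \<Longrightarrow> norm x \<le> B" using \<Omega>_bounded by blast
  obtain v G where W: "W0 ?U v G" and sol: "\<And>\<psi>. \<psi> \<in> test_functions ?U \<Longrightarrow>
      (LINT x:?U|lebesgue. a x (G x) \<bullet> gradient \<psi> x) = (LINT x:?U|lebesgue. ?T x \<bullet> gradient \<psi> x)"
  proof (rule weak_solution_exists[OF U(1) _ B(1) lam ell order_trans[OF U(2) \<Omega>_dilate]
        square_integrable_flux[OF W0_square_integrable(2)[OF W00]]])
    show "norm x \<le> B" if "x \<in> ?U" for x using that U(2) by (intro B(2)) blast
  qed blast
  have "(LINT x:?U|lebesgue. a x (G x) \<bullet> gradient \<phi> x) =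
      (LINT x:?U|lebesgue. F x \<bullet> gradient \<phi> x) + (LINT x:?U|lebesgue. f x * \<phi> x)" if \<phi>: "\<phi> \<in> test_functions ?U" for \<phi>
  proof -
    have "(LINT x:?U|lebesgue. a x (G x) \<bullet> gradient \<phi> x) = (LINT x:\<Omega>|lebesgue. ?T x \<bullet> gradient \<phi> x)"
      unfolding sol[OF \<phi>] using test_integral_restrict(1)[OF U(2) \<phi>, of ?T] by simp
    also have "\<dots> = (LINT x:\<Omega>|lebesgue. a x (G0 x) \<bullet> gradient \<phi> x)"
      unfolding set_lebesgue_integral_def by (intro Bochner_Integration.integral_cong refl) (simp add: indicator_def)
    also have "\<dots> = (LINT x:\<Omega>|lebesgue. F x \<bullet> gradient \<phi> x) + (LINT x:\<Omega>|lebesgue. f x * \<phi> x)"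
      using \<phi> test_functions_mono[OF U(2)] by (intro sol0) blast
    finally show ?thesis by (simp only: test_integral_restrict[OF U(2) \<phi>])
  qed
  with W show ?thesis unfolding local_solution_def by blast
qed

lemma local_solution_top: "local_solution (ocube c R) G0"
proof -
  have "\<Omega> \<subseteq> ocube c (2 * R)" using \<Omega>_top ocube_mono[of R "2 * R" c] R by auto
  then have "piece (ocube c R) = \<Omega>" using piece_props(2,4)[OF R, of c] by blast
  then show ?thesis unfolding local_solution_def using W00 sol0 by auto
qed

text \<open>
  On the largest cube the given solution is taken rather than an arbitrary one, since it is the one to be
  estimated.
\<close>

definition local_gradient :: "(real ^ 'n) set \<Rightarrow> real ^ 'n \<Rightarrow> real ^ 'n"
  where "local_gradient P = (if P = ocube c R then G0 else (SOME G. local_solution P G))"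

lemma local_gradient: "0 < r \<Longrightarrow> local_solution (ocube z r) (local_gradient (ocube z r))"
  using local_solution_top someI_ex[OF local_solution_exists] by (auto simp: local_gradient_def)

lemma local_gradient_top: "local_gradient (ocube c R) = G0"
  by (simp add: local_gradient_def)

lemma local_gradient_W0:
  assumes "0 < r"
  obtains v where "W0 (piece (ocube z r)) v (local_gradient (ocube z r))" "W0 \<Omega> v (local_gradient (ocube z r))"
  using local_gradient[OF assms, of z] W0_mono[OF piece_props(2)[OF assms, of z]] unfolding local_solution_def by blast

lemma local_gradient_sq:
  assumes "0 < r"
  shows "square_integrable (local_gradient (ocube z r))"
proof -
  obtain v where "W0 \<Omega> v (local_gradient (ocube z r))" using local_gradient_W0[OF assms] by blast
  then show ?thesis by (rule W0_square_integrable)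
qed

text \<open>
  Both local solutions see the same right-hand side on the smaller piece, so their fluxes have the same divergence there.
\<close>

lemma local_gradient_eq:
  assumes r: "0 < r" and s: "0 < s" and sub: "piece (ocube z r) \<subseteq> piece (ocube y s)" and \<phi>: "\<phi> \<in> test_functions (piece (ocube z r))"
  shows "(LINT x:piece (ocube z r)|lebesgue. a x (local_gradient (ocube z r) x) \<bullet> gradient \<phi> x) =
    (LINT x:piece (ocube z r)|lebesgue. a x (local_gradient (ocube y s) x) \<bullet> gradient \<phi> x)"
proof -
  have "\<phi> \<in> test_functions (piece (ocube y s))" using \<phi> test_functions_mono[OF sub] by blast
  then have "(LINT x:piece (ocube y s)|lebesgue. a x (local_gradient (ocube y s) x) \<bullet> gradient \<phi> x) =
      (LINT x:piece (ocube y s)|lebesgue. F x \<bullet> gradient \<phi> x) + (LINT x:piece (ocube y s)|lebesgue. f x * \<phi> x)"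
    using local_gradient[OF s, of y] by (simp add: local_solution_def)
  then have "(LINT x:piece (ocube z r)|lebesgue. a x (local_gradient (ocube y s) x) \<bullet> gradient \<phi> x) =
      (LINT x:piece (ocube z r)|lebesgue. F x \<bullet> gradient \<phi> x) + (LINT x:piece (ocube z r)|lebesgue. f x * \<phi> x)"
    by (simp only: test_integral_restrict[OF sub \<phi>])
  then show ?thesis using local_gradient[OF r, of z] \<phi> by (simp add: local_solution_def)
qed

definition energy :: "(real ^ 'n) set \<Rightarrow> ennreal"
  where "energy P = (\<integral>\<^sup>+x. ennreal (norm (local_gradient P x) powr ql) \<partial>lebesgue)"

lemma Lp_loc_on_subset:
  assumes "h \<in> Lp_loc_on s U" "V \<subseteq> U"
  shows "h \<in> Lp_loc_on s V"
proof -
  have "h \<in> borel_measurable (lebesgue_on V)"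
    using assms(1) unfolding Lp_loc_on_def by (intro measurable_restrict_mono[OF _ assms(2)]) blast
  then show ?thesis using assms unfolding Lp_loc_on_def by blast
qed

text \<open>
  The lower exponent for the given data; the two terms separate because \<open>1 / q\<^sub>l \<le> 1\<close>.
\<close>

lemma energy_estimate:
  assumes r: "0 < r"
  shows "ennpowr (energy (ocube z r)) (1 / ql) \<le> ennreal Nl *
    (ennpowr (\<integral>\<^sup>+x\<in>ocube z (3 * r). ennreal (norm (F x) powr ql) \<partial>lebesgue) (1 / ql)
     + ennpowr (\<integral>\<^sup>+x\<in>ocube z (3 * r). ennreal (\<bar>f x\<bar> powr star_exp CARD('n) ql) \<partial>lebesgue) (1 / star_exp CARD('n) ql))"
proof -
  let ?U = "piece (ocube z r)" and ?s = "star_exp CARD('n) ql"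
  note U = piece_props[OF r, of z]
  have s: "0 < ?s" using ql by (simp add: star_exp_def)
  obtain v where W: "W0 ?U v (local_gradient (ocube z r))" using local_gradient_W0[OF r] by blast
  have "ennpowr (energy (ocube z r)) (1 / ql) \<le> ennreal Nl * ennpowr
     ((\<integral>\<^sup>+x\<in>?U. ennreal (norm (F x) powr ql) \<partial>lebesgue)
      + ennpowr (\<integral>\<^sup>+x\<in>?U. ennreal (\<bar>f x\<bar> powr ?s) \<partial>lebesgue) (ql / ?s)) (1 / ql)"
    unfolding energy_def
  proof (rule lower_estimate[OF low r W _ F(1) Lp_loc_on_subset[OF F(2) U(2)] f(1) Lp_loc_on_subset[OF f(2) U(2)] f(3)])
    show "(LINT x:?U|lebesgue. a x (local_gradient (ocube z r) x) \<bullet> gradient \<phi> x) =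
        (LINT x:?U|lebesgue. F x \<bullet> gradient \<phi> x) + (LINT x:?U|lebesgue. f x * \<phi> x)" if "\<phi> \<in> test_functions ?U" for \<phi>
      using local_gradient[OF r, of z] that by (simp add: local_solution_def)
  qed
  also have "\<dots> \<le> ennreal Nl * ennpowr
     ((\<integral>\<^sup>+x\<in>ocube z (3 * r). ennreal (norm (F x) powr ql) \<partial>lebesgue)
      + ennpowr (\<integral>\<^sup>+x\<in>ocube z (3 * r). ennreal (\<bar>f x\<bar> powr ?s) \<partial>lebesgue) (ql / ?s)) (1 / ql)"
  proof -
    have "(\<integral>\<^sup>+x\<in>?U. k x \<partial>lebesgue) \<le> (\<integral>\<^sup>+x\<in>ocube z (3 * r). k x \<partial>lebesgue)" for k
      using U(3) by (intro nn_integral_mono) (auto simp: indicator_def)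
    then show ?thesis using ql s by (intro mult_left_mono ennpowr_mono add_mono) auto
  qed
  also have "\<dots> \<le> ennreal Nl * (ennpowr (\<integral>\<^sup>+x\<in>ocube z (3 * r). ennreal (norm (F x) powr ql) \<partial>lebesgue) (1 / ql)
      + ennpowr (ennpowr (\<integral>\<^sup>+x\<in>ocube z (3 * r). ennreal (\<bar>f x\<bar> powr ?s) \<partial>lebesgue) (ql / ?s)) (1 / ql))"
    using ql by (intro mult_left_mono ennpowr_subadditive) auto
  finally show ?thesis using ql by (simp add: ennpowr_ennpowr)
qed

lemma energy_density:
  assumes "0 < r"
  shows "(\<lambda>x. norm (local_gradient (ocube z r) x) powr ql) \<in> Lp_on 1 UNIV" "energy (ocube z r) < top"
    "(\<integral>\<^sup>+x. ennreal \<bar>norm (local_gradient (ocube z r) x) powr ql\<bar> \<partial>lebesgue) = energy (ocube z r)"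
proof -
  let ?G = "local_gradient (ocube z r)"
  obtain v where W: "W0 (piece (ocube z r)) v ?G" using local_gradient_W0[OF assms] by blast
  note U = piece_props[OF assms, of z]
  have "energy (ocube z r) = (\<integral>\<^sup>+x\<in>ocube z (3 * r). ennreal (norm (?G x) powr ql) \<partial>lebesgue)"
    unfolding energy_def
  proof (rule nn_integral_cong_AE)
    show "AE x in lebesgue. ennreal (norm (?G x) powr ql) = ennreal (norm (?G x) powr ql) * indicator (ocube z (3 * r)) x"
      using W0_vanishes_outside[OF W U(5)] by eventually_elim (use U(3) in \<open>auto simp: indicator_def\<close>)
  qed
  also have "\<dots> < top" using local_gradient_sq[OF assms] ql by (intro square_integrable_local) auto
  finally show fin: "energy (ocube z r) < top" .
  show "(\<integral>\<^sup>+x. ennreal \<bar>norm (?G x) powr ql\<bar> \<partial>lebesgue) = energy (ocube z r)" by (simp add: energy_def)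
  have "?G \<in> borel_measurable lebesgue" using local_gradient_sq[OF assms] by (simp add: square_integrable_def)
  then show "(\<lambda>x. norm (?G x) powr ql) \<in> Lp_on 1 UNIV"
    using fin by (simp add: Lp_on_def energy_def lebesgue_on_UNIV_eq)
qed

definition mass :: "(real ^ 'n) set \<Rightarrow> ennreal"
  where "mass P = (\<integral>\<^sup>+x\<in>P. ennreal (norm (local_gradient P x) * g x) \<partial>lebesgue)"

text \<open>
  Bounds the local masses on all scales at once; it depends on the solution on the largest cube only.
\<close>

definition majorant :: "real ^ 'n \<Rightarrow> ennreal"
  where "majorant x = ennreal (Bg * (Nl * \<Lambda> * 3 powr (real CARD('n) / ql))) *
    ennpowr (dyadic_maximal c R (\<lambda>x. norm (G0 x) powr ql) x) (1 / ql)"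

text \<open>
  By \<open>lower_estimate_homogeneous\<close> with the solution on the largest cube as comparison, the average of \<open>|G\<^sub>P|\<close> to the power
  \<open>q\<^sub>l\<close> over \<open>P\<close> is at most a constant times that of \<open>|G0|\<close> over \<open>3P\<close>, and thus times the maximal function at
  every point of \<open>P\<close>.
\<close>

lemma mass_le_majorant:
  assumes P: "P \<in> dyadic c R"
  shows "mass P \<le> (\<integral>\<^sup>+x\<in>P. majorant x \<partial>lebesgue)"
proof -
  obtain z r where zr: "P = ocube z r" "0 < r" using dyadic_ocube[OF R P] by blast
  let ?G = "local_gradient P" and ?h = "\<lambda>x. norm (G0 x) powr ql" and ?n = "real CARD('n)"
  have sqG: "square_integrable ?G" using local_gradient_sq[OF zr(2)] zr(1) by simp
  have Gm: "(\<lambda>x. norm (?G x)) \<in> borel_measurable lebesgue" using sqG by (auto simp: square_integrable_def intro: borel_measurable_norm)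
  obtain v where W: "W0 (piece (ocube z r)) v ?G" using local_gradient_W0[OF zr(2)] zr(1) by blast
  have sub: "piece (ocube z r) \<subseteq> piece (ocube c R)"
  proof -
    have "\<Omega> \<subseteq> ocube c (2 * R)" using \<Omega>_top ocube_mono[of R "2 * R" c] R by auto
    then show ?thesis using piece_props(4)[OF R, of c] piece_props(2)[OF zr(2), of z] by blast
  qed
  define V where "V = (2 * r) ^ CARD('n)"
  have V: "0 < V" "emeasure lebesgue P = ennreal V" using zr by (auto simp: V_def emeasure_ocube)
  have V3: "(2 * (3 * r)) ^ CARD('n) = 3 ^ CARD('n) * V" unfolding V_def power_mult_distrib[symmetric] by simp
  have "energy P \<le> ennreal ((Nl * \<Lambda>) powr ql) * (\<integral>\<^sup>+x\<in>ocube z (3 * r). ennreal (norm (G0 x) powr ql) \<partial>lebesgue)"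
    unfolding energy_def
  proof (rule lower_estimate_homogeneous[OF low ql zr(2) W W0_square_integrable(2)[OF W00]])
    show "(LINT x:piece (ocube z r)|lebesgue. a x (?G x) \<bullet> gradient \<phi> x) = (LINT x:piece (ocube z r)|lebesgue. a x (G0 x) \<bullet> gradient \<phi> x)"
      if "\<phi> \<in> test_functions (piece (ocube z r))" for \<phi>
      using local_gradient_eq[OF zr(2) R sub that] by (simp add: zr(1) local_gradient_top)
  qed
  also have "(\<integral>\<^sup>+x\<in>ocube z (3 * r). ennreal (norm (G0 x) powr ql) \<partial>lebesgue) = ennreal (3 ^ CARD('n) * V) * tripled_average P ?h"
  proof -
    have "tripled_average P ?h = (\<integral>\<^sup>+x\<in>ocube z (3 * r). ennreal (norm (G0 x) powr ql) \<partial>lebesgue) / ennreal (3 ^ CARD('n) * V)"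
      unfolding tripled_average_def zr(1) dilate_ocube[OF zr(2) zero_less_numeral] V3[symmetric]
      using zr(2) by (subst nn_integral_average_1) auto
    moreover have "y = ennreal d * (y / ennreal d)" if "0 < d" for y d
      using that by (simp add: ennreal_times_divide ennreal_mult_divide_eq mult.commute[of "ennreal d"])
    ultimately show ?thesis using V(1) by simp
  qed
  finally have en: "energy P \<le> ennreal ((Nl * \<Lambda>) powr ql) * (ennreal (3 ^ CARD('n) * V) * tripled_average P ?h)" .
  have "average P ql (\<lambda>x. norm (?G x)) \<le> ennreal (Nl * \<Lambda> * 3 powr (?n / ql)) * ennpowr (tripled_average P ?h) (1 / ql)"
  proof -
    have "(\<integral>\<^sup>+x\<in>P. ennreal (\<bar>norm (?G x)\<bar> powr ql) \<partial>lebesgue) \<le> energy P"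
      unfolding energy_def by (intro nn_integral_mono) (simp add: indicator_def)
    then have "(\<integral>\<^sup>+x\<in>P. ennreal (\<bar>norm (?G x)\<bar> powr ql) \<partial>lebesgue) / ennreal V
        \<le> ennreal ((Nl * \<Lambda>) powr ql) * (ennreal (3 ^ CARD('n) * V) * tripled_average P ?h) / ennreal V"
      using en by (intro divide_right_mono_ennreal) (rule order_trans)
    also have "\<dots> = ennreal ((Nl * \<Lambda>) powr ql * 3 ^ CARD('n)) * tripled_average P ?h"
    proof -
      have "ennreal A * (ennreal (B * V) * y) / ennreal V = ennreal (A * B) * y" if "0 \<le> A" "0 \<le> B" for A B y
      proof -
        have "ennreal A * (ennreal (B * V) * y) / ennreal V = ennreal A * ennreal (B * V) * ennreal (1 / V) * y"
          using V(1) by (simp add: divide_ennreal_def inverse_ennreal inverse_eq_divide mult_ac)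
        also have "ennreal A * ennreal (B * V) * ennreal (1 / V) = ennreal (A * B)"
          using V(1) that by (simp add: ennreal_mult[symmetric])
        finally show ?thesis .
      qed
      then show ?thesis by simp
    qed
    finally have "average P ql (\<lambda>x. norm (?G x)) \<le> ennpowr (ennreal ((Nl * \<Lambda>) powr ql * 3 ^ CARD('n)) * tripled_average P ?h) (1 / ql)"
      unfolding average_def V(2) using ql by (intro ennpowr_mono) auto
    also have "\<dots> = ennreal (((Nl * \<Lambda>) powr ql * 3 ^ CARD('n)) powr (1 / ql)) * ennpowr (tripled_average P ?h) (1 / ql)"
      using ql by (simp add: ennpowr_mult ennpowr_ennreal)
    also have "((Nl * \<Lambda>) powr ql * 3 ^ CARD('n)) powr (1 / ql) = Nl * \<Lambda> * 3 powr (?n / ql)"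
      using ql Nl lam by (simp add: powr_mult powr_powr powr_realpow[symmetric])
    finally show ?thesis .
  qed
  then have avg: "average P 1 (\<lambda>x. norm (?G x)) \<le> ennreal (Nl * \<Lambda> * 3 powr (?n / ql)) * ennpowr (tripled_average P ?h) (1 / ql)"
    using average_mono_exponent[of 1 ql P V "\<lambda>x. norm (?G x)"] ql V Gm zr(1) by (auto intro: order_trans)
  have "mass P \<le> (\<integral>\<^sup>+x. ennreal Bg * (ennreal (\<bar>norm (?G x)\<bar>) * indicator P x) \<partial>lebesgue)"
    unfolding mass_def
  proof (rule nn_integral_mono)
    fix x
    have "norm (?G x) * g x \<le> Bg * norm (?G x)" using g(3)[of x] by (subst mult.commute) (intro mult_right_mono, auto)
    then show "ennreal (norm (?G x) * g x) * indicator P x \<le> ennreal Bg * (ennreal \<bar>norm (?G x)\<bar> * indicator P x)"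
      using Bg by (simp add: indicator_def ennreal_mult[symmetric] ennreal_leI)
  qed
  also have "\<dots> = ennreal Bg * (\<integral>\<^sup>+x\<in>P. ennreal \<bar>norm (?G x)\<bar> \<partial>lebesgue)"
    using Gm zr(1) by (intro nn_integral_cmult borel_measurable_times_ennreal) auto
  also have "(\<integral>\<^sup>+x\<in>P. ennreal \<bar>norm (?G x)\<bar> \<partial>lebesgue) = ennreal V * average P 1 (\<lambda>x. norm (?G x))"
  proof -
    have "average P 1 (\<lambda>x. norm (?G x)) = (\<integral>\<^sup>+x\<in>P. ennreal \<bar>norm (?G x)\<bar> \<partial>lebesgue) / ennreal V"
      unfolding zr(1) V_def using zr(2) by (rule nn_integral_average_1)
    moreover have "y = ennreal d * (y / ennreal d)" if "0 < d" for y d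
      using that by (simp add: ennreal_times_divide ennreal_mult_divide_eq mult.commute[of "ennreal d"])
    ultimately show ?thesis using V(1) by simp
  qed
  also have "ennreal Bg * (ennreal V * average P 1 (\<lambda>x. norm (?G x))) \<le>
      ennreal Bg * (ennreal V * (ennreal (Nl * \<Lambda> * 3 powr (?n / ql)) * ennpowr (tripled_average P ?h) (1 / ql)))"
    using avg by (intro mult_left_mono) auto
  also have "\<dots> = (\<integral>\<^sup>+x. (ennreal Bg * (ennreal (Nl * \<Lambda> * 3 powr (?n / ql)) * ennpowr (tripled_average P ?h) (1 / ql))) * indicator P x \<partial>lebesgue)"
    using V zr(1) by (subst nn_integral_cmult_indicator) (auto simp: mult_ac)
  also have "\<dots> \<le> (\<integral>\<^sup>+x\<in>P. majorant x \<partial>lebesgue)"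
  proof (rule nn_integral_mono)
    fix x
    show "ennreal Bg * (ennreal (Nl * \<Lambda> * 3 powr (?n / ql)) * ennpowr (tripled_average P ?h) (1 / ql)) * indicator P x \<le> majorant x * indicator P x"
    proof (cases "x \<in> P")
      case True
      have "indicator P x * tripled_average P ?h \<le> dyadic_maximal c R ?h x"
        unfolding dyadic_maximal_def using P by (rule SUP_upper)
      then have "ennpowr (tripled_average P ?h) (1 / ql) \<le> ennpowr (dyadic_maximal c R ?h x) (1 / ql)"
        using True ql by (intro ennpowr_mono) auto
      then show ?thesis
        using True Bg Nl lam by (simp add: majorant_def ennreal_mult mult.assoc mult_left_mono)
    qed simp
  qed
  finally show ?thesis .
qed

lemma dyadic_maximal_measurable: "dyadic_maximal c R h \<in> borel_measurable lebesgue"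
  unfolding dyadic_maximal_def
proof (intro borel_measurable_SUP countable_dyadic borel_measurable_times_ennreal borel_measurable_indicator borel_measurable_const)
  fix P assume "P \<in> dyadic c R"
  then show "P \<in> sets lebesgue" using dyadic_ocube[OF R] by (metis sets_ocube(1))
qed

lemma ennpowr_measurable: "(\<lambda>x. ennpowr x s) \<in> borel_measurable borel"
  unfolding ennpowr_def by measurable

lemma majorant_measurable: "majorant \<in> borel_measurable lebesgue"
  unfolding majorant_def
  by (intro borel_measurable_times_ennreal borel_measurable_const measurable_compose[OF dyadic_maximal_measurable ennpowr_measurable])

end

locale sparse_setting = localized_equation lam \<Lambda> Q0 O0 \<Omega> c R a ql qh Nl F f g Bg u0 G0
  for lam \<Lambda> :: real and Q0 O0 \<Omega> :: "(real ^ 'n) set" and c :: "real ^ 'n" and R :: real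
    and a :: "real ^ 'n \<Rightarrow> real ^ 'n \<Rightarrow> real ^ 'n" and ql qh Nl :: real
    and F :: "real ^ 'n \<Rightarrow> real ^ 'n" and f g :: "real ^ 'n \<Rightarrow> real" and Bg :: real
    and u0 :: "real ^ 'n \<Rightarrow> real" and G0 :: "real ^ 'n \<Rightarrow> real ^ 'n" +
  fixes \<theta> :: real
  assumes \<theta>: "0 < \<theta>" "\<theta> < 1" and Mfin: "maximal_norm Q0 < top"
begin

lemma majorant_finite: "(\<integral>\<^sup>+x\<in>ocube c R. majorant x \<partial>lebesgue) < top"
proof -
  let ?h = "\<lambda>x. norm (G0 x) powr ql"
  have h: "?h \<in> Lp_on 1 UNIV" using energy_density(1)[OF R, of c] by (simp add: local_gradient_top)
  have m: "(\<lambda>x. ennpowr (dyadic_maximal c R ?h x) (1 / ql) * indicator (ocube c R) x) \<in> borel_measurable lebesgue"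
    by (intro borel_measurable_times_ennreal borel_measurable_indicator sets_ocube measurable_compose[OF dyadic_maximal_measurable ennpowr_measurable])
  have "(\<integral>\<^sup>+x\<in>ocube c R. majorant x \<partial>lebesgue) = ennreal (Bg * (Nl * \<Lambda> * 3 powr (real CARD('n) / ql))) *
      (\<integral>\<^sup>+x\<in>ocube c R. ennpowr (dyadic_maximal c R ?h x) (1 / ql) \<partial>lebesgue)"
    unfolding majorant_def mult.assoc by (rule nn_integral_cmult[OF m])
  also have "\<dots> < top"
    using Kolmogorov[OF Q0 Mfin h, of "1 / ql"] ql by (simp add: ennreal_mult_less_top)
  finally show ?thesis .
qed

end

section \<open>Stopping cubes\<close>

text \<open>
  Normalised and unnormalised forms of the same bound, used to change between averages and integrals.
\<close>

lemma average_le_iff: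
  assumes q: "0 < q" and V: "emeasure lebesgue E = ennreal V" "0 < V" and M: "0 \<le> M"
  shows "average E q h \<le> ennreal M \<longleftrightarrow> (\<integral>\<^sup>+x\<in>E. ennreal (\<bar>h x\<bar> powr q) \<partial>lebesgue) \<le> ennreal (M powr q * V)"
proof (cases "\<integral>\<^sup>+x\<in>E. ennreal (\<bar>h x\<bar> powr q) \<partial>lebesgue")
  case (real I)
  have "average E q h = ennreal ((I / V) powr (1 / q))"
    unfolding average_def V real(2) using real(1) V(2) by (simp add: divide_ennreal ennpowr_ennreal)
  moreover have "(I / V) powr (1 / q) \<le> M \<longleftrightarrow> I / V \<le> M powr q"
  proof
    assume "(I / V) powr (1 / q) \<le> M"
    then have "((I / V) powr (1 / q)) powr q \<le> M powr q" using q by (intro powr_mono2) auto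
    then show "I / V \<le> M powr q" using q real(1) V(2) by (simp add: powr_powr)
  next
    assume "I / V \<le> M powr q"
    then have "(I / V) powr (1 / q) \<le> (M powr q) powr (1 / q)" using q real(1) V(2) by (intro powr_mono2) auto
    then show "(I / V) powr (1 / q) \<le> M" using q M by (simp add: powr_powr)
  qed
  moreover have "I / V \<le> M powr q \<longleftrightarrow> I \<le> M powr q * V" using V(2) by (simp add: pos_divide_le_eq)
  ultimately show ?thesis using M V(2) real(1) unfolding real(2) by (simp add: ennreal_le_iff)
next
  case top
  then show ?thesis unfolding average_def V by (simp add: ennreal_top_divide top_unique)
qed

text \<open>
  Vanishing bounds are reached as limits of positive ones.
\<close>

lemma Minkowski_inequality_nonneg:
  fixes f g :: "'a \<Rightarrow> real"
  assumes q: "1 \<le> q" and m: "f \<in> borel_measurable M" "g \<in> borel_measurable M"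
    and nn: "\<And>x. 0 \<le> f x" "\<And>x. 0 \<le> g x"
    and f: "(\<integral>\<^sup>+x. ennreal (f x powr q) \<partial>M) \<le> ennreal (\<alpha> powr q)" and g: "(\<integral>\<^sup>+x. ennreal (g x powr q) \<partial>M) \<le> ennreal (\<beta> powr q)"
    and pos: "0 \<le> \<alpha>" "0 \<le> \<beta>"
  shows "(\<integral>\<^sup>+x. ennreal ((f x + g x) powr q) \<partial>M) \<le> ennreal ((\<alpha> + \<beta>) powr q)"
proof -
  let ?d = "\<lambda>k. inverse (real (Suc k))"
  have "(\<integral>\<^sup>+x. ennreal ((f x + g x) powr q) \<partial>M) \<le> ennreal (((\<alpha> + ?d k) + (\<beta> + ?d k)) powr q)" for k
  proof (rule Minkowski_inequality[OF q m nn])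
    have d: "0 < ?d k" by simp
    have "\<alpha> powr q \<le> (\<alpha> + ?d k) powr q" "\<beta> powr q \<le> (\<beta> + ?d k) powr q"
      using q pos d by (auto intro!: powr_mono2)
    then show "(\<integral>\<^sup>+x. ennreal (f x powr q) \<partial>M) \<le> ennreal ((\<alpha> + ?d k) powr q)"
      "(\<integral>\<^sup>+x. ennreal (g x powr q) \<partial>M) \<le> ennreal ((\<beta> + ?d k) powr q)"
      using order_trans[OF f ennreal_leI] order_trans[OF g ennreal_leI] by blast+
    show "0 < \<alpha> + ?d k" "0 < \<beta> + ?d k" using pos d by linarith+
  qed
  moreover have "(\<lambda>k. ennreal (((\<alpha> + ?d k) + (\<beta> + ?d k)) powr q)) \<longlonglongrightarrow> ennreal (((\<alpha> + 0) + (\<beta> + 0)) powr q)"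
    by (intro tendsto_ennrealI tendsto_powr' tendsto_add tendsto_const LIMSEQ_inverse_real_of_nat) (use q pos in auto)
  ultimately show ?thesis using LIMSEQ_le_const[of _ _ "\<integral>\<^sup>+x. ennreal ((f x + g x) powr q) \<partial>M"] by fastforce
qed

context sparse_setting
begin

text \<open>
  The value for which the weak type inequality bounds the superlevel set by \<open>\<theta> |Q|\<close>.
\<close>

definition threshold :: "(real ^ 'n) set \<Rightarrow> real"
  where "threshold Q = enn2real (maximal_norm Q0 * energy Q / ennreal (\<theta> * measure lebesgue Q))"

definition bad_cubes :: "(real ^ 'n) set \<Rightarrow> (real ^ 'n) set set"
  where "bad_cubes Q = {P \<in> dyadic c R. P \<subseteq> Q \<and>
    ennreal (threshold Q) < tripled_average P (\<lambda>x. norm (local_gradient Q x) powr ql)}"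

definition stopping_cubes :: "(real ^ 'n) set \<Rightarrow> (real ^ 'n) set set"
  where "stopping_cubes Q = {P \<in> bad_cubes Q. \<forall>P'\<in>bad_cubes Q. P \<subseteq> P' \<longrightarrow> P' = P}"

lemma threshold_nonneg: "0 \<le> threshold Q" by (simp add: threshold_def)

lemma threshold_ocube:
  assumes r: "0 < r"
  shows "ennreal (threshold (ocube z r)) = maximal_norm Q0 * energy (ocube z r) / ennreal (\<theta> * (2 * r) ^ CARD('n))"
proof -
  have m: "measure lebesgue (ocube z r) = (2 * r) ^ CARD('n)"
    unfolding measure_def emeasure_ocube(1)[OF less_imp_le[OF r]] using r by (intro enn2real_ennreal) simp
  have "maximal_norm Q0 * energy (ocube z r) / ennreal (\<theta> * (2 * r) ^ CARD('n)) < top"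
    using Mfin energy_density(2)[OF r, of z] \<theta> r by (intro ennreal_divide_less_top) (auto simp: ennreal_mult_less_top)
  then show ?thesis unfolding threshold_def m by (rule ennreal_enn2real)
qed

lemma stopping_cubes_props:
  "stopping_cubes Q \<subseteq> dyadic c R" "P \<in> stopping_cubes Q \<Longrightarrow> P \<subseteq> Q" "countable (stopping_cubes Q)"
proof -
  show 1: "stopping_cubes Q \<subseteq> dyadic c R" by (auto simp: stopping_cubes_def bad_cubes_def)
  show "countable (stopping_cubes Q)" by (rule countable_subset[OF 1 countable_dyadic])
  show "P \<in> stopping_cubes Q \<Longrightarrow> P \<subseteq> Q" by (simp add: stopping_cubes_def bad_cubes_def)
qed

lemma dyadicE:
  assumes "P \<in> dyadic c R"
  obtains m j where "P = dcube c R m j" "j \<in> dindex m"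
  using assms by (auto simp: dyadic_def)

lemma stopping_cubes_disjoint: "disjoint (stopping_cubes Q)"
proof (rule disjointI)
  fix P P' assume P: "P \<in> stopping_cubes Q" "P' \<in> stopping_cubes Q" "P \<noteq> P'"
  show "P \<inter> P' = {}"
  proof (rule ccontr)
    assume meet: "P \<inter> P' \<noteq> {}"
    obtain m j where mj: "P = dcube c R m j" using P(1) stopping_cubes_props(1) by (blast elim: dyadicE)
    obtain m' j' where mj': "P' = dcube c R m' j'" using P(2) stopping_cubes_props(1) by (blast elim: dyadicE)
    have "P \<subseteq> P' \<or> P' \<subseteq> P"
    proof (cases "m \<le> m'")
      case True
      then show ?thesis using dcube_nested[OF R True] meet unfolding mj mj' by blast
    next
      case False
      then have le: "m' \<le> m" by simp
      have "dcube c R m' j' \<inter> dcube c R m j \<noteq> {}" using meet unfolding mj mj' by blast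
      from dcube_nested[OF R le this] show ?thesis unfolding mj mj' by blast
    qed
    then show False using P unfolding stopping_cubes_def by blast
  qed
qed

text \<open>
  Among the bad cubes containing a point there is one of the lowest level. Dyadic cubes that meet are nested, so it is
  maximal.
\<close>

lemma Union_stopping_cubes: "\<Union>(stopping_cubes Q) = \<Union>(bad_cubes Q)"
proof
  show "\<Union>(bad_cubes Q) \<subseteq> \<Union>(stopping_cubes Q)"
  proof
    fix x assume "x \<in> \<Union>(bad_cubes Q)"
    then obtain P where P: "P \<in> bad_cubes Q" "x \<in> P" by blast
    define m where "m = (LEAST m. \<exists>j. dcube c R m j \<in> bad_cubes Q \<and> x \<in> dcube c R m j)"
    have "P \<in> dyadic c R" using P(1) by (simp add: bad_cubes_def)
    then obtain m' j' where "P = dcube c R m' j'" by (rule dyadicE)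
    then have "\<exists>m j. dcube c R m j \<in> bad_cubes Q \<and> x \<in> dcube c R m j" using P by blast
    then have "\<exists>j. dcube c R m j \<in> bad_cubes Q \<and> x \<in> dcube c R m j" unfolding m_def by (rule LeastI_ex)
    then obtain j where j: "dcube c R m j \<in> bad_cubes Q" "x \<in> dcube c R m j" by blast
    have "P' = dcube c R m j" if P': "P' \<in> bad_cubes Q" "dcube c R m j \<subseteq> P'" for P'
    proof -
      have "P' \<in> dyadic c R" using P'(1) by (simp add: bad_cubes_def)
      then obtain m' j' where mj': "P' = dcube c R m' j'" by (rule dyadicE)
      have "m \<le> m'" unfolding m_def by (rule Least_le) (use P' mj' j in blast)
      then have "P' \<subseteq> dcube c R m j" using dcube_nested[OF R] j(2) P'(2) unfolding mj' by blast
      then show ?thesis using P'(2) by blast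
    qed
    then have "dcube c R m j \<in> stopping_cubes Q" using j(1) unfolding stopping_cubes_def by blast
    then show "x \<in> \<Union>(stopping_cubes Q)" using j(2) by blast
  qed
qed (auto simp: stopping_cubes_def)

lemma stopping_cubes_measure:
  assumes Q: "Q \<in> dyadic c R"
  shows "emeasure lebesgue (\<Union>(stopping_cubes Q)) \<le> ennreal \<theta> * emeasure lebesgue Q"
proof -
  obtain z r where zr: "Q = ocube z r" "0 < r" using dyadic_ocube[OF R Q] by blast
  let ?h = "\<lambda>x. norm (local_gradient Q x) powr ql" and ?V = "(2 * r) ^ CARD('n)"
  have V: "0 < \<theta> * ?V" using \<theta> zr(2) by simp
  have "emeasure lebesgue (\<Union>(stopping_cubes Q)) \<le> emeasure lebesgue (\<Union>{P \<in> dyadic c R. ennreal (threshold Q) < tripled_average P ?h})"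
    unfolding Union_stopping_cubes
  proof (rule emeasure_mono)
    show "\<Union>{P \<in> dyadic c R. ennreal (threshold Q) < tripled_average P ?h} \<in> sets lebesgue"
      by (rule Union_dyadic_sets) blast
  qed (auto simp: bad_cubes_def)
  also have "\<dots> \<le> ennreal (\<theta> * ?V)"
    using superlevel_measure[OF Q0 Mfin energy_density(1)[OF zr(2), of z] V _ threshold_nonneg[of Q]]
      threshold_ocube[OF zr(2), of z] energy_density(3)[OF zr(2), of z] unfolding zr(1) by simp
  also have "\<dots> = ennreal \<theta> * emeasure lebesgue Q"
    unfolding zr(1) using \<theta> zr(2) by (subst emeasure_ocube(1)) (simp_all only: ennreal_mult less_imp_le zero_le_power zero_le_mult_iff zero_le_numeral simp_thms)
  finally show ?thesis .
qed

text \<open>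
  Otherwise the bad cubes would cover all of \<open>Q\<close>, but they cover at most the fraction \<open>\<theta> < 1\<close>.
\<close>

lemma not_bad_itself:
  assumes Q: "Q \<in> dyadic c R"
  shows "Q \<notin> bad_cubes Q"
proof
  obtain z r where zr: "Q = ocube z r" "0 < r" using dyadic_ocube[OF R Q] by blast
  define V where "V = (2 * r) ^ CARD('n)"
  have V: "0 < V" "emeasure lebesgue Q = ennreal V" using zr by (auto simp: V_def emeasure_ocube)
  assume "Q \<in> bad_cubes Q"
  then have "Q \<subseteq> \<Union>(stopping_cubes Q)" unfolding Union_stopping_cubes by blast
  moreover have "\<Union>(stopping_cubes Q) \<in> sets lebesgue" using Union_dyadic_sets[OF stopping_cubes_props(1)] .
  ultimately have "emeasure lebesgue Q \<le> ennreal \<theta> * emeasure lebesgue Q"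
    using stopping_cubes_measure[OF Q] emeasure_mono order_trans by blast
  then have "V \<le> \<theta> * V" using V \<theta> by (simp add: ennreal_mult[symmetric] ennreal_le_iff)
  then show False using V(1) \<theta> by simp
qed

text \<open>
  A stopping cube is a proper subcube of \<open>Q\<close>, so its dyadic parent still lies in \<open>Q\<close>, and by maximality the parent is not
  bad. Its triple contains \<open>3P\<close> and has \<open>6\<^sup>n\<close> times the measure of \<open>P\<close>. As the radius of \<open>P\<close> is at most half of that of \<open>Q\<close>, the triple
  \<open>3P\<close> lies in \<open>2Q\<close>, hence the domain of the local solution on \<open>P\<close> in that for \<open>Q\<close>.
\<close>

lemma stopping_cube_parent:
  assumes Q: "Q \<in> dyadic c R" and P: "P \<in> stopping_cubes Q"
  obtains z r where "P = ocube z r" "0 < r" "piece P \<subseteq> piece Q"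
    "(\<integral>\<^sup>+x\<in>ocube z (3 * r). ennreal (norm (local_gradient Q x) powr ql) \<partial>lebesgue)
      \<le> ennreal (threshold Q * (6 ^ CARD('n) * (2 * r) ^ CARD('n)))"
proof -
  let ?h = "\<lambda>x. norm (local_gradient Q x) powr ql"
  obtain mQ jQ where Qm: "Q = dcube c R mQ jQ" "jQ \<in> dindex mQ" using Q by (rule dyadicE)
  have "P \<in> dyadic c R" using P stopping_cubes_props(1) by blast
  then obtain m j where Pm: "P = dcube c R m j" "j \<in> dindex m" by (rule dyadicE)
  have PQ: "P \<subseteq> Q" using P by (rule stopping_cubes_props)
  have bad: "P \<in> bad_cubes Q" and max: "\<And>P'. P' \<in> bad_cubes Q \<Longrightarrow> P \<subseteq> P' \<Longrightarrow> P' = P"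
    using P by (auto simp: stopping_cubes_def)
  have ne: "P \<noteq> {}" using center_in_ocube[of "R / 2 ^ m"] R by (auto simp: Pm(1) dcube_def)
  have "mQ < m"
  proof (rule ccontr)
    assume "\<not> mQ < m"
    then have le: "m \<le> mQ" by simp
    have "dcube c R m j \<inter> dcube c R mQ jQ \<noteq> {}" using ne PQ unfolding Pm(1) Qm(1) by blast
    then have "Q \<subseteq> P" unfolding Pm(1) Qm(1) by (rule dcube_nested[OF R le])
    then have "Q = P" using PQ by blast
    then show False using bad not_bad_itself[OF Q] by simp
  qed
  then obtain m1 where m1: "m = Suc m1" "mQ \<le> m1" by (cases m) auto
  have m1m: "m1 \<le> m" using m1 by simp
  define j1 where "j1 = (\<chi> i. j $ i div 2 ^ (m - m1))"
  define P1 where "P1 = dcube c R m1 j1"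
  have P1: "P \<subseteq> P1" "P1 \<in> dyadic c R"
    using dcube_ancestor[OF R m1m, where j = j] Pm unfolding P1_def j1_def dyadic_def by blast+
  have P1Q: "P1 \<subseteq> Q"
    unfolding P1_def Qm(1) by (rule dcube_nested[OF R m1(2)]) (use ne PQ P1(1) in \<open>unfold P1_def Qm(1), blast\<close>)
  define z where "z = dcenter c R m j"
  define r where "r = R / 2 ^ m"
  define z1 where "z1 = dcenter c R m1 j1"
  define zQ where "zQ = dcenter c R mQ jQ"
  define rQ where "rQ = R / 2 ^ mQ"
  have r: "0 < r" "0 < rQ" using R by (auto simp: r_def rQ_def)
  have eqP: "P = ocube z r" "Q = ocube zQ rQ" by (simp_all add: Pm(1) Qm(1) dcube_def z_def r_def zQ_def rQ_def)
  have eq1: "P1 = ocube z1 (2 * r)" by (simp add: P1_def dcube_def z1_def r_def m1(1))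
  have r2: "2 * r \<le> rQ"
  proof -
    have "2 * r = R / 2 ^ m1" by (simp add: r_def m1(1))
    also have "\<dots> \<le> R / 2 ^ mQ" using R m1(2) by (intro divide_left_mono power_increasing) auto
    finally show ?thesis by (simp add: rQ_def)
  qed
  have "P1 \<noteq> P"
  proof
    assume "P1 = P"
    then have "ocube z1 (2 * r) \<subseteq> ocube z r" using eqP eq1 by simp
    from ocube_subset_imp[OF this] r have "\<bar>z1 $ (undefined :: 'n) - z $ undefined\<bar> \<le> r - 2 * r" by simp
    then show False using r(1) abs_ge_zero[of "z1 $ (undefined :: 'n) - z $ undefined"] by linarith
  qed
  then have "P1 \<notin> bad_cubes Q" using max[of P1] P1(1) by blast
  then have "tripled_average P1 ?h \<le> ennreal (threshold Q)"
    using P1(2) P1Q by (simp add: bad_cubes_def not_less)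
  then have avg: "average (ocube z1 (6 * r)) 1 ?h \<le> ennreal (threshold Q)"
    unfolding tripled_average_def eq1 using r by (simp add: dilate_ocube)
  have V6: "emeasure lebesgue (ocube z1 (6 * r)) = ennreal (6 ^ CARD('n) * (2 * r) ^ CARD('n))"
    unfolding power_mult_distrib[symmetric] using r by (subst emeasure_ocube(1)) (auto simp: mult.commute mult.left_commute)
  have "(\<integral>\<^sup>+x\<in>ocube z1 (6 * r). ennreal (\<bar>?h x\<bar> powr 1) \<partial>lebesgue) \<le> ennreal (threshold Q powr 1 * (6 ^ CARD('n) * (2 * r) ^ CARD('n)))"
    using average_le_iff[OF zero_less_one V6 _ threshold_nonneg, of ?h Q] avg r by simp
  then have I: "(\<integral>\<^sup>+x\<in>ocube z1 (6 * r). ennreal (?h x) \<partial>lebesgue) \<le> ennreal (threshold Q * (6 ^ CARD('n) * (2 * r) ^ CARD('n)))"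
    using threshold_nonneg[of Q] by simp
  have zz1: "\<bar>z $ i - z1 $ i\<bar> \<le> 2 * r - r" for i
    using ocube_subset_imp[of z r z1 "2 * r" i] P1(1) r unfolding eqP eq1 by simp
  have zzQ: "\<bar>z $ i - zQ $ i\<bar> \<le> rQ - r" for i
    using ocube_subset_imp[of z r zQ rQ i] PQ r unfolding eqP by simp
  have tri: "\<bar>y $ i - w $ i\<bar> < s + d" if "\<bar>y $ i - z $ i\<bar> < s" "\<bar>z $ i - w $ i\<bar> \<le> d" for y w :: "real ^ 'n" and i s d
    using that by linarith
  have sub6: "ocube z (3 * r) \<subseteq> ocube z1 (6 * r)"
  proof
    fix y assume "y \<in> ocube z (3 * r)"
    then have "\<bar>y $ i - z1 $ i\<bar> < 3 * r + (2 * r - r)" for i by (intro tri zz1) (simp add: ocube_def)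
    then show "y \<in> ocube z1 (6 * r)" unfolding ocube_def using r(1) by (smt (verit) mem_Collect_eq)
  qed
  have sub2: "ocube z (3 * r) \<subseteq> ocube zQ (2 * rQ)"
  proof
    fix y assume "y \<in> ocube z (3 * r)"
    then have "\<bar>y $ i - zQ $ i\<bar> < 3 * r + (rQ - r)" for i by (intro tri zzQ) (simp add: ocube_def)
    then show "y \<in> ocube zQ (2 * rQ)" unfolding ocube_def using r2 by (smt (verit) mem_Collect_eq)
  qed
  show thesis
  proof (rule that[OF eqP(1) r(1)])
    show "piece P \<subseteq> piece Q"
      using piece_props(2,3)[OF r(1), of z] piece_props(4)[OF r(2), of zQ] sub2 unfolding eqP by blast
    have "(\<integral>\<^sup>+x\<in>ocube z (3 * r). ennreal (?h x) \<partial>lebesgue) \<le> (\<integral>\<^sup>+x\<in>ocube z1 (6 * r). ennreal (?h x) \<partial>lebesgue)"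
      using sub6 by (intro nn_integral_mono) (auto simp: indicator_def)
    then show "(\<integral>\<^sup>+x\<in>ocube z (3 * r). ennreal (?h x) \<partial>lebesgue) \<le> ennreal (threshold Q * (6 ^ CARD('n) * (2 * r) ^ CARD('n)))"
      using I by (rule order_trans)
  qed
qed

text \<open>
  The bound for the average of \<open>|G\<^sub>Q - G\<^sub>P|\<close> with exponent \<open>q\<^sub>h\<close> on every stopping cube \<open>P\<close> and for \<open>|G\<^sub>Q|\<close> off the stopping cubes.
\<close>

definition gap :: "(real ^ 'n) set \<Rightarrow> real"
  where "gap Q = enn2real (N_h_bdr O0 \<Omega> a qh) * ((Nl * \<Lambda> + 1) * 3 powr (real CARD('n) / ql) * threshold Q powr (1 / ql))"

lemma gap_nonneg: "0 \<le> gap Q"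
  using Nl lam by (simp add: gap_def)

text \<open>
  The upper exponent reduces the claim to an average over \<open>2P\<close> with exponent \<open>1 / 2\<close>, which is at most the one with exponent \<open>q\<^sub>l\<close>.
  There Minkowski's inequality applies: \<open>G\<^sub>Q\<close> is controlled on \<open>3P\<close> by the parent of \<open>P\<close>, and \<open>G\<^sub>P\<close> by \<open>G\<^sub>Q\<close> on \<open>3P\<close> through
  the lower exponent. A cube that misses \<open>\<Omega>\<close> is not covered by the upper exponent, but both gradients vanish on it.
\<close>

lemma stopping_cube_comparison:
  assumes Q: "Q \<in> dyadic c R" and P: "P \<in> stopping_cubes Q"
  shows "average P qh (\<lambda>x. norm (local_gradient Q x - local_gradient P x)) \<le> ennreal (gap Q)"
proof -
  obtain z r where zr: "P = ocube z r" "0 < r" and sub: "piece P \<subseteq> piece Q"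
    and I: "(\<integral>\<^sup>+x\<in>ocube z (3 * r). ennreal (norm (local_gradient Q x) powr ql) \<partial>lebesgue)
      \<le> ennreal (threshold Q * (6 ^ CARD('n) * (2 * r) ^ CARD('n)))"
    using stopping_cube_parent[OF Q P] by blast
  obtain zQ rQ where zQ: "Q = ocube zQ rQ" "0 < rQ" using dyadic_ocube[OF R Q] by blast
  let ?G = "local_gradient Q" and ?H = "local_gradient P" and ?t = "threshold Q" and ?n = "real CARD('n)"
  obtain uQ where WQ: "W0 \<Omega> uQ ?G" using local_gradient_W0[OF zQ(2), of zQ] unfolding zQ(1) by blast
  obtain uP where WP: "W0 (piece P) uP ?H" "W0 \<Omega> uP ?H" using local_gradient_W0[OF zr(2), of z] unfolding zr(1) by blast
  have sq: "square_integrable ?G" "square_integrable ?H" using WQ WP(2) W0_square_integrable(2) by blast+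
  have m: "?G \<in> borel_measurable lebesgue" "?H \<in> borel_measurable lebesgue" using sq by (auto simp: square_integrable_def)
  have dm: "(\<lambda>x. norm (?G x - ?H x)) \<in> borel_measurable lebesgue" using m by measurable
  define V where "V = (2 * r) ^ CARD('n)"
  have V: "0 < V" using zr(2) by (simp add: V_def)
  have eq: "(LINT x:piece P|lebesgue. a x (?H x) \<bullet> gradient \<phi> x) = (LINT x:piece P|lebesgue. a x (?G x) \<bullet> gradient \<phi> x)"
    if "\<phi> \<in> test_functions (piece P)" for \<phi>
    using local_gradient_eq[OF zr(2) zQ(2)] sub that unfolding zr(1) zQ(1) by blast
  show ?thesis
  proof (cases "P \<inter> \<Omega> = {}")
    case True
    have "(\<integral>\<^sup>+x\<in>P. ennreal (\<bar>norm (?G x - ?H x)\<bar> powr qh) \<partial>lebesgue) = (\<integral>\<^sup>+x. 0 \<partial>(lebesgue :: (real ^ 'n) measure))"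
    proof (rule nn_integral_cong_AE)
      show "AE x in lebesgue. ennreal (\<bar>norm (?G x - ?H x)\<bar> powr qh) * indicator P x = 0"
        using W0_vanishes_outside[OF WQ \<Omega>_sets] W0_vanishes_outside[OF WP(2) \<Omega>_sets]
        by eventually_elim (use True in \<open>auto simp: indicator_def\<close>)
    qed
    then show ?thesis by (simp add: average_def)
  next
    case False
    have "average (ocube z r) qh (\<lambda>x. norm (?G x - ?H x)) \<le> N_h_bdr O0 \<Omega> a qh * average (ocube z (2 * r)) (1 / 2) (\<lambda>x. norm (?G x - ?H x))"
    proof (rule comparison[OF WQ WP(2) zr(2) zr(2) _ _ _ Nhfin])
      show "ocube z r \<subseteq> ocube z (2 * r)" using zr(2) by (intro ocube_mono) simp
      show "ocube z r \<inter> \<Omega> \<noteq> {}" using False zr(1) by simp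
    qed (use eq in \<open>simp add: piece_def zr(1)\<close>)
    also have "average (ocube z (2 * r)) (1 / 2) (\<lambda>x. norm (?G x - ?H x)) \<le> ennreal ((Nl * \<Lambda> + 1) * 3 powr (?n / ql) * ?t powr (1 / ql))"
    proof -
      define W where "W = 2 ^ CARD('n) * V"
      have W: "0 < W" "emeasure lebesgue (ocube z (2 * r)) = ennreal W"
      proof -
        have "W = (2 * (2 * r)) ^ CARD('n)" unfolding W_def V_def power_mult_distrib[symmetric] by (rule refl)
        then show "emeasure lebesgue (ocube z (2 * r)) = ennreal W" using emeasure_ocube(1)[of "2 * r" z] zr(2) by (simp only: mult_nonneg_nonneg less_imp_le zero_le_numeral simp_thms)
      qed (use V in \<open>simp add: W_def\<close>)
      have p6: "(6::real) ^ CARD('n) * V = 3 ^ CARD('n) * W" unfolding W_def mult.assoc[symmetric] power_mult_distrib[symmetric] by simp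
      define T where "T = ?t * (3 ^ CARD('n) * W)"
      have T: "0 \<le> T" "?t * (6 ^ CARD('n) * (2 * r) ^ CARD('n)) = T" using threshold_nonneg[of Q] W(1) p6 by (auto simp: T_def V_def)
      define \<tau> where "\<tau> = T powr (1 / ql)"
      have \<tau>: "0 \<le> \<tau>" "\<tau> powr ql = T" using T ql by (auto simp: \<tau>_def powr_powr)
      have IG: "(\<integral>\<^sup>+x\<in>ocube z (3 * r). ennreal (norm (?G x) powr ql) \<partial>lebesgue) \<le> ennreal T" using I T(2) by simp
      have f: "(\<integral>\<^sup>+x. ennreal ((norm (?G x) * indicator (ocube z (3 * r)) x) powr ql) \<partial>lebesgue) \<le> ennreal (\<tau> powr ql)"
      proof -
        have "(\<integral>\<^sup>+x. ennreal ((norm (?G x) * indicator (ocube z (3 * r)) x) powr ql) \<partial>lebesgue) = (\<integral>\<^sup>+x\<in>ocube z (3 * r). ennreal (norm (?G x) powr ql) \<partial>lebesgue)"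
          by (intro nn_integral_cong) (simp add: indicator_def)
        then show ?thesis using IG \<tau>(2) by simp
      qed
      have g: "(\<integral>\<^sup>+x. ennreal (norm (?H x) powr ql) \<partial>lebesgue) \<le> ennreal ((Nl * \<Lambda> * \<tau>) powr ql)"
      proof -
        have "(\<integral>\<^sup>+x. ennreal (norm (?H x) powr ql) \<partial>lebesgue) \<le> ennreal ((Nl * \<Lambda>) powr ql) * (\<integral>\<^sup>+x\<in>ocube z (3 * r). ennreal (norm (?G x) powr ql) \<partial>lebesgue)"
          using lower_estimate_homogeneous[OF low ql zr(2) _ sq(1)] WP(1) eq unfolding zr(1) by blast
        also have "\<dots> \<le> ennreal ((Nl * \<Lambda>) powr ql) * ennreal T" using IG by (intro mult_left_mono) auto
        also have "\<dots> = ennreal ((Nl * \<Lambda> * \<tau>) powr ql)" using Nl lam \<tau> T by (simp add: ennreal_mult[symmetric] powr_mult)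
        finally show ?thesis .
      qed
      have "(\<integral>\<^sup>+x\<in>ocube z (2 * r). ennreal (\<bar>norm (?G x - ?H x)\<bar> powr ql) \<partial>lebesgue) \<le>
          (\<integral>\<^sup>+x. ennreal ((norm (?G x) * indicator (ocube z (3 * r)) x + norm (?H x)) powr ql) \<partial>lebesgue)"
      proof (rule nn_integral_mono)
        fix x
        have "x \<in> ocube z (3 * r)" if "x \<in> ocube z (2 * r)" using that ocube_mono[of "2 * r" "3 * r" z] zr(2) by auto
        moreover have "\<bar>norm (?G x - ?H x)\<bar> powr ql \<le> (norm (?G x) + norm (?H x)) powr ql"
          using ql norm_triangle_ineq4[of "?G x" "?H x"] by (intro powr_mono2) auto
        ultimately show "ennreal (\<bar>norm (?G x - ?H x)\<bar> powr ql) * indicator (ocube z (2 * r)) x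
            \<le> ennreal ((norm (?G x) * indicator (ocube z (3 * r)) x + norm (?H x)) powr ql)"
          by (cases "x \<in> ocube z (2 * r)") (auto intro: ennreal_leI)
      qed
      also have "\<dots> \<le> ennreal ((\<tau> + Nl * \<Lambda> * \<tau>) powr ql)"
      proof (rule Minkowski_inequality_nonneg[OF _ _ _ _ _ f g])
        show "(\<lambda>x. norm (?G x) * indicator (ocube z (3 * r)) x) \<in> borel_measurable lebesgue" "(\<lambda>x. norm (?H x)) \<in> borel_measurable lebesgue"
          using m by (auto intro!: borel_measurable_times borel_measurable_norm)
      qed (use ql \<tau>(1) Nl lam in auto)
      also have "(\<tau> + Nl * \<Lambda> * \<tau>) powr ql = ((Nl * \<Lambda> + 1) * 3 powr (?n / ql) * ?t powr (1 / ql)) powr ql * W"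
      proof -
        have "\<tau> + Nl * \<Lambda> * \<tau> = (Nl * \<Lambda> + 1) * \<tau>" by (simp add: algebra_simps)
        then have "(\<tau> + Nl * \<Lambda> * \<tau>) powr ql = (Nl * \<Lambda> + 1) powr ql * T"
          using Nl lam \<tau> by (simp add: powr_mult)
        moreover have "((Nl * \<Lambda> + 1) * 3 powr (?n / ql) * ?t powr (1 / ql)) powr ql = (Nl * \<Lambda> + 1) powr ql * (3 ^ CARD('n) * ?t)"
          using Nl lam ql threshold_nonneg[of Q] by (simp add: powr_mult powr_powr powr_realpow)
        ultimately show ?thesis by (simp add: T_def)
      qed
      finally have "average (ocube z (2 * r)) ql (\<lambda>x. norm (?G x - ?H x)) \<le> ennreal ((Nl * \<Lambda> + 1) * 3 powr (?n / ql) * ?t powr (1 / ql))"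
        using ql Nl lam by (subst average_le_iff[OF _ W(2,1)]) auto
      moreover have "average (ocube z (2 * r)) (1 / 2) (\<lambda>x. norm (?G x - ?H x)) \<le> average (ocube z (2 * r)) ql (\<lambda>x. norm (?G x - ?H x))"
        by (rule average_mono_exponent[OF _ _ _ W(2,1) dm]) (use ql in auto)
      ultimately show ?thesis by (rule order_trans[rotated])
    qed
    finally show ?thesis
      using Nhfin Nl lam by (simp add: zr(1) gap_def ennreal_mult mult_left_mono)
  qed
qed

lemma threshold_le_gap: "threshold Q powr (1 / ql) \<le> gap Q"
proof -
  have "1 \<le> N_h_bdr O0 \<Omega> a qh" using qh by (intro N_h_bdr_ge_1) simp
  then have 1: "1 \<le> enn2real (N_h_bdr O0 \<Omega> a qh)" using enn2real_mono[of 1 "N_h_bdr O0 \<Omega> a qh"] Nhfin by simp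
  have 2: "1 \<le> 3 powr (real CARD('n) / ql)" using ql by (intro ge_one_powr_ge_zero) auto
  have 3: "1 \<le> Nl * \<Lambda> + 1" using Nl lam by simp
  have "1 * (1 * 1 * threshold Q powr (1 / ql)) \<le> gap Q"
    unfolding gap_def using 1 2 3 by (intro mult_mono) auto
  then show ?thesis by simp
qed

text \<open>
  All dyadic cubes in \<open>Q\<close> around such a point have averages below the threshold, so \<open>dyadic_differentiation\<close> applies
  from the level of \<open>Q\<close> on.
\<close>

lemma bounded_off_stopping_cubes:
  assumes Q: "Q \<in> dyadic c R"
  shows "AE x in lebesgue. x \<in> Q \<longrightarrow> x \<notin> \<Union>(stopping_cubes Q) \<longrightarrow> norm (local_gradient Q x) \<le> gap Q"
proof -
  obtain z r where zr: "Q = ocube z r" "0 < r" using dyadic_ocube[OF R Q] by blast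
  obtain mQ jQ where Qm: "Q = dcube c R mQ jQ" "jQ \<in> dindex mQ" using Q by (rule dyadicE)
  let ?h = "\<lambda>x. norm (local_gradient Q x) powr ql"
  have h: "?h \<in> Lp_on 1 UNIV" using energy_density(1)[OF zr(2), of z] zr(1) by simp
  show ?thesis
    using dyadic_differentiation[OF Q0 Mfin h threshold_nonneg[of Q], of mQ]
  proof eventually_elim
    case (elim x)
    show ?case
    proof (intro impI)
      assume x: "x \<in> Q" "x \<notin> \<Union>(stopping_cubes Q)"
      have "tripled_average (dcube c R m j) ?h \<le> ennreal (threshold Q)" if mj: "mQ \<le> m" "j \<in> dindex m" "x \<in> dcube c R m j" for m j
      proof (rule ccontr)
        assume "\<not> ?thesis"
        moreover have "dcube c R m j \<subseteq> Q" unfolding Qm(1) by (rule dcube_nested[OF R mj(1)]) (use x(1) mj(3) in \<open>unfold Qm(1), blast\<close>)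
        moreover have "dcube c R m j \<in> dyadic c R" using mj(2) unfolding dyadic_def by blast
        ultimately have "dcube c R m j \<in> bad_cubes Q" by (simp add: bad_cubes_def)
        then show False using x(2) mj(3) unfolding Union_stopping_cubes by blast
      qed
      then have "?h x \<le> threshold Q" using elim x(1) dyadic_subset_top[OF R Q] by blast
      then have "?h x powr (1 / ql) \<le> threshold Q powr (1 / ql)" using ql by (intro powr_mono2) auto
      moreover have "?h x powr (1 / ql) = norm (local_gradient Q x)" using ql by (simp add: powr_powr)
      ultimately show "norm (local_gradient Q x) \<le> gap Q" using threshold_le_gap[of Q] by linarith
    qed
  qed
qed

end

section \<open>The estimate on one dyadic cube\<close>

lemma ennreal_cancel:
  assumes "0 < d"
  shows "ennreal d * (y / ennreal d) = y" "ennreal d * y / ennreal d = y"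
proof -
  show "ennreal d * y / ennreal d = y"
    using assms by (simp add: ennreal_mult_divide_eq mult.commute[of "ennreal d"])
  then show "ennreal d * (y / ennreal d) = y" by (simp add: ennreal_times_divide)
qed

lemma nn_integral_Union_disjoint:
  assumes S: "countable \<C>" "\<C> \<subseteq> sets M" "disjoint \<C>" and f: "f \<in> borel_measurable M"
  shows "(\<integral>\<^sup>+x\<in>\<Union>\<C>. f x \<partial>M) = (\<integral>\<^sup>+P. (\<integral>\<^sup>+x\<in>P. f x \<partial>M) \<partial>count_space \<C>)"
proof -
  have "emeasure (density M f) (\<Union>P\<in>\<C>. P) = (\<integral>\<^sup>+P. emeasure (density M f) P \<partial>count_space \<C>)"
    using S by (intro emeasure_UN_countable) (auto simp: disjoint_family_on_def disjoint_def)
  also have "\<dots> = (\<integral>\<^sup>+P. (\<integral>\<^sup>+x\<in>P. f x \<partial>M) \<partial>count_space \<C>)"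
    using S(2) f by (intro nn_integral_cong) (auto simp: emeasure_density)
  finally have *: "emeasure (density M f) (\<Union>P\<in>\<C>. P) = (\<integral>\<^sup>+P. (\<integral>\<^sup>+x\<in>P. f x \<partial>M) \<partial>count_space \<C>)" .
  have "\<Union>\<C> \<in> sets M" using S by (intro sets.countable_Union) auto
  then show ?thesis using * f by (simp add: emeasure_density)
qed

lemma nn_integral_split:
  assumes "A \<in> sets M" "Q \<in> sets M" "A \<subseteq> Q" "f \<in> borel_measurable M"
  shows "(\<integral>\<^sup>+x\<in>Q. f x \<partial>M) = (\<integral>\<^sup>+x\<in>A. f x \<partial>M) + (\<integral>\<^sup>+x\<in>Q - A. f x \<partial>M)"
proof -
  have "(\<integral>\<^sup>+x\<in>Q. f x \<partial>M) = (\<integral>\<^sup>+x. f x * indicator A x + f x * indicator (Q - A) x \<partial>M)"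
    using assms(3) by (intro nn_integral_cong) (auto simp: indicator_def)
  also have "\<dots> = (\<integral>\<^sup>+x\<in>A. f x \<partial>M) + (\<integral>\<^sup>+x\<in>Q - A. f x \<partial>M)"
    using assms by (intro nn_integral_add borel_measurable_times_ennreal borel_measurable_indicator) auto
  finally show ?thesis .
qed

context localized_equation
begin

definition sparse_constant :: "real \<Rightarrow> ennreal"
  where "sparse_constant \<theta> = ennreal (9 powr (real CARD('n) / ql)) * (ennreal Nl * ennreal \<Lambda> + 1) * ennreal Nl
    * N_h_bdr O0 \<Omega> a qh * ennpowr (maximal_norm Q0 / ennreal \<theta>) (1 / ql)"

end

context sparse_setting
begin

text \<open>
  Subtract from \<open>G\<^sub>Q\<close> the function \<open>K\<close> that equals \<open>G\<^sub>P\<close> on every stopping cube \<open>P\<close> and zero elsewhere. The difference has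
  averages with exponent \<open>q\<^sub>h\<close> at most \<open>gap Q\<close> on the stopping cubes and is bounded by \<open>gap Q\<close> elsewhere, so one application of
  Hoelder's inequality on \<open>Q\<close> suffices. The integral of \<open>|K| g\<close> is the sum over the stopping cubes.
\<close>

lemma mass_step:
  assumes Q: "Q \<in> dyadic c R"
  shows "mass Q \<le> ennreal (gap Q) * emeasure lebesgue Q * average Q (conj_exp qh) g + (\<integral>\<^sup>+P. mass P \<partial>count_space (stopping_cubes Q))"
proof -
  obtain z r where zr: "Q = ocube z r" "0 < r" using dyadic_ocube[OF R Q] by blast
  let ?S = "stopping_cubes Q" and ?G = "local_gradient Q" and ?M = "gap Q"
  define V where "V = (2 * r) ^ CARD('n)"
  have V: "0 < V" "emeasure lebesgue Q = ennreal V" using zr by (auto simp: V_def emeasure_ocube)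
  have Ql: "Q \<in> sets lebesgue" using zr(1) by simp
  have Pm: "P \<in> sets lebesgue \<and> local_gradient P \<in> borel_measurable lebesgue" if P: "P \<in> dyadic c R" for P
  proof -
    obtain y s where ys: "P = ocube y s" "0 < s" using dyadic_ocube[OF R P] by blast
    show ?thesis using local_gradient_sq[OF ys(2), of y] by (simp add: ys(1) square_integrable_def)
  qed
  note S = stopping_cubes_props[where Q = Q] stopping_cubes_disjoint[of Q]
  have Sl: "?S \<subseteq> sets lebesgue" using S(1) Pm by blast
  define A where "A = \<Union>?S"
  have A: "A \<in> sets lebesgue" "A \<subseteq> Q" using S(2) Union_dyadic_sets[OF S(1)] unfolding A_def by blast+
  define K where "K x = (if x \<in> A then local_gradient (THE P. P \<in> ?S \<and> x \<in> P) x else 0)" for x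
  have K_in: "K x = local_gradient P x" if "P \<in> ?S" "x \<in> P" for P x
  proof -
    have "(THE P. P \<in> ?S \<and> x \<in> P) = P"
    proof (rule the_equality)
      show "P' = P" if "P' \<in> ?S \<and> x \<in> P'" for P'
        using disjointD[OF S(4), of P' P] that \<open>P \<in> ?S\<close> \<open>x \<in> P\<close> by blast
    qed (use that in blast)
    then show ?thesis using that unfolding K_def A_def by auto
  qed
  have Km: "K \<in> borel_measurable lebesgue"
  proof (rule measurable_piecewise_restrict[of "insert (- A) ?S"])
    show "countable (insert (- A) ?S)" using S(3) by simp
    show "B \<inter> space lebesgue \<in> sets lebesgue" if "B \<in> insert (- A) ?S" for B
      using that Sl sets.compl_sets[OF A(1)] by (auto simp: Compl_eq_Diff_UNIV)
    show "space lebesgue \<subseteq> \<Union>(insert (- A) ?S)" by (auto simp: A_def)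
    show "K \<in> borel_measurable (restrict_space lebesgue B)" if "B \<in> insert (- A) ?S" for B
    proof (cases "B = - A")
      case True
      have "(\<lambda>x. 0) \<in> borel_measurable (restrict_space lebesgue B)" by simp
      then show ?thesis by (subst measurable_cong[of _ _ "\<lambda>x. 0"]) (auto simp: True K_def)
    next
      case False
      then have B: "B \<in> ?S" using that by simp
      then have "local_gradient B \<in> borel_measurable (restrict_space lebesgue B)"
        using Pm S(1) by (intro measurable_restrict_space1) blast
      then show ?thesis by (subst measurable_cong[of _ _ "local_gradient B"]) (auto simp: K_in[OF B])
    qed
  qed
  have Gm: "?G \<in> borel_measurable lebesgue" using Pm Q by blast
  define H where "H x = norm (?G x - K x)" for x
  have Hm[measurable]: "H \<in> borel_measurable lebesgue" using Gm Km unfolding H_def by measurable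
  have gm[measurable]: "g \<in> borel_measurable lebesgue" by (rule g)
  have Kg[measurable]: "(\<lambda>x. ennreal (norm (K x) * g x)) \<in> borel_measurable lebesgue" using Km by measurable
  have Hq: "(\<lambda>x. ennreal (H x powr qh)) \<in> borel_measurable lebesgue" by measurable
  have H0: "0 \<le> H x" for x by (simp add: H_def)
  have Hint: "(\<integral>\<^sup>+x\<in>Q. ennreal (H x powr qh) \<partial>lebesgue) \<le> ennreal (?M powr qh * V)"
  proof -
    have "(\<integral>\<^sup>+x\<in>A. ennreal (H x powr qh) \<partial>lebesgue) = (\<integral>\<^sup>+P. (\<integral>\<^sup>+x\<in>P. ennreal (H x powr qh) \<partial>lebesgue) \<partial>count_space ?S)"
      unfolding A_def by (rule nn_integral_Union_disjoint[OF S(3) Sl S(4)]) measurable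
    also have "\<dots> \<le> (\<integral>\<^sup>+P. (\<integral>\<^sup>+x\<in>P. ennreal (?M powr qh) \<partial>lebesgue) \<partial>count_space ?S)"
    proof (rule nn_integral_mono)
      fix P assume "P \<in> space (count_space ?S)"
      then have P: "P \<in> ?S" by simp
      then obtain y s where ys: "P = ocube y s" "0 < s" using S(1) dyadic_ocube[OF R] by blast
      define W where "W = (2 * s) ^ CARD('n)"
      have W: "emeasure lebesgue P = ennreal W" "0 < W" using ys by (auto simp: W_def emeasure_ocube)
      have "(\<integral>\<^sup>+x\<in>P. ennreal (H x powr qh) \<partial>lebesgue) = (\<integral>\<^sup>+x\<in>P. ennreal (\<bar>norm (?G x - local_gradient P x)\<bar> powr qh) \<partial>lebesgue)"
        by (intro nn_integral_cong) (auto simp: indicator_def H_def K_in[OF P])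
      also have "\<dots> \<le> ennreal (?M powr qh * W)"
        using average_le_iff[OF _ W gap_nonneg, of qh] stopping_cube_comparison[OF Q P] qh by auto
      also have "\<dots> = (\<integral>\<^sup>+x\<in>P. ennreal (?M powr qh) \<partial>lebesgue)"
        using W Sl P by (subst nn_integral_cmult_indicator) (auto simp: ennreal_mult)
      finally show "(\<integral>\<^sup>+x\<in>P. ennreal (H x powr qh) \<partial>lebesgue) \<le> (\<integral>\<^sup>+x\<in>P. ennreal (?M powr qh) \<partial>lebesgue)" .
    qed
    also have "\<dots> = (\<integral>\<^sup>+x\<in>A. ennreal (?M powr qh) \<partial>lebesgue)"
      unfolding A_def by (rule nn_integral_Union_disjoint[OF S(3) Sl S(4), symmetric]) simp
    finally have 1: "(\<integral>\<^sup>+x\<in>A. ennreal (H x powr qh) \<partial>lebesgue) \<le> (\<integral>\<^sup>+x\<in>A. ennreal (?M powr qh) \<partial>lebesgue)" .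
    have 2: "(\<integral>\<^sup>+x\<in>Q - A. ennreal (H x powr qh) \<partial>lebesgue) \<le> (\<integral>\<^sup>+x\<in>Q - A. ennreal (?M powr qh) \<partial>lebesgue)"
    proof (rule nn_integral_mono_AE)
      show "AE x in lebesgue. ennreal (H x powr qh) * indicator (Q - A) x \<le> ennreal (?M powr qh) * indicator (Q - A) x"
        using bounded_off_stopping_cubes[OF Q]
      proof eventually_elim
        case (elim x)
        show ?case
        proof (cases "x \<in> Q - A")
          case True
          then have "H x \<le> ?M" using elim by (simp add: H_def K_def A_def)
          then have "H x powr qh \<le> ?M powr qh" using H0 qh by (intro powr_mono2) auto
          then show ?thesis using True by (simp add: ennreal_leI)
        qed simp
      qed
    qed
    have "(\<integral>\<^sup>+x\<in>Q. ennreal (H x powr qh) \<partial>lebesgue) \<le> (\<integral>\<^sup>+x\<in>Q. ennreal (?M powr qh) \<partial>lebesgue)"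
      unfolding nn_integral_split[OF A(1) Ql A(2) Hq] nn_integral_split[OF A(1) Ql A(2) borel_measurable_const]
      by (rule add_mono[OF 1 2])
    also have "\<dots> = ennreal (?M powr qh * V)"
      using V Ql by (subst nn_integral_cmult_indicator) (auto simp: ennreal_mult)
    finally show ?thesis .
  qed
  let ?q = "conj_exp qh"
  have q: "1 < ?q" "1 / qh + 1 / ?q = 1" using qh by (simp_all add: conj_exp_def field_simps)
  define J where "J = (\<integral>\<^sup>+x\<in>Q. ennreal (\<bar>g x\<bar> powr ?q) \<partial>lebesgue)"
  have Hg: "(\<integral>\<^sup>+x\<in>Q. ennreal (H x * g x) \<partial>lebesgue) \<le> ennreal (gap Q) * emeasure lebesgue Q * average Q ?q g"
  proof -
    let ?f1 = "\<lambda>x. H x * indicator Q x" and ?g1 = "\<lambda>x. g x * indicator Q x"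
    have "(\<integral>\<^sup>+x\<in>Q. ennreal (H x * g x) \<partial>lebesgue) = (\<integral>\<^sup>+x. ennreal (\<bar>?f1 x\<bar> * \<bar>?g1 x\<bar>) \<partial>lebesgue)"
      using H0 g(2) by (intro nn_integral_cong) (simp add: indicator_def)
    also have "\<dots> \<le> ennpowr (\<integral>\<^sup>+x. ennreal (\<bar>?f1 x\<bar> powr qh) \<partial>lebesgue) (1 / qh) * ennpowr (\<integral>\<^sup>+x. ennreal (\<bar>?g1 x\<bar> powr ?q) \<partial>lebesgue) (1 / ?q)"
      by (rule Hoelder_inequality) (use qh q Ql in \<open>auto intro!: borel_measurable_times\<close>)
    also have "(\<integral>\<^sup>+x. ennreal (\<bar>?f1 x\<bar> powr qh) \<partial>lebesgue) = (\<integral>\<^sup>+x\<in>Q. ennreal (H x powr qh) \<partial>lebesgue)"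
      using H0 by (intro nn_integral_cong) (simp add: indicator_def)
    also have "(\<integral>\<^sup>+x. ennreal (\<bar>?g1 x\<bar> powr ?q) \<partial>lebesgue) = J"
      unfolding J_def by (intro nn_integral_cong) (simp add: indicator_def)
    also have "ennpowr (\<integral>\<^sup>+x\<in>Q. ennreal (H x powr qh) \<partial>lebesgue) (1 / qh) * ennpowr J (1 / ?q)
        \<le> ennpowr (ennreal (?M powr qh * V)) (1 / qh) * ennpowr J (1 / ?q)"
      using Hint qh by (intro mult_right_mono ennpowr_mono) auto
    also have "ennpowr (ennreal (?M powr qh * V)) (1 / qh) = ennreal ?M * ennreal (V powr (1 / qh))"
      using gap_nonneg[of Q] V(1) qh by (subst ennpowr_ennreal) (auto simp: powr_mult powr_powr ennreal_mult)
    also have "ennpowr J (1 / ?q) = ennreal (V powr (1 / ?q)) * average Q ?q g"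
      unfolding average_def V(2) J_def[symmetric] using V(1) q(1) by (subst ennpowr_divide) (auto simp: ennreal_cancel)
    also have "ennreal ?M * ennreal (V powr (1 / qh)) * (ennreal (V powr (1 / ?q)) * average Q ?q g)
        = ennreal ?M * ennreal (V powr (1 / qh) * V powr (1 / ?q)) * average Q ?q g"
      by (simp add: ennreal_mult mult.assoc)
    also have "V powr (1 / qh) * V powr (1 / ?q) = V" using V(1) q(2) by (simp add: powr_add[symmetric])
    finally show ?thesis by (simp add: V(2))
  qed
  have Kmass: "(\<integral>\<^sup>+x\<in>Q. ennreal (norm (K x) * g x) \<partial>lebesgue) = (\<integral>\<^sup>+P. mass P \<partial>count_space ?S)"
  proof -
    have "(\<integral>\<^sup>+x\<in>Q. ennreal (norm (K x) * g x) \<partial>lebesgue) = (\<integral>\<^sup>+x\<in>A. ennreal (norm (K x) * g x) \<partial>lebesgue)"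
      using A(2) by (intro nn_integral_cong) (auto simp: indicator_def K_def)
    also have "\<dots> = (\<integral>\<^sup>+P. (\<integral>\<^sup>+x\<in>P. ennreal (norm (K x) * g x) \<partial>lebesgue) \<partial>count_space ?S)"
      unfolding A_def by (rule nn_integral_Union_disjoint[OF S(3) Sl S(4) Kg])
    also have "\<dots> = (\<integral>\<^sup>+P. mass P \<partial>count_space ?S)"
      unfolding mass_def by (intro nn_integral_cong) (auto simp: indicator_def K_in intro!: nn_integral_cong)
    finally show ?thesis .
  qed
  have "mass Q \<le> (\<integral>\<^sup>+x. ennreal (H x * g x) * indicator Q x + ennreal (norm (K x) * g x) * indicator Q x \<partial>lebesgue)"
    unfolding mass_def
  proof (rule nn_integral_mono)
    fix x
    have "norm (?G x) \<le> H x + norm (K x)" unfolding H_def using norm_triangle_sub[of "?G x" "K x"] by simp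
    then have "norm (?G x) * g x \<le> H x * g x + norm (K x) * g x"
      using g(2)[of x] by (metis distrib_right mult_right_mono)
    then have "ennreal (norm (?G x) * g x) \<le> ennreal (H x * g x) + ennreal (norm (K x) * g x)"
      using g(2)[of x] H0[of x] by (simp add: ennreal_plus[symmetric] ennreal_leI del: ennreal_plus)
    then show "ennreal (norm (?G x) * g x) * indicator Q x \<le> ennreal (H x * g x) * indicator Q x + ennreal (norm (K x) * g x) * indicator Q x"
      by (simp add: indicator_def)
  qed
  also have "\<dots> = (\<integral>\<^sup>+x\<in>Q. ennreal (H x * g x) \<partial>lebesgue) + (\<integral>\<^sup>+x\<in>Q. ennreal (norm (K x) * g x) \<partial>lebesgue)"
    using Ql by (intro nn_integral_add borel_measurable_times_ennreal borel_measurable_indicator Kg) measurable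
  also have "\<dots> \<le> ennreal (gap Q) * emeasure lebesgue Q * average Q ?q g + (\<integral>\<^sup>+P. mass P \<partial>count_space ?S)"
    unfolding Kmass using Hg by (intro add_mono) auto
  finally show ?thesis .
qed

text \<open>
  Two factors \<open>3\<^sup>n\<^sup>/\<^sup>q\<close> with \<open>q = q\<^sub>l\<close>, one from \<open>gap\<close> and one from the normalisation of the averages over \<open>3Q\<close>, give the power of
  nine. The side length of \<open>3Q\<close> appears because the exponents of \<open>f\<close> and of the energy satisfy \<open>1 / q\<^sub>* = 1 / q + 1 / n\<close>.
\<close>

lemma gap_le:
  assumes r: "0 < r"
  shows "ennreal (gap (ocube z r)) \<le> sparse_constant \<theta> * (average (ocube z (3 * r)) ql (\<lambda>x. norm (F x))
    + ennreal (3 * (2 * r)) * average (ocube z (3 * r)) (star_exp CARD('n) ql) f)"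
proof -
  let ?s = "star_exp CARD('n) ql" and ?n = "real CARD('n)" and ?Q = "ocube z r" and ?T = "ocube z (3 * r)"
  let ?\<alpha> = "average ?T ql (\<lambda>x. norm (F x))" and ?\<beta> = "average ?T ?s f"
  define V where "V = (2 * r) ^ CARD('n)"
  define W where "W = 3 ^ CARD('n) * V"
  have V: "0 < V" using r by (simp add: V_def)
  have W: "0 < W" using V by (simp add: W_def)
  have TW: "emeasure lebesgue ?T = ennreal W"
  proof -
    have "W = (2 * (3 * r)) ^ CARD('n)" unfolding W_def V_def power_mult_distrib[symmetric] by simp
    then show ?thesis using emeasure_ocube(1)[of "3 * r" z] r by (simp only: mult_nonneg_nonneg less_imp_le zero_le_numeral simp_thms)
  qed
  have n: "0 < ?n" by simp
  have s: "0 < ?s" "1 / ?s = 1 / ql + 1 / ?n" using ql n by (simp_all add: star_exp_def field_simps)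
  have Wn: "W powr (1 / ?n) = 3 * (2 * r)"
  proof -
    have "W = (3 * (2 * r)) powr ?n" unfolding W_def V_def power_mult_distrib[symmetric] using r by (simp add: powr_realpow)
    then show ?thesis using r n by (simp add: powr_powr)
  qed
  define A where "A = ennpowr (\<integral>\<^sup>+x\<in>?T. ennreal (norm (F x) powr ql) \<partial>lebesgue) (1 / ql)"
  define B where "B = ennpowr (\<integral>\<^sup>+x\<in>?T. ennreal (\<bar>f x\<bar> powr ?s) \<partial>lebesgue) (1 / ?s)"
  define w where "w = W powr (1 / ql)"
  define v where "v = V powr (1 / ql)"
  define b where "b = 3 powr (?n / ql)"
  have pos: "0 < w" "0 < v" "0 < b" using W V by (auto simp: w_def v_def b_def)
  have wv: "w = b * v" using V ql unfolding w_def W_def b_def v_def by (simp add: powr_mult powr_realpow[symmetric] powr_powr)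
  have A: "A = ennreal w * ?\<alpha>"
    unfolding average_def TW A_def w_def using W ql by (subst ennpowr_divide) (auto simp: ennreal_cancel)
  have B: "B = ennreal w * (ennreal (3 * (2 * r)) * ?\<beta>)"
  proof -
    have "W powr (1 / ?s) = w * (3 * (2 * r))" unfolding s(2) powr_add Wn w_def by simp
    then have "ennreal w * ennreal (3 * (2 * r)) = ennreal (W powr (1 / ?s))" using r pos by (simp add: ennreal_mult[symmetric])
    moreover have "B = ennreal (W powr (1 / ?s)) * ?\<beta>"
      unfolding average_def TW B_def using W s(1) by (subst ennpowr_divide) (auto simp: ennreal_cancel)
    ultimately show ?thesis by (metis mult.assoc)
  qed
  let ?K = "ennpowr (maximal_norm Q0 / ennreal \<theta>) (1 / ql)" and ?I = "energy ?Q"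
  have "ennreal (threshold ?Q powr (1 / ql)) = ennpowr (ennreal (threshold ?Q)) (1 / ql)"
    by (simp add: ennpowr_ennreal threshold_nonneg)
  also have "ennreal (threshold ?Q) = (maximal_norm Q0 / ennreal \<theta>) * ?I / ennreal V"
  proof -
    have i: "inverse (ennreal (\<theta> * V)) = inverse (ennreal \<theta>) * inverse (ennreal V)"
      using V \<theta> by (simp add: inverse_ennreal ennreal_mult[symmetric] inverse_eq_divide)
    show ?thesis unfolding threshold_ocube[OF r] V_def[symmetric] divide_ennreal_def i by (simp add: mult_ac)
  qed
  also have "ennpowr ((maximal_norm Q0 / ennreal \<theta>) * ?I / ennreal V) (1 / ql) = ?K * ennpowr ?I (1 / ql) / ennreal v"
    using ql V unfolding v_def by (subst ennpowr_divide) (auto simp: ennpowr_mult)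
  also have "\<dots> \<le> ?K * (ennreal Nl * (A + B)) / ennreal v"
    using energy_estimate[OF r, of z] unfolding A_def B_def by (intro divide_right_mono_ennreal mult_left_mono) auto
  also have "\<dots> = ?K * ennreal Nl * ennreal b * (?\<alpha> + ennreal (3 * (2 * r)) * ?\<beta>)"
  proof -
    have "?K * (ennreal Nl * (A + B)) = ennreal v * (?K * ennreal Nl * ennreal b * (?\<alpha> + ennreal (3 * (2 * r)) * ?\<beta>))"
      unfolding A B wv using pos by (simp add: ennreal_mult distrib_left mult_ac)
    then show ?thesis using ennreal_cancel(2)[OF pos(2)] by simp
  qed
  finally have t: "ennreal (threshold ?Q powr (1 / ql)) \<le> ?K * ennreal Nl * ennreal b * (?\<alpha> + ennreal (3 * (2 * r)) * ?\<beta>)" .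
  have "ennreal (gap ?Q) = N_h_bdr O0 \<Omega> a qh * ((ennreal Nl * ennreal \<Lambda> + 1) * ennreal b * ennreal (threshold ?Q powr (1 / ql)))"
    using Nhfin Nl lam by (simp add: gap_def b_def ennreal_mult ennreal_plus)
  also have "\<dots> \<le> N_h_bdr O0 \<Omega> a qh * ((ennreal Nl * ennreal \<Lambda> + 1) * ennreal b * (?K * ennreal Nl * ennreal b * (?\<alpha> + ennreal (3 * (2 * r)) * ?\<beta>)))"
    using t by (intro mult_left_mono) auto
  also have "\<dots> = sparse_constant \<theta> * (?\<alpha> + ennreal (3 * (2 * r)) * ?\<beta>)"
  proof -
    have "(9::real) powr (?n / ql) = b * b" unfolding b_def by (simp add: powr_mult[symmetric])
    then have "ennreal (9 powr (?n / ql)) = ennreal b * ennreal b" using pos by (simp add: ennreal_mult)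
    then show ?thesis unfolding sparse_constant_def by (simp only: mult_ac)
  qed
  finally show ?thesis .
qed

end

section \<open>Iteration\<close>

text \<open>
  The iteration works with integrals over counting measures, for which sums over disjoint unions split by countable
  additivity.
\<close>

lemma count_space_le_infsum:
  fixes b :: "'a \<Rightarrow> ennreal"
  assumes "countable A"
  shows "(\<integral>\<^sup>+P. b P \<partial>count_space A) \<le> (\<Sum>\<^sub>\<infinity>P\<in>A. b P)"
proof (cases "A = {}")
  case False
  let ?\<nu> = "density (count_space UNIV) b"
  define B where "B k = from_nat_into A ` {..<k}" for k
  have \<nu>: "emeasure ?\<nu> X = (\<integral>\<^sup>+P. b P \<partial>count_space X)" for X
    by (simp add: emeasure_density nn_integral_count_space_indicator)
  have "(\<Union>k. B k) = from_nat_into A ` (\<Union>k. {..<k})" unfolding B_def by blast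
  then have U: "(\<Union>k. B k) = A" using range_from_nat_into[OF False assms] by (simp add: UN_lessThan_UNIV)
  have "emeasure ?\<nu> (\<Union>k. B k) = (SUP k. emeasure ?\<nu> (B k))"
    by (rule SUP_emeasure_incseq[symmetric]) (auto simp: incseq_def B_def)
  also have "\<dots> \<le> (\<Sum>\<^sub>\<infinity>P\<in>A. b P)"
  proof (rule SUP_least)
    fix k
    have fin: "finite (B k)" "B k \<subseteq> A" using U by (auto simp: B_def)
    have "emeasure ?\<nu> (B k) = sum b (B k)" unfolding \<nu> using fin by (simp add: nn_integral_count_space_finite)
    also have "\<dots> \<le> (\<Sum>\<^sub>\<infinity>P\<in>A. b P)"
      by (subst nonneg_infsum_complete) (use fin in \<open>auto intro!: SUP_upper\<close>)
    finally show "emeasure ?\<nu> (B k) \<le> (\<Sum>\<^sub>\<infinity>P\<in>A. b P)" .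
  qed
  finally show ?thesis unfolding U \<nu> .
qed (simp add: nn_integral_empty)

text \<open>
  The family consists of \<open>T\<close>, its children \<open>ch T\<close>, their children, and so on. The sets \<open>Q - \<Union>(ch Q)\<close> are disjoint and large,
  which gives sparseness. Applying the step inequality to a whole generation leaves the sum of \<open>X\<close> over the next
  one, and this is at most the integral of \<open>w\<close> over a set whose measure decreases geometrically.
\<close>

lemma sparse_domination:
  fixes D :: "(real ^ 'n) set set" and X b :: "(real ^ 'n) set \<Rightarrow> ennreal" and w :: "real ^ 'n \<Rightarrow> ennreal"
  assumes \<theta>: "0 < \<theta>" "\<theta> < 1" and T: "T \<in> D"
    and D: "\<And>Q. Q \<in> D \<Longrightarrow> is_cube Q" "\<And>Q. Q \<in> D \<Longrightarrow> Q \<in> sets lebesgue"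
      "\<And>Q. Q \<in> D \<Longrightarrow> 0 < emeasure lebesgue Q" "\<And>Q. Q \<in> D \<Longrightarrow> emeasure lebesgue Q < top"
    and ch: "\<And>Q. Q \<in> D \<Longrightarrow> ch Q \<subseteq> D" "\<And>Q. Q \<in> D \<Longrightarrow> countable (ch Q)" "\<And>Q. Q \<in> D \<Longrightarrow> disjoint (ch Q)"
      "\<And>Q P. Q \<in> D \<Longrightarrow> P \<in> ch Q \<Longrightarrow> P \<subseteq> Q"
      "\<And>Q. Q \<in> D \<Longrightarrow> emeasure lebesgue (\<Union>(ch Q)) \<le> ennreal \<theta> * emeasure lebesgue Q"
    and step: "\<And>Q. Q \<in> D \<Longrightarrow> X Q \<le> b Q + (\<integral>\<^sup>+P. X P \<partial>count_space (ch Q))"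
    and w: "w \<in> borel_measurable lebesgue" "\<And>Q. Q \<in> D \<Longrightarrow> X Q \<le> (\<integral>\<^sup>+x\<in>Q. w x \<partial>lebesgue)" "(\<integral>\<^sup>+x\<in>T. w x \<partial>lebesgue) < top"
  shows "\<exists>\<P>\<subseteq>D. sparse_family (1 - \<theta>) \<P> \<and> X T \<le> (\<integral>\<^sup>+P. b P \<partial>count_space \<P>)"
proof -
  define gen where "gen = rec_nat {T} (\<lambda>_ \<S>. \<Union>Q\<in>\<S>. ch Q)"
  have gen0: "gen 0 = {T}" by (simp add: gen_def)
  have genS: "gen (Suc k) = (\<Union>Q\<in>gen k. ch Q)" for k by (simp add: gen_def)
  have genD: "Q \<in> gen k \<Longrightarrow> Q \<in> D" for k Q
  proof (induction k arbitrary: Q)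
    case 0 then show ?case using T by (simp add: gen0)
  next
    case (Suc k) then show ?case using ch(1) unfolding genS by blast
  qed
  have genc: "countable (gen k)" for k
  proof (induction k)
    case 0 show ?case by (simp add: gen0)
  next
    case (Suc k) show ?case unfolding genS using Suc ch(2) genD by (intro countable_UN) auto
  qed
  have gend: "disjoint (gen k)" for k
  proof (induction k)
    case 0 show ?case by (simp add: gen0)
  next
    case (Suc k)
    show ?case
    proof (rule disjointI)
      fix P P' assume P: "P \<in> gen (Suc k)" "P' \<in> gen (Suc k)" "P \<noteq> P'"
      obtain Q where Q: "Q \<in> gen k" "P \<in> ch Q" using P(1) unfolding genS by blast
      obtain Q' where Q': "Q' \<in> gen k" "P' \<in> ch Q'" using P(2) unfolding genS by blast
      show "P \<inter> P' = {}"
      proof (cases "Q = Q'")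
        case True
        then show ?thesis using disjointD[OF ch(3)[OF genD[OF Q(1)]] Q(2) _ P(3)] Q'(2) by simp
      next
        case False
        then show ?thesis using disjointD[OF Suc Q(1) Q'(1) False] ch(4)[OF genD[OF Q(1)] Q(2)] ch(4)[OF genD[OF Q'(1)] Q'(2)] by blast
      qed
    qed
  qed
  have ne: "Q \<noteq> {}" if "Q \<in> D" for Q using D(3)[OF that] by auto
  define U where "U k = \<Union>(gen k)" for k
  have chl: "\<Union>(ch Q) \<in> sets lebesgue" if "Q \<in> D" for Q
    using ch(1,2)[OF that] D(2) by (intro sets.countable_Union) auto
  have gl: "gen k \<subseteq> sets lebesgue" for k using genD D(2) by blast
  have Ul: "U k \<in> sets lebesgue" for k unfolding U_def using genc gl by (intro sets.countable_Union) auto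
  have US: "U (Suc k) = (\<Union>Q\<in>gen k. \<Union>(ch Q))" for k unfolding U_def genS by blast
  have sub: "\<Union>(ch Q) \<subseteq> Q" if "Q \<in> D" for Q using ch(4)[OF that] by blast
  have "U (Suc k) \<subseteq> U k" for k unfolding US unfolding U_def using sub genD by blast
  then have dec: "decseq U" by (rule decseq_SucI)
  have small: "emeasure lebesgue (U (Suc k)) \<le> ennreal \<theta> * emeasure lebesgue (U k)" for k
  proof -
    have "emeasure lebesgue (U (Suc k)) = (\<integral>\<^sup>+Q. emeasure lebesgue (\<Union>(ch Q)) \<partial>count_space (gen k))"
      unfolding US
    proof (rule emeasure_UN_countable)
      show "disjoint_family_on (\<lambda>Q. \<Union>(ch Q)) (gen k)"
        unfolding disjoint_family_on_def
      proof (intro ballI impI)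
        fix Q Q' assume Q: "Q \<in> gen k" "Q' \<in> gen k" "Q \<noteq> Q'"
        show "\<Union>(ch Q) \<inter> \<Union>(ch Q') = {}"
          using disjointD[OF gend Q] sub[OF genD[OF Q(1)]] sub[OF genD[OF Q(2)]] by blast
      qed
    qed (use chl genD genc in auto)
    also have "\<dots> \<le> (\<integral>\<^sup>+Q. ennreal \<theta> * emeasure lebesgue Q \<partial>count_space (gen k))"
      using ch(5) genD by (intro nn_integral_mono) auto
    also have "\<dots> = ennreal \<theta> * (\<integral>\<^sup>+Q. emeasure lebesgue Q \<partial>count_space (gen k))"
      by (rule nn_integral_cmult) simp
    also have "(\<integral>\<^sup>+Q. emeasure lebesgue Q \<partial>count_space (gen k)) = emeasure lebesgue (\<Union>Q\<in>gen k. Q)"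
      using gl genc gend by (intro emeasure_UN_countable[symmetric]) (auto simp: disjoint_family_on_def disjoint_def)
    finally show ?thesis by (simp add: U_def)
  qed
  obtain v where v: "0 \<le> v" "emeasure lebesgue T = ennreal v" using D(4)[OF T] by (cases "emeasure lebesgue T") auto
  have pow: "emeasure lebesgue (U k) \<le> ennreal (\<theta> ^ k * v)" for k
  proof (induction k)
    case 0 show ?case by (simp add: U_def gen0 v)
  next
    case (Suc k)
    have "emeasure lebesgue (U (Suc k)) \<le> ennreal \<theta> * ennreal (\<theta> ^ k * v)"
      using small[of k] mult_left_mono[OF Suc, of "ennreal \<theta>"] by simp
    then show ?case using \<theta> v by (simp add: ennreal_mult[symmetric] mult.assoc)
  qed
  have null: "(\<Inter>k. U k) \<in> null_sets lebesgue"
  proof (rule null_setsI)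
    have "(\<lambda>k. ennreal (\<theta> ^ k * v)) \<longlonglongrightarrow> ennreal (0 * v)"
      using \<theta> by (intro tendsto_ennrealI tendsto_mult LIMSEQ_power_zero tendsto_const) auto
    moreover have "emeasure lebesgue (\<Inter>k. U k) \<le> ennreal (\<theta> ^ k * v)" for k
      using pow[of k] emeasure_mono[of "\<Inter>k. U k" "U k" lebesgue] Ul by (meson INT_lower UNIV_I order_trans)
    ultimately have "emeasure lebesgue (\<Inter>k. U k) \<le> ennreal (0 * v)" by (intro LIMSEQ_le_const) auto
    then show "emeasure lebesgue (\<Inter>k. U k) = 0" by simp
    show "(\<Inter>k. U k) \<in> sets lebesgue" using Ul by (intro sets.countable_INT) auto
  qed
  define E where "E Q = Q - \<Union>(ch Q)" for Q
  have El: "E Q \<in> sets lebesgue" if "Q \<in> D" for Q unfolding E_def using D(2) chl that by (intro sets.Diff) auto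
  have Elarge: "ennreal (1 - \<theta>) * emeasure lebesgue Q \<le> emeasure lebesgue (E Q)" if Q: "Q \<in> D" for Q
  proof -
    obtain q where q: "0 \<le> q" "emeasure lebesgue Q = ennreal q" using D(4)[OF Q] by (cases "emeasure lebesgue Q") auto
    have "E Q \<union> \<Union>(ch Q) = Q" "E Q \<inter> \<Union>(ch Q) = {}" using sub[OF Q] by (auto simp: E_def)
    then have "emeasure lebesgue Q = emeasure lebesgue (E Q) + emeasure lebesgue (\<Union>(ch Q))"
      using plus_emeasure[OF El[OF Q] chl[OF Q]] by metis
    also have "\<dots> \<le> emeasure lebesgue (E Q) + ennreal (\<theta> * q)"
      using ch(5)[OF Q] q \<theta> by (intro add_left_mono) (simp add: ennreal_mult)
    finally have le: "ennreal q \<le> emeasure lebesgue (E Q) + ennreal (\<theta> * q)" unfolding q .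
    show ?thesis
    proof (cases "emeasure lebesgue (E Q)")
      case (real e)
      then have "q \<le> e + \<theta> * q" using le q \<theta> by (simp add: ennreal_plus[symmetric] ennreal_le_iff del: ennreal_plus)
      then have "(1 - \<theta>) * q \<le> e" by (simp add: algebra_simps)
      then show ?thesis using real q \<theta> by (simp add: ennreal_mult[symmetric] ennreal_leI)
    qed simp
  qed
  have EU: "E Q \<inter> U (Suc k) = {}" if Q: "Q \<in> gen k" for Q k
  proof (rule ccontr)
    assume "E Q \<inter> U (Suc k) \<noteq> {}"
    then obtain x Q' where x: "x \<in> E Q" "Q' \<in> gen k" "x \<in> \<Union>(ch Q')" unfolding US by blast
    then have "x \<in> Q \<inter> Q'" using sub[OF genD[OF x(2)]] by (auto simp: E_def)
    then have "Q = Q'" using disjointD[OF gend Q x(2)] by blast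
    then show False using x by (simp add: E_def)
  qed
  have later: "E Q \<inter> Q' = {}" if "Q \<in> gen k" "Q' \<in> gen l" "k < l" for Q Q' k l
  proof -
    have "Q' \<subseteq> U l" using that(2) by (auto simp: U_def)
    also have "U l \<subseteq> U (Suc k)" using decseqD[OF dec, of "Suc k" l] that(3) by simp
    finally show ?thesis using EU[OF that(1)] by blast
  qed
  (* No cube occurs in two generations, for then its part outside its children would be
     empty; without this a term could be counted twice. *)
  have gendis: "gen k \<inter> gen l = {}" if "k < l" for k l
  proof (rule ccontr)
    assume "gen k \<inter> gen l \<noteq> {}"
    then obtain Q where Q: "Q \<in> gen k" "Q \<in> gen l" by blast
    have "E Q = {}" using later[OF Q that] by (auto simp: E_def)
    then have "ennreal (1 - \<theta>) * emeasure lebesgue Q = 0" using Elarge[OF genD[OF Q(1)]] by simp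
    then show False using D(3)[OF genD[OF Q(1)]] \<theta> by (auto simp: ennreal_eq_0_iff)
  qed
  define \<P> where "\<P> = (\<Union>k. gen k)"
  have \<P>D: "\<P> \<subseteq> D" using genD by (auto simp: \<P>_def)
  have Edisj: "Q = Q'" if "Q \<in> \<P>" "Q' \<in> \<P>" "x \<in> E Q" "x \<in> E Q'" for Q Q' x
  proof -
    obtain k l where kl: "Q \<in> gen k" "Q' \<in> gen l" using \<open>Q \<in> \<P>\<close> \<open>Q' \<in> \<P>\<close> by (auto simp: \<P>_def)
    have x: "x \<in> Q" "x \<in> Q'" using that by (auto simp: E_def)
    consider "k < l" | "l < k" | "k = l" by linarith
    then show ?thesis
    proof cases
      case 1 then show ?thesis using later[OF kl 1] that(3) x by blast
    next
      case 2 then show ?thesis using later[OF kl(2,1) 2] that(4) x by blast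
    next
      case 3 then show ?thesis using disjointD[OF gend kl(1)] kl(2) x by blast
    qed
  qed
  have sparse: "sparse_family (1 - \<theta>) \<P>"
    unfolding sparse_family_def
  proof (intro conjI ballI exI[of _ E] allI)
    fix Q assume Q: "Q \<in> \<P>"
    then have QD: "Q \<in> D" using \<P>D by blast
    show "is_cube Q" "E Q \<in> sets lebesgue" "ennreal (1 - \<theta>) * emeasure lebesgue Q \<le> emeasure lebesgue (E Q)"
      using D(1) El Elarge QD by blast+
    show "E Q \<subseteq> Q" by (auto simp: E_def)
  next
    fix x
    show "(\<Sum>\<^sub>\<infinity>Q\<in>\<P>. indicator (E Q) x) \<le> (1 :: ennreal)"
    proof (cases "\<exists>Q\<in>\<P>. x \<in> E Q")
      case True
      then obtain Q where Q: "Q \<in> \<P>" "x \<in> E Q" by blast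
      have "(\<Sum>\<^sub>\<infinity>Q\<in>\<P>. indicator (E Q) x) = (\<Sum>\<^sub>\<infinity>Q\<in>{Q}. indicator (E Q) x :: ennreal)"
      proof (rule infsum_cong_neutral)
        show "indicator (E Q') x = (0 :: ennreal)" if "Q' \<in> \<P> - {Q}" for Q'
          using that Edisj[of Q' Q x] Q by (auto simp: indicator_def)
      qed (use Q in auto)
      then show ?thesis using Q by simp
    next
      case False
      then have "(\<Sum>\<^sub>\<infinity>Q\<in>\<P>. indicator (E Q) x) = (0 :: ennreal)" by (intro infsum_0) (auto simp: indicator_def)
      then show ?thesis by simp
    qed
  qed
  let ?\<mu> = "density (count_space UNIV) X" and ?\<nu> = "density (count_space UNIV) b"
  have \<mu>: "emeasure ?\<mu> A = (\<integral>\<^sup>+P. X P \<partial>count_space A)" and \<nu>: "emeasure ?\<nu> A = (\<integral>\<^sup>+P. b P \<partial>count_space A)" for A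
    by (simp_all add: emeasure_density nn_integral_count_space_indicator)
  have gstep: "emeasure ?\<mu> (gen k) \<le> emeasure ?\<nu> (gen k) + emeasure ?\<mu> (gen (Suc k))" for k
  proof -
    have "emeasure ?\<mu> (gen k) \<le> (\<integral>\<^sup>+Q. b Q + emeasure ?\<mu> (ch Q) \<partial>count_space (gen k))"
      unfolding \<mu> using step genD by (intro nn_integral_mono) auto
    also have "\<dots> = emeasure ?\<nu> (gen k) + (\<integral>\<^sup>+Q. emeasure ?\<mu> (ch Q) \<partial>count_space (gen k))"
      unfolding \<nu> by (intro nn_integral_add) auto
    also have "(\<integral>\<^sup>+Q. emeasure ?\<mu> (ch Q) \<partial>count_space (gen k)) = emeasure ?\<mu> (gen (Suc k))"
      unfolding genS
    proof (rule emeasure_UN_countable[symmetric])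
      show "disjoint_family_on ch (gen k)"
        unfolding disjoint_family_on_def
      proof (intro ballI impI)
        fix Q Q' assume Q: "Q \<in> gen k" "Q' \<in> gen k" "Q \<noteq> Q'"
        have "P \<notin> ch Q'" if "P \<in> ch Q" for P
          using disjointD[OF gend Q] ch(4)[OF genD[OF Q(1)] that] ch(4)[OF genD[OF Q(2)], of P] ne[of P] ch(1)[OF genD[OF Q(1)]] that by blast
        then show "ch Q \<inter> ch Q' = {}" by blast
      qed
    qed (use genc in auto)
    finally show ?thesis .
  qed
  have acc: "X T \<le> emeasure ?\<nu> (\<Union>i<k. gen i) + emeasure ?\<mu> (gen k)" for k
  proof (induction k)
    case 0 show ?case by (simp add: \<mu> gen0 nn_integral_count_space_finite)
  next
    case (Suc k)
    have "(\<Union>i<k. gen i) \<inter> gen k = {}" using gendis[of _ k] by blast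
    then have "emeasure ?\<nu> (\<Union>i<k. gen i) + emeasure ?\<nu> (gen k) = emeasure ?\<nu> (\<Union>i<Suc k. gen i)"
      by (subst plus_emeasure) (auto simp: lessThan_Suc Un_commute)
    then show ?case using Suc add_left_mono[OF gstep[of k], of "emeasure ?\<nu> (\<Union>i<k. gen i)"] by (simp add: add.assoc[symmetric])
  qed
  have bound: "X T \<le> emeasure ?\<nu> \<P> + (\<integral>\<^sup>+x\<in>U k. w x \<partial>lebesgue)" for k
  proof -
    have 1: "emeasure ?\<nu> (\<Union>i<k. gen i) \<le> emeasure ?\<nu> \<P>" by (intro emeasure_mono) (auto simp: \<P>_def)
    have "emeasure ?\<mu> (gen k) \<le> (\<integral>\<^sup>+Q. (\<integral>\<^sup>+x\<in>Q. w x \<partial>lebesgue) \<partial>count_space (gen k))"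
      unfolding \<mu> using w(2) genD by (intro nn_integral_mono) auto
    also have "\<dots> = (\<integral>\<^sup>+x\<in>U k. w x \<partial>lebesgue)"
      unfolding U_def by (rule nn_integral_Union_disjoint[OF genc gl gend w(1), symmetric])
    finally show ?thesis by (rule order_trans[OF acc[of k] add_mono[OF 1]])
  qed
  have "(\<lambda>k. emeasure (density lebesgue w) (U k)) \<longlonglongrightarrow> emeasure (density lebesgue w) (\<Inter>k. U k)"
  proof (rule Lim_emeasure_decseq)
    show "emeasure (density lebesgue w) (U k) \<noteq> \<infinity>" for k
    proof -
      have "U k \<subseteq> T" using decseqD[OF dec, of 0 k] by (simp add: U_def gen0)
      then have "(\<integral>\<^sup>+x\<in>U k. w x \<partial>lebesgue) \<le> (\<integral>\<^sup>+x\<in>T. w x \<partial>lebesgue)" by (intro nn_integral_mono) (auto simp: indicator_def)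
      then show ?thesis using w(1,3) Ul by (simp add: emeasure_density)
    qed
  qed (use Ul dec in auto)
  moreover have "emeasure (density lebesgue w) (\<Inter>k. U k) = 0"
    using null w(1) nn_integral_null_set[OF null] by (simp add: emeasure_density null_setsD2)
  ultimately have "(\<lambda>k. \<integral>\<^sup>+x\<in>U k. w x \<partial>lebesgue) \<longlonglongrightarrow> 0" using w(1) Ul by (simp add: emeasure_density)
  then have "(\<lambda>k. emeasure ?\<nu> \<P> + (\<integral>\<^sup>+x\<in>U k. w x \<partial>lebesgue)) \<longlonglongrightarrow> emeasure ?\<nu> \<P> + 0"
    by (intro tendsto_add tendsto_const)
  then have "X T \<le> emeasure ?\<nu> \<P> + 0" using bound by (intro LIMSEQ_le_const) auto
  then show ?thesis using \<P>D sparse unfolding \<nu> add_0_right by blast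
qed

section \<open>The sparse bound\<close>

lemma Lp_on_imp_Lp_loc_on:
  fixes h :: "real ^ 'n \<Rightarrow> 'b::euclidean_space"
  assumes h: "h \<in> Lp_on p E" and E: "E \<in> sets lebesgue" "emeasure lebesgue E < top" and q: "0 < q" "q \<le> p" and V: "V \<subseteq> E"
  shows "h \<in> Lp_loc_on q V"
  unfolding Lp_loc_on_def
proof (intro CollectI conjI allI impI)
  have hm: "h \<in> borel_measurable (lebesgue_on E)" and hI: "(\<integral>\<^sup>+x\<in>E. ennreal (norm (h x) powr p) \<partial>lebesgue) < top"
    using h by (auto simp: Lp_on_def)
  show "h \<in> borel_measurable (lebesgue_on V)" by (rule measurable_restrict_mono[OF hm V])
  have "(\<lambda>x. ennreal (norm (h x) powr p)) \<in> borel_measurable (lebesgue_on E)" using hm by measurable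
  then have m: "(\<lambda>x. ennreal (norm (h x) powr p) * indicator E x) \<in> borel_measurable lebesgue"
    by (rule borel_measurable_restrict_space_iff_ennreal[THEN iffD1, rotated]) (use E(1) in simp)
  fix K assume K: "compact K \<and> K \<subseteq> V"
  have "(\<integral>\<^sup>+x\<in>K. ennreal (norm (h x) powr q) \<partial>lebesgue) \<le> (\<integral>\<^sup>+x. indicator E x + ennreal (norm (h x) powr p) * indicator E x \<partial>lebesgue)"
  proof (rule nn_integral_mono)
    fix x
    have "norm (h x) powr q \<le> 1 + norm (h x) powr p"
    proof (cases "norm (h x) \<le> 1")
      case True
      then have "norm (h x) powr q \<le> 1 powr q" using q by (intro powr_mono2) auto
      then have "norm (h x) powr q \<le> 1" by simp
      then show ?thesis using powr_ge_zero[of "norm (h x)" p] by linarith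
    next
      case False
      then have "norm (h x) powr q \<le> norm (h x) powr p" using q by (intro powr_mono) auto
      then show ?thesis by simp
    qed
    then have "ennreal (norm (h x) powr q) \<le> 1 + ennreal (norm (h x) powr p)"
      by (metis ennreal_1 ennreal_leI ennreal_plus powr_ge_zero zero_le_one)
    then show "ennreal (norm (h x) powr q) * indicator K x \<le> indicator E x + ennreal (norm (h x) powr p) * indicator E x"
      using K V by (auto simp: indicator_def)
  qed
  also have "\<dots> = emeasure lebesgue E + (\<integral>\<^sup>+x\<in>E. ennreal (norm (h x) powr p) \<partial>lebesgue)"
    using E(1) m by (subst nn_integral_add) auto
  also have "\<dots> < top" using E(2) hI by simp
  finally show "(\<integral>\<^sup>+x\<in>K. ennreal (norm (h x) powr q) \<partial>lebesgue) < \<infinity>" by simp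
qed

lemma star_exp_bounds:
  assumes "0 < n" "0 < q" "q \<le> p"
  shows "0 < star_exp n q" "star_exp n q \<le> star_exp n p"
proof -
  have n: "0 < real n" using assms(1) by simp
  show "0 < star_exp n q" using n assms by (simp add: star_exp_def)
  have "real n * real n * q \<le> real n * real n * p" using assms by (intro mult_left_mono) auto
  then have "real n * q * (real n + p) \<le> real n * p * (real n + q)" by (simp add: algebra_simps)
  then show "star_exp n q \<le> star_exp n p"
    unfolding star_exp_def using n assms by (simp add: divide_le_eq le_divide_eq mult.commute)
qed

lemma dilate_dyadic_subset:
  assumes Q0: "cube_like Q0 c R" and P: "P \<in> dyadic c R"
  shows "dilate 3 P \<subseteq> dilate 3 Q0"
proof -
  have R: "0 < R" using Q0 by (simp add: cube_like_def)
  obtain z r where zr: "P = ocube z r" "0 < r" "r \<le> R" using dyadic_ocube[OF R P] by blast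
  have zc: "\<bar>z $ i - c $ i\<bar> \<le> R - r" for i
    using ocube_subset_imp[of z r c R i] dyadic_subset_top[OF R P] zr by simp
  have "ocube z (3 * r) \<subseteq> ocube c (3 * R)"
  proof
    fix y assume "y \<in> ocube z (3 * r)"
    then have yz: "\<bar>y $ i - z $ i\<bar> < 3 * r" for i by (simp add: ocube_def)
    have "\<bar>y $ i - c $ i\<bar> < 3 * R" for i using yz[of i] zc[of i] zr(3) by linarith
    then show "y \<in> ocube c (3 * R)" by (simp add: ocube_def)
  qed
  then show ?thesis using cube_like_dilate[OF Q0, of 3] zr(1,2) by (auto simp: dilate_ocube cube_like_def)
qed

context localized_equation
begin

definition F_term :: "(real ^ 'n) set \<Rightarrow> ennreal"
  where "F_term P = emeasure lebesgue P * average (dilate 3 P) ql (\<lambda>x. norm (F x)) * average P (conj_exp qh) g"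

definition f_term :: "(real ^ 'n) set \<Rightarrow> ennreal"
  where "f_term P = emeasure lebesgue P * ennreal (3 * side P) * average (dilate 3 P) (star_exp CARD('n) ql) f * average P (conj_exp qh) g"

lemma average_eq_0_iff:
  assumes "0 < r"
  shows "average (ocube z r) q h = 0 \<longleftrightarrow> (\<integral>\<^sup>+x\<in>ocube z r. ennreal (\<bar>h x\<bar> powr q) \<partial>lebesgue) = 0"
proof -
  have "emeasure lebesgue (ocube z r) \<noteq> top" using assms by (subst emeasure_ocube(1)) auto
  then show ?thesis unfolding average_def by (simp add: ennpowr_eq_0_iff ennreal_divide_eq_0_iff)
qed

text \<open>
  If the integral of \<open>|G0| g\<close> is positive, then \<open>g\<close> does not vanish on the cube, and by the lower exponent its constant is
  positive and not both \<open>F\<close> and \<open>f\<close> vanish on the triple cube. Hence one of the two terms is infinite.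
\<close>

lemma mass_le_if_infinite_constant:
  assumes M: "maximal_norm Q0 = top" and \<theta>: "0 < \<theta>"
  shows "mass (ocube c R) \<le> sparse_constant \<theta> * F_term (ocube c R) + sparse_constant \<theta> * f_term (ocube c R)"
proof (cases "mass (ocube c R) = 0")
  case False
  let ?T = "ocube c R" and ?s = "star_exp CARD('n) ql"
  obtain v where W: "W0 (piece ?T) v G0" using local_gradient_W0[OF R, of c] unfolding local_gradient_top by blast
  have Gm: "G0 \<in> borel_measurable lebesgue" by (rule W0_square_integrable(5)[OF W])
  have e: "energy ?T \<noteq> 0"
  proof
    assume "energy ?T = 0"
    then have "AE x in lebesgue. ennreal (norm (G0 x) powr ql) = 0"
      unfolding energy_def local_gradient_top using Gm by (subst (asm) nn_integral_0_iff_AE) auto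
    then have "mass ?T = (\<integral>\<^sup>+x. 0 \<partial>(lebesgue :: (real ^ 'n) measure))"
      unfolding mass_def local_gradient_top
      by (intro nn_integral_cong_AE) (elim eventually_mono, simp)
    then show False using False by simp
  qed
  then have e': "ennpowr (energy ?T) (1 / ql) \<noteq> 0" by (simp add: ennpowr_eq_0_iff)
  note est = energy_estimate[OF R, of c]
  have Nl0: "0 < Nl" using est e' Nl by (cases "Nl = 0") auto
  have "N_h_bdr O0 \<Omega> a qh \<noteq> 0" using N_h_bdr_ge_1[of qh] qh by auto
  moreover have "maximal_norm Q0 / ennreal \<theta> = top" using M \<theta> by (simp add: ennreal_top_divide)
  ultimately have C: "sparse_constant \<theta> = top"
    unfolding sparse_constant_def using Nl0 by (simp add: ennreal_mult_eq_top_iff ennreal_eq_0_iff)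
  have g0: "average ?T (conj_exp qh) g \<noteq> 0"
  proof
    assume "average ?T (conj_exp qh) g = 0"
    then have "(\<integral>\<^sup>+x\<in>?T. ennreal (\<bar>g x\<bar> powr conj_exp qh) \<partial>lebesgue) = 0" using average_eq_0_iff[OF R] by blast
    then have "AE x in lebesgue. ennreal (\<bar>g x\<bar> powr conj_exp qh) * indicator ?T x = 0"
      using g(1) by (subst (asm) nn_integral_0_iff_AE) (auto intro!: borel_measurable_times_ennreal)
    then have "mass ?T = (\<integral>\<^sup>+x. 0 \<partial>(lebesgue :: (real ^ 'n) measure))"
      unfolding mass_def by (intro nn_integral_cong_AE) (elim eventually_mono, auto simp: indicator_def)
    then show False using False by simp
  qed
  have T3: "dilate 3 ?T = ocube c (3 * R)" using R by (simp add: dilate_ocube)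
  have R3: "0 < 3 * R" using R by simp
  have "average (dilate 3 ?T) ql (\<lambda>x. norm (F x)) \<noteq> 0 \<or> average (dilate 3 ?T) ?s f \<noteq> 0"
  proof (rule ccontr)
    assume "\<not> ?thesis"
    then have "(\<integral>\<^sup>+x\<in>ocube c (3 * R). ennreal (norm (F x) powr ql) \<partial>lebesgue) = 0"
      "(\<integral>\<^sup>+x\<in>ocube c (3 * R). ennreal (\<bar>f x\<bar> powr ?s) \<partial>lebesgue) = 0"
      unfolding T3 average_eq_0_iff[OF R3] by auto
    then show False using est e' by simp
  qed
  moreover have "emeasure lebesgue ?T \<noteq> 0"
    unfolding emeasure_ocube(1)[OF less_imp_le[OF R]] ennreal_eq_0_iff not_le using R by (intro zero_less_power) simp
  moreover have "ennreal (3 * side ?T) \<noteq> 0" using cube_like_side[OF cube_like_ocube[OF R, of c]] R by (simp add: ennreal_eq_0_iff)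
  ultimately have "F_term ?T \<noteq> 0 \<or> f_term ?T \<noteq> 0" using g0 by (auto simp: F_term_def f_term_def)
  then have "sparse_constant \<theta> * F_term ?T + sparse_constant \<theta> * f_term ?T = top" unfolding C by (auto simp: ennreal_top_mult)
  then show ?thesis by (simp only: top_greatest)
qed simp

end

context sparse_setting
begin

lemma mass_le_sparse_sum:
  "\<exists>\<P>\<subseteq>dyadic c R. sparse_family (1 - \<theta>) \<P> \<and>
    mass (ocube c R) \<le> (\<integral>\<^sup>+P. sparse_constant \<theta> * (F_term P + f_term P) \<partial>count_space \<P>)"
proof (rule sparse_domination[OF \<theta> top_in_dyadic])
  fix Q assume Q: "Q \<in> dyadic c R"
  obtain z r where zr: "Q = ocube z r" "0 < r" using dyadic_ocube[OF R Q] by blast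
  show "is_cube Q" unfolding zr(1) by (rule is_cube_ocube[OF zr(2)])
  show "Q \<in> sets lebesgue" by (simp add: zr(1))
  show "0 < emeasure lebesgue Q" "emeasure lebesgue Q < top" unfolding zr(1) using zr(2) by (subst emeasure_ocube(1); simp)+
  show "stopping_cubes Q \<subseteq> dyadic c R" "countable (stopping_cubes Q)" "\<And>P. P \<in> stopping_cubes Q \<Longrightarrow> P \<subseteq> Q"
    by (fact stopping_cubes_props)+
  show "disjoint (stopping_cubes Q)" by (rule stopping_cubes_disjoint)
  show "emeasure lebesgue (\<Union>(stopping_cubes Q)) \<le> ennreal \<theta> * emeasure lebesgue Q" by (rule stopping_cubes_measure[OF Q])
  show "mass Q \<le> (\<integral>\<^sup>+x\<in>Q. majorant x \<partial>lebesgue)" by (rule mass_le_majorant[OF Q])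
  have "ennreal (gap Q) * emeasure lebesgue Q * average Q (conj_exp qh) g \<le>
      sparse_constant \<theta> * (average (dilate 3 Q) ql (\<lambda>x. norm (F x)) + ennreal (3 * side Q) * average (dilate 3 Q) (star_exp CARD('n) ql) f)
        * emeasure lebesgue Q * average Q (conj_exp qh) g"
    using gap_le[OF zr(2), of z] cube_like_side[OF cube_like_ocube[OF zr(2), of z]] zr(2)
    by (intro mult_right_mono) (simp_all add: zr(1) dilate_ocube)
  also have "\<dots> = sparse_constant \<theta> * (F_term Q + f_term Q)"
    unfolding F_term_def f_term_def by (simp only: distrib_left distrib_right mult_ac)
  finally show "mass Q \<le> sparse_constant \<theta> * (F_term Q + f_term Q) + (\<integral>\<^sup>+P. mass P \<partial>count_space (stopping_cubes Q))"
    using mass_step[OF Q] by (meson add_right_mono order_trans)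
qed (rule majorant_measurable majorant_finite)+

end

lemma (in localized_equation) sparse_bound:
  assumes \<theta>: "0 < \<theta>" "\<theta> < 1"
  shows "\<exists>\<P>\<subseteq>dyadic c R. sparse_family (1 - \<theta>) \<P> \<and>
    mass (ocube c R) \<le> sparse_constant \<theta> * (\<Sum>\<^sub>\<infinity>P\<in>\<P>. F_term P) + sparse_constant \<theta> * (\<Sum>\<^sub>\<infinity>P\<in>\<P>. f_term P)"
proof (cases "maximal_norm Q0 < top")
  case True
  interpret sparse_setting lam \<Lambda> Q0 O0 \<Omega> c R a ql qh Nl F f g Bg u0 G0 \<theta>
    using \<theta> True by unfold_locales
  obtain \<P> where \<P>: "\<P> \<subseteq> dyadic c R" "sparse_family (1 - \<theta>) \<P>"
    and le: "mass (ocube c R) \<le> (\<integral>\<^sup>+P. sparse_constant \<theta> * (F_term P + f_term P) \<partial>count_space \<P>)"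
    using mass_le_sparse_sum by blast
  have c: "countable \<P>" by (rule countable_subset[OF \<P>(1) countable_dyadic])
  have "(\<integral>\<^sup>+P. sparse_constant \<theta> * (F_term P + f_term P) \<partial>count_space \<P>)
      = sparse_constant \<theta> * ((\<integral>\<^sup>+P. F_term P \<partial>count_space \<P>) + (\<integral>\<^sup>+P. f_term P \<partial>count_space \<P>))"
    by (simp add: nn_integral_cmult nn_integral_add)
  also have "\<dots> \<le> sparse_constant \<theta> * ((\<Sum>\<^sub>\<infinity>P\<in>\<P>. F_term P) + (\<Sum>\<^sub>\<infinity>P\<in>\<P>. f_term P))"
    by (intro mult_left_mono add_mono count_space_le_infsum c) auto
  finally show ?thesis using \<P> le by (auto simp: distrib_left intro: order_trans)
next
  case False
  then have M: "maximal_norm Q0 = top" by (metis top.not_eq_extremum)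
  let ?T = "ocube c R"
  have "sparse_family (1 - \<theta>) {?T}"
    unfolding sparse_family_def
  proof (intro conjI exI[of _ "\<lambda>Q. Q"] ballI allI)
    have "ennreal (1 - \<theta>) * emeasure lebesgue ?T \<le> 1 * emeasure lebesgue ?T"
      using \<theta> by (intro mult_right_mono) (auto simp: ennreal_le_1)
    then show "ennreal (1 - \<theta>) * emeasure lebesgue Q \<le> emeasure lebesgue Q" if "Q \<in> {?T}" for Q using that by simp
    show "(\<Sum>\<^sub>\<infinity>Q\<in>{?T}. indicator Q x) \<le> (1::ennreal)" for x by (cases "x \<in> ?T") simp_all
  qed (use is_cube_ocube[OF R] in auto)
  then show ?thesis using mass_le_if_infinite_constant[OF M \<theta>(1)] top_in_dyadic[of c R] by (intro exI[of _ "{?T}"]) simp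
qed

theorem theorem3p3:
  fixes \<theta> lam \<Lambda> q\<^sub>l q\<^sub>h p N\<^sub>l :: real
    and Q\<^sub>0 \<Omega> O\<^sub>0 :: "(real ^ 'n) set"
    and a :: "real ^ 'n \<Rightarrow> real ^ 'n \<Rightarrow> real ^ 'n"
    and F :: "real ^ 'n \<Rightarrow> real ^ 'n"
    and f u g :: "real ^ 'n \<Rightarrow> real"
  defines "C \<equiv> ennreal (9 powr (real CARD('n) / q\<^sub>l)) * (ennreal N\<^sub>l * ennreal \<Lambda> + 1) * ennreal N\<^sub>l
                 * N_h_bdr O\<^sub>0 \<Omega> a q\<^sub>h * ennpowr (maximal_norm Q\<^sub>0 / ennreal \<theta>) (1 / q\<^sub>l)"
  assumes "0 < \<theta>" and "\<theta> < 1"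
    and "0 < lam" and "lam \<le> \<Lambda>"
    and "reference_domain O\<^sub>0"
    and "is_cube Q\<^sub>0"
    and "elliptic_coefficient lam \<Lambda> (dilate 3 Q\<^sub>0) a"
    and "is_domain \<Omega>" and "\<Omega> \<subseteq> Q\<^sub>0"
    and "admissible_lower_exponent O\<^sub>0 \<Omega> a q\<^sub>l" and "lower_constant O\<^sub>0 \<Omega> a q\<^sub>l N\<^sub>l"
    and "admissible_upper_exponent O\<^sub>0 \<Omega> a q\<^sub>h"
    and "N_h_bdr O\<^sub>0 \<Omega> a q\<^sub>h < \<infinity>"
    and "q\<^sub>l < p"
    and "F \<in> Lp_on p (dilate 3 Q\<^sub>0)"
    and "f \<in> Lp_on (star_exp CARD('n) p) (dilate 3 Q\<^sub>0)"
    and "\<not> (AE x in lebesgue_on (dilate 3 Q\<^sub>0). f x = 0) \<Longrightarrow> star_exp CARD('n) q\<^sub>l > 1"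
    and "u \<in> W12_0 \<Omega>" and "solves \<Omega> a F f u"
    and "g \<in> Linf_on (dilate 3 Q\<^sub>0)" and "AE x in lebesgue_on (dilate 3 Q\<^sub>0). 0 \<le> g x"
  shows "\<exists>\<P>. sparse_family (1 - \<theta>) \<P> \<and> (\<forall>P\<in>\<P>. dilate 3 P \<subseteq> dilate 3 Q\<^sub>0) \<and>
    (\<integral>\<^sup>+x\<in>\<Omega>. ennreal (norm (weak_gradient \<Omega> u x) * g x) \<partial>lebesgue)
      \<le> C * (\<Sum>\<^sub>\<infinity>P\<in>\<P>. emeasure lebesgue P
               * average (dilate 3 P) q\<^sub>l (\<lambda>x. norm (F x)) * average P (conj_exp q\<^sub>h) g)
        + C * (\<Sum>\<^sub>\<infinity>P\<in>\<P>. emeasure lebesgue P * ennreal (3 * side P)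
               * average (dilate 3 P) (star_exp CARD('n) q\<^sub>l) f * average P (conj_exp q\<^sub>h) g)"
proof -
  let ?E = "dilate 3 Q\<^sub>0" and ?s = "star_exp CARD('n)"
  obtain c R where cl: "cube_like Q\<^sub>0 c R" using is_cube_imp_cube_like[OF \<open>is_cube Q\<^sub>0\<close>] by blast
  interpret elliptic_setting lam \<Lambda> Q\<^sub>0 O\<^sub>0 \<Omega> c R a
    by unfold_locales (fact cl assms)+
  have ql: "1 < q\<^sub>l" "q\<^sub>l \<le> 2" using \<open>admissible_lower_exponent O\<^sub>0 \<Omega> a q\<^sub>l\<close> by (auto simp: admissible_lower_exponent_def)
  have qh: "2 < q\<^sub>h" using \<open>admissible_upper_exponent O\<^sub>0 \<Omega> a q\<^sub>h\<close> by (simp add: admissible_upper_exponent_def)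
  have cE: "cube_like ?E c (3 * R)" using cube_like_dilate[OF cl, of 3] by simp
  have E: "?E \<in> sets lebesgue" "emeasure lebesgue ?E < top"
    using cube_like_sets[OF cE] cube_like_emeasure[OF cE] by auto
  have s: "0 < ?s q\<^sub>l" "?s q\<^sub>l \<le> ?s p" using star_exp_bounds[of "CARD('n)" q\<^sub>l p] ql \<open>q\<^sub>l < p\<close> by auto
  define u0 where "u0 x = (if x \<in> \<Omega> then u x else 0)" for x
  define G0 where "G0 x = (if x \<in> \<Omega> then weak_gradient \<Omega> u x else 0)" for x
  have W: "W0 \<Omega> u0 G0" unfolding u0_def G0_def by (rule W12_0_imp_W0[OF \<open>u \<in> W12_0 \<Omega>\<close> open_\<Omega>])
  obtain B where B: "AE x in lebesgue_on ?E. \<bar>g x\<bar> \<le> B" using \<open>g \<in> Linf_on ?E\<close> by (auto simp: Linf_on_def)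
  define h where "h x = (if x \<in> ?E then g x else 0)" for x
  (* g is nonnegative and bounded only almost everywhere on the triple cube; it is replaced by a
     version for which this holds everywhere. *)
  define g' where "g' x = (if 0 \<le> h x \<and> h x \<le> \<bar>B\<bar> then h x else 0)" for x
  have gg': "AE x in lebesgue. x \<in> ?E \<longrightarrow> g' x = g x"
  proof -
    have "AE x in lebesgue. x \<in> ?E \<longrightarrow> \<bar>g x\<bar> \<le> B" "AE x in lebesgue. x \<in> ?E \<longrightarrow> 0 \<le> g x"
      using B \<open>AE x in lebesgue_on ?E. 0 \<le> g x\<close> E(1) by (auto simp: AE_restrict_space_iff)
    then show ?thesis by eventually_elim (auto simp: g'_def h_def)
  qed
  have "h \<in> borel_measurable lebesgue"
    unfolding h_def using \<open>g \<in> Linf_on ?E\<close> E(1) by (intro borel_measurable_if_I) (auto simp: Linf_on_def)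
  then have g'm: "g' \<in> borel_measurable lebesgue" unfolding g'_def by measurable
  interpret localized_equation lam \<Lambda> Q\<^sub>0 O\<^sub>0 \<Omega> c R a q\<^sub>l q\<^sub>h N\<^sub>l F f g' "\<bar>B\<bar>" u0 G0
  proof unfold_locales
    show "F \<in> Lp_loc_on q\<^sub>l \<Omega>"
      using Lp_on_imp_Lp_loc_on[OF \<open>F \<in> Lp_on p ?E\<close> E _ _ \<Omega>_dilate] ql \<open>q\<^sub>l < p\<close> by simp
    show "f \<in> Lp_loc_on (?s q\<^sub>l) \<Omega>"
      using Lp_on_imp_Lp_loc_on[OF \<open>f \<in> Lp_on (?s p) ?E\<close> E s \<Omega>_dilate] .
    show "F \<in> Lp_loc_on 1 \<Omega>" "f \<in> Lp_loc_on 1 \<Omega>" using \<open>solves \<Omega> a F f u\<close> by (simp_all add: solves_def)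
    show "?s q\<^sub>l \<le> 1 \<longrightarrow> (AE x in lebesgue_on \<Omega>. f x = 0)"
    proof
      assume "?s q\<^sub>l \<le> 1"
      then have "AE x in lebesgue_on ?E. f x = 0"
        using \<open>\<not> (AE x in lebesgue_on ?E. f x = 0) \<Longrightarrow> ?s q\<^sub>l > 1\<close> by force
      then have "AE x in lebesgue. x \<in> ?E \<longrightarrow> f x = 0" using E(1) by (simp add: AE_restrict_space_iff)
      then have "AE x in lebesgue. x \<in> \<Omega> \<longrightarrow> f x = 0" by eventually_elim (use \<Omega>_dilate in blast)
      then show "AE x in lebesgue_on \<Omega>. f x = 0" by (simp add: AE_restrict_space_iff)
    qed
    fix \<phi> assume \<phi>: "\<phi> \<in> test_functions \<Omega>"
    have "(LINT x:\<Omega>|lebesgue. a x (G0 x) \<bullet> gradient \<phi> x) = (LINT x:\<Omega>|lebesgue. a x (weak_gradient \<Omega> u x) \<bullet> gradient \<phi> x)"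
      unfolding set_lebesgue_integral_def by (intro Bochner_Integration.integral_cong refl) (simp add: indicator_def G0_def)
    then show "(LINT x:\<Omega>|lebesgue. a x (G0 x) \<bullet> gradient \<phi> x) =
        (LINT x:\<Omega>|lebesgue. F x \<bullet> gradient \<phi> x) + (LINT x:\<Omega>|lebesgue. f x * \<phi> x)"
      using \<open>solves \<Omega> a F f u\<close> \<phi> by (simp add: solves_def)
  qed (use ql qh W g'm \<open>N_h_bdr O\<^sub>0 \<Omega> a q\<^sub>h < \<infinity>\<close> \<open>lower_constant O\<^sub>0 \<Omega> a q\<^sub>l N\<^sub>l\<close> in \<open>auto simp: g'_def\<close>)
  obtain \<P> where \<P>: "\<P> \<subseteq> dyadic c R" "sparse_family (1 - \<theta>) \<P>"
    and le: "mass (ocube c R) \<le> sparse_constant \<theta> * (\<Sum>\<^sub>\<infinity>P\<in>\<P>. F_term P) + sparse_constant \<theta> * (\<Sum>\<^sub>\<infinity>P\<in>\<P>. f_term P)"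
    using sparse_bound[OF \<open>0 < \<theta>\<close> \<open>\<theta> < 1\<close>] by blast
  have avg: "average P (conj_exp q\<^sub>h) g' = average P (conj_exp q\<^sub>h) g" if P: "P \<in> \<P>" for P
  proof -
    obtain z r where zr: "P = ocube z r" "0 < r" using P \<P>(1) dyadic_ocube[OF R] by blast
    have "ocube z r \<subseteq> ocube z (3 * r)" using zr(2) by (intro ocube_mono) simp
    then have PE: "P \<subseteq> ?E" using dilate_dyadic_subset[OF cl, of P] P \<P>(1) zr by (auto simp: dilate_ocube)
    have "(\<integral>\<^sup>+x\<in>P. ennreal (\<bar>g' x\<bar> powr conj_exp q\<^sub>h) \<partial>lebesgue) = (\<integral>\<^sup>+x\<in>P. ennreal (\<bar>g x\<bar> powr conj_exp q\<^sub>h) \<partial>lebesgue)"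
      by (rule nn_integral_cong_AE) (use gg' in eventually_elim, use PE in \<open>auto simp: indicator_def\<close>)
    then show ?thesis by (simp add: average_def)
  qed
  have "(\<integral>\<^sup>+x\<in>\<Omega>. ennreal (norm (weak_gradient \<Omega> u x) * g x) \<partial>lebesgue) = mass (ocube c R)"
    unfolding mass_def local_gradient_top
  proof (rule nn_integral_cong_AE)
    show "AE x in lebesgue. ennreal (norm (weak_gradient \<Omega> u x) * g x) * indicator \<Omega> x = ennreal (norm (G0 x) * g' x) * indicator (ocube c R) x"
      using gg' by eventually_elim (use \<Omega>_dilate \<Omega>_top in \<open>auto simp: indicator_def G0_def\<close>)
  qed
  also have "\<dots> \<le> C * (\<Sum>\<^sub>\<infinity>P\<in>\<P>. F_term P) + C * (\<Sum>\<^sub>\<infinity>P\<in>\<P>. f_term P)"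
    using le unfolding sparse_constant_def C_def .
  also have "(\<Sum>\<^sub>\<infinity>P\<in>\<P>. F_term P) = (\<Sum>\<^sub>\<infinity>P\<in>\<P>. emeasure lebesgue P
      * average (dilate 3 P) q\<^sub>l (\<lambda>x. norm (F x)) * average P (conj_exp q\<^sub>h) g)"
    by (rule infsum_cong) (simp add: F_term_def avg)
  also have "(\<Sum>\<^sub>\<infinity>P\<in>\<P>. f_term P) = (\<Sum>\<^sub>\<infinity>P\<in>\<P>. emeasure lebesgue P * ennreal (3 * side P)
      * average (dilate 3 P) (?s q\<^sub>l) f * average P (conj_exp q\<^sub>h) g)"
    by (rule infsum_cong) (simp add: f_term_def avg)
  finally show ?thesis using \<P> dilate_dyadic_subset[OF cl] by (intro exI[of _ \<P>]) blast
qed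

end
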